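(* Let $\mathcal{D}$ be a datum as described in the context, let $A$ be a right coideal subalgebra of $U(\mathcal{D})$, put $G = \Gamma \cap A$, and let $\mathfrak{J}_1, \dots, \mathfrak{J}_m$ be the equivalence classes of the relation $\sim_G$ on $\{1,\dots,\theta\}$. Then there are reduced data $C_k$ for $\mathfrak{J}_k$ ($k = 1,\dots,m$) such that the set $$G \cup X_{\mathfrak{J}_1}(C_1) \cup \cdots \cup X_{\mathfrak{J}_m}(C_m)$$ generates $A$ as an algebra.
   Context: $\Bbbk$ is an algebraically closed field of characteristic zero. A right coideal subalgebra of a Hopf algebra $H$ is a (unital) subalgebra $A$ with $\Delta(A) \subset A \otimes H$. Datum $\mathcal{D} = (\Gamma, (g_i), (\chi_i), (\lambda_{ij})_{i<j}, (\mu_i))$, $1 \le i,j \le \theta$: $\theta$ is a positive integer; $\Gamma$ is a finite abelian group with identity $e$; $g_i \in \Gamma$ and $\chi_i \in \hat\Gamma := \mathrm{Hom}(\Gamma, \Bbbk^\times)$ satisfy $\chi_i(g_i) \ne 1$ and $\chi_i(g_j)\chi_j(g_i) = 1$ for $i \ne j$; $N_i$ denotes the order of $\chi_i(g_i)$; $\lambda_{ij} \in \Bbbk$ ($i<j$) is such that $\lambda_{ij} = 0$ if $g_i g_j = e$ or $\chi_i\chi_j \ne \varepsilon$ (with $\varepsilon$ the trivial character); $\mu_i \in \{0,1\}$ is such that $\mu_i = 0$ if $g_i^{N_i} = e$ or $\chi_i^{N_i} \ne \varepsilon$. $U(\mathcal{D})$ is the algebra generated by the elements $g \in \Gamma$ (satisfying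 the multiplication relations of $\Gamma$, with $e=1$) and $x_1,\dots,x_\theta$ subject to $g x_i = \chi_i(g) x_i g$, $x_j x_i = \chi_i(g_j) x_i x_j + \lambda_{ij}(1 - g_i g_j)$ ($i<j$), $x_i^{N_i} = \mu_i(1 - g_i^{N_i})$. It is a Hopf algebra with $\Delta(g) = g \otimes g$ and $\Delta(x_i) = x_i \otimes g_i + 1 \otimes x_i$. It is known that $\{ g x_1^{m_1}\cdots x_\theta^{m_\theta} \mid g \in \Gamma,\ 0 \le m_i < N_i\}$ is a basis of $U(\mathcal{D})$. For a subgroup $G \le \Gamma$ put $G^\perp = \{\chi \in \hat\Gamma \mid \chi(g) = 1\ \forall g \in G\}$ and define $i \sim_G j$ iff $g_i \equiv g_j \pmod G$ and $\chi_i \equiv \chi_j \pmod{G^\perp}$. For an equivalence class $\mathfrak{J} = \{i_1 < \cdots < i_n\}$ and $c_1,\dots,c_n,a \in \Bbbk$ put $$\xi_{\mathfrak{J}}(c_1,\dots,c_n,a) = g_{i_1}\sum_{s=1}^n c_s g_{i_s}^{-1} x_{i_s} + a g_{i_1},$$ and for an $n \times (n+1)$ matrix $C = (c_{rs})$ over $\Bbbk$ put $X_{\mathfrak{J}}(C) = \{ \xi_{\mathfrak{J}}(c_{r,1},\dots,c_{r,n},c_{r,n+1}) \mid 1 \le r \le n\}$. Such a matrix $C$ is a reduced datum for $\mathfrak{J}$ if: (RD1) $C$ is in reduced row echelon form; (RD2) the last column of $C$ is zero if $\chi_j \not\equiv \varepsilon \pmod{G^\perp}$ for $j \in \mathfrak{J}$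 (this does not depend on the choice of $j \in \mathfrak{J}$); (RD3) $C$ has the same rank as the submatrix obtained by removing its last column. *)

theory Defs
  imports
    "HOL-Library.Poly_Mapping"
    "HOL-Algebra.QuotRing"
    "HOL-Algebra.Subrings"
    "HOL-Algebra.Multiplicative_Group"
    "Jordan_Normal_Form.Gauss_Jordan_Elimination"
    "Jordan_Normal_Form.DL_Rank"
begin

section \<open>Algebras over a field\<close>

text \<open>
  The scalars form a type \<open>'k\<close> of class \<open>field\<close>; an algebra is a record of type
  \<open>('k, 'a) module\<close>, i.e. a (not necessarily commutative) ring with a scalar multiplication.
  The library's locale \<open>algebra\<close> is restricted to commutative algebras.
\<close>

locale k_algebra = ring A for A :: "('k::field, 'a) module" (structure) +
  assumes smult_closed: "x \<in> carrier A \<Longrightarrow> c \<odot> x \<in> carrier A"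
    and smult_l_distr: "x \<in> carrier A \<Longrightarrow> (c + d) \<odot> x = c \<odot> x \<oplus> d \<odot> x"
    and smult_r_distr: "x \<in> carrier A \<Longrightarrow> y \<in> carrier A \<Longrightarrow> c \<odot> (x \<oplus> y) = c \<odot> x \<oplus> c \<odot> y"
    and smult_assoc1: "x \<in> carrier A \<Longrightarrow> (c * d) \<odot> x = c \<odot> (d \<odot> x)"
    and smult_one: "x \<in> carrier A \<Longrightarrow> 1 \<odot> x = x"
    and smult_mult_l: "x \<in> carrier A \<Longrightarrow> y \<in> carrier A \<Longrightarrow> (c \<odot> x) \<otimes> y = c \<odot> (x \<otimes> y)"
    and smult_mult_r: "x \<in> carrier A \<Longrightarrow> y \<in> carrier A \<Longrightarrow> x \<otimes> (c \<odot> y) = c \<odot> (x \<otimes> y)"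

definition alg_hom :: "('k, 'a) module \<Rightarrow> ('k, 'b) module \<Rightarrow> ('a \<Rightarrow> 'b) set" where
  "alg_hom A B = {f \<in> Ring.ring_hom A B. \<forall>c. \<forall>x\<in>carrier A. f (c \<odot>\<^bsub>A\<^esub> x) = c \<odot>\<^bsub>B\<^esub> f x}"

definition is_subalgebra :: "('k, 'a) module \<Rightarrow> 'a set \<Rightarrow> bool" where
  "is_subalgebra A S \<longleftrightarrow> subring S A \<and> (\<forall>c. \<forall>x\<in>S. c \<odot>\<^bsub>A\<^esub> x \<in> S)"

definition subalgebra_generated :: "('k, 'a) module \<Rightarrow> 'a set \<Rightarrow> 'a set" where
  "subalgebra_generated A X = \<Inter>{S. is_subalgebra A S \<and> X \<subseteq> S}"

text \<open>The quotient of an algebra by a two-sided ideal (\<open>ideal\<close> is two-sided in the library):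
  the quotient ring together with the induced scalar multiplication.\<close>

definition quot_algebra :: "('k, 'a) module \<Rightarrow> 'a set \<Rightarrow> ('k, 'a set) module" where
  "quot_algebra A I =
    \<lparr> carrier = carrier (A Quot I), mult = mult (A Quot I), one = one (A Quot I),
      zero = zero (A Quot I), add = add (A Quot I),
      smult = (\<lambda>c X. \<Union>x\<in>X. I +>\<^bsub>A\<^esub> (c \<odot>\<^bsub>A\<^esub> x)) \<rparr>"

text \<open>The monoid algebra: formal linear combinations of elements of the monoid, with
  \<^term>\<open>Poly_Mapping.single a c\<close> standing for \<open>c\<close> times the basis element \<open>a\<close>.\<close>

definition monoid_algebra :: "('m, 'z) monoid_scheme \<Rightarrow> ('k::field, 'm \<Rightarrow>\<^sub>0 'k) module" where
  "monoid_algebra M =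
    \<lparr> carrier = {p. Poly_Mapping.keys p \<subseteq> carrier M},
      mult = (\<lambda>p q. \<Sum>a\<in>Poly_Mapping.keys p. \<Sum>b\<in>Poly_Mapping.keys q.
                Poly_Mapping.single (a \<otimes>\<^bsub>M\<^esub> b) (Poly_Mapping.lookup p a * Poly_Mapping.lookup q b)),
      one = Poly_Mapping.single \<one>\<^bsub>M\<^esub> 1,
      zero = 0,
      add = (+),
      smult = (\<lambda>c. Poly_Mapping.map ((*) c)) \<rparr>"

definition free_monoid :: "'x set \<Rightarrow> 'x list monoid" where
  "free_monoid X = \<lparr> carrier = lists X, mult = (@), one = [] \<rparr>"

definition free_algebra :: "'x set \<Rightarrow> ('k::field, 'x list \<Rightarrow>\<^sub>0 'k) module" where
  "free_algebra X = monoid_algebra (free_monoid X)"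


section \<open>Tensor products of algebras\<close>

text \<open>
  \<open>A \<otimes> B\<close> is the space of formal linear combinations of pairs modulo the bilinearity
  relations. The free space on the pairs is the monoid algebra of the product of the
  multiplicative monoids of \<open>A\<close> and \<open>B\<close>, which provides the product
  \<open>(a \<otimes> b)(a' \<otimes> b') = aa' \<otimes> bb'\<close>; the subspace spanned by the bilinearity relations
  is already an ideal, so that the ideal generated by them adds nothing.
\<close>

definition bilinearity_relators ::
  "('k::field, 'a) module \<Rightarrow> ('k, 'b) module \<Rightarrow> ('a \<times> 'b \<Rightarrow>\<^sub>0 'k) set" where
  "bilinearity_relators A B =
     {Poly_Mapping.single (a \<oplus>\<^bsub>A\<^esub> a', b) 1 - Poly_Mapping.single (a, b) 1 - Poly_Mapping.single (a', b) 1
        | a a' b. a \<in> carrier A \<and> a' \<in> carrier A \<and> b \<in> carrier B}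
   \<union> {Poly_Mapping.single (a, b \<oplus>\<^bsub>B\<^esub> b') 1 - Poly_Mapping.single (a, b) 1 - Poly_Mapping.single (a, b') 1
        | a b b'. a \<in> carrier A \<and> b \<in> carrier B \<and> b' \<in> carrier B}
   \<union> {Poly_Mapping.single (c \<odot>\<^bsub>A\<^esub> a, b) 1 - Poly_Mapping.single (a, b) c
        | c a b. a \<in> carrier A \<and> b \<in> carrier B}
   \<union> {Poly_Mapping.single (a, c \<odot>\<^bsub>B\<^esub> b) 1 - Poly_Mapping.single (a, b) c
        | c a b. a \<in> carrier A \<and> b \<in> carrier B}"

definition tensor_ideal ::
  "('k::field, 'a) module \<Rightarrow> ('k, 'b) module \<Rightarrow> ('a \<times> 'b \<Rightarrow>\<^sub>0 'k) set" where
  "tensor_ideal A B = Idl\<^bsub>monoid_algebra (A \<times>\<times> B)\<^esub> bilinearity_relators A B"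

definition tensor_algebra ::
  "('k::field, 'a) module \<Rightarrow> ('k, 'b) module \<Rightarrow> ('k, ('a \<times> 'b \<Rightarrow>\<^sub>0 'k) set) module" where
  "tensor_algebra A B = quot_algebra (monoid_algebra (A \<times>\<times> B)) (tensor_ideal A B)"

definition tensor_class ::
  "('k::field, 'a) module \<Rightarrow> ('k, 'b) module \<Rightarrow> ('a \<times> 'b \<Rightarrow>\<^sub>0 'k) \<Rightarrow> ('a \<times> 'b \<Rightarrow>\<^sub>0 'k) set" where
  "tensor_class A B p = tensor_ideal A B +>\<^bsub>monoid_algebra (A \<times>\<times> B)\<^esub> p"

definition pure_tensor ::
  "('k::field, 'a) module \<Rightarrow> ('k, 'b) module \<Rightarrow> 'a \<Rightarrow> 'b \<Rightarrow> ('a \<times> 'b \<Rightarrow>\<^sub>0 'k) set" where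
  "pure_tensor A B a b = tensor_class A B (Poly_Mapping.single (a, b) 1)"

text \<open>For subspaces \<open>S\<close> of \<open>A\<close> and \<open>T\<close> of \<open>B\<close>, the subspace \<open>S \<otimes> T\<close> of \<open>A \<otimes> B\<close>:
  all linear combinations of the \<open>s \<otimes> t\<close>.\<close>

definition tensor_subspace ::
  "('k::field, 'a) module \<Rightarrow> ('k, 'b) module \<Rightarrow> 'a set \<Rightarrow> 'b set \<Rightarrow> ('a \<times> 'b \<Rightarrow>\<^sub>0 'k) set set" where
  "tensor_subspace A B S T = tensor_class A B ` {p. Poly_Mapping.keys p \<subseteq> S \<times> T}"

definition right_coideal_subalgebra ::
  "('k::field, 'a) module \<Rightarrow> ('a \<Rightarrow> ('a \<times> 'a \<Rightarrow>\<^sub>0 'k) set) \<Rightarrow> 'a set \<Rightarrow> bool" where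
  "right_coideal_subalgebra H \<Delta> A \<longleftrightarrow>
     is_subalgebra H A \<and> \<Delta> ` A \<subseteq> tensor_subspace H H A (carrier H)"


section \<open>Characters and data\<close>

abbreviation scalar_units :: "'k::field monoid" where
  "scalar_units \<equiv> mult_of class_ring"

text \<open>Characters are functions on the carrier only, hence extensional.\<close>

definition dual_group :: "('g, 'z) monoid_scheme \<Rightarrow> ('g \<Rightarrow> 'k::field) monoid" where
  "dual_group M =
    \<lparr> carrier = hom M scalar_units \<inter> extensional (carrier M),
      mult = (\<lambda>\<phi> \<psi>. \<lambda>g\<in>carrier M. \<phi> g * \<psi> g),
      one = (\<lambda>g\<in>carrier M. 1) \<rparr>"

definition perp :: "('g, 'z) monoid_scheme \<Rightarrow> 'g set \<Rightarrow> ('g \<Rightarrow> 'k::field) set" where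
  "perp M G = {\<chi> \<in> carrier (dual_group M). \<forall>g\<in>G. \<chi> g = 1}"

record ('g, 'k) datum =
  grp :: "'g monoid"
  rk :: nat
  elt :: "nat \<Rightarrow> 'g"
  chr :: "nat \<Rightarrow> 'g \<Rightarrow> 'k"
  lnk :: "nat \<Rightarrow> nat \<Rightarrow> 'k"
  rtp :: "nat \<Rightarrow> 'k"

text \<open>In the notation of the literature a datum
  \<open>D = (\<Gamma>, (g\<^sub>i), (\<chi>\<^sub>i), (\<lambda>\<^sub>i\<^sub>j)\<^sub>i\<^sub><\<^sub>j, (\<mu>\<^sub>i))\<close>, \<open>1 \<le> i, j \<le> \<theta>\<close>, has \<open>\<Gamma> = grp D\<close>,
  \<open>\<theta> = rk D\<close>, \<open>g\<^sub>i = elt D i\<close>, \<open>\<chi>\<^sub>i = chr D i\<close>, \<open>\<lambda>\<^sub>i\<^sub>j = lnk D i j\<close> (linking parameters) and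
  \<open>\<mu>\<^sub>i = rtp D i\<close> (root vector parameters).\<close>

definition idx :: "('g, 'k) datum \<Rightarrow> nat set" where
  "idx D = {1..rk D}"

definition Nord :: "('g, 'k::field) datum \<Rightarrow> nat \<Rightarrow> nat" where
  "Nord D i = group.ord scalar_units (chr D i (elt D i))"

definition is_datum :: "('g, 'k::field) datum \<Rightarrow> bool" where
  "is_datum D \<longleftrightarrow>
     comm_group (grp D) \<and> finite (carrier (grp D)) \<and> 0 < rk D
   \<and> (\<forall>i\<in>idx D. elt D i \<in> carrier (grp D) \<and> chr D i \<in> carrier (dual_group (grp D))
        \<and> chr D i (elt D i) \<noteq> 1)
   \<and> (\<forall>i\<in>idx D. \<forall>j\<in>idx D. i \<noteq> j \<longrightarrow> chr D i (elt D j) * chr D j (elt D i) = 1)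
   \<and> (\<forall>i\<in>idx D. \<forall>j\<in>idx D. i < j \<longrightarrow>
        elt D i \<otimes>\<^bsub>grp D\<^esub> elt D j = \<one>\<^bsub>grp D\<^esub>
        \<or> chr D i \<otimes>\<^bsub>dual_group (grp D)\<^esub> chr D j \<noteq> \<one>\<^bsub>dual_group (grp D)\<^esub>
        \<longrightarrow> lnk D i j = 0)
   \<and> (\<forall>i\<in>idx D. rtp D i \<in> {0, 1})
   \<and> (\<forall>i\<in>idx D.
        elt D i [^]\<^bsub>grp D\<^esub> Nord D i = \<one>\<^bsub>grp D\<^esub>
        \<or> chr D i [^]\<^bsub>dual_group (grp D)\<^esub> Nord D i \<noteq> \<one>\<^bsub>dual_group (grp D)\<^esub>
        \<longrightarrow> rtp D i = 0)"


section \<open>The Hopf algebra of a datum\<close>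

datatype 'g gen = GenG 'g | GenX nat

definition gens :: "('g, 'k) datum \<Rightarrow> 'g gen set" where
  "gens D = GenG ` carrier (grp D) \<union> GenX ` idx D"

text \<open>The words in the generators are lists over \<^term>\<open>gens D\<close>; a relation \<open>l = r\<close> is
  represented by \<open>l - r\<close>.\<close>

definition relators :: "('g, 'k::field) datum \<Rightarrow> ('g gen list \<Rightarrow>\<^sub>0 'k) set" where
  "relators D =
     {Poly_Mapping.single [GenG g, GenG h] 1 - Poly_Mapping.single [GenG (g \<otimes>\<^bsub>grp D\<^esub> h)] 1
        | g h. g \<in> carrier (grp D) \<and> h \<in> carrier (grp D)}
   \<union> {Poly_Mapping.single [GenG \<one>\<^bsub>grp D\<^esub>] 1 - Poly_Mapping.single [] 1}
   \<union> {Poly_Mapping.single [GenG g, GenX i] 1 - Poly_Mapping.single [GenX i, GenG g] (chr D i g)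
        | g i. g \<in> carrier (grp D) \<and> i \<in> idx D}
   \<union> {Poly_Mapping.single [GenX j, GenX i] 1
        - (Poly_Mapping.single [GenX i, GenX j] (chr D i (elt D j))
           + (Poly_Mapping.single [] (lnk D i j)
              - Poly_Mapping.single [GenG (elt D i \<otimes>\<^bsub>grp D\<^esub> elt D j)] (lnk D i j)))
        | i j. i \<in> idx D \<and> j \<in> idx D \<and> i < j}
   \<union> {Poly_Mapping.single (replicate (Nord D i) (GenX i)) 1
        - (Poly_Mapping.single [] (rtp D i)
           - Poly_Mapping.single [GenG (elt D i [^]\<^bsub>grp D\<^esub> Nord D i)] (rtp D i))
        | i. i \<in> idx D}"

definition Uideal :: "('g, 'k::field) datum \<Rightarrow> ('g gen list \<Rightarrow>\<^sub>0 'k) set" where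
  "Uideal D = Idl\<^bsub>free_algebra (gens D)\<^esub> relators D"

definition Ualg :: "('g, 'k::field) datum \<Rightarrow> ('k, ('g gen list \<Rightarrow>\<^sub>0 'k) set) module" where
  "Ualg D = quot_algebra (free_algebra (gens D)) (Uideal D)"

definition Ugen :: "('g, 'k::field) datum \<Rightarrow> 'g gen \<Rightarrow> ('g gen list \<Rightarrow>\<^sub>0 'k) set" where
  "Ugen D y = Uideal D +>\<^bsub>free_algebra (gens D)\<^esub> Poly_Mapping.single [y] 1"

abbreviation ug :: "('g, 'k::field) datum \<Rightarrow> 'g \<Rightarrow> ('g gen list \<Rightarrow>\<^sub>0 'k) set" where
  "ug D g \<equiv> Ugen D (GenG g)"

abbreviation ux :: "('g, 'k::field) datum \<Rightarrow> nat \<Rightarrow> ('g gen list \<Rightarrow>\<^sub>0 'k) set" where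
  "ux D i \<equiv> Ugen D (GenX i)"

definition is_comult ::
  "('g, 'k::field) datum
   \<Rightarrow> (('g gen list \<Rightarrow>\<^sub>0 'k) set
       \<Rightarrow> (('g gen list \<Rightarrow>\<^sub>0 'k) set \<times> ('g gen list \<Rightarrow>\<^sub>0 'k) set \<Rightarrow>\<^sub>0 'k) set) \<Rightarrow> bool" where
  "is_comult D \<Delta> \<longleftrightarrow>
     \<Delta> \<in> alg_hom (Ualg D) (tensor_algebra (Ualg D) (Ualg D)) \<inter> extensional (carrier (Ualg D))
   \<and> (\<forall>g\<in>carrier (grp D). \<Delta> (ug D g) = pure_tensor (Ualg D) (Ualg D) (ug D g) (ug D g))
   \<and> (\<forall>i\<in>idx D. \<Delta> (ux D i) =
        pure_tensor (Ualg D) (Ualg D) (ux D i) (ug D (elt D i))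
        \<oplus>\<^bsub>tensor_algebra (Ualg D) (Ualg D)\<^esub> pure_tensor (Ualg D) (Ualg D) \<one>\<^bsub>Ualg D\<^esub> (ux D i))"

text \<open>There is exactly one such \<open>\<Delta>\<close>: theorem \<open>comult_ex1\<close> below.\<close>

definition comult ::
  "('g, 'k::field) datum
   \<Rightarrow> ('g gen list \<Rightarrow>\<^sub>0 'k) set
   \<Rightarrow> (('g gen list \<Rightarrow>\<^sub>0 'k) set \<times> ('g gen list \<Rightarrow>\<^sub>0 'k) set \<Rightarrow>\<^sub>0 'k) set" where
  "comult D = (THE \<Delta>. is_comult D \<Delta>)"


section \<open>Reduced data\<close>

text \<open>The subgroup \<open>\<Gamma> \<inter> A\<close> of \<open>\<Gamma>\<close>, as a subset of \<^term>\<open>carrier (grp D)\<close>.\<close>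

definition group_part :: "('g, 'k::field) datum \<Rightarrow> ('g gen list \<Rightarrow>\<^sub>0 'k) set set \<Rightarrow> 'g set" where
  "group_part D A = {g \<in> carrier (grp D). ug D g \<in> A}"

definition sim :: "('g, 'k::field) datum \<Rightarrow> 'g set \<Rightarrow> (nat \<times> nat) set" where
  "sim D G = {(i, j). i \<in> idx D \<and> j \<in> idx D
     \<and> (elt D i, elt D j) \<in> rcong\<^bsub>grp D\<^esub> G
     \<and> (chr D i, chr D j) \<in> rcong\<^bsub>dual_group (grp D)\<^esub> (perp (grp D) G)}"

text \<open>For \<open>J = {i\<^sub>1 < \<dots> < i\<^sub>n}\<close>, the index \<open>i\<^sub>s\<close> is \<open>nth_index J (s - 1)\<close>: vectors and
  matrices are indexed from 0. The vector \<open>c\<close> below is \<open>(c\<^sub>1, \<dots>, c\<^sub>n, a)\<close>.\<close>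

definition nth_index :: "nat set \<Rightarrow> nat \<Rightarrow> nat" where
  "nth_index J s = sorted_list_of_set J ! s"

definition xi_elt :: "('g, 'k::field) datum \<Rightarrow> nat set \<Rightarrow> 'k vec \<Rightarrow> ('g gen list \<Rightarrow>\<^sub>0 'k) set" where
  "xi_elt D J c =
     ug D (elt D (nth_index J 0))
       \<otimes>\<^bsub>Ualg D\<^esub> (\<Oplus>\<^bsub>Ualg D\<^esub>s\<in>{..<card J}.
          c $ s \<odot>\<^bsub>Ualg D\<^esub> (ug D (inv\<^bsub>grp D\<^esub> elt D (nth_index J s)) \<otimes>\<^bsub>Ualg D\<^esub> ux D (nth_index J s)))
     \<oplus>\<^bsub>Ualg D\<^esub> c $ card J \<odot>\<^bsub>Ualg D\<^esub> ug D (elt D (nth_index J 0))"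

definition Xset :: "('g, 'k::field) datum \<Rightarrow> nat set \<Rightarrow> 'k mat \<Rightarrow> ('g gen list \<Rightarrow>\<^sub>0 'k) set set" where
  "Xset D J C = {xi_elt D J (row C r) | r. r < card J}"

text \<open>The library's \<^const>\<open>row_echelon_form\<close> is the \<^emph>\<open>reduced\<close> row echelon form: pivots
  are 1 and are the only nonzero entries of their columns.\<close>

definition reduced_datum :: "('g, 'k::field) datum \<Rightarrow> 'g set \<Rightarrow> nat set \<Rightarrow> 'k mat \<Rightarrow> bool" where
  "reduced_datum D G J C \<longleftrightarrow>
     C \<in> carrier_mat (card J) (card J + 1)
   \<and> row_echelon_form C
   \<and> ((\<exists>j\<in>J. (chr D j, \<one>\<^bsub>dual_group (grp D)\<^esub>) \<notin> rcong\<^bsub>dual_group (grp D)\<^esub> (perp (grp D) G))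
        \<longrightarrow> (\<forall>r < card J. C $$ (r, card J) = 0))
   \<and> vec_space.rank (card J) C =
       vec_space.rank (card J) (mat (card J) (card J) (\<lambda>(r, s). C $$ (r, s)))"


section \<open>Existence and uniqueness of the comultiplication\<close>


subsection \<open>Monoid algebras\<close>

abbreviation "sng \<equiv> Poly_Mapping.single"

lemma pm_decomp: "p = (\<Sum>a\<in>Poly_Mapping.keys p. sng a (Poly_Mapping.lookup p a))"
proof (rule poly_mapping_eqI)
  fix k
  have "Poly_Mapping.lookup (\<Sum>a\<in>Poly_Mapping.keys p. sng a (Poly_Mapping.lookup p a)) k
     = (\<Sum>a\<in>Poly_Mapping.keys p. if a = k then Poly_Mapping.lookup p a else 0)"
    by (auto simp: lookup_sum lookup_single when_def intro!: sum.cong)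
  also have "\<dots> = Poly_Mapping.lookup p k" by (simp add: in_keys_iff)
  finally show "Poly_Mapping.lookup p k = Poly_Mapping.lookup (\<Sum>a\<in>Poly_Mapping.keys p. sng a (Poly_Mapping.lookup p a)) k" by simp
qed

lemma pm_sum_add:
  fixes h :: "'m \<Rightarrow> 'k::comm_monoid_add \<Rightarrow> 'c::comm_monoid_add"
  assumes "\<And>a. h a 0 = 0" "\<And>a x y. h a (x + y) = h a x + h a y"
  shows "(\<Sum>a\<in>Poly_Mapping.keys (p+q). h a (Poly_Mapping.lookup (p+q) a)) =
    (\<Sum>a\<in>Poly_Mapping.keys p. h a (Poly_Mapping.lookup p a)) + (\<Sum>a\<in>Poly_Mapping.keys q. h a (Poly_Mapping.lookup q a))"
  using setsum_keys_plus_distrib[of h p q] assms by simp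

context
  fixes M :: "('m, 'z) monoid_scheme" and A :: "('k::field, 'm \<Rightarrow>\<^sub>0 'k) module"
  defines "A \<equiv> monoid_algebra M"
begin

lemma ma_simps:
  "carrier A = {p. Poly_Mapping.keys p \<subseteq> carrier M}"
  "one A = sng \<one>\<^bsub>M\<^esub> 1" "zero A = 0" "add A = (+)"
  "smult A c = Poly_Mapping.map ((*) c)"
  by (simp_all add: A_def monoid_algebra_def)

lemma ma_mult: "mult A p q = (\<Sum>a\<in>Poly_Mapping.keys p. \<Sum>b\<in>Poly_Mapping.keys q.
                sng (a \<otimes>\<^bsub>M\<^esub> b) (Poly_Mapping.lookup p a * Poly_Mapping.lookup q b))"
  by (simp add: A_def monoid_algebra_def)

lemma ma_induct:
  assumes "p \<in> carrier A" "P 0" "\<And>a c. a \<in> carrier M \<Longrightarrow> P (sng a c)"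
    "\<And>p q. p \<in> carrier A \<Longrightarrow> q \<in> carrier A \<Longrightarrow> P p \<Longrightarrow> P q \<Longrightarrow> P (p + q)"
  shows "P p"
proof -
  have "P (\<Sum>a\<in>S. sng a (f a)) \<and> (\<Sum>a\<in>S. sng a (f a)) \<in> carrier A"
    if "finite S" "S \<subseteq> carrier M" for S and f :: "'m \<Rightarrow> 'k"
    using that
  proof (induction S rule: finite_induct)
    case empty then show ?case using assms(2) by (simp add: ma_simps)
  next
    case (insert x F)
    have 1: "sng x (f x) \<in> carrier A" using insert by (simp add: ma_simps)
    then have "sng x (f x) + (\<Sum>a\<in>F. sng a (f a)) \<in> carrier A"
      using insert keys_add[of "sng x (f x)" "\<Sum>a\<in>F. sng a (f a)"] by (auto simp: ma_simps)
    then show ?case using insert assms(3)[of x "f x"] assms(4) 1 by simp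
  qed
  from this[of "Poly_Mapping.keys p" "Poly_Mapping.lookup p"] assms(1)
  have "P (\<Sum>a\<in>Poly_Mapping.keys p. sng a (Poly_Mapping.lookup p a))" by (simp add: ma_simps)
  then show ?thesis by (simp only: pm_decomp[symmetric])
qed

lemma ma_mult_addl: "mult A (p + q) r = mult A p r + mult A q r"
  unfolding ma_mult by (rule pm_sum_add) (simp_all add: algebra_simps single_add sum.distrib)

lemma ma_mult_addr: "mult A r (p + q) = mult A r p + mult A r q"
  unfolding ma_mult sum.distrib[symmetric]
  by (intro sum.cong refl pm_sum_add) (simp_all add: algebra_simps single_add)

lemma ma_mult0: "mult A 0 r = 0" "mult A r 0 = 0" by (simp_all add: ma_mult)

lemma ma_mult_single: "mult A (sng a c) (sng b d) = sng (a \<otimes>\<^bsub>M\<^esub> b) (c * d)"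
  by (cases "c = 0"; cases "d = 0") (simp_all add: ma_mult)

lemma ma_smult_add: "smult A c (p + q) = smult A c p + smult A c q"
  by (rule poly_mapping_eqI)
    (auto simp: ma_simps lookup_add map.rep_eq when_def simp flip: distrib_left)

lemma ma_smult_single: "smult A c (sng b d) = sng b (c * d)"
  by (simp add: ma_simps)

lemma ma_smult0: "smult A c 0 = 0"
  by (simp add: ma_simps map_eq_zero_iff)

lemma ma_add_closed: "p \<in> carrier A \<Longrightarrow> q \<in> carrier A \<Longrightarrow> p + q \<in> carrier A"
  using keys_add[of p q] by (auto simp: ma_simps)

lemma ma_uminus_closed: "p \<in> carrier A \<Longrightarrow> - p \<in> carrier A"
  by (auto simp: ma_simps in_keys_iff)

lemma ma_single_closed: "a \<in> carrier M \<Longrightarrow> sng a c \<in> carrier A"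
  by (auto simp: ma_simps)

lemma ma_zero_closed: "0 \<in> carrier A" by (simp add: ma_simps)

context assumes M: "monoid M" begin

interpretation M: monoid M by (rule M)

lemma ma_mult_closed:
  assumes "p \<in> carrier A" "q \<in> carrier A"
  shows "mult A p q \<in> carrier A"
  using assms(1)
proof (rule ma_induct)
  fix a c assume "a \<in> carrier M"
  show "mult A (sng a c) q \<in> carrier A"
    using assms(2) 
    by (rule ma_induct) (auto simp: ma_mult0 ma_zero_closed ma_mult_single ma_mult_addr \<open>a \<in> carrier M\<close> intro!: ma_single_closed ma_add_closed)
qed (auto simp: ma_mult0 ma_zero_closed ma_mult_addl ma_add_closed)

lemma ma_smult_closed:
  assumes "p \<in> carrier A" shows "smult A c p \<in> carrier A"
  using assms by (auto simp: ma_simps in_keys_iff map.rep_eq when_def split: if_splits)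

lemma ma_assoc:
  assumes p: "p \<in> carrier A" and q: "q \<in> carrier A" and r: "r \<in> carrier A"
  shows "mult A (mult A p q) r = mult A p (mult A q r)"
  using p
proof (rule ma_induct)
  fix a and c :: 'k assume a: "a \<in> carrier M"
  show "mult A (mult A (sng a c) q) r = mult A (sng a c) (mult A q r)"
    using q
  proof (rule ma_induct)
    fix b and d :: 'k assume b: "b \<in> carrier M"
    show "mult A (mult A (sng a c) (sng b d)) r = mult A (sng a c) (mult A (sng b d) r)"
      using r
      by (rule ma_induct) (simp_all add: ma_mult0 ma_mult_addr ma_mult_single a b M.m_assoc mult.assoc)
  qed (simp_all add: ma_mult0 ma_mult_addr ma_mult_addl)
qed (simp_all add: ma_mult0 ma_mult_addr ma_mult_addl)

lemma ma_onel:
  assumes p: "p \<in> carrier A" shows "mult A (one A) p = p"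
  using p by (rule ma_induct) (simp_all add: ma_mult0 ma_mult_addr ma_mult_single ma_simps(2))

lemma ma_oner:
  assumes p: "p \<in> carrier A" shows "mult A p (one A) = p"
  using p by (rule ma_induct) (simp_all add: ma_mult0 ma_mult_addl ma_mult_single ma_simps(2))

lemma ma_one_closed: "one A \<in> carrier A" by (simp add: ma_simps)

lemma ma_ring: "ring A"
proof (rule ringI)
  show "abelian_group A"
  proof (rule abelian_groupI)
    fix x assume "x \<in> carrier A"
    then show "\<exists>y\<in>carrier A. y \<oplus>\<^bsub>A\<^esub> x = \<zero>\<^bsub>A\<^esub>"
      by (intro bexI[of _ "-x"]) (simp_all add: ma_uminus_closed ma_simps(3,4))
  qed (simp_all add: ma_add_closed ma_zero_closed ma_simps(3,4) algebra_simps)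
  show "monoid A" by (rule monoidI) (simp_all add: ma_mult_closed ma_one_closed ma_assoc ma_onel ma_oner)
qed (simp_all add: ma_simps(3,4) ma_mult_addl ma_mult_addr)

lemma ma_k_algebra: "k_algebra A"
proof -
  interpret ring A by (rule ma_ring)
  show ?thesis
  proof
    fix x y :: "'m \<Rightarrow>\<^sub>0 'k" and c d
    assume x: "x \<in> carrier A"
    show "c \<odot>\<^bsub>A\<^esub> x \<in> carrier A" using ma_smult_closed[OF x] .
    show "(c + d) \<odot>\<^bsub>A\<^esub> x = c \<odot>\<^bsub>A\<^esub> x \<oplus>\<^bsub>A\<^esub> d \<odot>\<^bsub>A\<^esub> x" 
      by (rule poly_mapping_eqI) (simp add: ma_simps lookup_add map.rep_eq when_def algebra_simps)
    show "(c * d) \<odot>\<^bsub>A\<^esub> x = c \<odot>\<^bsub>A\<^esub> (d \<odot>\<^bsub>A\<^esub> x)" 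
      by (rule poly_mapping_eqI) (simp add: ma_simps lookup_add map.rep_eq when_def algebra_simps)
    show "1 \<odot>\<^bsub>A\<^esub> x = x" 
      by (rule poly_mapping_eqI) (simp add: ma_simps lookup_add map.rep_eq when_def algebra_simps)
    assume y: "y \<in> carrier A"
    show "c \<odot>\<^bsub>A\<^esub> (x \<oplus>\<^bsub>A\<^esub> y) = c \<odot>\<^bsub>A\<^esub> x \<oplus>\<^bsub>A\<^esub> c \<odot>\<^bsub>A\<^esub> y"
      using ma_smult_add by (simp add: ma_simps(4))
    show "(c \<odot>\<^bsub>A\<^esub> x) \<otimes>\<^bsub>A\<^esub> y = c \<odot>\<^bsub>A\<^esub> (x \<otimes>\<^bsub>A\<^esub> y)"
      using x
    proof (rule ma_induct)
      fix a and d :: 'k assume a: "a \<in> carrier M"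
      show "(c \<odot>\<^bsub>A\<^esub> sng a d) \<otimes>\<^bsub>A\<^esub> y = c \<odot>\<^bsub>A\<^esub> (sng a d \<otimes>\<^bsub>A\<^esub> y)"
        using y by (rule ma_induct) (simp_all add: ma_mult0 ma_smult0 ma_smult_add ma_smult_single ma_mult_addr ma_mult_single a mult.assoc)
    qed (simp_all add: ma_mult0 ma_smult0 ma_smult_add ma_mult_addl)
    show "x \<otimes>\<^bsub>A\<^esub> (c \<odot>\<^bsub>A\<^esub> y) = c \<odot>\<^bsub>A\<^esub> (x \<otimes>\<^bsub>A\<^esub> y)"
      using x
    proof (rule ma_induct)
      fix a and d :: 'k assume a: "a \<in> carrier M"
      show "sng a d \<otimes>\<^bsub>A\<^esub> (c \<odot>\<^bsub>A\<^esub> y) = c \<odot>\<^bsub>A\<^esub> (sng a d \<otimes>\<^bsub>A\<^esub> y)"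
        using y by (rule ma_induct) (simp_all add: ma_mult0 ma_smult0 ma_smult_add ma_smult_single ma_mult_addr ma_mult_single a algebra_simps)
    qed (simp_all add: ma_mult0 ma_smult0 ma_smult_add ma_mult_addl)
  qed
qed

end
end


subsection \<open>Quotients and universal properties\<close>

context k_algebra begin

lemma smult_zero_right [simp]: "c \<odot> \<zero> = \<zero>"
proof -
  have "c \<odot> \<zero> \<oplus> c \<odot> \<zero> = c \<odot> \<zero> \<oplus> \<zero>"
    using smult_r_distr[of \<zero> \<zero> c] smult_closed[of \<zero> c] by simp
  then show ?thesis using smult_closed[OF zero_closed, of c] add.l_cancel_one by simp
qed

lemma smult_zero_left [simp]: 
  assumes "x \<in> carrier A" shows "0 \<odot> x = \<zero>"
proof -
  have "0 \<odot> x \<oplus> 0 \<odot> x = 0 \<odot> x \<oplus> \<zero>"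
    using smult_l_distr[OF assms, of 0 0] smult_closed[OF assms, of 0] by simp
  then show ?thesis using smult_closed[OF assms, of 0] add.l_cancel_one by simp
qed

lemma smult_minus: 
  assumes "x \<in> carrier A" shows "(- 1) \<odot> x = \<ominus> x"
proof -
  have "(- 1) \<odot> x \<oplus> x = \<zero>"
    using smult_l_distr[OF assms, of "-1" 1] assms by (simp add: smult_one)
  then show ?thesis using smult_closed[OF assms] assms minus_equality by metis
qed

lemma smult_ideal:
  assumes "ideal I A" "x \<in> I" shows "c \<odot> x \<in> I"
proof -
  interpret I: ideal I A by fact
  have x: "x \<in> carrier A" using assms(2) I.a_Hcarr by blast
  have "c \<odot> x = (c \<odot> \<one>) \<otimes> x" using x by (simp add: smult_mult_l)
  then show ?thesis using I.I_l_closed[OF assms(2) smult_closed[OF one_closed]] by simp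
qed

lemma quot_carrier: "carrier (quot_algebra A I) = (\<lambda>x. I +> x) ` carrier A"
  by (auto simp: quot_algebra_def FactRing_def A_RCOSETS_def' )

lemma quot_smult:
  assumes "ideal I A" "x \<in> carrier A"
  shows "c \<odot>\<^bsub>quot_algebra A I\<^esub> (I +> x) = I +> (c \<odot> x)"
proof -
  interpret I: ideal I A by fact
  have "I +> (c \<odot> y) = I +> (c \<odot> x)" if yI: "y \<in> I +> x" for y
  proof -
    obtain i where i: "i \<in> I" "y = i \<oplus> x" using yI by (auto simp: a_r_coset_def')
    have ic: "i \<in> carrier A" using i I.a_Hcarr by blast
    have "c \<odot> y = c \<odot> i \<oplus> c \<odot> x" using i ic assms(2) by (simp add: smult_r_distr)
    then have "c \<odot> y \<in> I +> (c \<odot> x)" using smult_ideal[OF assms(1) i(1)] by (auto simp: a_r_coset_def')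
    then show ?thesis using I.a_repr_independence'[OF _ smult_closed[OF assms(2)]] by simp
  qed
  moreover have "x \<in> I +> x" using assms(2) I.a_rcos_self by blast
  ultimately have "(\<Union>y\<in>I +> x. I +> (c \<odot> y)) = I +> (c \<odot> x)" by blast
  then show ?thesis by (simp add: quot_algebra_def)
qed

lemma quot_ops:
  assumes "ideal I A" 
  shows "x \<in> carrier A \<Longrightarrow> y \<in> carrier A \<Longrightarrow> (I +> x) \<otimes>\<^bsub>quot_algebra A I\<^esub> (I +> y) = I +> (x \<otimes> y)"
    "x \<in> carrier A \<Longrightarrow> y \<in> carrier A \<Longrightarrow> (I +> x) \<oplus>\<^bsub>quot_algebra A I\<^esub> (I +> y) = I +> (x \<oplus> y)"
    "\<one>\<^bsub>quot_algebra A I\<^esub> = I +> \<one>"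
    "\<zero>\<^bsub>quot_algebra A I\<^esub> = I +> \<zero>"
proof -
  interpret I: ideal I A by fact
  show "x \<in> carrier A \<Longrightarrow> y \<in> carrier A \<Longrightarrow> (I +> x) \<otimes>\<^bsub>quot_algebra A I\<^esub> (I +> y) = I +> (x \<otimes> y)"
    by (simp add: quot_algebra_def FactRing_def I.rcoset_mult_add)
  show "x \<in> carrier A \<Longrightarrow> y \<in> carrier A \<Longrightarrow> (I +> x) \<oplus>\<^bsub>quot_algebra A I\<^esub> (I +> y) = I +> (x \<oplus> y)"
    by (simp add: quot_algebra_def FactRing_def I.a_rcos_sum)
  have "I +> \<zero> = I" by (rule I.a_rcos_const) (rule I.zero_closed)
  then show "\<zero>\<^bsub>quot_algebra A I\<^esub> = I +> \<zero>" by (simp add: quot_algebra_def FactRing_def)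
qed (simp add: quot_algebra_def FactRing_def)

lemma ring_quot:
  assumes "ideal I A" shows "ring (quot_algebra A I)"
proof -
  interpret I: ideal I A by fact
  show ?thesis
  proof (rule ringI)
    show "abelian_group (quot_algebra A I)"
    proof (rule abelian_groupI)
      fix X assume "X \<in> carrier (quot_algebra A I)"
      then obtain x where x: "x \<in> carrier A" "X = I +> x" by (auto simp: quot_carrier)
      then show "\<exists>Y\<in>carrier (quot_algebra A I). Y \<oplus>\<^bsub>quot_algebra A I\<^esub> X = \<zero>\<^bsub>quot_algebra A I\<^esub>"
        by (intro bexI[of _ "I +> (\<ominus> x)"]) (auto simp: quot_carrier quot_ops[OF assms] l_neg)
    qed (auto simp: quot_carrier quot_ops[OF assms] a_ac)
    show "Group.monoid (quot_algebra A I)"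
      by (rule Group.monoidI) (auto simp: quot_carrier quot_ops[OF assms] m_assoc)
  qed (auto simp: quot_carrier quot_ops[OF assms] l_distr r_distr)
qed

lemma k_algebra_quot:
  assumes "ideal I A" shows "k_algebra (quot_algebra A I)"
proof -
  interpret Q: ring "quot_algebra A I" by (rule ring_quot[OF assms])
  show ?thesis
    by unfold_locales
      (auto simp: quot_carrier quot_ops[OF assms] quot_smult[OF assms] smult_closed smult_l_distr
        smult_r_distr smult_assoc1 smult_one smult_mult_l smult_mult_r)
qed

lemma quot_factor:
  fixes B :: "('k, 'b) module"
  assumes B: "k_algebra B" and f: "f \<in> alg_hom A B" and S: "S \<subseteq> carrier A"
    and fS: "\<And>s. s \<in> S \<Longrightarrow> f s = \<zero>\<^bsub>B\<^esub>"
  shows "\<exists>h\<in>alg_hom (quot_algebra A (Idl S)) B. \<forall>x\<in>carrier A. h (Idl S +> x) = f x"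
proof -
  interpret B: k_algebra B by fact
  have fr: "f \<in> Ring.ring_hom A B" using f by (simp add: alg_hom_def)
  interpret f: ring_hom_ring A B f
    by (intro ring_hom_ringI2 ring_axioms B.ring_axioms fr)
  have I: "ideal (Idl S) A" using S by (rule genideal_ideal)
  interpret I: ideal "Idl S" A by fact
  have ker: "ideal (a_kernel A B f) A" by (rule f.kernel_is_ideal)
  have "S \<subseteq> a_kernel A B f" unfolding a_kernel_def' using S fS by blast
  then have sub: "Idl S \<subseteq> a_kernel A B f" by (rule genideal_minimal[OF ker])
  define h where "h = (\<lambda>X. the_elem (f ` X))"
  have h: "h (Idl S +> x) = f x" if x: "x \<in> carrier A" for x
  proof -
    have "f y = f x" if "y \<in> Idl S +> x" for y
    proof -
      obtain i where i: "i \<in> Idl S" "y = i \<oplus> x" using \<open>y \<in> _\<close> by (auto simp: a_r_coset_def')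
      then have "i \<in> carrier A" "f i = \<zero>\<^bsub>B\<^esub>" using sub unfolding a_kernel_def' by blast+
      then show ?thesis using i x by simp
    qed
    moreover have "x \<in> Idl S +> x" using x I.a_rcos_self by blast
    ultimately have "f ` (Idl S +> x) = {f x}" by blast
    then show ?thesis by (simp add: h_def)
  qed
  have sm: "f (c \<odot> x) = c \<odot>\<^bsub>B\<^esub> f x" if "x \<in> carrier A" for c x
    using f that by (simp add: alg_hom_def)
  have "h \<in> alg_hom (quot_algebra A (Idl S)) B"
    by (auto simp: alg_hom_def Ring.ring_hom_def quot_carrier quot_ops[OF I] quot_smult[OF I] h sm smult_closed)
  then show ?thesis using h by blast
qed

end

lemma finsum_superset:
  assumes "abelian_monoid B" "finite S" "T \<subseteq> S" "\<And>a. a \<in> T \<Longrightarrow> f a \<in> carrier B" "\<And>a. a \<in> S - T \<Longrightarrow> f a = \<zero>\<^bsub>B\<^esub>"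
  shows "finsum B f S = finsum B f T"
proof -
  interpret abelian_monoid B by fact
  have "f x \<in> carrier B" if "x \<in> S" for x using assms(4,5)[of x] that by (cases "x \<in> T") auto
  then show ?thesis using assms(2,3,5) by (intro add.finprod_mono_neutral_cong_right) auto
qed

lemma ma_ext:
  fixes B :: "('k::field, 'b) module"
  assumes M: "Group.monoid M" and B: "k_algebra B"
    and cl: "\<And>a. a \<in> carrier M \<Longrightarrow> \<phi> a \<in> carrier B"
    and one: "\<phi> \<one>\<^bsub>M\<^esub> = \<one>\<^bsub>B\<^esub>"
    and mul: "\<And>a b. a \<in> carrier M \<Longrightarrow> b \<in> carrier M \<Longrightarrow> \<phi> (a \<otimes>\<^bsub>M\<^esub> b) = \<phi> a \<otimes>\<^bsub>B\<^esub> \<phi> b"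
  shows "\<exists>f\<in>alg_hom (monoid_algebra M) B. \<forall>a\<in>carrier M. \<forall>c. f (sng a c) = c \<odot>\<^bsub>B\<^esub> \<phi> a"
proof -
  interpret B: k_algebra B by fact
  interpret M: Group.monoid M by fact
  let ?A = "monoid_algebra M :: ('k, _) module"
  interpret A: k_algebra ?A using ma_k_algebra[OF M] .
  define f where "f p = finsum B (\<lambda>a. Poly_Mapping.lookup p a \<odot>\<^bsub>B\<^esub> \<phi> a) (Poly_Mapping.keys p)" for p
  have fS: "f p = finsum B (\<lambda>a. Poly_Mapping.lookup p a \<odot>\<^bsub>B\<^esub> \<phi> a) S"
    if "finite S" "Poly_Mapping.keys p \<subseteq> S" "S \<subseteq> carrier M" for p S
    unfolding f_def using that 
    by (intro finsum_superset[symmetric])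
      (auto simp: B.abelian_monoid_axioms in_keys_iff cl subset_iff intro!: B.smult_closed)
  have fs: "f (sng a c) = c \<odot>\<^bsub>B\<^esub> \<phi> a" if "a \<in> carrier M" for a c
    using that by (subst fS[of "{a}"]) (auto simp: cl B.smult_closed)
  have f0: "f 0 = \<zero>\<^bsub>B\<^esub>" by (simp add: f_def)
  have fc: "f p \<in> carrier B" if "p \<in> carrier ?A" for p
    using that unfolding f_def ma_simps by (intro B.finsum_closed) (auto intro!: B.smult_closed cl)
  have fadd: "f (p + q) = f p \<oplus>\<^bsub>B\<^esub> f q" if "p \<in> carrier ?A" "q \<in> carrier ?A" for p q
  proof -
    let ?S = "Poly_Mapping.keys p \<union> Poly_Mapping.keys q"
    have S: "finite ?S" "?S \<subseteq> carrier M" using that by (auto simp: ma_simps)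
    have cc: "\<And>a. a \<in> ?S \<Longrightarrow> \<phi> a \<in> carrier B" using S cl by blast
    have "f (p + q) = finsum B (\<lambda>a. Poly_Mapping.lookup p a \<odot>\<^bsub>B\<^esub> \<phi> a \<oplus>\<^bsub>B\<^esub> Poly_Mapping.lookup q a \<odot>\<^bsub>B\<^esub> \<phi> a) ?S"
    proof -
      have "f (p + q) = finsum B (\<lambda>a. Poly_Mapping.lookup (p + q) a \<odot>\<^bsub>B\<^esub> \<phi> a) ?S"
        using S keys_add[of p q] by (intro fS) auto
      also have "\<dots> = finsum B (\<lambda>a. Poly_Mapping.lookup p a \<odot>\<^bsub>B\<^esub> \<phi> a \<oplus>\<^bsub>B\<^esub> Poly_Mapping.lookup q a \<odot>\<^bsub>B\<^esub> \<phi> a) ?S"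
        by (intro B.finsum_cong') (use cc in \<open>auto simp: lookup_add B.smult_l_distr intro!: B.smult_closed\<close>)
      finally show ?thesis .
    qed
    also have "\<dots> = finsum B (\<lambda>a. Poly_Mapping.lookup p a \<odot>\<^bsub>B\<^esub> \<phi> a) ?S \<oplus>\<^bsub>B\<^esub> finsum B (\<lambda>a. Poly_Mapping.lookup q a \<odot>\<^bsub>B\<^esub> \<phi> a) ?S"
      using S by (intro B.finsum_addf) (auto intro!: B.smult_closed cl)
    also have "\<dots> = f p \<oplus>\<^bsub>B\<^esub> f q"
      using S fS[of ?S p] fS[of ?S q] by auto
    finally show ?thesis .
  qed
  have fsm: "f (c \<odot>\<^bsub>?A\<^esub> p) = c \<odot>\<^bsub>B\<^esub> f p" if "p \<in> carrier ?A" for c p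
    using that
    by (rule ma_induct)
      (simp_all add: f0 fs fadd fc ma_smult0 ma_smult_single ma_smult_add A.smult_closed B.smult_assoc1 B.smult_r_distr cl)
  have fmul: "f (p \<otimes>\<^bsub>?A\<^esub> q) = f p \<otimes>\<^bsub>B\<^esub> f q" if p: "p \<in> carrier ?A" and q: "q \<in> carrier ?A" for p q
    using p
  proof (rule ma_induct)
    fix a and c :: 'k assume a: "a \<in> carrier M"
    have sc: "sng a c \<in> carrier ?A" using ma_single_closed[OF a] .
    show "f (sng a c \<otimes>\<^bsub>?A\<^esub> q) = f (sng a c) \<otimes>\<^bsub>B\<^esub> f q"
      using q
    proof (rule ma_induct)
      fix b and d :: 'k assume b: "b \<in> carrier M"
      show "f (sng a c \<otimes>\<^bsub>?A\<^esub> sng b d) = f (sng a c) \<otimes>\<^bsub>B\<^esub> f (sng b d)"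
        by (simp add: ma_mult_single fs a b mul cl B.smult_mult_l B.smult_mult_r B.smult_closed B.smult_assoc1[symmetric] mult.commute)
    qed (simp_all add: f0 ma_mult0 ma_mult_addr fs a cl B.smult_closed fadd A.m_closed sc fc B.r_distr)
  qed (simp_all add: f0 ma_mult0 ma_mult_addl fadd A.m_closed q fc B.l_distr)
  have "f \<in> alg_hom ?A B"
    by (auto simp: alg_hom_def Ring.ring_hom_def fc fmul fsm)
      (simp_all add: ma_simps(2,4) fs one fadd B.smult_one)
  then show ?thesis using fs by blast
qed

lemma monoid_free_monoid: "Group.monoid (free_monoid X)"
  by (rule Group.monoidI) (auto simp: free_monoid_def)

definition wprod :: "('k::field, 'b) module \<Rightarrow> ('x \<Rightarrow> 'b) \<Rightarrow> 'x list \<Rightarrow> 'b" where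
  "wprod B \<phi> w = foldr (\<lambda>y r. \<phi> y \<otimes>\<^bsub>B\<^esub> r) w \<one>\<^bsub>B\<^esub>"

lemma wprod_simps [simp]: "wprod B \<phi> [] = \<one>\<^bsub>B\<^esub>" "wprod B \<phi> (y # w) = \<phi> y \<otimes>\<^bsub>B\<^esub> wprod B \<phi> w"
  by (simp_all add: wprod_def)

lemma wprod_closed:
  assumes "k_algebra B" "\<And>y. y \<in> X \<Longrightarrow> \<phi> y \<in> carrier B" "w \<in> lists X"
  shows "wprod B \<phi> w \<in> carrier B"
proof -
  interpret k_algebra B by fact
  show ?thesis using assms(3) by (induction w) (auto simp: assms(2))
qed

lemma wprod_append:
  assumes "k_algebra B" "\<And>y. y \<in> X \<Longrightarrow> \<phi> y \<in> carrier B" "w \<in> lists X" "v \<in> lists X"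
  shows "wprod B \<phi> (w @ v) = wprod B \<phi> w \<otimes>\<^bsub>B\<^esub> wprod B \<phi> v"
proof -
  interpret k_algebra B by fact
  show ?thesis using assms(3) 
    by (induction w) (auto simp: assms(2) wprod_closed[OF assms(1,2)] assms(4) m_assoc)
qed

lemma wprod_replicate:
  assumes "k_algebra B" "\<phi> y \<in> carrier B"
  shows "wprod B \<phi> (replicate n y) = \<phi> y [^]\<^bsub>B\<^esub> n"
proof -
  interpret k_algebra B by fact
  show ?thesis by (induction n) (use assms(2) nat_pow_Suc2[of "\<phi> y"] in simp_all)
qed

lemma free_ext:
  fixes B :: "('k::field, 'b) module"
  assumes B: "k_algebra B" and cl: "\<And>y. y \<in> X \<Longrightarrow> \<phi> y \<in> carrier B"
  shows "\<exists>f\<in>alg_hom (free_algebra X) B. \<forall>w\<in>lists X. \<forall>c. f (sng w c) = c \<odot>\<^bsub>B\<^esub> wprod B \<phi> w"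
  using ma_ext[OF monoid_free_monoid[of X] B, of "wprod B \<phi>"] wprod_closed[OF B, of X \<phi>] wprod_append[OF B, of X \<phi>] cl
  by (auto simp: free_algebra_def free_monoid_def)


subsection \<open>The q-binomial theorem\<close>

fun gauss_binom :: "'k::field \<Rightarrow> nat \<Rightarrow> nat \<Rightarrow> 'k" where
  "gauss_binom q n 0 = 1"
| "gauss_binom q 0 (Suc k) = 0"
| "gauss_binom q (Suc n) (Suc k) = q ^ Suc k * gauss_binom q n (Suc k) + gauss_binom q n k"

lemma gauss_binom_gt: "k > n \<Longrightarrow> gauss_binom q n k = 0"
  by (induction q n k rule: gauss_binom.induct) auto

lemma gauss_binom_diag: "gauss_binom q n n = 1"
  by (induction n) (auto simp: gauss_binom_gt)

lemma gauss_binom_pascal2: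
  "k \<le> n \<Longrightarrow> gauss_binom q (Suc n) (Suc k) = gauss_binom q n (Suc k) + q ^ (n - k) * gauss_binom q n k"
proof (induction n arbitrary: k)
  case 0 then show ?case by simp
next
  case (Suc n)
  show ?case
  proof (cases "k = Suc n")
    case True then show ?thesis using gauss_binom_gt[of "Suc n" "Suc (Suc n)" q] by simp
  next
    case False
    then have k: "k \<le> n" using Suc.prems by simp
    have "q ^ Suc n * gauss_binom q n k + gauss_binom q (Suc n) k = gauss_binom q n k + q ^ (Suc n - k) * gauss_binom q (Suc n) k"
    proof (cases k)
      case 0 then show ?thesis by simp
    next
      case (Suc j)
      have e: "q ^ Suc n = q ^ (n - j) * q ^ Suc j" using k Suc by (simp flip: power_add)
      have "j \<le> n" using k Suc by simp
      from Suc.IH[OF this] have p2: "gauss_binom q (Suc n) (Suc j) = gauss_binom q n (Suc j) + q ^ (n - j) * gauss_binom q n j" .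
      have p1: "gauss_binom q (Suc n) (Suc j) = q ^ Suc j * gauss_binom q n (Suc j) + gauss_binom q n j" by simp
      have "q ^ Suc n * gauss_binom q n (Suc j) + gauss_binom q (Suc n) (Suc j)
        = q ^ (n - j) * q ^ Suc j * gauss_binom q n (Suc j) + (gauss_binom q n (Suc j) + q ^ (n - j) * gauss_binom q n j)"
        unfolding e p2 ..
      also have "\<dots> = gauss_binom q n (Suc j) + q ^ (n - j) * gauss_binom q (Suc n) (Suc j)"
        unfolding p1 by (simp add: algebra_simps)
      finally show ?thesis unfolding Suc by simp
    qed
    note key = this
    have e: "q ^ Suc k * q ^ (n - k) = q ^ Suc n" using k by (simp flip: power_add)
    have "gauss_binom q (Suc (Suc n)) (Suc k) = q ^ Suc k * gauss_binom q (Suc n) (Suc k) + gauss_binom q (Suc n) k" by simp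
    also have "\<dots> = q ^ Suc k * gauss_binom q n (Suc k) + (q ^ Suc k * q ^ (n - k)) * gauss_binom q n k + gauss_binom q (Suc n) k"
      unfolding Suc.IH[OF k] by (simp add: algebra_simps)
    also have "\<dots> = q ^ Suc k * gauss_binom q n (Suc k) + (q ^ Suc n * gauss_binom q n k + gauss_binom q (Suc n) k)"
      unfolding e by (simp add: algebra_simps)
    also have "\<dots> = gauss_binom q (Suc n) (Suc k) + q ^ (Suc n - k) * gauss_binom q (Suc n) k"
      unfolding key by simp
    finally show ?thesis .
  qed
qed

lemma gauss_binom_root:
  assumes q: "\<And>n. q ^ n = 1 \<longleftrightarrow> N dvd n" and k: "0 < k" "k < N"
  shows "gauss_binom q N k = 0"
  using k
proof (induction k)
  case (Suc k)
  have "(1 - q ^ Suc k) * gauss_binom q N (Suc k) = (1 - q ^ (N - k)) * gauss_binom q N k"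
    using gauss_binom_pascal2[of k N q] Suc.prems by (simp add: algebra_simps)
  moreover have "(1 - q ^ (N - k)) * gauss_binom q N k = 0"
    using Suc q[of N] by (cases "k = 0") auto
  moreover have "q ^ Suc k \<noteq> 1" using q[of "Suc k"] Suc.prems nat_dvd_not_less by blast
  ultimately show ?case by simp
qed simp

context k_algebra begin

lemma gauss_binomial:
  assumes a: "a \<in> carrier A" and b: "b \<in> carrier A" and ab: "a \<otimes> b = q \<odot> (b \<otimes> a)"
  shows "(a \<oplus> b) [^] n = (\<Oplus>k\<in>{..n}. gauss_binom q n k \<odot> (b [^] k \<otimes> a [^] (n - k)))"
proof (induction n)
  case 0 then show ?case by (simp add: smult_one)
next
  case (Suc n)
  note cl = a b smult_closed
  have abk: "a \<otimes> b [^] k = q ^ k \<odot> (b [^] k \<otimes> a)" for k :: nat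
  proof (induction k)
    case 0 then show ?case using a by (simp add: smult_one)
  next
    case (Suc k)
    have "a \<otimes> b [^] Suc k = (a \<otimes> b [^] k) \<otimes> b" using a b by (simp add: m_assoc)
    also have "\<dots> = q ^ k \<odot> (b [^] k \<otimes> (a \<otimes> b))" using a b by (simp add: Suc smult_mult_l m_assoc)
    also have "\<dots> = q ^ Suc k \<odot> (b [^] Suc k \<otimes> a)"
      using a b by (simp add: ab smult_mult_r smult_assoc1[symmetric] m_assoc mult.commute)
    finally show ?case .
  qed
  define t where "t n k = gauss_binom q n k \<odot> (b [^] k \<otimes> a [^] (n - k))" for n k
  define u where "u k = (q ^ k * gauss_binom q n k) \<odot> (b [^] k \<otimes> a [^] (Suc n - k))" for k
  define v where "v k = gauss_binom q n k \<odot> (b [^] Suc k \<otimes> a [^] (n - k))" for k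
  have tc: "t m k \<in> carrier A" for m k using a b by (simp add: t_def smult_closed)
  have uc: "u k \<in> carrier A" for k using a b by (simp add: u_def smult_closed)
  have vc: "v k \<in> carrier A" for k using a b unfolding v_def by (intro smult_closed m_closed nat_pow_closed)
  have at: "a \<otimes> t n k = u k" if "k \<le> n" for k
  proof -
    have "a \<otimes> t n k = gauss_binom q n k \<odot> ((a \<otimes> b [^] k) \<otimes> a [^] (n - k))"
      using a b by (simp add: t_def smult_mult_r m_assoc)
    also have "\<dots> = (q ^ k * gauss_binom q n k) \<odot> (b [^] k \<otimes> (a \<otimes> a [^] (n - k)))"
      unfolding abk using a b by (simp add: smult_mult_l smult_closed smult_assoc1[symmetric] m_assoc mult.commute)
    also have "a \<otimes> a [^] (n - k) = a [^] (Suc n - k)"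
      using nat_pow_Suc2[OF a, of "n - k"] that by (simp add: Suc_diff_le)
    finally show ?thesis by (simp add: u_def)
  qed
  have bt: "b \<otimes> t n k = v k" for k
  proof -
    have "b \<otimes> t n k = gauss_binom q n k \<odot> ((b \<otimes> b [^] k) \<otimes> a [^] (n - k))"
      using a b by (simp add: t_def smult_mult_r m_assoc)
    then show ?thesis using nat_pow_Suc2[OF b, of k] by (simp add: v_def)
  qed
  have tuv: "t (Suc n) (Suc k) = u (Suc k) \<oplus> v k" for k
    using a b by (simp add: t_def u_def v_def smult_l_distr)
  have t0: "t (Suc n) 0 = u 0" by (simp add: t_def u_def)
  have un: "u (Suc n) = \<zero>" using a b gauss_binom_gt[of n "Suc n" q] by (simp add: u_def)
  have IH: "(a \<oplus> b) [^] n = (\<Oplus>k\<in>{..n}. t n k)" using Suc by (simp add: t_def)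
  have "(a \<oplus> b) [^] Suc n = (a \<oplus> b) \<otimes> (\<Oplus>k\<in>{..n}. t n k)"
    using nat_pow_Suc2[of "a \<oplus> b" n] a b IH by simp
  also have "\<dots> = a \<otimes> (\<Oplus>k\<in>{..n}. t n k) \<oplus> b \<otimes> (\<Oplus>k\<in>{..n}. t n k)"
    using a b tc by (intro l_distr finsum_closed) auto
  also have "a \<otimes> (\<Oplus>k\<in>{..n}. t n k) = (\<Oplus>k\<in>{..n}. a \<otimes> t n k)"
    using a tc by (intro finsum_rdistr) auto
  also have "\<dots> = (\<Oplus>k\<in>{..n}. u k)" using uc by (intro finsum_cong') (auto simp: at)
  also have "b \<otimes> (\<Oplus>k\<in>{..n}. t n k) = (\<Oplus>k\<in>{..n}. b \<otimes> t n k)"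
    using b tc by (intro finsum_rdistr) auto
  also have "\<dots> = (\<Oplus>k\<in>{..n}. v k)" using vc by (intro finsum_cong') (auto simp: bt)
  finally have L: "(a \<oplus> b) [^] Suc n = (\<Oplus>k\<in>{..n}. u k) \<oplus> (\<Oplus>k\<in>{..n}. v k)" .
  have sv: "(\<Oplus>k\<in>{..n}. v k) \<in> carrier A" and su: "(\<Oplus>k\<in>{..n}. u k) \<in> carrier A"
    and su': "(\<Oplus>k\<in>{..n}. u (Suc k)) \<in> carrier A"
    using uc vc by (auto intro!: finsum_closed)
  have "(\<Oplus>k\<in>{..Suc n}. t (Suc n) k) = (\<Oplus>k\<in>{..n}. t (Suc n) (Suc k)) \<oplus> t (Suc n) 0"
    using tc by (intro finsum_Suc2) auto
  also have "(\<Oplus>k\<in>{..n}. t (Suc n) (Suc k)) = (\<Oplus>k\<in>{..n}. u (Suc k) \<oplus> v k)" by (simp add: tuv)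
  also have "\<dots> = (\<Oplus>k\<in>{..n}. u (Suc k)) \<oplus> (\<Oplus>k\<in>{..n}. v k)"
    using uc vc by (intro finsum_addf) auto
  also have "\<dots> \<oplus> t (Suc n) 0 = ((\<Oplus>k\<in>{..n}. u (Suc k)) \<oplus> u 0) \<oplus> (\<Oplus>k\<in>{..n}. v k)"
    unfolding t0 using sv su' uc by (simp add: a_ac)
  also have "(\<Oplus>k\<in>{..n}. u (Suc k)) \<oplus> u 0 = (\<Oplus>k\<in>{..Suc n}. u k)"
    using uc by (intro finsum_Suc2[symmetric]) auto
  also have "\<dots> = u (Suc n) \<oplus> (\<Oplus>k\<in>{..n}. u k)"
    using uc by (intro finsum_Suc) auto
  also have "\<dots> = (\<Oplus>k\<in>{..n}. u k)" using su un by simp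
  finally show ?case unfolding L t_def ..
qed

lemma gauss_binomial_root:
  assumes a: "a \<in> carrier A" and b: "b \<in> carrier A" and ab: "a \<otimes> b = q \<odot> (b \<otimes> a)"
    and q: "\<And>n. q ^ n = 1 \<longleftrightarrow> N dvd n" and N: "N > 0"
  shows "(a \<oplus> b) [^] N = a [^] N \<oplus> b [^] N"
proof -
  define t where "t k = gauss_binom q N k \<odot> (b [^] k \<otimes> a [^] (N - k))" for k
  have tc: "t k \<in> carrier A" for k using a b unfolding t_def by (intro smult_closed m_closed nat_pow_closed)
  have "(a \<oplus> b) [^] N = (\<Oplus>k\<in>{..N}. t k)" unfolding t_def by (rule gauss_binomial[OF a b ab])
  also have "\<dots> = (\<Oplus>k\<in>{0, N}. t k)"
  proof (rule finsum_superset[OF abelian_monoid_axioms])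
    fix k assume "k \<in> {..N} - {0, N}"
    then have "gauss_binom q N k = 0" using q by (intro gauss_binom_root) auto
    then show "t k = \<zero>" using a b by (simp add: t_def)
  qed (use tc in auto)
  also have "\<dots> = t 0 \<oplus> t N"
    using N tc by (subst finsum_insert) auto
  also have "\<dots> = a [^] N \<oplus> b [^] N"
    using a b by (simp add: t_def gauss_binom_diag smult_one)
  finally show ?thesis .
qed

end


subsection \<open>Homomorphisms and presentations\<close>

lemma ma_hom:
  fixes f :: "('m \<Rightarrow>\<^sub>0 'k::field) \<Rightarrow> 'b"
  assumes M: "Group.monoid M" and B: "k_algebra B" and f: "f \<in> alg_hom (monoid_algebra M) B"
    and p: "p \<in> carrier (monoid_algebra M :: ('k, _) module)" and q: "q \<in> carrier (monoid_algebra M :: ('k, _) module)"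
  shows "f p \<in> carrier B" "f (p + q) = f p \<oplus>\<^bsub>B\<^esub> f q" "f (p - q) = f p \<oplus>\<^bsub>B\<^esub> (-1) \<odot>\<^bsub>B\<^esub> f q"
    "f (p - q) = \<zero>\<^bsub>B\<^esub> \<longleftrightarrow> f p = f q" "p - q \<in> carrier (monoid_algebra M :: ('k, _) module)"
proof -
  let ?A = "monoid_algebra M :: ('k, _) module"
  interpret A: k_algebra ?A by (rule ma_k_algebra[OF M])
  interpret B: k_algebra B by fact
  have pm: "-q = (-1) \<odot>\<^bsub>?A\<^esub> q"
    by (rule poly_mapping_eqI) (simp add: ma_simps map.rep_eq when_def)
  have nq: "-q \<in> carrier ?A" using q by (rule ma_uminus_closed)
  have h: "f x \<in> carrier B" if "x \<in> carrier ?A" for x using f that by (auto simp: alg_hom_def Ring.ring_hom_def)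
  have ad: "f (x + y) = f x \<oplus>\<^bsub>B\<^esub> f y" if "x \<in> carrier ?A" "y \<in> carrier ?A" for x y
    using f that by (auto simp: alg_hom_def Ring.ring_hom_def ma_simps(4))
  have sm: "f (c \<odot>\<^bsub>?A\<^esub> x) = c \<odot>\<^bsub>B\<^esub> f x" if "x \<in> carrier ?A" for c x
    using f that by (auto simp: alg_hom_def)
  show 1: "f p \<in> carrier B" "f (p + q) = f p \<oplus>\<^bsub>B\<^esub> f q" using h ad p q by auto
  show 2: "f (p - q) = f p \<oplus>\<^bsub>B\<^esub> (-1) \<odot>\<^bsub>B\<^esub> f q"
    using ad[OF p nq] sm[OF q, of "-1"] by (simp flip: pm)
  show "p - q \<in> carrier ?A" using ma_add_closed[OF p nq] by simp
  have "f p \<oplus>\<^bsub>B\<^esub> (-1) \<odot>\<^bsub>B\<^esub> f q = \<zero>\<^bsub>B\<^esub> \<longleftrightarrow> f p = f q"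
    using h[OF p] h[OF q] B.smult_minus[OF h[OF q]] B.r_right_minus_eq[of "f p" "f q"]
    by (simp add: a_minus_def)
  then show "f (p - q) = \<zero>\<^bsub>B\<^esub> \<longleftrightarrow> f p = f q" using 2 by simp
qed

lemma quot_proj:
  assumes "k_algebra A" "ideal I A"
  shows "(\<lambda>x. I +>\<^bsub>A\<^esub> x) \<in> alg_hom A (quot_algebra A I)"
proof -
  interpret k_algebra A by fact
  show ?thesis by (auto simp: alg_hom_def Ring.ring_hom_def quot_carrier quot_ops[OF assms(2)] quot_smult[OF assms(2)])
qed

lemma quot_proj_zero:
  assumes "k_algebra A" "ideal I A" "x \<in> I"
  shows "I +>\<^bsub>A\<^esub> x = \<zero>\<^bsub>quot_algebra A I\<^esub>"
proof -
  interpret k_algebra A by fact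
  interpret I: ideal I A by fact
  show ?thesis using assms(3) I.a_rcos_const by (simp add: quot_algebra_def FactRing_def)
qed


definition sat :: "('g, 'k::field) datum \<Rightarrow> ('k, 'b) module \<Rightarrow> ('g gen \<Rightarrow> 'b) \<Rightarrow> bool" where
  "sat D B \<phi> \<longleftrightarrow>
     (\<forall>g\<in>carrier (grp D). \<forall>h\<in>carrier (grp D). \<phi> (GenG g) \<otimes>\<^bsub>B\<^esub> \<phi> (GenG h) = \<phi> (GenG (g \<otimes>\<^bsub>grp D\<^esub> h)))
   \<and> \<phi> (GenG \<one>\<^bsub>grp D\<^esub>) = \<one>\<^bsub>B\<^esub>
   \<and> (\<forall>g\<in>carrier (grp D). \<forall>i\<in>idx D. \<phi> (GenG g) \<otimes>\<^bsub>B\<^esub> \<phi> (GenX i) = chr D i g \<odot>\<^bsub>B\<^esub> (\<phi> (GenX i) \<otimes>\<^bsub>B\<^esub> \<phi> (GenG g)))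
   \<and> (\<forall>i\<in>idx D. \<forall>j\<in>idx D. i < j \<longrightarrow> \<phi> (GenX j) \<otimes>\<^bsub>B\<^esub> \<phi> (GenX i) =
        chr D i (elt D j) \<odot>\<^bsub>B\<^esub> (\<phi> (GenX i) \<otimes>\<^bsub>B\<^esub> \<phi> (GenX j)) \<oplus>\<^bsub>B\<^esub>
         (lnk D i j \<odot>\<^bsub>B\<^esub> \<one>\<^bsub>B\<^esub> \<oplus>\<^bsub>B\<^esub> (- lnk D i j) \<odot>\<^bsub>B\<^esub> \<phi> (GenG (elt D i \<otimes>\<^bsub>grp D\<^esub> elt D j))))
   \<and> (\<forall>i\<in>idx D. \<phi> (GenX i) [^]\<^bsub>B\<^esub> Nord D i =
         rtp D i \<odot>\<^bsub>B\<^esub> \<one>\<^bsub>B\<^esub> \<oplus>\<^bsub>B\<^esub> (- rtp D i) \<odot>\<^bsub>B\<^esub> \<phi> (GenG (elt D i [^]\<^bsub>grp D\<^esub> Nord D i)))"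

lemma free_algebra_k_algebra: "k_algebra (free_algebra X)"
  unfolding free_algebra_def by (rule ma_k_algebra[OF monoid_free_monoid])

lemma single_free: "w \<in> lists X \<Longrightarrow> sng w c \<in> carrier (free_algebra X)"
  unfolding free_algebra_def by (rule ma_single_closed) (simp add: free_monoid_def)

lemmas free_hom = ma_hom[OF monoid_free_monoid, folded free_algebra_def]

context
  fixes D :: "('g, 'k::field) datum"
  assumes D: "is_datum D"
begin

lemma D_facts:
  "comm_group (grp D)" "finite (carrier (grp D))" "i \<in> idx D \<Longrightarrow> elt D i \<in> carrier (grp D)"
  "i \<in> idx D \<Longrightarrow> chr D i \<in> hom (grp D) scalar_units"
  "i \<in> idx D \<Longrightarrow> j \<in> idx D \<Longrightarrow> i \<noteq> j \<Longrightarrow> chr D i (elt D j) * chr D j (elt D i) = 1"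
  using D by (auto simp: is_datum_def dual_group_def)

interpretation G: comm_group "grp D" by (rule D_facts)

lemma gens_lists:
  "[] \<in> lists (gens D)" "GenG g \<in> gens D \<longleftrightarrow> g \<in> carrier (grp D)" "GenX i \<in> gens D \<longleftrightarrow> i \<in> idx D"
  by (auto simp: gens_def)

lemma relators_closed: "relators D \<subseteq> carrier (free_algebra (gens D))"
proof -
  interpret k_algebra "free_algebra (gens D) :: ('k, _) module" by (rule free_algebra_k_algebra)
  note [simp] = gens_lists D_facts(3) 
  have m: "p - q \<in> carrier (free_algebra (gens D) :: ('k, _) module)" if "p \<in> carrier (free_algebra (gens D))" "q \<in> carrier (free_algebra (gens D))" 
    for p q :: "'g gen list \<Rightarrow>\<^sub>0 'k"
    using that ma_add_closed[OF _ ma_uminus_closed, of p "free_monoid (gens D)" q] by (simp add: free_algebra_def)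
  have a: "p + q \<in> carrier (free_algebra (gens D) :: ('k, _) module)" if "p \<in> carrier (free_algebra (gens D))" "q \<in> carrier (free_algebra (gens D))" 
    for p q :: "'g gen list \<Rightarrow>\<^sub>0 'k"
    using that ma_add_closed[of p "free_monoid (gens D)" q] by (simp add: free_algebra_def)
  show ?thesis
    unfolding relators_def by (auto intro!: m a single_free simp: in_lists_conv_set)
qed

lemma sat_iff:
  assumes B: "k_algebra B" and f: "f \<in> alg_hom (free_algebra (gens D)) B"
    and w: "\<And>w c. w \<in> lists (gens D) \<Longrightarrow> f (sng w c) = c \<odot>\<^bsub>B\<^esub> wprod B \<phi> w"
    and cl: "\<And>y. y \<in> gens D \<Longrightarrow> \<phi> y \<in> carrier B"
  shows "(\<forall>s\<in>relators D. f s = \<zero>\<^bsub>B\<^esub>) \<longleftrightarrow> sat D B \<phi>"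
proof -
  interpret B: k_algebra B by fact
  note [simp] = gens_lists D_facts(3) 
  note fh = free_hom[OF B f]
  have clG: "g \<in> carrier (grp D) \<Longrightarrow> \<phi> (GenG g) \<in> carrier B" and clX: "i \<in> idx D \<Longrightarrow> \<phi> (GenX i) \<in> carrier B" for g i
    using cl by auto
  note s = single_free[where X = "gens D"]
  have r1: "f (sng [GenG g, GenG h] 1 - sng [GenG (g \<otimes>\<^bsub>grp D\<^esub> h)] 1) = \<zero>\<^bsub>B\<^esub> \<longleftrightarrow> 
      \<phi> (GenG g) \<otimes>\<^bsub>B\<^esub> \<phi> (GenG h) = \<phi> (GenG (g \<otimes>\<^bsub>grp D\<^esub> h))"
    if "g \<in> carrier (grp D)" "h \<in> carrier (grp D)" for g h
    using that by (subst fh(4)) (auto intro!: s simp: w clG B.smult_one)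
  have r2: "f (sng [GenG \<one>\<^bsub>grp D\<^esub>] 1 - sng [] 1) = \<zero>\<^bsub>B\<^esub> \<longleftrightarrow> \<phi> (GenG \<one>\<^bsub>grp D\<^esub>) = \<one>\<^bsub>B\<^esub>"
    by (subst fh(4)) (auto intro!: s simp: w clG B.smult_one)
  have r3: "f (sng [GenG g, GenX i] 1 - sng [GenX i, GenG g] (chr D i g)) = \<zero>\<^bsub>B\<^esub> \<longleftrightarrow> 
      \<phi> (GenG g) \<otimes>\<^bsub>B\<^esub> \<phi> (GenX i) = chr D i g \<odot>\<^bsub>B\<^esub> (\<phi> (GenX i) \<otimes>\<^bsub>B\<^esub> \<phi> (GenG g))"
    if "g \<in> carrier (grp D)" "i \<in> idx D" for g i
    using that by (subst fh(4)) (auto intro!: s simp: w clG clX B.smult_one)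
  have lin: "f (sng [] c - sng [GenG g] c) = c \<odot>\<^bsub>B\<^esub> \<one>\<^bsub>B\<^esub> \<oplus>\<^bsub>B\<^esub> (- c) \<odot>\<^bsub>B\<^esub> \<phi> (GenG g)"
    "sng [] c - sng [GenG g] c \<in> carrier (free_algebra (gens D))"
    if "g \<in> carrier (grp D)" for g c
  proof -
    show "f (sng [] c - sng [GenG g] c) = c \<odot>\<^bsub>B\<^esub> \<one>\<^bsub>B\<^esub> \<oplus>\<^bsub>B\<^esub> (- c) \<odot>\<^bsub>B\<^esub> \<phi> (GenG g)"
      using that by (subst fh(3)) (auto intro!: s simp: w clG B.smult_assoc1[symmetric])
    show "sng [] c - sng [GenG g] c \<in> carrier (free_algebra (gens D))"
      using that by (intro fh(5) s) auto
  qed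
  have r4: "f (sng [GenX j, GenX i] 1
        - (sng [GenX i, GenX j] (chr D i (elt D j))
           + (sng [] (lnk D i j) - sng [GenG (elt D i \<otimes>\<^bsub>grp D\<^esub> elt D j)] (lnk D i j)))) = \<zero>\<^bsub>B\<^esub> \<longleftrightarrow> 
      \<phi> (GenX j) \<otimes>\<^bsub>B\<^esub> \<phi> (GenX i) =
        chr D i (elt D j) \<odot>\<^bsub>B\<^esub> (\<phi> (GenX i) \<otimes>\<^bsub>B\<^esub> \<phi> (GenX j)) \<oplus>\<^bsub>B\<^esub>
         (lnk D i j \<odot>\<^bsub>B\<^esub> \<one>\<^bsub>B\<^esub> \<oplus>\<^bsub>B\<^esub> (- lnk D i j) \<odot>\<^bsub>B\<^esub> \<phi> (GenG (elt D i \<otimes>\<^bsub>grp D\<^esub> elt D j)))"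
    if "i \<in> idx D" "j \<in> idx D" for i j
  proof -
    have gg: "elt D i \<otimes>\<^bsub>grp D\<^esub> elt D j \<in> carrier (grp D)" using that by simp
    have x1: "sng [GenX i, GenX j] (chr D i (elt D j)) \<in> carrier (free_algebra (gens D))"
      "sng [GenX j, GenX i] 1 \<in> carrier (free_algebra (gens D) :: ('k, _) module)" using that by (auto intro!: s)
    have x2: "sng [GenX i, GenX j] (chr D i (elt D j))
           + (sng [] (lnk D i j) - sng [GenG (elt D i \<otimes>\<^bsub>grp D\<^esub> elt D j)] (lnk D i j)) \<in> carrier (free_algebra (gens D))"
      using ma_add_closed[OF x1(1)[unfolded free_algebra_def] lin(2)[OF gg, unfolded free_algebra_def]]
      unfolding free_algebra_def .
    show ?thesis
      unfolding fh(4)[OF x1(2) x2] fh(2)[OF x1(1) lin(2)[OF gg]] lin(1)[OF gg]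
      using that by (simp add: w clX B.smult_one)
  qed
  have r5: "f (sng (replicate (Nord D i) (GenX i)) 1
        - (sng [] (rtp D i) - sng [GenG (elt D i [^]\<^bsub>grp D\<^esub> Nord D i)] (rtp D i))) = \<zero>\<^bsub>B\<^esub> \<longleftrightarrow> 
       \<phi> (GenX i) [^]\<^bsub>B\<^esub> Nord D i =
         rtp D i \<odot>\<^bsub>B\<^esub> \<one>\<^bsub>B\<^esub> \<oplus>\<^bsub>B\<^esub> (- rtp D i) \<odot>\<^bsub>B\<^esub> \<phi> (GenG (elt D i [^]\<^bsub>grp D\<^esub> Nord D i))"
    if "i \<in> idx D" for i
  proof -
    have gg: "elt D i [^]\<^bsub>grp D\<^esub> Nord D i \<in> carrier (grp D)" using that by simp
    have l: "replicate (Nord D i) (GenX i) \<in> lists (gens D)" using that by (auto simp: in_lists_conv_set)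
    show ?thesis
      unfolding fh(4)[OF s[OF l] lin(2)[OF gg]] lin(1)[OF gg]
      using that by (simp add: w[OF l] wprod_replicate[OF B] clX B.smult_one)
  qed
  show ?thesis
    unfolding relators_def sat_def ball_Un
    by (simp add: Ball_def r2) (auto simp: r1 r3 r4 r5; metis r1 r3 r4 r5)
qed

end

lemma alg_hom_comp:
  assumes f: "f \<in> alg_hom A B" and g: "g \<in> alg_hom B C"
  shows "(\<lambda>x. g (f x)) \<in> alg_hom A C"
proof -
  have 1: "f \<in> Ring.ring_hom A B" "g \<in> Ring.ring_hom B C"
    and 2: "\<And>c x. x \<in> carrier A \<Longrightarrow> f (c \<odot>\<^bsub>A\<^esub> x) = c \<odot>\<^bsub>B\<^esub> f x"
    "\<And>c x. x \<in> carrier B \<Longrightarrow> g (c \<odot>\<^bsub>B\<^esub> x) = c \<odot>\<^bsub>C\<^esub> g x"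
    using f g by (auto simp: alg_hom_def)
  have 3: "x \<in> carrier A \<Longrightarrow> f x \<in> carrier B" for x using 1(1) by (rule ring_hom_closed)
  have "g \<circ> f \<in> Ring.ring_hom A C" using 1 by (rule ring_hom_trans)
  then show ?thesis using 2 3 by (simp add: alg_hom_def o_def)
qed

subsection \<open>Tensor products\<close>

context
  fixes A :: "('k::field, 'a) module" and B :: "('k, 'b) module"
  assumes A: "k_algebra A" and B: "k_algebra B"
begin

interpretation A: k_algebra A by (rule A)
interpretation B: k_algebra B by (rule B)

lemma AB_monoid: "Group.monoid (A \<times>\<times> B)"
  by (rule DirProd_monoid) (rule A.monoid_axioms B.monoid_axioms)+

interpretation AB: k_algebra "monoid_algebra (A \<times>\<times> B) :: ('k, 'a \<times> 'b \<Rightarrow>\<^sub>0 'k) module" by (rule ma_k_algebra[OF AB_monoid])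

lemma AB_single: "a \<in> carrier A \<Longrightarrow> b \<in> carrier B \<Longrightarrow> sng (a, b) (c::'k) \<in> carrier (monoid_algebra (A \<times>\<times> B))"
  by (rule ma_single_closed) (simp add: DirProd_def)

lemma AB_minus: "p \<in> carrier (monoid_algebra (A \<times>\<times> B)) \<Longrightarrow> q \<in> carrier (monoid_algebra (A \<times>\<times> B)) \<Longrightarrow>
  p - q \<in> carrier (monoid_algebra (A \<times>\<times> B) :: ('k, _) module)"
  using ma_add_closed[OF _ ma_uminus_closed, of p "A \<times>\<times> B" q] by simp

lemma bilinearity_relators_closed: "bilinearity_relators A B \<subseteq> carrier (monoid_algebra (A \<times>\<times> B))"
  unfolding bilinearity_relators_def
  by (auto intro!: AB_minus AB_single A.smult_closed B.smult_closed)

lemma tensor_ideal_ideal: "ideal (tensor_ideal A B) (monoid_algebra (A \<times>\<times> B))"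
  unfolding tensor_ideal_def by (rule AB.genideal_ideal[OF bilinearity_relators_closed])

lemma tensor_k_algebra: "k_algebra (tensor_algebra A B)"
  unfolding tensor_algebra_def by (rule AB.k_algebra_quot[OF tensor_ideal_ideal])

interpretation T: k_algebra "tensor_algebra A B" by (rule tensor_k_algebra)

lemma tensor_class_hom: "tensor_class A B \<in> alg_hom (monoid_algebra (A \<times>\<times> B)) (tensor_algebra A B)"
  using quot_proj[OF AB.k_algebra_axioms tensor_ideal_ideal]
  by (simp add: tensor_class_def[abs_def] tensor_algebra_def)

lemmas tc = ma_hom[OF AB_monoid tensor_k_algebra tensor_class_hom]

lemma tensor_class_rel: "s \<in> bilinearity_relators A B \<Longrightarrow> tensor_class A B s = \<zero>\<^bsub>tensor_algebra A B\<^esub>"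
  unfolding tensor_class_def tensor_algebra_def 
  by (rule quot_proj_zero[OF AB.k_algebra_axioms tensor_ideal_ideal])
    (use AB.genideal_self[OF bilinearity_relators_closed] in \<open>auto simp: tensor_ideal_def\<close>)

lemma tensor_class_single: 
  assumes "a \<in> carrier A" "b \<in> carrier B"
  shows "tensor_class A B (sng (a, b) c) = c \<odot>\<^bsub>tensor_algebra A B\<^esub> pure_tensor A B a b"
proof -
  have "sng (a, b) c = c \<odot>\<^bsub>monoid_algebra (A \<times>\<times> B)\<^esub> sng (a, b) (1::'k)" by (simp add: ma_smult_single)
  then show ?thesis using tensor_class_hom AB_single[OF assms, of 1] by (simp add: alg_hom_def pure_tensor_def)
qed

lemma pt_closed: "a \<in> carrier A \<Longrightarrow> b \<in> carrier B \<Longrightarrow> pure_tensor A B a b \<in> carrier (tensor_algebra A B)"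
  unfolding pure_tensor_def by (rule tc(1)[OF AB_single AB_single])

lemma pt_add_l:
  assumes "a \<in> carrier A" "a' \<in> carrier A" "b \<in> carrier B"
  shows "pure_tensor A B (a \<oplus>\<^bsub>A\<^esub> a') b = pure_tensor A B a b \<oplus>\<^bsub>tensor_algebra A B\<^esub> pure_tensor A B a' b"
proof -
  have "tensor_class A B (sng (a \<oplus>\<^bsub>A\<^esub> a', b) 1 - (sng (a, b) 1 + sng (a', b) 1)) = \<zero>\<^bsub>tensor_algebra A B\<^esub>"
    using assms unfolding diff_diff_eq[symmetric]
    by (intro tensor_class_rel) (auto simp: bilinearity_relators_def)
  then have "tensor_class A B (sng (a \<oplus>\<^bsub>A\<^esub> a', b) 1) = tensor_class A B (sng (a, b) 1 + sng (a', b) 1)"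
    using assms by (subst (asm) tc(4)) (auto intro!: AB_single ma_add_closed)
  then show ?thesis using assms by (subst (asm) tc(2)) (auto intro!: AB_single simp: pure_tensor_def)
qed

lemma pt_add_r:
  assumes "a \<in> carrier A" "b \<in> carrier B" "b' \<in> carrier B"
  shows "pure_tensor A B a (b \<oplus>\<^bsub>B\<^esub> b') = pure_tensor A B a b \<oplus>\<^bsub>tensor_algebra A B\<^esub> pure_tensor A B a b'"
proof -
  have "tensor_class A B (sng (a, b \<oplus>\<^bsub>B\<^esub> b') 1 - (sng (a, b) 1 + sng (a, b') 1)) = \<zero>\<^bsub>tensor_algebra A B\<^esub>"
    using assms unfolding diff_diff_eq[symmetric]
    by (intro tensor_class_rel) (auto simp: bilinearity_relators_def)
  then have "tensor_class A B (sng (a, b \<oplus>\<^bsub>B\<^esub> b') 1) = tensor_class A B (sng (a, b) 1 + sng (a, b') 1)"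
    using assms by (subst (asm) tc(4)) (auto intro!: AB_single ma_add_closed)
  then show ?thesis using assms by (subst (asm) tc(2)) (auto intro!: AB_single simp: pure_tensor_def)
qed

lemma pt_smult_l:
  assumes "a \<in> carrier A" "b \<in> carrier B"
  shows "pure_tensor A B (c \<odot>\<^bsub>A\<^esub> a) b = c \<odot>\<^bsub>tensor_algebra A B\<^esub> pure_tensor A B a b"
proof -
  have "tensor_class A B (sng (c \<odot>\<^bsub>A\<^esub> a, b) 1 - sng (a, b) c) = \<zero>\<^bsub>tensor_algebra A B\<^esub>"
    using assms by (intro tensor_class_rel) (auto simp: bilinearity_relators_def)
  then have "tensor_class A B (sng (c \<odot>\<^bsub>A\<^esub> a, b) 1) = tensor_class A B (sng (a, b) c)"
    using assms by (subst (asm) tc(4)) (auto intro!: AB_single A.smult_closed)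
  then show ?thesis using assms by (simp add: tensor_class_single) (simp add: pure_tensor_def)
qed

lemma pt_smult_r:
  assumes "a \<in> carrier A" "b \<in> carrier B"
  shows "pure_tensor A B a (c \<odot>\<^bsub>B\<^esub> b) = c \<odot>\<^bsub>tensor_algebra A B\<^esub> pure_tensor A B a b"
proof -
  have "tensor_class A B (sng (a, c \<odot>\<^bsub>B\<^esub> b) 1 - sng (a, b) c) = \<zero>\<^bsub>tensor_algebra A B\<^esub>"
    using assms by (intro tensor_class_rel) (auto simp: bilinearity_relators_def)
  then have "tensor_class A B (sng (a, c \<odot>\<^bsub>B\<^esub> b) 1) = tensor_class A B (sng (a, b) c)"
    using assms by (subst (asm) tc(4)) (auto intro!: AB_single B.smult_closed)
  then show ?thesis using assms by (simp add: tensor_class_single) (simp add: pure_tensor_def)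
qed

lemma pt_mult:
  assumes "a \<in> carrier A" "b \<in> carrier B" "a' \<in> carrier A" "b' \<in> carrier B"
  shows "pure_tensor A B a b \<otimes>\<^bsub>tensor_algebra A B\<^esub> pure_tensor A B a' b' = pure_tensor A B (a \<otimes>\<^bsub>A\<^esub> a') (b \<otimes>\<^bsub>B\<^esub> b')"
proof -
  have "tensor_class A B (sng (a, b) 1 \<otimes>\<^bsub>monoid_algebra (A \<times>\<times> B)\<^esub> sng (a', b') 1) = pure_tensor A B a b \<otimes>\<^bsub>tensor_algebra A B\<^esub> pure_tensor A B a' b'"
    using tensor_class_hom AB_single[OF assms(1,2), of 1] AB_single[OF assms(3,4), of 1]
    by (simp add: alg_hom_def Ring.ring_hom_def pure_tensor_def)
  then show ?thesis by (simp add: ma_mult_single pure_tensor_def DirProd_def)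
qed

lemma pt_one: "pure_tensor A B \<one>\<^bsub>A\<^esub> \<one>\<^bsub>B\<^esub> = \<one>\<^bsub>tensor_algebra A B\<^esub>"
proof -
  have "tensor_class A B \<one>\<^bsub>monoid_algebra (A \<times>\<times> B)\<^esub> = \<one>\<^bsub>tensor_algebra A B\<^esub>"
    using tensor_class_hom by (simp add: alg_hom_def Ring.ring_hom_def)
  then show ?thesis by (simp add: ma_simps pure_tensor_def DirProd_def)
qed

lemma pt_pow:
  assumes "a \<in> carrier A" "b \<in> carrier B"
  shows "pure_tensor A B a b [^]\<^bsub>tensor_algebra A B\<^esub> (n::nat) = pure_tensor A B (a [^]\<^bsub>A\<^esub> n) (b [^]\<^bsub>B\<^esub> n)"
  by (induction n) (use assms in \<open>simp_all add: pt_one pt_mult\<close>)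

end


subsection \<open>The comultiplication\<close>

context
  fixes D :: "('g, 'k::field) datum"
  assumes D: "is_datum D"
begin

interpretation G: comm_group "grp D" by (rule D_facts[OF D])
interpretation F: k_algebra "free_algebra (gens D) :: ('k, 'g gen list \<Rightarrow>\<^sub>0 'k) module"
  by (rule free_algebra_k_algebra)

lemma Uideal_ideal: "ideal (Uideal D) (free_algebra (gens D))"
  unfolding Uideal_def by (rule F.genideal_ideal[OF relators_closed[OF D]])

lemma Ualg_k_algebra: "k_algebra (Ualg D)"
  unfolding Ualg_def by (rule F.k_algebra_quot[OF Uideal_ideal])

interpretation U: k_algebra "Ualg D" by (rule Ualg_k_algebra)

definition "Uproj = (\<lambda>p. Uideal D +>\<^bsub>free_algebra (gens D)\<^esub> p)"

lemma Uproj_hom: "Uproj \<in> alg_hom (free_algebra (gens D)) (Ualg D)"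
  using quot_proj[OF F.k_algebra_axioms Uideal_ideal] by (simp add: Ualg_def Uproj_def)

lemma Ugen_closed: "y \<in> gens D \<Longrightarrow> Ugen D y \<in> carrier (Ualg D)"
  using Uproj_hom single_free[of "[y]" "gens D" "1::'k"]
  by (auto simp: Ugen_def alg_hom_def Ring.ring_hom_def Uproj_def)

lemma Ugen_closed': "g \<in> carrier (grp D) \<Longrightarrow> ug D g \<in> carrier (Ualg D)"
  "i \<in> idx D \<Longrightarrow> ux D i \<in> carrier (Ualg D)"
  by (auto intro!: Ugen_closed simp: gens_def)

lemma ma_single_smult: "sng w c = c \<odot>\<^bsub>free_algebra X\<^esub> sng w (1 :: 'k)"
  by (simp add: free_algebra_def ma_smult_single)

lemma hom_word:
  fixes f :: "('g gen list \<Rightarrow>\<^sub>0 'k) \<Rightarrow> 'b"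
  assumes B: "k_algebra B" and f: "f \<in> alg_hom (free_algebra (gens D)) B" and w: "w \<in> lists (gens D)"
  shows "f (sng w c) = c \<odot>\<^bsub>B\<^esub> wprod B (\<lambda>y. f (sng [y] 1)) w"
proof -
  interpret B: k_algebra B by fact
  have fm: "f (x \<otimes>\<^bsub>free_algebra (gens D)\<^esub> y) = f x \<otimes>\<^bsub>B\<^esub> f y"
    if "x \<in> carrier (free_algebra (gens D))" "y \<in> carrier (free_algebra (gens D))" for x y
    using f that by (auto simp: alg_hom_def Ring.ring_hom_def)
  have f1: "f \<one>\<^bsub>free_algebra (gens D)\<^esub> = \<one>\<^bsub>B\<^esub>"
    using f by (auto simp: alg_hom_def Ring.ring_hom_def)
  have "f (sng w 1) = wprod B (\<lambda>y. f (sng [y] 1)) w"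
    using w
  proof (induction w)
    case Nil
    then show ?case using f1 by (simp add: free_algebra_def ma_simps free_monoid_def)
  next
    case (Cons y w)
    have "sng (y # w) 1 = sng [y] 1 \<otimes>\<^bsub>free_algebra (gens D)\<^esub> sng w (1::'k)"
      by (simp add: free_algebra_def ma_mult_single free_monoid_def)
    then have "f (sng (y # w) 1) = f (sng [y] 1) \<otimes>\<^bsub>B\<^esub> f (sng w 1)"
      using Cons by (simp add: fm single_free)
    then show ?case using Cons by simp
  qed
  moreover have "f (sng w c) = c \<odot>\<^bsub>B\<^esub> f (sng w 1)"
    using f single_free[OF w, of "1::'k"] ma_single_smult[of w c "gens D"] by (simp add: alg_hom_def)
  ultimately show ?thesis by simp
qed

lemma Uproj_word: "w \<in> lists (gens D) \<Longrightarrow> Uproj (sng w c) = c \<odot>\<^bsub>Ualg D\<^esub> wprod (Ualg D) (Ugen D) w"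
  using hom_word[OF Ualg_k_algebra Uproj_hom, of w c]
  by (simp add: Uproj_def[abs_def] Ugen_def[abs_def])

lemma sat_Ualg: "sat D (Ualg D) (Ugen D)"
proof -
  have "\<forall>s\<in>relators D. Uproj s = \<zero>\<^bsub>Ualg D\<^esub>"
    using quot_proj_zero[OF F.k_algebra_axioms Uideal_ideal] F.genideal_self[OF relators_closed[OF D]]
    by (auto simp: Uproj_def Ualg_def Uideal_def)
  then show ?thesis
    using sat_iff[OF D Ualg_k_algebra Uproj_hom, of "Ugen D"] Uproj_word Ugen_closed by blast
qed

lemma Ualg_ext:
  assumes B: "k_algebra B" and cl: "\<And>y. y \<in> gens D \<Longrightarrow> \<phi> y \<in> carrier B" and sat: "sat D B \<phi>"
  shows "\<exists>h\<in>alg_hom (Ualg D) B. \<forall>y\<in>gens D. h (Ugen D y) = \<phi> y"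
proof -
  interpret B: k_algebra B by fact
  obtain f where f: "f \<in> alg_hom (free_algebra (gens D)) B"
    and fw: "\<And>w c. w \<in> lists (gens D) \<Longrightarrow> f (sng w c) = c \<odot>\<^bsub>B\<^esub> wprod B \<phi> w"
    using free_ext[OF B, of "gens D" \<phi>] cl by blast
  have "\<forall>s\<in>relators D. f s = \<zero>\<^bsub>B\<^esub>"
    using sat_iff[OF D B f, of \<phi>] fw cl sat by blast
  then obtain h where h: "h \<in> alg_hom (Ualg D) B"
    and hf: "\<And>x. x \<in> carrier (free_algebra (gens D)) \<Longrightarrow> h (Uproj x) = f x"
    using F.quot_factor[OF B f relators_closed[OF D]] unfolding Ualg_def Uideal_def Uproj_def by blast
  have "h (Ugen D y) = \<phi> y" if y: "y \<in> gens D" for y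
  proof -
    have "h (Ugen D y) = f (sng [y] 1)"
      using hf[of "sng [y] 1"] y single_free[of "[y]" "gens D" "1::'k"] by (simp add: Ugen_def Uproj_def)
    also have "\<dots> = \<phi> y" using y cl fw[of "[y]" 1] by (simp add: B.smult_one)
    finally show ?thesis .
  qed
  then show ?thesis using h by blast
qed

lemma Ualg_hom_unique:
  assumes B: "k_algebra B" and h: "h \<in> alg_hom (Ualg D) B" "h' \<in> alg_hom (Ualg D) B"
    and e: "\<And>y. y \<in> gens D \<Longrightarrow> h (Ugen D y) = h' (Ugen D y)" and x: "x \<in> carrier (Ualg D)"
  shows "h x = h' x"
proof -
  have comp: "(\<lambda>p. k (Uproj p)) \<in> alg_hom (free_algebra (gens D)) B" if "k \<in> alg_hom (Ualg D) B" for k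
    by (rule alg_hom_comp[OF Uproj_hom that])
  obtain p where p: "p \<in> carrier (free_algebra (gens D))" "x = Uproj p"
    using x unfolding Ualg_def F.quot_carrier Uproj_def by blast
  have "h (Uproj p) = h' (Uproj p)"
    using p(1)[unfolded free_algebra_def]
  proof (rule ma_induct)
    fix w and c :: 'k assume "w \<in> carrier (free_monoid (gens D))"
    then have w: "w \<in> lists (gens D)" by (simp add: free_monoid_def)
    have "wprod B (\<lambda>y. h (Uproj (sng [y] 1))) w = wprod B (\<lambda>y. h' (Uproj (sng [y] 1))) w"
      using w by (induction w) (auto simp: e[unfolded Ugen_def, folded Uproj_def])
    then show "h (Uproj (sng w c)) = h' (Uproj (sng w c))"
      using hom_word[OF B comp[OF h(1)] w] hom_word[OF B comp[OF h(2)] w] by simp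
  next
    have "(\<lambda>_. 0) = (\<lambda>_. 0::'k)" by simp
    have z: "k (Uproj 0) = \<zero>\<^bsub>B\<^esub>" if "k \<in> alg_hom (Ualg D) B" for k
      using free_hom(4)[OF B comp[OF that] p(1) p(1)] by simp
    show "h (Uproj 0) = h' (Uproj 0)" by (simp only: z[OF h(1)] z[OF h(2)])
  next
    fix p q :: "'g gen list \<Rightarrow>\<^sub>0 'k"
    assume pq: "p \<in> carrier (monoid_algebra (free_monoid (gens D)))" "q \<in> carrier (monoid_algebra (free_monoid (gens D)))"
      and "h (Uproj p) = h' (Uproj p)" "h (Uproj q) = h' (Uproj q)"
    then show "h (Uproj (p + q)) = h' (Uproj (p + q))"
      using free_hom(2)[OF B comp[OF h(1)] pq[folded free_algebra_def]] free_hom(2)[OF B comp[OF h(2)] pq[folded free_algebra_def]]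
      by simp
  qed
  then show ?thesis using p by simp
qed

definition "cogen y = (case y of
     GenG g \<Rightarrow> pure_tensor (Ualg D) (Ualg D) (ug D g) (ug D g)
   | GenX i \<Rightarrow> pure_tensor (Ualg D) (Ualg D) (ux D i) (ug D (elt D i))
        \<oplus>\<^bsub>tensor_algebra (Ualg D) (Ualg D)\<^esub> pure_tensor (Ualg D) (Ualg D) \<one>\<^bsub>Ualg D\<^esub> (ux D i))"

lemma Nord_facts:
  assumes i: "i \<in> idx D"
  shows "chr D i (elt D i) ^ n = 1 \<longleftrightarrow> Nord D i dvd n" "Nord D i > 0"
proof -
  interpret K: group "scalar_units :: 'k monoid" by (rule field.field_mult_group[OF class_field])
  have hm: "chr D i \<in> hom (grp D) scalar_units" using D_facts[OF D] i by blast
  have g: "elt D i \<in> carrier (grp D)" using D_facts[OF D] i by blast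
  have c: "chr D i (elt D i) \<in> carrier scalar_units" using hm g by (auto simp: hom_def)
  have pw: "x [^]\<^bsub>scalar_units\<^esub> n = x ^ n" for x :: 'k and n :: nat
    by (induction n) (simp_all add: nat_pow_def)
  show 1: "chr D i (elt D i) ^ n = 1 \<longleftrightarrow> Nord D i dvd n" for n
    using K.pow_eq_id[OF c, of n] by (simp add: pw Nord_def)
  interpret h: group_hom "grp D" scalar_units "chr D i" 
    by unfold_locales (rule hm)
  have "chr D i (elt D i) ^ Coset.order (grp D) = chr D i (elt D i [^]\<^bsub>grp D\<^esub> Coset.order (grp D))"
    using h.hom_nat_pow[OF g] by (simp add: pw)
  also have "\<dots> = 1" using G.pow_order_eq_1[OF g] h.hom_one by simp
  finally have "Nord D i dvd Coset.order (grp D)" using 1 by blast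
  moreover have "Coset.order (grp D) > 0" using D_facts(2)[OF D] G.order_gt_0_iff_finite by simp
  ultimately show "Nord D i > 0" using dvd_pos_nat by blast
qed


end

context
  fixes D :: "('g, 'k::field) datum"
  assumes D: "is_datum D"
begin

interpretation G: comm_group "grp D" by (rule D_facts[OF D])
interpretation F: k_algebra "free_algebra (gens D) :: ('k, 'g gen list \<Rightarrow>\<^sub>0 'k) module"
  by (rule free_algebra_k_algebra)
interpretation U: k_algebra "Ualg D" by (rule Ualg_k_algebra[OF D])
lemmas UU = Ualg_k_algebra[OF D]
lemma sat_cogen: "sat D (tensor_algebra (Ualg D) (Ualg D)) (cogen D)"
proof -
  let ?U = "Ualg D" and ?pt = "pure_tensor (Ualg D) (Ualg D)"
  let ?T = "tensor_algebra ?U ?U"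
  interpret T: k_algebra ?T by (rule tensor_k_algebra[OF UU UU])
  note pc = pt_closed[OF UU UU]
    and pal = pt_add_l[OF UU UU] and par = pt_add_r[OF UU UU]
    and psl = pt_smult_l[OF UU UU] and psr = pt_smult_r[OF UU UU]
    and pm = pt_mult[OF UU UU] and p1 = pt_one[OF UU UU]
    and pp = pt_pow[OF UU UU]
  note S = sat_Ualg[OF D, unfolded sat_def]
  have S1: "ug D g \<otimes>\<^bsub>?U\<^esub> ug D h = ug D (g \<otimes>\<^bsub>grp D\<^esub> h)" if "g \<in> carrier (grp D)" "h \<in> carrier (grp D)" for g h
    using S[THEN conjunct1] that by simp
  have S2: "ug D \<one>\<^bsub>grp D\<^esub> = \<one>\<^bsub>?U\<^esub>" by (rule S[THEN conjunct2, THEN conjunct1])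
  have S3: "ug D g \<otimes>\<^bsub>?U\<^esub> ux D i = chr D i g \<odot>\<^bsub>?U\<^esub> (ux D i \<otimes>\<^bsub>?U\<^esub> ug D g)" if "g \<in> carrier (grp D)" "i \<in> idx D" for g i
    using S[THEN conjunct2, THEN conjunct2, THEN conjunct1] that by simp
  have S4: "ux D j \<otimes>\<^bsub>?U\<^esub> ux D i =
        chr D i (elt D j) \<odot>\<^bsub>?U\<^esub> (ux D i \<otimes>\<^bsub>?U\<^esub> ux D j) \<oplus>\<^bsub>?U\<^esub>
         (lnk D i j \<odot>\<^bsub>?U\<^esub> \<one>\<^bsub>?U\<^esub> \<oplus>\<^bsub>?U\<^esub> (- lnk D i j) \<odot>\<^bsub>?U\<^esub> ug D (elt D i \<otimes>\<^bsub>grp D\<^esub> elt D j))"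
    if "i \<in> idx D" "j \<in> idx D" "i < j" for i j using S[THEN conjunct2, THEN conjunct2, THEN conjunct2, THEN conjunct1] that by simp
  have S5: "ux D i [^]\<^bsub>?U\<^esub> Nord D i =
         rtp D i \<odot>\<^bsub>?U\<^esub> \<one>\<^bsub>?U\<^esub> \<oplus>\<^bsub>?U\<^esub> (- rtp D i) \<odot>\<^bsub>?U\<^esub> ug D (elt D i [^]\<^bsub>grp D\<^esub> Nord D i)"
    if "i \<in> idx D" for i using S[THEN conjunct2, THEN conjunct2, THEN conjunct2, THEN conjunct2] that by simp
  note ec = D_facts(3)[OF D]
  note cl = Ugen_closed'(1)[OF D] Ugen_closed'(2)[OF D] ec U.smult_closed T.smult_closed pc
  have cX: "(cogen D) (GenX i) = ?pt (ux D i) (ug D (elt D i)) \<oplus>\<^bsub>?T\<^esub> ?pt \<one>\<^bsub>?U\<^esub> (ux D i)" for i by (simp add: cogen_def[OF D])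
  have cG: "(cogen D) (GenG g) = ?pt (ug D g) (ug D g)" for g by (simp add: cogen_def[OF D])
  have 3: "(cogen D) (GenG g) \<otimes>\<^bsub>?T\<^esub> (cogen D) (GenX i) = chr D i g \<odot>\<^bsub>?T\<^esub> ((cogen D) (GenX i) \<otimes>\<^bsub>?T\<^esub> (cogen D) (GenG g))"
    if g: "g \<in> carrier (grp D)" and i: "i \<in> idx D" for g i
  proof -
    have "ug D g \<otimes>\<^bsub>?U\<^esub> ug D (elt D i) = ug D (elt D i) \<otimes>\<^bsub>?U\<^esub> ug D g"
      using g i ec by (simp add: S1 G.m_comm)
    then show ?thesis using g i
      by (simp add: cX cG T.r_distr T.l_distr cl pm psl psr S3 T.smult_r_distr)
  qed
  have 4: "(cogen D) (GenX j) \<otimes>\<^bsub>?T\<^esub> (cogen D) (GenX i) =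
        chr D i (elt D j) \<odot>\<^bsub>?T\<^esub> ((cogen D) (GenX i) \<otimes>\<^bsub>?T\<^esub> (cogen D) (GenX j)) \<oplus>\<^bsub>?T\<^esub>
         (lnk D i j \<odot>\<^bsub>?T\<^esub> \<one>\<^bsub>?T\<^esub> \<oplus>\<^bsub>?T\<^esub> (- lnk D i j) \<odot>\<^bsub>?T\<^esub> (cogen D) (GenG (elt D i \<otimes>\<^bsub>grp D\<^esub> elt D j)))"
    if i: "i \<in> idx D" and j: "j \<in> idx D" and ij: "i < j" for i j
  proof -
    define xi xj gi gj q q' l where "xi = ux D i" "xj = ux D j" "gi = ug D (elt D i)" "gj = ug D (elt D j)"
      "q = chr D i (elt D j)" "q' = chr D j (elt D i)" "l = lnk D i j"
    note dd = this
    have c: "xi \<in> carrier ?U" "xj \<in> carrier ?U" "gi \<in> carrier ?U" "gj \<in> carrier ?U"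
      using i j by (simp_all add: dd cl)
    have gg: "ug D (elt D i \<otimes>\<^bsub>grp D\<^esub> elt D j) = gi \<otimes>\<^bsub>?U\<^esub> gj" using i j by (simp add: dd S1 ec)
    have ggc: "gj \<otimes>\<^bsub>?U\<^esub> gi = gi \<otimes>\<^bsub>?U\<^esub> gj" using i j by (simp add: dd S1 ec G.m_comm)
    have xx: "xj \<otimes>\<^bsub>?U\<^esub> xi = q \<odot>\<^bsub>?U\<^esub> (xi \<otimes>\<^bsub>?U\<^esub> xj) \<oplus>\<^bsub>?U\<^esub> (l \<odot>\<^bsub>?U\<^esub> \<one>\<^bsub>?U\<^esub> \<oplus>\<^bsub>?U\<^esub> (- l) \<odot>\<^bsub>?U\<^esub> (gi \<otimes>\<^bsub>?U\<^esub> gj))"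
      using S4[OF i j ij] unfolding gg by (simp add: dd)
    have gjxi: "gj \<otimes>\<^bsub>?U\<^esub> xi = q \<odot>\<^bsub>?U\<^esub> (xi \<otimes>\<^bsub>?U\<^esub> gj)" using i j by (simp add: dd S3 ec)
    have "gi \<otimes>\<^bsub>?U\<^esub> xj = q' \<odot>\<^bsub>?U\<^esub> (xj \<otimes>\<^bsub>?U\<^esub> gi)" using i j by (simp add: dd S3 ec)
    moreover have qq: "q * q' = 1" using D_facts(5)[OF D i j] ij by (simp add: dd)
    ultimately have xjgi: "xj \<otimes>\<^bsub>?U\<^esub> gi = q \<odot>\<^bsub>?U\<^esub> (gi \<otimes>\<^bsub>?U\<^esub> xj)"
      using c by (simp add: U.smult_assoc1[symmetric] U.smult_one)
    define a1 a2 a3 a4 b g1 where "a1 = ?pt (xi \<otimes>\<^bsub>?U\<^esub> xj) (gi \<otimes>\<^bsub>?U\<^esub> gj)" "a2 = ?pt xj (xi \<otimes>\<^bsub>?U\<^esub> gj)"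
      "a3 = ?pt xi (gi \<otimes>\<^bsub>?U\<^esub> xj)" "a4 = ?pt \<one>\<^bsub>?U\<^esub> (xi \<otimes>\<^bsub>?U\<^esub> xj)" 
      "b = ?pt \<one>\<^bsub>?U\<^esub> (gi \<otimes>\<^bsub>?U\<^esub> gj)" "g1 = ?pt (gi \<otimes>\<^bsub>?U\<^esub> gj) (gi \<otimes>\<^bsub>?U\<^esub> gj)"
    note aa = this
    have ac: "a1 \<in> carrier ?T" "a2 \<in> carrier ?T" "a3 \<in> carrier ?T" "a4 \<in> carrier ?T" "b \<in> carrier ?T" "g1 \<in> carrier ?T"
      using c by (simp_all add: aa pc)
    have cb: "b \<in> carrier ?T" "l \<odot>\<^bsub>?T\<^esub> b \<in> carrier ?T" "(-l) \<odot>\<^bsub>?T\<^esub> b \<in> carrier ?T" using ac by (auto intro: T.smult_closed)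
    have canc: "l \<odot>\<^bsub>?T\<^esub> b \<oplus>\<^bsub>?T\<^esub> (-l) \<odot>\<^bsub>?T\<^esub> b = \<zero>\<^bsub>?T\<^esub>"
      using ac by (simp add: T.smult_l_distr[symmetric])
    have m: "(cogen D) (GenX k) \<otimes>\<^bsub>?T\<^esub> (cogen D) (GenX k') =
        (?pt (ux D k \<otimes>\<^bsub>?U\<^esub> ux D k') (ug D (elt D k) \<otimes>\<^bsub>?U\<^esub> ug D (elt D k')) \<oplus>\<^bsub>?T\<^esub> ?pt (ux D k) (ug D (elt D k) \<otimes>\<^bsub>?U\<^esub> ux D k'))
        \<oplus>\<^bsub>?T\<^esub> (?pt (ux D k') (ux D k \<otimes>\<^bsub>?U\<^esub> ug D (elt D k')) \<oplus>\<^bsub>?T\<^esub> ?pt \<one>\<^bsub>?U\<^esub> (ux D k \<otimes>\<^bsub>?U\<^esub> ux D k'))"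
      if "k \<in> idx D" "k' \<in> idx D" for k k'
      using that by (simp add: cX T.r_distr T.l_distr cl pm T.a_ac)
    have L1: "?pt (xj \<otimes>\<^bsub>?U\<^esub> xi) (gj \<otimes>\<^bsub>?U\<^esub> gi) = q \<odot>\<^bsub>?T\<^esub> a1 \<oplus>\<^bsub>?T\<^esub> (l \<odot>\<^bsub>?T\<^esub> b \<oplus>\<^bsub>?T\<^esub> (-l) \<odot>\<^bsub>?T\<^esub> g1)"
      using c unfolding xx ggc by (simp add: aa pal psl U.smult_closed)
    have L2: "?pt xj (gj \<otimes>\<^bsub>?U\<^esub> xi) = q \<odot>\<^bsub>?T\<^esub> a2" using c unfolding gjxi by (simp add: aa psr)
    have L3: "?pt xi (xj \<otimes>\<^bsub>?U\<^esub> gi) = q \<odot>\<^bsub>?T\<^esub> a3" using c unfolding xjgi by (simp add: aa psr)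
    have L4: "?pt \<one>\<^bsub>?U\<^esub> (xj \<otimes>\<^bsub>?U\<^esub> xi) = q \<odot>\<^bsub>?T\<^esub> a4 \<oplus>\<^bsub>?T\<^esub> (l \<odot>\<^bsub>?T\<^esub> \<one>\<^bsub>?T\<^esub> \<oplus>\<^bsub>?T\<^esub> (-l) \<odot>\<^bsub>?T\<^esub> b)"
      using c unfolding xx by (simp add: aa par psr U.smult_closed p1)
    have "(cogen D) (GenX j) \<otimes>\<^bsub>?T\<^esub> (cogen D) (GenX i) =
       ((q \<odot>\<^bsub>?T\<^esub> a1 \<oplus>\<^bsub>?T\<^esub> (l \<odot>\<^bsub>?T\<^esub> b \<oplus>\<^bsub>?T\<^esub> (-l) \<odot>\<^bsub>?T\<^esub> g1)) \<oplus>\<^bsub>?T\<^esub> q \<odot>\<^bsub>?T\<^esub> a2) \<oplus>\<^bsub>?T\<^esub>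
       (q \<odot>\<^bsub>?T\<^esub> a3 \<oplus>\<^bsub>?T\<^esub> (q \<odot>\<^bsub>?T\<^esub> a4 \<oplus>\<^bsub>?T\<^esub> (l \<odot>\<^bsub>?T\<^esub> \<one>\<^bsub>?T\<^esub> \<oplus>\<^bsub>?T\<^esub> (-l) \<odot>\<^bsub>?T\<^esub> b)))"
      unfolding m[OF j i] L1[symmetric] L2[symmetric] L3[symmetric] L4[symmetric] by (simp add: dd)
    also have "\<dots> = (q \<odot>\<^bsub>?T\<^esub> a1 \<oplus>\<^bsub>?T\<^esub> q \<odot>\<^bsub>?T\<^esub> a2 \<oplus>\<^bsub>?T\<^esub> q \<odot>\<^bsub>?T\<^esub> a3 \<oplus>\<^bsub>?T\<^esub> q \<odot>\<^bsub>?T\<^esub> a4) \<oplus>\<^bsub>?T\<^esub> (l \<odot>\<^bsub>?T\<^esub> \<one>\<^bsub>?T\<^esub> \<oplus>\<^bsub>?T\<^esub> (-l) \<odot>\<^bsub>?T\<^esub> g1)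
        \<oplus>\<^bsub>?T\<^esub> (l \<odot>\<^bsub>?T\<^esub> b \<oplus>\<^bsub>?T\<^esub> (-l) \<odot>\<^bsub>?T\<^esub> b)"
      using ac by (simp add: T.smult_closed T.a_ac)
    also have "\<dots> = (q \<odot>\<^bsub>?T\<^esub> a1 \<oplus>\<^bsub>?T\<^esub> q \<odot>\<^bsub>?T\<^esub> a2 \<oplus>\<^bsub>?T\<^esub> q \<odot>\<^bsub>?T\<^esub> a3 \<oplus>\<^bsub>?T\<^esub> q \<odot>\<^bsub>?T\<^esub> a4) \<oplus>\<^bsub>?T\<^esub> (l \<odot>\<^bsub>?T\<^esub> \<one>\<^bsub>?T\<^esub> \<oplus>\<^bsub>?T\<^esub> (-l) \<odot>\<^bsub>?T\<^esub> g1)"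
      unfolding canc using ac by (simp add: T.smult_closed)
    also have "q \<odot>\<^bsub>?T\<^esub> a1 \<oplus>\<^bsub>?T\<^esub> q \<odot>\<^bsub>?T\<^esub> a2 \<oplus>\<^bsub>?T\<^esub> q \<odot>\<^bsub>?T\<^esub> a3 \<oplus>\<^bsub>?T\<^esub> q \<odot>\<^bsub>?T\<^esub> a4
       = q \<odot>\<^bsub>?T\<^esub> ((a1 \<oplus>\<^bsub>?T\<^esub> a3) \<oplus>\<^bsub>?T\<^esub> (a2 \<oplus>\<^bsub>?T\<^esub> a4))"
      using ac by (simp add: T.smult_closed T.smult_r_distr T.a_ac)
    also have "(a1 \<oplus>\<^bsub>?T\<^esub> a3) \<oplus>\<^bsub>?T\<^esub> (a2 \<oplus>\<^bsub>?T\<^esub> a4) = (cogen D) (GenX i) \<otimes>\<^bsub>?T\<^esub> (cogen D) (GenX j)"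
      unfolding m[OF i j] by (simp add: aa dd)
    also have "g1 = (cogen D) (GenG (elt D i \<otimes>\<^bsub>grp D\<^esub> elt D j))" by (simp add: cG gg aa)
    finally show ?thesis by (simp add: dd)
  qed
  have 5: "(cogen D) (GenX i) [^]\<^bsub>?T\<^esub> Nord D i =
         rtp D i \<odot>\<^bsub>?T\<^esub> \<one>\<^bsub>?T\<^esub> \<oplus>\<^bsub>?T\<^esub> (- rtp D i) \<odot>\<^bsub>?T\<^esub> (cogen D) (GenG (elt D i [^]\<^bsub>grp D\<^esub> Nord D i))"
    if i: "i \<in> idx D" for i
  proof -
    define N where "N = Nord D i"
    define x g m where "x = ux D i" "g = ug D (elt D i)" "m = rtp D i"
    note dd = this
    have c: "x \<in> carrier ?U" "g \<in> carrier ?U" using i by (simp_all add: dd cl)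
    have gx: "g \<otimes>\<^bsub>?U\<^esub> x = chr D i (elt D i) \<odot>\<^bsub>?U\<^esub> (x \<otimes>\<^bsub>?U\<^esub> g)" using i by (simp add: dd S3 ec)
    have gN: "ug D (elt D i [^]\<^bsub>grp D\<^esub> n) = g [^]\<^bsub>?U\<^esub> n" for n :: nat
      by (induction n) (use i in \<open>simp_all add: S2 S1[symmetric] dd ec\<close>)
    have xN: "x [^]\<^bsub>?U\<^esub> N = m \<odot>\<^bsub>?U\<^esub> \<one>\<^bsub>?U\<^esub> \<oplus>\<^bsub>?U\<^esub> (- m) \<odot>\<^bsub>?U\<^esub> (g [^]\<^bsub>?U\<^esub> N)"
      using S5[OF i] unfolding gN by (simp add: dd N_def)
    define h where "h = g [^]\<^bsub>?U\<^esub> N"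
    have hc: "h \<in> carrier ?U" using c by (simp add: h_def)
    have "(cogen D) (GenX i) [^]\<^bsub>?T\<^esub> N = (?pt x g \<oplus>\<^bsub>?T\<^esub> ?pt \<one>\<^bsub>?U\<^esub> x) [^]\<^bsub>?T\<^esub> N" by (simp add: cX dd)
    also have "\<dots> = ?pt x g [^]\<^bsub>?T\<^esub> N \<oplus>\<^bsub>?T\<^esub> ?pt \<one>\<^bsub>?U\<^esub> x [^]\<^bsub>?T\<^esub> N"
    proof (rule T.gauss_binomial_root)
      show "?pt x g \<otimes>\<^bsub>?T\<^esub> ?pt \<one>\<^bsub>?U\<^esub> x = chr D i (elt D i) \<odot>\<^bsub>?T\<^esub> (?pt \<one>\<^bsub>?U\<^esub> x \<otimes>\<^bsub>?T\<^esub> ?pt x g)"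
        using c by (simp add: pm gx psr)
    qed (use c Nord_facts[OF D i] in \<open>simp_all add: pc N_def\<close>)
    also have "\<dots> = ?pt (x [^]\<^bsub>?U\<^esub> N) h \<oplus>\<^bsub>?T\<^esub> ?pt \<one>\<^bsub>?U\<^esub> (x [^]\<^bsub>?U\<^esub> N)" using c by (simp add: pp h_def)
    also have "\<dots> = (m \<odot>\<^bsub>?T\<^esub> ?pt \<one>\<^bsub>?U\<^esub> h \<oplus>\<^bsub>?T\<^esub> (-m) \<odot>\<^bsub>?T\<^esub> ?pt h h) \<oplus>\<^bsub>?T\<^esub> (m \<odot>\<^bsub>?T\<^esub> \<one>\<^bsub>?T\<^esub> \<oplus>\<^bsub>?T\<^esub> (-m) \<odot>\<^bsub>?T\<^esub> ?pt \<one>\<^bsub>?U\<^esub> h)"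
      unfolding xN h_def[symmetric] using hc by (simp add: pal par psl psr U.smult_closed p1)
    also have "\<dots> = (m \<odot>\<^bsub>?T\<^esub> \<one>\<^bsub>?T\<^esub> \<oplus>\<^bsub>?T\<^esub> (-m) \<odot>\<^bsub>?T\<^esub> ?pt h h) \<oplus>\<^bsub>?T\<^esub> (m \<odot>\<^bsub>?T\<^esub> ?pt \<one>\<^bsub>?U\<^esub> h \<oplus>\<^bsub>?T\<^esub> (-m) \<odot>\<^bsub>?T\<^esub> ?pt \<one>\<^bsub>?U\<^esub> h)"
      using hc by (simp add: pc T.smult_closed T.a_ac)
    also have "m \<odot>\<^bsub>?T\<^esub> ?pt \<one>\<^bsub>?U\<^esub> h \<oplus>\<^bsub>?T\<^esub> (-m) \<odot>\<^bsub>?T\<^esub> ?pt \<one>\<^bsub>?U\<^esub> h = \<zero>\<^bsub>?T\<^esub>"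
      using hc pc by (simp add: T.smult_l_distr[symmetric])
    finally show ?thesis using hc pc by (simp add: dd N_def cG gN h_def T.smult_closed)
  qed
  show ?thesis
    unfolding sat_def
  proof (intro conjI ballI impI)
    fix g h assume "g \<in> carrier (grp D)" "h \<in> carrier (grp D)"
    then show "(cogen D) (GenG g) \<otimes>\<^bsub>?T\<^esub> (cogen D) (GenG h) = (cogen D) (GenG (g \<otimes>\<^bsub>grp D\<^esub> h))"
      by (simp add: cG pm cl S1)
  next
    show "(cogen D) (GenG \<one>\<^bsub>grp D\<^esub>) = \<one>\<^bsub>?T\<^esub>" by (simp add: cG S2 p1)
  qed ((rule 3 4 5; assumption)+)
qed

lemma cogen_closed: "y \<in> gens D \<Longrightarrow> (cogen D) y \<in> carrier (tensor_algebra (Ualg D) (Ualg D))"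
proof -
  interpret T: k_algebra "tensor_algebra (Ualg D) (Ualg D)" by (rule tensor_k_algebra[OF UU UU])
  assume "y \<in> gens D"
  then show ?thesis
    by (auto simp: gens_def cogen_def[OF D] Ugen_closed'[OF D] D_facts(3)[OF D] intro!: T.a_closed pt_closed[OF UU UU])
qed

lemma is_comult_alt:
  "is_comult D \<Delta> \<longleftrightarrow> \<Delta> \<in> alg_hom (Ualg D) (tensor_algebra (Ualg D) (Ualg D)) \<inter> extensional (carrier (Ualg D))
   \<and> (\<forall>y\<in>gens D. \<Delta> (Ugen D y) = (cogen D) y)"
  by (auto simp: is_comult_def gens_def cogen_def[OF D] ball_Un)

theorem comult_ex1: "\<exists>!\<Delta>. is_comult D \<Delta>"
proof -
  let ?T = "tensor_algebra (Ualg D) (Ualg D)"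
  have T: "k_algebra ?T" by (rule tensor_k_algebra[OF UU UU])
  obtain h where h: "h \<in> alg_hom (Ualg D) ?T" "\<And>y. y \<in> gens D \<Longrightarrow> h (Ugen D y) = (cogen D) y"
    using Ualg_ext[OF D T cogen_closed sat_cogen] by blast
  have "restrict h (carrier (Ualg D)) \<in> alg_hom (Ualg D) ?T"
    using h(1) by (auto simp: alg_hom_def Ring.ring_hom_def U.smult_closed)
  then have ex: "is_comult D (restrict h (carrier (Ualg D)))"
    using h(2) by (simp add: is_comult_alt Ugen_closed[OF D])
  have "\<Delta> = \<Delta>'" if d: "is_comult D \<Delta>" "is_comult D \<Delta>'" for \<Delta> \<Delta>'
  proof (rule extensionalityI[of _ "carrier (Ualg D)"])
    fix x assume x: "x \<in> carrier (Ualg D)"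
    have h: "\<Delta> \<in> alg_hom (Ualg D) ?T" "\<Delta>' \<in> alg_hom (Ualg D) ?T"
      and e: "\<And>y. y \<in> gens D \<Longrightarrow> \<Delta> (Ugen D y) = \<Delta>' (Ugen D y)"
      using d by (simp_all add: is_comult_alt)
    show "\<Delta> x = \<Delta>' x" by (rule Ualg_hom_unique[OF D T h e x])
  qed (use d in \<open>auto simp: is_comult_alt\<close>)
  with ex show ?thesis by blast
qed

corollary is_comult_comult: "is_comult D (comult D)"
  unfolding comult_def by (rule theI'[OF comult_ex1])

end

end

theory Submission
  imports Defs
begin

text \<open>The algebra \<open>U\<close> acts on functions on \<open>\<Gamma> \<times> \<nat>\<^sup>\<theta>\<close>: group elements translate, and \<open>x\<^sub>j\<close> raises the
  \<open>j\<close>-th exponent and, because of the linking relations, lowers each exponent \<open>i < j\<close>. Applied to the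
  delta function at \<open>(1, 0)\<close>, an element \<open>u\<close> becomes its coefficient function with respect to the
  basis of monomials \<open>g x\<^sup>m\<close>. In these coordinates the coefficients of \<open>\<Delta>(u)\<close> at
  \<open>- \<otimes> t\<close> and \<open>- \<otimes> t x\<^sub>i\<close> are the components of \<open>u\<close> for a
  \<open>\<Gamma>\<close>-grading and skew derivations, so that both preserve a right coideal subalgebra \<open>A\<close>.
  Differentiating an element of \<open>A\<close> down to degree one shows that each of its monomials of top
  degree leads to linear elements of \<open>A\<close>, which are combinations of the \<open>\<xi>\<close>'s. Gaussian elimination in
  the space of linear elements of each class yields pivot variables, and a product of the \<open>\<xi>\<close>'s of
  the pivots occurring in a top monomial removes this monomial from the element.\<close>

section \<open>The operator model\<close>

text \<open>Coefficient arguments need independent monomials in an algebra known only by generators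
  and relations; the explicit module supplies them. Its critical relations, linking and powers, are
  checked on pieces of the operator of \<open>x_j\<close>, each changing one exponent and possibly
  translating in \<Gamma>. A nonzero linking parameter makes two characters inverse to each other,
  so every contributing piece shifts the character weight of a monomial by \<open>chi j\<close>.
  This makes the pieces commute up to scalars, and the q-binomial theorem evaluates powers of their
  sum.

  The two halves of the equivalence relation have different origins. Congruence of the group
  elements comes from the coproduct: a slice isolates one degree in \<Gamma>. Congruence of the
  characters comes from conjugation by G inside A: averaging over this finite group, possible in
  characteristic zero, isolates one weight. Of a linear element of A, a suitable choice of degree
  and weight leaves variables of a single class and, if the weight is trivial on G, a constant.
  Hence the shape of the \<xi>'s and condition (RD2).\<close>

definition endo_alg :: "'b set \<Rightarrow> ('k::field, ('b \<Rightarrow> 'k) \<Rightarrow> 'b \<Rightarrow> 'k) module" where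
  "endo_alg S =
    \<lparr> carrier = {T. (\<forall>F G. T (\<lambda>b. F b + G b) = (\<lambda>b. T F b + T G b))
                  \<and> (\<forall>c F. T (\<lambda>b. c * F b) = (\<lambda>b. c * T F b))
                  \<and> (\<forall>F b. b \<notin> S \<longrightarrow> T F b = 0)
                  \<and> (\<forall>F F'. (\<forall>b\<in>S. F b = F' b) \<longrightarrow> T F = T F')},
      mult = (\<lambda>T T' F. T (T' F)),
      one = (\<lambda>F b. if b \<in> S then F b else 0),
      zero = (\<lambda>F b. 0),
      add = (\<lambda>T T' F b. T F b + T' F b),
      smult = (\<lambda>c T F b. c * T F b) \<rparr>"

lemma endo_alg_simps:
  "mult (endo_alg S) T T' = (\<lambda>F. T (T' F))"
  "one (endo_alg S) = (\<lambda>F b. if b \<in> S then F b else 0)"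
  "zero (endo_alg S) = (\<lambda>F b. 0)"
  "add (endo_alg S) T T' = (\<lambda>F b. T F b + T' F b)"
  "smult (endo_alg S) c T = (\<lambda>F b. c * T F b)"
  by (simp_all add: endo_alg_def)

lemma endo_algI:
  assumes "\<And>F G. T (\<lambda>b. F b + G b) = (\<lambda>b. T F b + T G b)"
    and "\<And>c F. T (\<lambda>b. c * F b) = (\<lambda>b. c * T F b)"
    and "\<And>F b. b \<notin> S \<Longrightarrow> T F b = 0"
    and "\<And>F F'. (\<And>b. b \<in> S \<Longrightarrow> F b = F' b) \<Longrightarrow> T F = T F'"
  shows "T \<in> carrier (endo_alg S)"
proof -
  have "T F = T F'" if "\<forall>b\<in>S. F b = F' b" for F F'
    by (rule assms(4)) (rule that[rule_format])
  then show ?thesis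
    unfolding endo_alg_def partial_object.simps mem_Collect_eq
    by (intro conjI) (intro allI impI assms(1), intro allI impI assms(2), intro allI impI assms(3), assumption, intro allI impI, blast)
qed

lemma endo_algD:
  assumes "T \<in> carrier (endo_alg S)"
  shows "T (\<lambda>b. F b + G b) = (\<lambda>b. T F b + T G b)"
    and "T (\<lambda>b. c * F b) = (\<lambda>b. c * T F b)"
    and "b \<notin> S \<Longrightarrow> T F b = 0"
    and "(\<And>b. b \<in> S \<Longrightarrow> F b = F' b) \<Longrightarrow> T F = T F'"
proof -
  have *: "(\<forall>F G. T (\<lambda>b. F b + G b) = (\<lambda>b. T F b + T G b))
                  \<and> (\<forall>c F. T (\<lambda>b. c * F b) = (\<lambda>b. c * T F b))
                  \<and> (\<forall>F b. b \<notin> S \<longrightarrow> T F b = 0)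
                  \<and> (\<forall>F F'. (\<forall>b\<in>S. F b = F' b) \<longrightarrow> T F = T F')"
    using assms unfolding endo_alg_def partial_object.simps mem_Collect_eq .
  note 1 = *[THEN conjunct1] and 2 = *[THEN conjunct2, THEN conjunct1]
    and 3 = *[THEN conjunct2, THEN conjunct2, THEN conjunct1]
    and 4 = *[THEN conjunct2, THEN conjunct2, THEN conjunct2]
  show "T (\<lambda>b. F b + G b) = (\<lambda>b. T F b + T G b)" by (rule 1[rule_format])
  show "T (\<lambda>b. c * F b) = (\<lambda>b. c * T F b)" by (rule 2[rule_format])
  show "b \<notin> S \<Longrightarrow> T F b = 0" by (rule 3[rule_format])
  show "T F = T F'" if "\<And>b. b \<in> S \<Longrightarrow> F b = F' b"
    by (rule 4[rule_format]) (rule that)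
qed

lemma endo_alg_zero: "T \<in> carrier (endo_alg S) \<Longrightarrow> T (\<lambda>b. 0) = (\<lambda>b. 0)"
  using endo_algD(2)[of T S 0 "\<lambda>b. 0"] by simp

lemma endo_alg_sum:
  assumes "T \<in> carrier (endo_alg S)" "finite I"
  shows "T (\<lambda>b. \<Sum>i\<in>I. c i * F i b) b = (\<Sum>i\<in>I. c i * T (F i) b)"
  using assms(2)
proof (induction I rule: finite_induct)
  case empty then show ?case using endo_alg_zero[OF assms(1)] by simp
next
  case (insert x I)
  then show ?case by (simp add: endo_algD(1)[OF assms(1)] endo_algD(2)[OF assms(1)])
qed

text \<open>The unit is truncation to S. It is a left unit because operators produce functions
  vanishing outside S, and a right unit because they depend only on the values on S; this is the
  role of the last two conditions on the carrier.\<close>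

lemma endo_alg_k_algebra:
  fixes S :: "'b set"
  shows "k_algebra (endo_alg S :: ('k::field, ('b \<Rightarrow> 'k) \<Rightarrow> 'b \<Rightarrow> 'k) module)"
proof -
  let ?E = "endo_alg S :: ('k, ('b \<Rightarrow> 'k) \<Rightarrow> 'b \<Rightarrow> 'k) module"
  note D = endo_algD
  have ext4: "T F = T F'" if "T \<in> carrier ?E" "\<And>b. b \<in> S \<Longrightarrow> F b = F' b" for T and F F' :: "'b \<Rightarrow> 'k"
    by (rule D(4)[OF that(1)]) (rule that(2))
  have add: "(\<lambda>F b. T F b + T' F b) \<in> carrier ?E" if T: "T \<in> carrier ?E" "T' \<in> carrier ?E" for T T'
  proof (rule endo_algI)
    fix F F' :: "'b \<Rightarrow> 'k" assume F: "\<And>b. b \<in> S \<Longrightarrow> F b = F' b"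
    have "T F = T F'" "T' F = T' F'" by (rule ext4[OF T(1) F] ext4[OF T(2) F]; assumption)+
    then show "(\<lambda>b. T F b + T' F b) = (\<lambda>b. T F' b + T' F' b)" by simp
  qed (simp_all add: D(1,2)[OF T(1)] D(1,2)[OF T(2)] D(3)[OF T(1)] D(3)[OF T(2)] algebra_simps)
  have sm: "(\<lambda>F b. c * T F b) \<in> carrier ?E" if T: "T \<in> carrier ?E" for T and c :: 'k
  proof (rule endo_algI)
    fix F F' :: "'b \<Rightarrow> 'k" assume F: "\<And>b. b \<in> S \<Longrightarrow> F b = F' b"
    have "T F = T F'" by (rule ext4[OF T F])
    then show "(\<lambda>b. c * T F b) = (\<lambda>b. c * T F' b)" by simp
  qed (simp_all add: D(1,2,3)[OF T] algebra_simps)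
  have mu: "(\<lambda>F. T (T' F)) \<in> carrier ?E" if T: "T \<in> carrier ?E" "T' \<in> carrier ?E" for T T'
  proof (rule endo_algI)
    fix F F' :: "'b \<Rightarrow> 'k" assume F: "\<And>b. b \<in> S \<Longrightarrow> F b = F' b"
    have "T' F = T' F'" by (rule ext4[OF T(2) F])
    then show "T (T' F) = T (T' F')" by simp
  qed (simp_all add: D(1,2)[OF T(1)] D(1,2)[OF T(2)] D(3)[OF T(1)])
  have z: "(\<lambda>F b. 0) \<in> carrier ?E" by (rule endo_algI) auto
  have o: "(\<lambda>F b. if b \<in> S then F b else 0) \<in> carrier ?E" by (rule endo_algI) auto
  have ol: "(\<lambda>F b. if b \<in> S then T F b else 0) = T" if "T \<in> carrier ?E" for T
    by (intro ext) (auto simp: D(3)[OF that])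
  have or: "(\<lambda>F. T (\<lambda>b. if b \<in> S then F b else 0)) = T" if "T \<in> carrier ?E" for T
    by (intro ext, rule fun_cong, rule D(4)[OF that]) auto
  have "ring ?E"
  proof (rule ringI)
    show "abelian_group ?E"
    proof (rule abelian_groupI)
      fix T assume "T \<in> carrier ?E"
      then show "\<exists>y\<in>carrier ?E. y \<oplus>\<^bsub>?E\<^esub> T = \<zero>\<^bsub>?E\<^esub>"
        using sm[of T "-1"] by (intro bexI[of _ "\<lambda>F b. (-1) * T F b"]) (simp_all add: endo_alg_simps)
    qed (simp_all add: endo_alg_simps z add algebra_simps)
    show "Group.monoid ?E"
    proof (rule Group.monoidI)
      fix T assume T: "T \<in> carrier ?E"
      show "T \<otimes>\<^bsub>?E\<^esub> \<one>\<^bsub>?E\<^esub> = T" unfolding endo_alg_simps by (rule or[OF T])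
      show "\<one>\<^bsub>?E\<^esub> \<otimes>\<^bsub>?E\<^esub> T = T" unfolding endo_alg_simps by (rule ol[OF T])
    qed (simp_all add: endo_alg_simps o mu)
  next
    fix T T' T'' assume T: "T \<in> carrier ?E" "T' \<in> carrier ?E" "T'' \<in> carrier ?E"
    show "T'' \<otimes>\<^bsub>?E\<^esub> (T \<oplus>\<^bsub>?E\<^esub> T') = T'' \<otimes>\<^bsub>?E\<^esub> T \<oplus>\<^bsub>?E\<^esub> T'' \<otimes>\<^bsub>?E\<^esub> T'"
      by (simp add: endo_alg_simps D(1)[OF T(3)])
  qed (simp_all add: endo_alg_simps)
  then interpret ring ?E .
  show ?thesis
  proof
    fix T T' c assume T: "T \<in> carrier ?E" "T' \<in> carrier ?E"
    show "T \<otimes>\<^bsub>?E\<^esub> (c \<odot>\<^bsub>?E\<^esub> T') = c \<odot>\<^bsub>?E\<^esub> (T \<otimes>\<^bsub>?E\<^esub> T')"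
      by (simp add: endo_alg_simps D(2)[OF T(1)])
  qed (simp_all add: endo_alg_simps sm algebra_simps)
qed

text \<open>The q-integer. It weighs the n positions at which the linking relation can act while
  \<open>x_j\<close> moves past the n-th power of a linked variable.\<close>

definition qn :: "'k::field \<Rightarrow> nat \<Rightarrow> 'k" where "qn x n = (\<Sum>t<n. x ^ t)"

lemma qn_0 [simp]: "qn x 0 = 0" by (simp add: qn_def)

lemma qn_Suc: "qn x (Suc n) = qn x n + x ^ n" by (simp add: qn_def)

lemma qn_Suc': "qn x (Suc n) = 1 + x * qn x n"
  by (simp add: qn_def sum.lessThan_Suc_shift sum_distrib_left del: sum.lessThan_Suc)

lemma qn_zero_iff: "x \<noteq> 1 \<Longrightarrow> qn x n = 0 \<longleftrightarrow> x ^ n = 1"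
  using one_diff_power_eq[of x n] by (auto simp: qn_def)

locale datum =
  fixes D :: "('g, 'k::field) datum"
  assumes D: "is_datum D"
begin

sublocale G: comm_group "grp D" by (rule D_facts(1)[OF D])
sublocale U: k_algebra "Ualg D" by (rule Ualg_k_algebra[OF D])

abbreviation Gam ("\<Gamma>") where "\<Gamma> \<equiv> carrier (grp D)"
abbreviation gmult (infixl "\<otimes>\<^sub>G" 70) where "g \<otimes>\<^sub>G h \<equiv> g \<otimes>\<^bsub>grp D\<^esub> h"
abbreviation gone ("\<one>\<^sub>G") where "\<one>\<^sub>G \<equiv> \<one>\<^bsub>grp D\<^esub>"
abbreviation ginv ("inv\<^sub>G _" [81] 80) where "inv\<^sub>G g \<equiv> inv\<^bsub>grp D\<^esub> g"
abbreviation "I \<equiv> idx D"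
abbreviation "chi \<equiv> chr D"
abbreviation "el \<equiv> elt D"
abbreviation "N \<equiv> Nord D"
definition q where "q i = chi i (el i)"

lemma fin_G: "finite \<Gamma>" by (rule D_facts(2)[OF D])
lemma el [simp]: "i \<in> I \<Longrightarrow> el i \<in> \<Gamma>" by (rule D_facts(3)[OF D])
lemma chi_hom: "i \<in> I \<Longrightarrow> chi i \<in> hom (grp D) scalar_units" by (rule D_facts(4)[OF D])

lemma chi_nz [simp]: "i \<in> I \<Longrightarrow> g \<in> \<Gamma> \<Longrightarrow> chi i g \<noteq> 0"
  using chi_hom[of i] by (auto simp: hom_def)

lemma chi_mult [simp]: "i \<in> I \<Longrightarrow> g \<in> \<Gamma> \<Longrightarrow> h \<in> \<Gamma> \<Longrightarrow> chi i (g \<otimes>\<^sub>G h) = chi i g * chi i h"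
  using chi_hom[of i] by (auto simp: hom_def)

lemma chi_one [simp]: "i \<in> I \<Longrightarrow> chi i \<one>\<^sub>G = 1"
  using chi_mult[of i "\<one>\<^sub>G" "\<one>\<^sub>G"] chi_nz[of i "\<one>\<^sub>G"] by simp

lemma chi_inv [simp]: "i \<in> I \<Longrightarrow> g \<in> \<Gamma> \<Longrightarrow> chi i (inv\<^sub>G g) = inverse (chi i g)"
  using chi_mult[of i g "inv\<^sub>G g"] chi_nz[of i g] by (simp add: field_simps)

lemma chi_pow [simp]: "i \<in> I \<Longrightarrow> g \<in> \<Gamma> \<Longrightarrow> chi i (g [^]\<^bsub>grp D\<^esub> (n::nat)) = chi i g ^ n"
  by (induction n) (simp_all add: mult.commute)

lemma chi_symm: "i \<in> I \<Longrightarrow> j \<in> I \<Longrightarrow> i \<noteq> j \<Longrightarrow> chi i (el j) * chi j (el i) = 1"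
  by (rule D_facts(5)[OF D])

lemma q_nz [simp]: "i \<in> I \<Longrightarrow> q i \<noteq> 0" by (simp add: q_def)
lemma q_ne1: "i \<in> I \<Longrightarrow> q i \<noteq> 1" using D by (simp add: is_datum_def q_def)
lemma q_pow_iff: "i \<in> I \<Longrightarrow> q i ^ n = 1 \<longleftrightarrow> N i dvd n" using Nord_facts(1)[OF D] by (simp add: q_def)
lemma N_pos: "i \<in> I \<Longrightarrow> N i > 0" using Nord_facts(2)[OF D] .
lemma N_gt1: "i \<in> I \<Longrightarrow> N i > 1"
  using q_pow_iff[of i 1] q_ne1[of i] N_pos[of i] by (cases "N i = 1") auto
lemma q_N [simp]: "i \<in> I \<Longrightarrow> q i ^ N i = 1" by (simp add: q_pow_iff)
lemma qn_q_zero_iff: "i \<in> I \<Longrightarrow> qn (q i) n = 0 \<longleftrightarrow> N i dvd n"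
  by (simp add: qn_zero_iff q_ne1 q_pow_iff)

lemma dual_mult_one:
  assumes "i \<in> I" "j \<in> I" "chi i \<otimes>\<^bsub>dual_group (grp D)\<^esub> chi j = \<one>\<^bsub>dual_group (grp D)\<^esub>" "g \<in> \<Gamma>"
  shows "chi i g * chi j g = 1"
  using fun_cong[OF assms(3), of g] assms(4) by (simp add: dual_group_def)

lemma linked:
  assumes "i \<in> I" "j \<in> I" "i < j" "lnk D i j \<noteq> 0" "g \<in> \<Gamma>"
  shows "chi i g * chi j g = 1"
proof (rule dual_mult_one[OF assms(1,2) _ assms(5)])
  show "chi i \<otimes>\<^bsub>dual_group (grp D)\<^esub> chi j = \<one>\<^bsub>dual_group (grp D)\<^esub>"
    using D assms(1-4) unfolding is_datum_def by blast
qed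

lemma dual_pow: "g \<in> \<Gamma> \<Longrightarrow> (chi i [^]\<^bsub>dual_group (grp D)\<^esub> (n::nat)) g = chi i g ^ n"
  by (induction n) (simp_all add: dual_group_def nat_pow_def mult.commute)

lemma rooted:
  assumes "i \<in> I" "rtp D i \<noteq> 0" "g \<in> \<Gamma>"
  shows "chi i g ^ N i = 1"
proof -
  have "chi i [^]\<^bsub>dual_group (grp D)\<^esub> N i = \<one>\<^bsub>dual_group (grp D)\<^esub>"
    using D assms(1,2) unfolding is_datum_def by blast
  from fun_cong[OF this, of g] dual_pow[OF assms(3), of i "N i"] assms(3) show ?thesis
    by (simp add: dual_group_def)
qed

definition PP where "PP j a l = (\<Prod>b\<in>{1..<a}. chi b (el j) ^ l b)" for l :: "nat \<Rightarrow> nat"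

lemma idx_less: "a \<in> I \<Longrightarrow> b \<in> {1..<a} \<Longrightarrow> b \<in> I" by (auto simp: idx_def)

lemma PP_nz [simp]: "a \<in> I \<Longrightarrow> j \<in> I \<Longrightarrow> PP j a l \<noteq> 0"
  using idx_less[of a] by (auto simp: PP_def)

lemma PP_upd_ge: "a \<le> c \<Longrightarrow> PP j a (l(c := v)) = PP j a l"
  unfolding PP_def by (intro prod.cong) auto

lemma PP_upd_less:
  assumes "a \<in> I" "j \<in> I" "c \<in> I" "c < a"
  shows "PP j a (l(c := v)) * chi c (el j) ^ l c = PP j a l * chi c (el j) ^ v"
proof -
  have c: "c \<in> {1..<a}" using assms by (auto simp: idx_def)
  have e: "PP j a k = chi c (el j) ^ k c * (\<Prod>b\<in>{1..<a} - {c}. chi b (el j) ^ k b)" for k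
    unfolding PP_def using c by (subst prod.remove[of _ c]) auto
  have "(\<Prod>b\<in>{1..<a} - {c}. chi b (el j) ^ (l(c := v)) b) = (\<Prod>b\<in>{1..<a} - {c}. chi b (el j) ^ l b)"
    by (intro prod.cong) auto
  then show ?thesis unfolding e[of l] e[of "l(c := v)"] by simp
qed

text \<open>The pieces of the operator \<open>x\<^sub>j\<close>. The character values arise from moving \<open>x\<^sub>j\<close> to the right
  past \<open>h\<close> and past \<open>x\<^sub>b\<^bsup>l b\<^esup>\<close> for \<open>b < a\<close>, until it acts on the exponent of \<open>x\<^sub>a\<close>.\<close>

definition Tp :: "nat \<Rightarrow> nat \<Rightarrow> (nat \<Rightarrow> 'k) \<Rightarrow> 'g \<Rightarrow> (nat \<Rightarrow> nat) \<Rightarrow> ('g \<times> (nat \<Rightarrow> nat) \<Rightarrow> 'k) \<Rightarrow> 'g \<times> (nat \<Rightarrow> nat) \<Rightarrow> 'k" where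
  "Tp j a z u f F = (\<lambda>(h, l). if h \<in> \<Gamma> then
     inverse (chi j h) * PP j a l * z (l a) * F (inv\<^sub>G u \<otimes>\<^sub>G h, l(a := f (l a))) else 0)"

abbreviation EE :: "('k, ('g \<times> (nat \<Rightarrow> nat) \<Rightarrow> 'k) \<Rightarrow> 'g \<times> (nat \<Rightarrow> nat) \<Rightarrow> 'k) module"
  where "EE \<equiv> endo_alg (\<Gamma> \<times> UNIV)"

lemma Tp_carrier: 
  assumes "u \<in> \<Gamma>"
  shows "Tp j a z u f \<in> carrier EE"
proof (rule endo_algI)
  fix F b assume "b \<notin> \<Gamma> \<times> (UNIV :: (nat \<Rightarrow> nat) set)"
  then show "Tp j a z u f F b = 0" by (cases b) (simp add: Tp_def)
next
  fix F F' :: "'g \<times> (nat \<Rightarrow> nat) \<Rightarrow> 'k"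
  assume "\<And>b. b \<in> \<Gamma> \<times> UNIV \<Longrightarrow> F b = F' b"
  then show "Tp j a z u f F = Tp j a z u f F'" using assms by (intro ext) (simp add: Tp_def split: prod.split)
qed (simp_all add: Tp_def fun_eq_iff algebra_simps)

text \<open>Exchanging the two pieces has three effects: the new exponent at b enters
  \<open>PP j a\<close>, and the translations by u and u' change the values of \<open>chi i\<close>
  and \<open>chi j\<close>. The hypothesis on r is their balance. It is required only where both
  coefficients are nonzero, since both sides vanish elsewhere.\<close>

lemma Tp_qcomm:
  assumes ix: "i \<in> I" "j \<in> I" "a \<in> I" "b \<in> I" and u: "u \<in> \<Gamma>" "u' \<in> \<Gamma>" and ba: "b < a"
    and r: "\<And>n n'. z n \<noteq> 0 \<Longrightarrow> z' n' \<noteq> 0 \<Longrightarrow>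
       chi i u * chi b (el j) ^ n' = r * chi j u' * chi b (el j) ^ f' n'"
  shows "Tp j a z u f (Tp i b z' u' f' F) = (\<lambda>\<beta>. r * Tp i b z' u' f' (Tp j a z u f F) \<beta>)"
proof (intro ext, clarify)
  fix h l
  show "Tp j a z u f (Tp i b z' u' f' F) (h, l) = r * Tp i b z' u' f' (Tp j a z u f F) (h, l)"
  proof (cases "h \<in> \<Gamma> \<and> z (l a) \<noteq> 0 \<and> z' (l b) \<noteq> 0")
    case False
    then show ?thesis using ba by (auto simp: Tp_def)
  next
    case True
    then have h: "h \<in> \<Gamma>" by simp
    have P1: "PP i b (l(a := f (l a))) = PP i b l" using ba by (simp add: PP_upd_ge)
    have P2: "PP j a (l(b := f' (l b))) = PP j a l * chi b (el j) ^ f' (l b) / chi b (el j) ^ l b"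
      using PP_upd_less[of a j b l "f' (l b)"] ix ba by (simp add: field_simps)
    have tw: "l(a := f (l a), b := f' (l b)) = l(b := f' (l b), a := f (l a))"
      using ba by (intro fun_upd_twist) auto
    have hh: "inv\<^sub>G u' \<otimes>\<^sub>G (inv\<^sub>G u \<otimes>\<^sub>G h) = inv\<^sub>G u \<otimes>\<^sub>G (inv\<^sub>G u' \<otimes>\<^sub>G h)"
      using u h by (simp add: G.m_ac)
    have rr: "chi i u * chi b (el j) ^ l b = r * chi j u' * chi b (el j) ^ f' (l b)"
      using r True by blast
    have rr': "r * (chi j u' * chi b (el j) ^ f' (l b) / chi b (el j) ^ l b) = chi i u"
      using rr ix by (simp add: field_simps)
    define Fv where "Fv = F (inv\<^sub>G u \<otimes>\<^sub>G (inv\<^sub>G u' \<otimes>\<^sub>G h), l(b := f' (l b), a := f (l a)))"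
    have "Tp j a z u f (Tp i b z' u' f' F) (h, l) = 
       inverse (chi j h) * inverse (chi i h) * PP j a l * PP i b l * z (l a) * z' (l b) * Fv * chi i u"
      using h u ix ba by (simp add: Tp_def P1 tw hh Fv_def field_simps)
    also have "\<dots> = inverse (chi j h) * inverse (chi i h) * PP j a l * PP i b l * z (l a) * z' (l b) * Fv * 
        (r * (chi j u' * chi b (el j) ^ f' (l b) / chi b (el j) ^ l b))"
      unfolding rr' ..
    also have "\<dots> = r * Tp i b z' u' f' (Tp j a z u f F) (h, l)"
      using h u ix ba by (simp add: Tp_def P2 Fv_def field_simps)
    finally show ?thesis .
  qed
qed

end

section \<open>Commutation relations between the pieces of the operators\<close>

context datum begin

text \<open>A nonzero linking parameter \<open>\<lambda>\<^sub>x\<^sub>y\<close> forces \<open>lk x y\<close>. A vertex with two linked neighbours has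
  \<open>q\<^sup>2 = 1\<close>, which is why the pieces of one operator commute up to scalars.\<close>

definition lk where "lk x y \<longleftrightarrow> (\<forall>g\<in>\<Gamma>. chi x g * chi y g = 1)"

lemma lk_sym: "lk x y \<Longrightarrow> lk y x" by (simp add: lk_def mult.commute)

text \<open>Evaluate the relation between the two characters at \<open>el x\<close> and at
  \<open>el y\<close>, and compare with \<open>chi_symm\<close>.\<close>

lemma lk_q:
  assumes "x \<in> I" "y \<in> I" "x \<noteq> y" "lk x y"
  shows "q x * q y = 1" and "chi x (el y) = q x"
proof -
  have 1: "chi x (el x) * chi y (el x) = 1" "chi x (el y) * chi y (el y) = 1" "chi x (el y) * chi y (el x) = 1"
    using assms chi_symm by (auto simp: lk_def)
  then have "chi y (el x) \<noteq> 0" by auto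
  then show 2: "chi x (el y) = q x" using 1 unfolding q_def by (metis mult_cancel_right)
  show "q x * q y = 1" using 1(2) 2 by (simp add: q_def)
qed

text \<open>Both links fix the values of \<open>chi x\<close> at the neighbours to be
  \<open>q x\<close>. So \<open>chi y (el w)\<close> and \<open>chi w (el y)\<close> are both
  inverse to \<open>q x\<close>, while their product is 1.\<close>

lemma lk_two_neighbours:
  assumes "x \<in> I" "y \<in> I" "w \<in> I" "x \<noteq> y" "x \<noteq> w" "y \<noteq> w" "lk x y" "lk x w"
  shows "q x * q x = 1"
proof -
  have xy: "q x * q y = 1" "q x * q w = 1" using lk_q assms by auto
  have "chi x (el w) * chi y (el w) = 1" using assms by (auto simp: lk_def)
  then have 1: "q x * chi y (el w) = 1" using lk_q(2)[of x w] assms by simp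
  have "chi x (el y) * chi w (el y) = 1" using assms by (auto simp: lk_def)
  then have 2: "q x * chi w (el y) = 1" using lk_q(2)[of x y] assms by simp
  have "chi y (el w) * chi w (el y) = 1" using chi_symm assms by auto
  then have "(q x * chi y (el w)) * (q x * chi w (el y)) = q x * q x" by (simp add: algebra_simps)
  then show ?thesis using 1 2 by simp
qed

text \<open>Exponents are not truncated at \<open>N j\<close>: raising across a multiple of \<open>N j\<close> jumps back by \<open>N j\<close>,
  as dictated by \<open>x\<^sub>j\<^bsup>N j\<^esup> = \<mu>\<^sub>j (1 - g\<^sub>j\<^bsup>N j\<^esup>)\<close>; each side of \<open>1 - g\<close> gives one piece, \<open>Y1\<close> and \<open>Y2\<close>.\<close>

definition ff where "ff j a n = (if a = j then if n mod N j \<noteq> 0 then n - 1 else n + N j - 1 else Suc n)"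
definition z1 where "z1 j a n = (if a = j then if n mod N j \<noteq> 0 then 1 else rtp D j
   else lnk D a j * qn (q a) (Suc n))"
text \<open>For a < j, write g for \<open>el a\<close> times \<open>el j\<close>. Linking puts a g
  between two powers of \<open>x_a\<close>; as \<open>chi a g\<close> is the square of
  \<open>q a\<close>, moving g to the left replaces the q-integer of \<open>q a\<close> by that of
  its inverse, which accounts for \<open>inverse (q a) ^ n\<close>. The two further factors are the
  value of \<open>chi j\<close> at g: \<open>Tp\<close> evaluates this character at the group
  coordinate of the result and not at that of the source. For a = j the corresponding value is
  1.\<close>

definition z2 where "z2 j a n = (if a = j then if n mod N j \<noteq> 0 then 0 else - rtp D j
   else - (lnk D a j * qn (q a) (Suc n) * inverse (q a) ^ (n + 2)))"
definition u2 where "u2 j a = (if a = j then el j [^]\<^bsub>grp D\<^esub> N j else el a \<otimes>\<^sub>G el j)"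

definition "Y1 j a = Tp j a (z1 j a) \<one>\<^sub>G (ff j a)"
definition "Y2 j a = Tp j a (z2 j a) (u2 j a) (ff j a)"
definition "Y j a F = (\<lambda>\<beta>. Y1 j a F \<beta> + Y2 j a F \<beta>)"
definition "XX j F = (\<lambda>\<beta>. \<Sum>a\<in>{1..j}. Y j a F \<beta>)"
definition GG :: "'g \<Rightarrow> ('g \<times> (nat \<Rightarrow> nat) \<Rightarrow> 'k) \<Rightarrow> 'g \<times> (nat \<Rightarrow> nat) \<Rightarrow> 'k"
  where "GG g F = (\<lambda>(h, l). if h \<in> \<Gamma> then F (inv\<^sub>G g \<otimes>\<^sub>G h, l) else 0)"

lemma idx_le: "j \<in> I \<Longrightarrow> a \<in> {1..j} \<Longrightarrow> a \<in> I" by (auto simp: idx_def)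

lemma u2_closed [simp]: "j \<in> I \<Longrightarrow> a \<in> I \<Longrightarrow> u2 j a \<in> \<Gamma>" by (simp add: u2_def)

lemma piece_linked:
  assumes "j \<in> I" "a \<in> I" "a < j" "z1 j a n \<noteq> 0 \<or> z2 j a n \<noteq> 0"
  shows "lk a j"
  using assms linked[of a j] unfolding lk_def z1_def z2_def by auto

lemma piece_linked_q:
  assumes "j \<in> I" "a \<in> I" "a < j" "z1 j a n \<noteq> 0 \<or> z2 j a n \<noteq> 0"
  shows "q a * q j = 1" "chi a (el j) = q a" "chi j (el a) = q j"
  using lk_q[of a j] lk_q[of j a] piece_linked[OF assms] lk_sym[OF piece_linked[OF assms]] assms by auto

text \<open>A lowering piece removes a variable whose character is inverse to \<open>chi j\<close>,
  and a jump by \<open>N j\<close> happens only when the \<open>N j\<close>-th power of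
  \<open>chi j\<close> is trivial. So every contributing piece changes the weight exactly as
  multiplication by \<open>x_j\<close> does.\<close>

lemma ff_weight:
  assumes j: "j \<in> I" and a: "a \<in> I" "a \<le> j" and z: "z1 j a n \<noteq> 0 \<or> z2 j a n \<noteq> 0" and g: "g \<in> \<Gamma>"
  shows "chi a g ^ ff j a n * chi j g = chi a g ^ n"
proof (cases "a = j")
  case True
  show ?thesis
  proof (cases "n mod N j = 0")
    case False
    then have "n > 0" by (cases n) auto
    then show ?thesis using True False by (cases n) (auto simp: ff_def)
  next
    case n: True
    then have "rtp D j \<noteq> 0" using z True by (auto simp: z1_def z2_def)
    then have "chi j g ^ N j = 1" using rooted j g by blast
    moreover have "Suc (n + N j - 1) = n + N j" using N_pos[OF j] by simp
    ultimately show ?thesis using True n by (simp add: ff_def power_add flip: power_Suc2)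
  qed
next
  case False
  then have "chi a g * chi j g = 1" using piece_linked[OF j a(1) _ z] a g by (auto simp: lk_def)
  then show ?thesis using False by (simp add: ff_def mult.assoc mult.left_commute)
qed

text \<open>By \<open>chi_symm\<close> the value at \<open>u2 j a\<close> is, up to inversion, the
  value at \<open>el i\<close> of a character that linking or the root relation makes trivial. The
  argument fails for i = a < j, which gives the exceptional value; \<open>Y_comm\<close> shows that
  it too is 1 whenever it matters.\<close>

lemma chi_u2:
  assumes i: "i \<in> I" and j: "j \<in> I" and a: "a \<in> I" "a \<le> j" and z: "z2 j a n \<noteq> 0"
    and ij: "i \<noteq> j \<or> a = j"
  shows "i \<noteq> a \<or> a = j \<Longrightarrow> chi i (u2 j a) = 1" "a < j \<Longrightarrow> i = a \<Longrightarrow> chi i (u2 j a) = q a * q a"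
proof -
  show "chi i (u2 j a) = 1" if ia: "i \<noteq> a \<or> a = j"
  proof (cases "a = j")
    case True
    then have r: "rtp D j \<noteq> 0" using z by (auto simp: z2_def split: if_splits)
    have "chi i (el j) ^ N j = 1"
    proof (cases "i = j")
      case True then show ?thesis using q_N[OF j] by (simp add: q_def)
    next
      case False
      have "(chi i (el j) * chi j (el i)) ^ N j = 1" using chi_symm i j False by simp
      then show ?thesis using rooted[OF j r el[OF i]] by (simp add: power_mult_distrib)
    qed
    then show ?thesis using True i j by (simp add: u2_def)
  next
    case False
    then have aj: "a < j" using a by simp
    have l: "chi a (el i) * chi j (el i) = 1" using piece_linked[OF j a(1) aj, of n] z i by (auto simp: lk_def)
    have "chi i (el a) * chi a (el i) = 1" "chi i (el j) * chi j (el i) = 1" using chi_symm ia ij i a j False by auto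
    then have "(chi i (el a) * chi i (el j)) * (chi a (el i) * chi j (el i)) = 1" by (simp add: algebra_simps)
    then show ?thesis using l i a j False by (simp add: u2_def)
  qed
  show "chi i (u2 j a) = q a * q a" if "a < j" "i = a"
    using piece_linked_q(2)[OF j a(1) that(1), of n] z that a j by (simp add: u2_def q_def)
qed

lemma Y_carrier: "j \<in> I \<Longrightarrow> a \<in> I \<Longrightarrow> Y1 j a \<in> carrier EE" "j \<in> I \<Longrightarrow> a \<in> I \<Longrightarrow> Y2 j a \<in> carrier EE"
  by (simp_all add: Y1_def Y2_def Tp_carrier)

lemma Yd_carrier: "j \<in> I \<Longrightarrow> a \<in> I \<Longrightarrow> Y j a \<in> carrier EE"
proof -
  interpret E: k_algebra EE by (rule endo_alg_k_algebra)
  assume "j \<in> I" "a \<in> I"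
  then have "Y1 j a \<oplus>\<^bsub>EE\<^esub> Y2 j a \<in> carrier EE" by (intro E.a_closed Y_carrier)
  then show "Y j a \<in> carrier EE" by (simp add: endo_alg_simps Y_def[abs_def])
qed

text \<open>The weight shift of \<open>ff_weight\<close> is the balance that \<open>Tp_qcomm\<close>
  asks for. If a < b the roles are exchanged, and \<open>chi_symm\<close> inverts the resulting
  scalar.\<close>

lemma piece_comm:
  assumes ix: "i \<in> I" "j \<in> I" "a \<in> I" "b \<in> I" and le: "a \<le> j" "b \<le> i" and ij: "i \<noteq> j" and ab: "a \<noteq> b"
    and u: "u \<in> \<Gamma>" "u' \<in> \<Gamma>"
    and z: "\<And>n. z n \<noteq> 0 \<Longrightarrow> z1 j a n \<noteq> 0 \<or> z2 j a n \<noteq> 0"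
    and z': "\<And>n. z' n \<noteq> 0 \<Longrightarrow> z1 i b n \<noteq> 0 \<or> z2 i b n \<noteq> 0"
    and uu: "\<And>n n'. z n \<noteq> 0 \<Longrightarrow> z' n' \<noteq> 0 \<Longrightarrow> chi i u = 1 \<and> chi j u' = 1"
  shows "Tp j a z u (ff j a) (Tp i b z' u' (ff i b) F)
    = (\<lambda>\<beta>. chi i (el j) * Tp i b z' u' (ff i b) (Tp j a z u (ff j a) F) \<beta>)"
proof (cases "b < a")
  case True
  show ?thesis
  proof (rule Tp_qcomm[OF ix u True])
    fix n n' assume nz: "z n \<noteq> 0" "z' n' \<noteq> 0"
    show "chi i u * chi b (el j) ^ n' = chi i (el j) * chi j u' * chi b (el j) ^ ff i b n'"
      using ff_weight[OF ix(1,4) le(2) z'[OF nz(2)], of "el j"] uu[OF nz] ix by (simp add: mult.commute)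
  qed
next
  case False
  then have ab': "a < b" using ab by simp
  have "Tp i b z' u' (ff i b) (Tp j a z u (ff j a) F)
    = (\<lambda>\<beta>. chi j (el i) * Tp j a z u (ff j a) (Tp i b z' u' (ff i b) F) \<beta>)"
  proof (rule Tp_qcomm[OF ix(2,1,4,3) u(2,1) ab'])
    fix n n' assume nz: "z' n \<noteq> 0" "z n' \<noteq> 0"
    show "chi j u' * chi a (el i) ^ n' = chi j (el i) * chi i u * chi a (el i) ^ ff j a n'"
      using ff_weight[OF ix(2,3) le(1) z[OF nz(2)], of "el i"] uu[OF nz(2,1)] ix by (simp add: mult.commute)
  qed
  then show ?thesis using chi_symm[OF ix(1,2) ij] by (simp add: fun_eq_iff flip: mult.assoc)
qed

lemma piece_same:
  assumes "\<And>n. z n * z' (f n) = 0" "\<And>n. z' n * z (f' n) = 0" and h: "u \<in> \<Gamma>" "u' \<in> \<Gamma>"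
  shows "Tp j a z u f (Tp i a z' u' f' F) = (\<lambda>\<beta>. 0)" "Tp i a z' u' f' (Tp j a z u f F) = (\<lambda>\<beta>. 0)"
  using assms by (auto simp: Tp_def fun_eq_iff)

text \<open>Pieces on different exponents fall under \<open>piece_comm\<close>; in the exceptional
  case a = i the vertex i has the two linked neighbours j and b, so its square of \<open>q i\<close>
  is 1. Two pieces lowering the same exponent annihilate each other. The excluded pair is the one
  that produces the linking relation.\<close>

lemma Y_comm:
  assumes ix: "i \<in> I" "j \<in> I" "i < j" and a: "a \<in> {1..j}" and b: "b \<in> {1..i}" and nn: "\<not> (a = i \<and> b = i)"
  shows "Y j a (Y i b F) \<beta> = chi i (el j) * Y i b (Y j a F) \<beta>"
proof -
  have ab: "a \<in> I" "b \<in> I" using idx_le a b ix by auto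
  have le: "a \<le> j" "b \<le> i" using a b by auto
  note L = endo_algD(1)[OF Y_carrier(1)] endo_algD(1)[OF Y_carrier(2)]
  have exp: "Y j a (Y i b F) \<beta> = (Y1 j a (Y1 i b F) \<beta> + Y1 j a (Y2 i b F) \<beta>) + (Y2 j a (Y1 i b F) \<beta> + Y2 j a (Y2 i b F) \<beta>)"
    "Y i b (Y j a F) \<beta> = (Y1 i b (Y1 j a F) \<beta> + Y1 i b (Y2 j a F) \<beta>) + (Y2 i b (Y1 j a F) \<beta> + Y2 i b (Y2 j a F) \<beta>)"
    using ix ab by (simp_all add: Y_def[abs_def] L)
  show ?thesis
  proof (cases "a = b")
    case False
    have ui: "chi i (u2 j a) = 1" if z: "z2 j a n \<noteq> 0" and z': "z1 i b n' \<noteq> 0 \<or> z2 i b n' \<noteq> 0" for n n'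
    proof (cases "a = i")
      case True
      then have bi: "b < i" using nn le by auto
      have 1: "lk i j" using piece_linked[OF ix(2) ab(1)] z True ix by auto
      have 2: "lk i b" using lk_sym piece_linked[OF ix(1) ab(2) bi z'] by blast
      have "q i * q i = 1" using lk_two_neighbours[OF ix(1,2) ab(2)] 1 2 ix bi by auto
      moreover have "chi i (u2 j a) = q a * q a"
        by (rule chi_u2(2)[OF ix(1,2) ab(1) le(1) z]) (use True ix in simp_all)
      ultimately show ?thesis using True by simp
    next
      case False
      then show ?thesis using chi_u2(1)[OF ix(1,2) ab(1) le(1) z] ix by auto
    qed
    have uj: "chi j (u2 i b) = 1" if "z2 i b n \<noteq> 0" for n
      using chi_u2(1)[OF ix(2,1) ab(2) le(2) that] ix le by auto
    have ne: "i \<noteq> j" using ix by simp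
    note pc = piece_comm[OF ix(1,2) ab le ne False, THEN fun_cong, of _ _ _ _ F \<beta>]
    note cl = G.one_closed u2_closed[OF ix(2) ab(1)] u2_closed[OF ix(1) ab(2)]
    have c1: "chi i \<one>\<^sub>G = 1" "chi j \<one>\<^sub>G = 1" using ix by auto
    have "Y1 j a (Y1 i b F) \<beta> = chi i (el j) * Y1 i b (Y1 j a F) \<beta>"
      unfolding Y1_def by (rule pc; use cl c1 in blast)
    moreover have "Y1 j a (Y2 i b F) \<beta> = chi i (el j) * Y2 i b (Y1 j a F) \<beta>"
      unfolding Y1_def Y2_def by (rule pc; use cl c1 uj in blast)
    moreover have "Y2 j a (Y1 i b F) \<beta> = chi i (el j) * Y1 i b (Y2 j a F) \<beta>"
      unfolding Y1_def Y2_def by (rule pc; use cl c1 ui in blast)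
    moreover have "Y2 j a (Y2 i b F) \<beta> = chi i (el j) * Y2 i b (Y2 j a F) \<beta>"
      unfolding Y1_def Y2_def by (rule pc; use cl ui uj in blast)
    ultimately show ?thesis unfolding exp by (simp add: algebra_simps)
  next
    case True
    then have lt: "a < i" "a < j" "b < i" using nn le ix by auto
    have fz: "ff j a n = Suc n" "ff i b n = Suc n" for n using lt True by (auto simp: ff_def)
    \<comment> \<open>Two links at a force \<open>N a\<close> = 2, and one of two consecutive
      integers is even, so one of the two q-integers vanishes.\<close>
    have zz: "(lnk D a j * qn (q a) (Suc n)) * (lnk D a i * qn (q a) (Suc (Suc n))) = 0" for n
    proof (cases "lnk D a j = 0 \<or> lnk D a i = 0")
      case False
      then have "lk a j" "lk a i" using linked[of a j] linked[of a i] ab ix lt by (auto simp: lk_def)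
      then have "q a * q a = 1" using lk_two_neighbours[of a j i] ab ix lt by auto
      then have "q a ^ 2 = 1" by (simp add: power2_eq_square)
      then have d: "N a dvd 2" using q_pow_iff ab by blast
      have N2: "N a = 2" using dvd_imp_le[OF d] N_gt1[OF ab(1)] by simp
      have "N a dvd Suc n \<or> N a dvd Suc (Suc n)" unfolding N2 by presburger
      then show ?thesis using qn_q_zero_iff[OF ab(1)] by auto
    qed auto
    have zz': "qn (q a) (Suc n) = 0 \<or> qn (q a) (Suc (Suc n)) = 0 \<or> lnk D a j = 0 \<or> lnk D a i = 0" for n
      using zz[of n] by auto
    have c: "z1 j a n * z1 i a (Suc n) = 0" "z1 j a n * z2 i a (Suc n) = 0" "z2 j a n * z1 i a (Suc n) = 0"
      "z2 j a n * z2 i a (Suc n) = 0" "z1 i a n * z1 j a (Suc n) = 0" "z1 i a n * z2 j a (Suc n) = 0"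
      "z2 i a n * z1 j a (Suc n) = 0" "z2 i a n * z2 j a (Suc n) = 0" for n
      using zz'[of n] lt by (auto simp: z1_def z2_def)
    have c': "w n * w' (ff i a n) = 0" if "\<And>n. w n * w' (Suc n) = 0" for w w' :: "nat \<Rightarrow> 'k" and n
      using that fz True by simp
    have c'': "w n * w' (ff j a n) = 0" if "\<And>n. w n * w' (Suc n) = 0" for w w' :: "nat \<Rightarrow> 'k" and n
      using that fz True by simp
    note ps = piece_same[where a = a and f = "ff j a" and f' = "ff i a" and j = j and i = i]
    have "Y1 j a (Y1 i b F) \<beta> = 0" "Y1 i b (Y1 j a F) \<beta> = 0"
      "Y1 j a (Y2 i b F) \<beta> = 0" "Y1 i b (Y2 j a F) \<beta> = 0" "Y2 j a (Y1 i b F) \<beta> = 0" "Y2 i b (Y1 j a F) \<beta> = 0"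
      "Y2 j a (Y2 i b F) \<beta> = 0" "Y2 i b (Y2 j a F) \<beta> = 0"
      unfolding Y1_def Y2_def True[symmetric]
      by (rule ps[THEN fun_cong]; (rule c' c''; rule c | use ix ab in simp))+
    then show ?thesis unfolding exp by simp
  qed
qed

end

text \<open>Each entry commutes up to r with the sum of the later entries, so the two-term
  q-binomial theorem at a root of unity of exact order M applies repeatedly and no mixed terms
  survive.\<close>

lemma (in k_algebra) qcomm_list_pow:
  assumes "set xs \<subseteq> carrier A" "sorted_wrt (\<lambda>x y. x \<otimes> y = r \<odot> (y \<otimes> x)) xs"
    and r: "\<And>n. r ^ n = 1 \<longleftrightarrow> M dvd n" "M > 0"
  shows "foldr (\<oplus>) xs \<zero> [^] M = foldr (\<oplus>) (map (\<lambda>x. x [^] M) xs) \<zero>"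
  using assms(1,2)
proof (induction xs)
  case Nil then show ?case using r(2) by (simp add: nat_pow_zero)
next
  case (Cons x xs)
  have cl: "foldr (\<oplus>) ys \<zero> \<in> carrier A" if "set ys \<subseteq> carrier A" for ys
    using that by (induction ys) auto
  have "x \<otimes> foldr (\<oplus>) ys \<zero> = r \<odot> (foldr (\<oplus>) ys \<zero> \<otimes> x)" if "set ys \<subseteq> set xs" for ys
    using that
  proof (induction ys)
    case (Cons y ys)
    have "x \<in> carrier A" "y \<in> carrier A" "set ys \<subseteq> carrier A" "x \<otimes> y = r \<odot> (y \<otimes> x)"
      using Cons.prems \<open>set (x # xs) \<subseteq> _\<close> \<open>sorted_wrt _ (x # xs)\<close> by auto
    then show ?case using Cons cl[of ys] by (simp add: r_distr l_distr smult_r_distr)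
  qed (use Cons.prems in simp)
  then have "x \<otimes> foldr (\<oplus>) xs \<zero> = r \<odot> (foldr (\<oplus>) xs \<zero> \<otimes> x)" by blast
  then show ?case
    using gauss_binomial_root[of x "foldr (\<oplus>) xs \<zero>" r M] Cons cl[of xs] r by simp
qed

context datum begin

interpretation E: k_algebra EE by (rule endo_alg_k_algebra)

lemma Ylow:
  assumes "a < j" "h \<in> \<Gamma>"
  shows "Y j a F (h, l) = inverse (chi j h) * PP j a l * (lnk D a j * qn (q a) (Suc (l a))) *
    (F (h, l(a := Suc (l a))) - inverse (q a) ^ (l a + 2) * F (inv\<^sub>G (el a \<otimes>\<^sub>G el j) \<otimes>\<^sub>G h, l(a := Suc (l a))))"
  using assms by (simp add: Y_def Y1_def Y2_def Tp_def z1_def z2_def u2_def ff_def algebra_simps)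

lemma Yraise:
  assumes "h \<in> \<Gamma>"
  shows "Y j j F (h, l) = inverse (chi j h) * PP j j l *
    (if l j mod N j \<noteq> 0 then F (h, l(j := l j - 1)) else
      rtp D j * (F (h, l(j := l j + N j - 1)) - F (inv\<^sub>G (el j [^]\<^bsub>grp D\<^esub> N j) \<otimes>\<^sub>G h, l(j := l j + N j - 1))))"
  using assms by (simp add: Y_def Y1_def Y2_def Tp_def z1_def z2_def u2_def ff_def algebra_simps)

lemma Y_outside: "h \<notin> \<Gamma> \<Longrightarrow> Y j a F (h, l) = 0"
  by (simp add: Y_def Y1_def Y2_def Tp_def)

text \<open>Both composites are q-integers times F and a translate of F. The inhomogeneous term is
  what remains of two consecutive q-integers, once for F and once for the translate.\<close>

lemma Y_lower_raise:
  assumes ix: "i \<in> I" "j \<in> I" "i < j" and h: "h \<in> \<Gamma>"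
  shows "Y j i (Y i i F) (h, l) = chi i (el j) * Y i i (Y j i F) (h, l) +
    lnk D i j * (F (h, l) - F (inv\<^sub>G (el i \<otimes>\<^sub>G el j) \<otimes>\<^sub>G h, l))"
proof (cases "lnk D i j = 0")
  case True
  then have "Y j i F' (a, b) = 0" for F' a b by (cases "a \<in> \<Gamma>") (use ix(3) in \<open>simp_all add: Y_outside Ylow\<close>)
  then have "Y j i F' = (\<lambda>\<beta>. 0)" for F' by (auto simp: fun_eq_iff)
  then show ?thesis using endo_alg_zero[OF Yd_carrier[OF ix(1,1)]] True by simp
next
  case False
  define n where "n = l i"
  define L where "L = lnk D i j"
  define u where "u = el i \<otimes>\<^sub>G el j"
  define F1 where "F1 = F (inv\<^sub>G u \<otimes>\<^sub>G h, l)"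
  have u: "u \<in> \<Gamma>" using ix by (simp add: u_def)
  have lij: "lk i j" using False linked[OF ix] by (auto simp: lk_def)
  note lq = lk_q[OF ix(1,2) _ lij]
  have q1: "chi i (el j) = q i" using lq ix by simp
  have cu: "chi i u = q i * q i" using ix q1 by (simp add: u_def q_def)
  have ch: "inverse (chi j h) * inverse (chi i h) = 1"
    using lij h ix by (simp add: lk_def field_simps)
  \<comment> \<open>Passing \<open>x_i\<close> and then \<open>x_j\<close> across a smaller variable
    costs nothing in total: by \<open>chi_symm\<close> this factor is inverse to the product of the
    linked characters at \<open>el b\<close>.\<close>
  have pp: "PP j i l * PP i i l = 1"
  proof -
    have "chi b (el j) * chi b (el i) = 1" if "b \<in> {1..<i}" for b
    proof -
      have b: "b \<in> I" "b < i" using that idx_less[OF ix(1)] by auto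
      have "(chi b (el j) * chi j (el b)) * (chi b (el i) * chi i (el b)) = 1"
        using chi_symm[OF b(1) ix(2)] chi_symm[OF b(1) ix(1)] b ix by simp
      moreover have "chi i (el b) * chi j (el b) = 1" using lij b by (simp add: lk_def)
      ultimately show ?thesis by (metis (no_types, lifting) mult.assoc mult.commute mult_1)
    qed
    then show ?thesis unfolding PP_def prod.distrib[symmetric] power_mult_distrib[symmetric] by simp
  qed
  have ppi: "PP j i (l(i := v)) = PP j i l" "PP i i (l(i := v)) = PP i i l" for v by (simp_all add: PP_upd_ge)
  have uh: "inv\<^sub>G u \<otimes>\<^sub>G h \<in> \<Gamma>" using u h by simp
  have qq: "inverse (q i) ^ (k + 2) * (q i * q i) = inverse (q i) ^ k" for k
    using ix by (simp add: field_simps power2_eq_square)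
  \<comment> \<open>The branch of the raising piece that jumps by \<open>N i\<close> never
    contributes, here and in the next step: it always meets a q-integer at a multiple of
    \<open>N i\<close>.\<close>
  have 1: "Y j i (Y i i F) (h, l) = L * qn (q i) (Suc n) * (F (h, l) - inverse (q i) ^ n * F1)"
  proof (cases "Suc n mod N i = 0")
    case True
    then have "qn (q i) (Suc n) = 0" using qn_q_zero_iff[OF ix(1)] by auto
    then show ?thesis using ix h by (simp add: Ylow n_def)
  next
    case False
    have "Y j i (Y i i F) (h, l) = (inverse (chi j h) * inverse (chi i h)) * (PP j i l * PP i i l) * L * qn (q i) (Suc n) * 
       (F (h, l) - (inverse (q i) ^ (n + 2) * chi i u) * F1)"
      using ix h False uh u unfolding Ylow[OF ix(3) h] u_def[symmetric] F1_def n_def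
      by (simp add: Yraise ppi L_def algebra_simps)
    then show ?thesis by (simp only: ch pp cu qq mult_1)
  qed
  have 2: "Y i i (Y j i F) (h, l) = L * qn (q i) n * (F (h, l) - inverse (q i) ^ (n + 1) * F1)"
  proof (cases "n mod N i = 0")
    case True
    have "qn (q i) (n + N i) = 0" "qn (q i) n = 0" using True qn_q_zero_iff[OF ix(1)] by auto
    moreover have "Suc (n + N i - 1) = n + N i" using N_pos[OF ix(1)] by simp
    moreover have "inv\<^sub>G (el i [^]\<^bsub>grp D\<^esub> N i) \<otimes>\<^sub>G h \<in> \<Gamma>" using h ix by simp
    ultimately show ?thesis using True ix h by (simp add: Yraise Ylow n_def)
  next
    case False
    then obtain m where m: "n = Suc m" by (cases n) auto
    have lm: "l(i := Suc m) = l" using m by (auto simp: n_def)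
    have "Y i i (Y j i F) (h, l) = (inverse (chi j h) * inverse (chi i h)) * (PP j i l * PP i i l) * L * qn (q i) n * 
       (F (h, l) - inverse (q i) ^ (n + 1) * F1)"
      using ix h False uh u m unfolding Yraise[OF h] u_def[symmetric] F1_def n_def
      by (simp add: Ylow ppi L_def algebra_simps u_def lm)
    then show ?thesis by (simp only: ch pp mult_1)
  qed
  \<comment> \<open>The two recursions of the q-integer, adding the new term at either end: the
    first serves F, the second its translate.\<close>
  have e: "qn (q i) (Suc n) = 1 + q i * qn (q i) n" by (rule qn_Suc')
  have e': "inverse (q i) ^ n * qn (q i) (Suc n) = inverse (q i) ^ n * qn (q i) n + 1"
    using ix by (simp add: qn_Suc field_simps)
  have "qn (q i) (Suc n) * (F (h, l) - inverse (q i) ^ n * F1) - q i * (qn (q i) n * (F (h, l) - inverse (q i) ^ (n + 1) * F1))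
    = (qn (q i) (Suc n) - q i * qn (q i) n) * F (h, l) - (inverse (q i) ^ n * qn (q i) (Suc n) - inverse (q i) ^ n * qn (q i) n) * F1"
    using ix by (simp add: field_simps)
  also have "\<dots> = F (h, l) - F1" unfolding e' unfolding e by simp
  finally have k: "qn (q i) (Suc n) * (F (h, l) - inverse (q i) ^ n * F1)
     = q i * (qn (q i) n * (F (h, l) - inverse (q i) ^ (n + 1) * F1)) + (F (h, l) - F1)" by (simp add: algebra_simps)
  have "Y j i (Y i i F) (h, l) = L * (qn (q i) (Suc n) * (F (h, l) - inverse (q i) ^ n * F1))"
    unfolding 1 by (simp only: mult.assoc)
  also have "\<dots> = q i * Y i i (Y j i F) (h, l) + L * (F (h, l) - F1)"
    unfolding k 2 by (simp only: distrib_left mult.assoc mult.left_commute)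
  finally show ?thesis unfolding L_def F1_def u_def q1 .
qed

lemma XX_carrier: "j \<in> I \<Longrightarrow> XX j \<in> carrier EE"
proof -
  assume j: "j \<in> I"
  have "(\<lambda>F \<beta>. \<Sum>a\<in>S. Y j a F \<beta>) \<in> carrier EE" if "finite S" "S \<subseteq> I" for S
    using that
  proof (induction S rule: finite_induct)
    case empty
    then show ?case using E.zero_closed by (simp add: endo_alg_simps)
  next
    case (insert x S)
    then have "Y j x \<oplus>\<^bsub>EE\<^esub> (\<lambda>F \<beta>. \<Sum>a\<in>S. Y j a F \<beta>) \<in> carrier EE"
      using Yd_carrier[OF j] by (intro E.a_closed) auto
    then show ?case using insert by (simp add: endo_alg_simps)
  qed
  moreover have "{1..j} \<subseteq> I" using idx_le[OF j] by blast
  ultimately show "XX j \<in> carrier EE" unfolding XX_def[abs_def] by blast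
qed

text \<open>Among all pairs of pieces only the one where both act on the exponent of
  \<open>x_i\<close> fails to commute up to \<open>chi i (el j)\<close>; it carries the whole
  inhomogeneous part of the relation.\<close>

lemma XX_comm:
  assumes ix: "i \<in> I" "j \<in> I" "i < j" and h: "h \<in> \<Gamma>"
  shows "XX j (XX i F) (h, l) = chi i (el j) * XX i (XX j F) (h, l) +
    lnk D i j * (F (h, l) - F (inv\<^sub>G (el i \<otimes>\<^sub>G el j) \<otimes>\<^sub>G h, l))"
proof -
  define \<beta> where "\<beta> = (h, l)"
  define \<delta> where "\<delta> = lnk D i j * (F (h, l) - F (inv\<^sub>G (el i \<otimes>\<^sub>G el j) \<otimes>\<^sub>G h, l))"
  have i1: "i \<in> {1..i}" "i \<in> {1..j}" using ix by (auto simp: idx_def)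
  have s: "Y j a (\<lambda>b. \<Sum>c\<in>K. G c b) \<beta> = (\<Sum>c\<in>K. Y j a (G c) \<beta>)" if "j \<in> I" "a \<in> {1..j}" "finite K" for j a K G
    using endo_alg_sum[OF Yd_carrier[OF that(1) idx_le[OF that(1,2)]] that(3), of "\<lambda>_. 1"] by simp
  have "XX j (XX i F) \<beta> = (\<Sum>a\<in>{1..j}. \<Sum>b\<in>{1..i}. Y j a (Y i b F) \<beta>)"
    unfolding XX_def by (intro sum.cong refl) (simp add: s ix)
  also have "\<dots> = (\<Sum>a\<in>{1..j}. \<Sum>b\<in>{1..i}. chi i (el j) * Y i b (Y j a F) \<beta> + (if a = i then if b = i then \<delta> else 0 else 0))"
  proof (intro sum.cong refl)
    fix a b assume "a \<in> {1..j}" "b \<in> {1..i}"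
    then show "Y j a (Y i b F) \<beta> = chi i (el j) * Y i b (Y j a F) \<beta> + (if a = i then if b = i then \<delta> else 0 else 0)"
      using Y_lower_raise[OF ix h, of F l] Y_comm[OF ix, of a b F \<beta>] by (auto simp: \<beta>_def \<delta>_def)
  qed
  also have "\<dots> = chi i (el j) * (\<Sum>a\<in>{1..j}. \<Sum>b\<in>{1..i}. Y i b (Y j a F) \<beta>) + (\<Sum>a\<in>{1..j}. if a = i then \<delta> else 0)"
  proof -
    have "(\<Sum>b\<in>{1..i}. if a = i then if b = i then \<delta> else 0 else 0) = (if a = i then \<delta> else 0)" for a
      using i1 by simp
    then show ?thesis by (simp only: sum.distrib sum_distrib_left)
  qed
  also have "(\<Sum>a\<in>{1..j}. if a = i then \<delta> else 0) = \<delta>" using i1 by simp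
  also have "(\<Sum>a\<in>{1..j}. \<Sum>b\<in>{1..i}. Y i b (Y j a F) \<beta>) = XX i (XX j F) \<beta>"
    unfolding XX_def by (subst sum.swap, intro sum.cong refl) (simp add: s ix)
  finally show ?thesis by (simp add: \<beta>_def \<delta>_def)
qed

lemma GG_carrier: "g \<in> \<Gamma> \<Longrightarrow> GG g \<in> carrier EE"
proof -
  assume g: "g \<in> \<Gamma>"
  show "GG g \<in> carrier EE"
  proof (rule endo_algI)
    fix F F' :: "'g \<times> (nat \<Rightarrow> nat) \<Rightarrow> 'k"
    assume "\<And>b. b \<in> \<Gamma> \<times> UNIV \<Longrightarrow> F b = F' b"
    then show "GG g F = GG g F'" using g by (intro ext) (simp add: GG_def split: prod.split)
  next
    fix F b assume "b \<notin> \<Gamma> \<times> (UNIV :: (nat \<Rightarrow> nat) set)"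
    then show "GG g F b = 0" by (cases b) (simp add: GG_def)
  qed (simp_all add: GG_def fun_eq_iff)
qed

lemma GG_mult:
  assumes "g \<in> \<Gamma>" "h \<in> \<Gamma>"
  shows "GG g (GG h F) = GG (g \<otimes>\<^sub>G h) F"
  using assms by (auto simp: GG_def fun_eq_iff G.inv_mult_group G.m_assoc)

lemma GG_one: "GG \<one>\<^sub>G = \<one>\<^bsub>EE\<^esub>"
  by (auto simp: GG_def endo_alg_simps fun_eq_iff)

lemma GG_Tp:
  assumes "j \<in> I" "a \<in> I" "u \<in> \<Gamma>" "g \<in> \<Gamma>"
  shows "GG g (Tp j a z u f F) \<beta> = chi j g * Tp j a z u f (GG g F) \<beta>"
proof (cases \<beta>)
  case (Pair h l)
  have "inv\<^sub>G u \<otimes>\<^sub>G (inv\<^sub>G g \<otimes>\<^sub>G h) = inv\<^sub>G g \<otimes>\<^sub>G (inv\<^sub>G u \<otimes>\<^sub>G h)" if "h \<in> \<Gamma>"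
    using assms that by (simp add: G.m_ac)
  then show ?thesis using assms Pair by (simp add: GG_def Tp_def)
qed

lemma GG_XX:
  assumes "j \<in> I" "g \<in> \<Gamma>"
  shows "GG g (XX j F) \<beta> = chi j g * XX j (GG g F) \<beta>"
proof -
  have "GG g (Y j a F) \<beta> = chi j g * Y j a (GG g F) \<beta>" if "a \<in> {1..j}" for a
    using idx_le[OF assms(1) that] assms
    by (simp add: Y_def[abs_def] endo_algD(1)[OF GG_carrier] Y1_def Y2_def GG_Tp algebra_simps)
  then have "(\<Sum>a\<in>{1..j}. GG g (Y j a F) \<beta>) = (\<Sum>a\<in>{1..j}. chi j g * Y j a (GG g F) \<beta>)" by simp
  moreover have "GG g (XX j F) \<beta> = (\<Sum>a\<in>{1..j}. GG g (Y j a F) \<beta>)"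
    using endo_alg_sum[OF GG_carrier[OF assms(2)], of "{1..j}" "\<lambda>_. 1" "\<lambda>a. Y j a F" \<beta>] by (simp add: XX_def[abs_def])
  ultimately show ?thesis by (simp add: XX_def sum_distrib_left)
qed

end

section \<open>Powers of the operators and the root relations\<close>

context datum begin

interpretation E: k_algebra EE by (rule endo_alg_k_algebra)

lemma endo_pow_Suc: "T \<in> carrier EE \<Longrightarrow> (T [^]\<^bsub>EE\<^esub> Suc k) F = T ((T [^]\<^bsub>EE\<^esub> k) F)"
  unfolding E.nat_pow_Suc2 by (simp add: endo_alg_simps)

lemma Tp_nilpotent:
  assumes u: "u \<in> \<Gamma>" and z: "\<And>n. \<exists>t<k. z ((f ^^ t) n) = 0"
  shows "Tp j a z u f [^]\<^bsub>EE\<^esub> k = \<zero>\<^bsub>EE\<^esub>"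
proof -
  have "(Tp j a z u f [^]\<^bsub>EE\<^esub> m) F (h, l) = 0" if "\<exists>t<m. z ((f ^^ t) (l a)) = 0" "h \<in> \<Gamma>" for m F h l
    using that
  proof (induction m arbitrary: h l)
    case (Suc m)
    show ?case
    proof (cases "z (l a) = 0")
      case True
      then show ?thesis unfolding endo_pow_Suc[OF Tp_carrier[OF u]] by (simp add: Tp_def)
    next
      case False
      then obtain t where t: "t < Suc m" "z ((f ^^ t) (l a)) = 0" using Suc.prems by blast
      with False obtain s where s: "t = Suc s" by (cases t) auto
      have "(Tp j a z u f [^]\<^bsub>EE\<^esub> m) F (inv\<^sub>G u \<otimes>\<^sub>G h, l(a := f (l a))) = 0"
      proof (rule Suc.IH)
        show "\<exists>t<m. z ((f ^^ t) ((l(a := f (l a))) a)) = 0"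
          using t s by (intro exI[of _ s]) (simp add: funpow_swap1)
        show "inv\<^sub>G u \<otimes>\<^sub>G h \<in> \<Gamma>" using u Suc.prems by simp
      qed
      then show ?thesis unfolding endo_pow_Suc[OF Tp_carrier[OF u]] by (simp add: Tp_def)
    qed
  qed simp
  moreover have "(Tp j a z u f [^]\<^bsub>EE\<^esub> k) F (h, l) = 0" if "h \<notin> \<Gamma>" for F h l
    by (rule endo_algD(3)[OF E.nat_pow_closed[OF Tp_carrier[OF u]]]) (use that in simp)
  ultimately have "(Tp j a z u f [^]\<^bsub>EE\<^esub> k) F (h, l) = 0" for F h l using z by blast
  then show ?thesis by (auto simp: endo_alg_simps fun_eq_iff)
qed

text \<open>A link makes \<open>q a\<close> and \<open>q j\<close> inverse to each other, so they
  have the same order. Iterating a lowering piece runs through \<open>N j\<close> consecutive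
  exponents, and at one of them the q-integer vanishes.\<close>

lemma low_nilpotent:
  assumes j: "j \<in> I" and a: "a \<in> I" "a < j"
  shows "Y1 j a [^]\<^bsub>EE\<^esub> N j = \<zero>\<^bsub>EE\<^esub>" "Y2 j a [^]\<^bsub>EE\<^esub> N j = \<zero>\<^bsub>EE\<^esub>"
proof -
  have f: "(ff j a ^^ t) n = n + t" for t n using a by (induction t) (auto simp: ff_def)
  have "\<exists>t < N j. z1 j a (n + t) = 0 \<and> z2 j a (n + t) = 0" for n
  proof (cases "lnk D a j = 0")
    case True
    then show ?thesis using N_pos[OF j] a by (auto simp: z1_def z2_def)
  next
    case False
    then have "q a * q j = 1" using lk_q[of a j] linked[of a j] a j by (auto simp: lk_def)
    then have "q a ^ n * q j ^ n = 1" for n by (simp flip: power_mult_distrib)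
    then have "q a ^ n = 1 \<longleftrightarrow> q j ^ n = 1" for n by (metis mult_1 mult.right_neutral)
    then have "N a dvd n \<longleftrightarrow> N j dvd n" for n using q_pow_iff a j by simp
    then have NN: "N a = N j" by (meson dvd_antisym dvd_refl)
    \<comment> \<open>Chosen so that n + t + 1 is the next multiple of \<open>N j\<close> above
      n.\<close>
    define t where "t = N j - 1 - n mod N j"
    have t: "t < N j" using N_pos[OF j] by (simp add: t_def)
    have "n mod N j < N j" using N_pos[OF j] by simp
    then have "Suc (n + t) = N j * (n div N j) + N j" using mult_div_mod_eq[of "N j" n] unfolding t_def by linarith
    then have "N a dvd Suc (n + t)" using NN by simp
    then have "qn (q a) (Suc (n + t)) = 0" using qn_q_zero_iff a by blast
    then show ?thesis using t a by (auto simp: z1_def z2_def)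
  qed
  then show "Y1 j a [^]\<^bsub>EE\<^esub> N j = \<zero>\<^bsub>EE\<^esub>" "Y2 j a [^]\<^bsub>EE\<^esub> N j = \<zero>\<^bsub>EE\<^esub>"
    unfolding Y1_def Y2_def using j a by (auto intro!: Tp_nilpotent simp: f; blast)+
qed

text \<open>If both pieces contribute, j has two linked neighbours, so \<open>q j\<close> equals its
  own inverse and the order of the two factors is irrelevant.\<close>

lemma low_comm:
  assumes j: "j \<in> I" and ab: "a \<in> I" "b \<in> I" "a < j" "b < j" "a \<noteq> b"
    and u: "u \<in> {\<one>\<^sub>G, u2 j a}" "u' \<in> {\<one>\<^sub>G, u2 j b}"
    and z: "z \<in> {z1 j a, z2 j a}" "z' \<in> {z1 j b, z2 j b}"
  shows "Tp j a z u (ff j a) (Tp j b z' u' (ff j b) F) \<beta>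
    = q j * Tp j b z' u' (ff j b) (Tp j a z u (ff j a) F) \<beta>"
proof -
  have *: "Tp j a z u (ff j a) (Tp j b z' u' (ff j b) F) = (\<lambda>\<beta>. r * Tp j b z' u' (ff j b) (Tp j a z u (ff j a) F) \<beta>)"
    if ab: "a \<in> I" "b \<in> I" "a < j" "b < j" "b < a" and u: "u \<in> {\<one>\<^sub>G, u2 j a}" "u' \<in> {\<one>\<^sub>G, u2 j b}"
      and z: "z \<in> {z1 j a, z2 j a}" "z' \<in> {z1 j b, z2 j b}" and r: "r = q j \<or> r = inverse (q j)" for a b u u' z z' r
  proof (rule Tp_qcomm)
    fix n n' assume nz: "z n \<noteq> 0" "z' n' \<noteq> 0"
    have na: "z1 j a n \<noteq> 0 \<or> z2 j a n \<noteq> 0" and nb: "z1 j b n' \<noteq> 0 \<or> z2 j b n' \<noteq> 0" using nz z by auto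
    have "q j * q j = 1" using lk_two_neighbours[of j a b] lk_sym piece_linked[OF j ab(1,3) na] piece_linked[OF j ab(2,4) nb] ab j by auto
    moreover have "chi j (u2 j a) = q j * q j" "chi j (u2 j b) = q j * q j"
      using piece_linked_q(3)[OF j ab(1,3) na] piece_linked_q(3)[OF j ab(2,4) nb] ab j by (auto simp: u2_def q_def)
    ultimately have "chi j u = 1" "chi j u' = 1" using u j by auto
    moreover have "r * chi b (el j) = 1"
    proof -
      have "inverse (q j) = q j" using \<open>q j * q j = 1\<close> by (rule inverse_unique)
      then have "r = q j" using r by auto
      then show ?thesis using piece_linked_q(1,2)[OF j ab(2,4) nb] by (simp add: mult.commute)
    qed
    ultimately show "chi j u * chi b (el j) ^ n' = r * chi j u' * chi b (el j) ^ ff j b n'"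
      using ab by (simp add: ff_def flip: mult.assoc)
  qed (use that j in auto)
  show ?thesis
  proof (cases "b < a")
    case True
    then show ?thesis using *[OF ab(1,2,3,4) True u z, of "q j"] by simp
  next
    case False
    then have "a < b" using ab by simp
    then show ?thesis using *[OF ab(2,1,4,3) _ u(2,1) z(2,1), of "inverse (q j)"] j by (simp add: field_simps)
  qed
qed

text \<open>Applying \<open>Y2\<close> outside evaluates \<open>chi j\<close> after the translation,
  which gives the square of \<open>q j\<close>; applying it inside raises by one the power of
  \<open>inverse (q a)\<close> in its coefficient, which gives one factor \<open>q j\<close>. The
  quotient is the scalar.\<close>

lemma Y21_comm:
  assumes j: "j \<in> I" and a: "a \<in> I" "a < j"
  shows "Y2 j a (Y1 j a F) \<beta> = q j * Y1 j a (Y2 j a F) \<beta>"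
proof (cases \<beta>)
  case (Pair h l)
  define n where "n = l a"
  show ?thesis
  proof (cases "h \<in> \<Gamma> \<and> lnk D a j \<noteq> 0")
    case False
    then show ?thesis using a Pair by (auto simp: Y1_def Y2_def Tp_def z1_def z2_def)
  next
    case True
    then have l: "lk a j" using linked[of a j] a j by (auto simp: lk_def)
    have qq: "q a * q j = 1" and ca: "chi j (el a) = q j" using lk_q[of a j] lk_q[of j a] l lk_sym[OF l] a j by auto
    have cu: "chi j (u2 j a) = q j * q j" using ca a j by (simp add: u2_def q_def)
    have qa: "inverse (q a) = q j" using qq by (simp add: inverse_unique)
    have ppa: "PP j a (l(a := v)) = PP j a l" for v by (simp add: PP_upd_ge)
    have ne: "a \<noteq> j" using a by simp
    have h: "h \<in> \<Gamma>" using True by simp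
    have ci: "inverse (chi j (inv\<^sub>G (u2 j a) \<otimes>\<^sub>G h)) = inverse (chi j h) * (q j * q j)"
      using h j a cu by (simp add: u2_closed[OF j a(1)])
    show ?thesis using h a j ne unfolding Pair
      by (simp add: Y1_def Y2_def Tp_def z1_def z2_def ff_def ppa ci qa algebra_simps del: chi_mult)
  qed
qed

text \<open>The translation in \<open>Y2\<close> contributes the square of \<open>q j\<close> and
  thereby inverts the scalar obtained for \<open>Y1\<close>. This dictates the order of the pieces
  in \<open>XX_root\<close>: the translated lowering pieces before the raising piece, the others
  after it.\<close>

lemma Yraise_comm:
  assumes j: "j \<in> I" and a: "a \<in> I" "a < j"
  shows "Y j j (Y1 j a F) \<beta> = q j * Y1 j a (Y j j F) \<beta>"
    and "Y2 j a (Y j j F) \<beta> = q j * Y j j (Y2 j a F) \<beta>"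
proof -
  have cj: "chi j (u2 j j) = 1" using j q_N[OF j] by (simp add: u2_def q_def)
  have 1: "T (Y1 j a F) \<beta> = q j * Y1 j a (T F) \<beta>" if T: "T \<in> {Y1 j j, Y2 j j}" for T
  proof -
    have "Tp j j z u (ff j j) (Y1 j a F) = (\<lambda>\<beta>. q j * Y1 j a (Tp j j z u (ff j j) F) \<beta>)"
      if u: "u \<in> \<Gamma>" "chi j u = 1" for z u
      unfolding Y1_def
    proof (rule Tp_qcomm)
      fix n n' assume "z1 j a n' \<noteq> 0"
      then have "chi a (el j) = q a" "q a * q j = 1" using piece_linked_q[OF j a] by auto
      then show "chi j u * chi a (el j) ^ n' = q j * chi j \<one>\<^sub>G * chi a (el j) ^ ff j a n'"
        using u j a by (simp add: ff_def mult.commute flip: mult.assoc)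
    qed (use j a u in auto)
    from this[of "\<one>\<^sub>G" "z1 j j"] this[of "u2 j j" "z2 j j"] T cj j show ?thesis
      by (auto simp: Y1_def Y2_def)
  qed
  have 2: "Y2 j a (T F) \<beta> = q j * T (Y2 j a F) \<beta>" if T: "T \<in> {Y1 j j, Y2 j j}" for T
  proof -
    have "Tp j j z u (ff j j) (Y2 j a F) = (\<lambda>\<beta>. inverse (q j) * Y2 j a (Tp j j z u (ff j j) F) \<beta>)"
      if u: "u \<in> \<Gamma>" "chi j u = 1" for z u
      unfolding Y2_def
    proof (rule Tp_qcomm)
      fix n n' assume n: "z2 j a n' \<noteq> 0"
      then have "chi a (el j) = q a" "q a * q j = 1" "chi j (el a) = q j" using piece_linked_q[OF j a] by auto
      then show "chi j u * chi a (el j) ^ n' = inverse (q j) * chi j (u2 j a) * chi a (el j) ^ ff j a n'"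
        using u j a by (simp add: ff_def u2_def q_def field_simps)
    qed (use j a u in auto)
    from this[of "\<one>\<^sub>G" "z1 j j"] this[of "u2 j j" "z2 j j"] T cj j show ?thesis
      by (auto simp: Y1_def Y2_def)
  qed
  note add = endo_algD(1)[OF Y_carrier(1)[OF j a(1)]] endo_algD(1)[OF Y_carrier(2)[OF j a(1)]]
  show "Y j j (Y1 j a F) \<beta> = q j * Y1 j a (Y j j F) \<beta>"
    using 1[of "Y1 j j"] 1[of "Y2 j j"] by (simp add: Y_def[abs_def] add distrib_left)
  show "Y2 j a (Y j j F) \<beta> = q j * Y j j (Y2 j a F) \<beta>"
    using 2[of "Y1 j j"] 2[of "Y2 j j"] by (simp add: Y_def[abs_def] add distrib_left)
qed

text \<open>For at most \<open>N j\<close> steps the exponent jumps at most once. The translation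
  belonging to the jump does not affect the prefactors, since \<open>chi j\<close> is 1 on the
  \<open>N j\<close>-th power of \<open>el j\<close>.\<close>

lemma Yraise_pow:
  assumes j: "j \<in> I" and h: "h \<in> \<Gamma>" and k: "k \<le> N j"
  shows "(Y j j [^]\<^bsub>EE\<^esub> k) F (h, l) = (inverse (chi j h) * PP j j l) ^ k *
    (if k \<le> l j mod N j then F (h, l(j := l j - k)) else
      rtp D j * (F (h, l(j := l j + N j - k)) - F (inv\<^sub>G (el j [^]\<^bsub>grp D\<^esub> N j) \<otimes>\<^sub>G h, l(j := l j + N j - k))))"
  using k h
proof (induction k arbitrary: h l)
  case 0
  then show ?case by (simp add: endo_alg_simps)
next
  case (Suc k)
  define g where "g = el j [^]\<^bsub>grp D\<^esub> N j"
  have g: "g \<in> \<Gamma>" "chi j g = 1" using j q_N[OF j] by (auto simp: g_def q_def)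
  have gh: "inv\<^sub>G g \<otimes>\<^sub>G h \<in> \<Gamma>" "chi j (inv\<^sub>G g \<otimes>\<^sub>G h) = chi j h"
    using g j Suc.prems by simp_all
  have pp: "PP j j (l(j := v)) = PP j j l" for v by (simp add: PP_upd_ge)
  have kN: "k \<le> N j" using Suc.prems by simp
  show ?case
  proof (cases "l j mod N j = 0")
    case False
    then obtain m where m: "l j = Suc m" by (cases "l j") auto
    have mm: "l j mod N j = Suc (m mod N j)" using False m by (simp add: mod_Suc split: if_splits)
    show ?thesis
      unfolding endo_pow_Suc[OF Yd_carrier[OF j j]] Yraise[OF Suc.prems(2)] Suc.IH[OF kN Suc.prems(2)]
      using False m mm by (simp add: pp)
  next
    case True
    have NN: "N j > 0" by (rule N_pos[OF j])
    have md: "(l j + N j - 1) mod N j = N j - 1"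
    proof -
      have "l j + N j - 1 = N j * (l j div N j) + (N j - 1)" using True NN by (metis Nat.add_diff_assoc Suc_leI One_nat_def mult_div_mod_eq add.right_neutral)
      then show ?thesis using NN by (simp only: mod_mult_self4) simp
    qed
    have k1: "k \<le> N j - 1" using Suc.prems by simp
    show ?thesis
      unfolding endo_pow_Suc[OF Yd_carrier[OF j j]] Yraise[OF Suc.prems(2)] g_def[symmetric]
        Suc.IH[OF kN Suc.prems(2)] Suc.IH[OF kN gh(1)]
      using True md k1 NN gh(2) by (simp add: pp algebra_simps)
  qed
qed

lemma Yraise_root:
  assumes j: "j \<in> I"
  shows "Y j j [^]\<^bsub>EE\<^esub> N j =
    rtp D j \<odot>\<^bsub>EE\<^esub> \<one>\<^bsub>EE\<^esub> \<oplus>\<^bsub>EE\<^esub> (- rtp D j) \<odot>\<^bsub>EE\<^esub> GG (el j [^]\<^bsub>grp D\<^esub> N j)"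
proof (intro ext, clarify)
  fix F h l
  show "(Y j j [^]\<^bsub>EE\<^esub> N j) F (h, l) =
    (rtp D j \<odot>\<^bsub>EE\<^esub> \<one>\<^bsub>EE\<^esub> \<oplus>\<^bsub>EE\<^esub> (- rtp D j) \<odot>\<^bsub>EE\<^esub> GG (el j [^]\<^bsub>grp D\<^esub> N j)) F (h, l)"
  proof (cases "h \<in> \<Gamma>")
    case False
    then have "(Y j j [^]\<^bsub>EE\<^esub> N j) F (h, l) = 0"
      by (intro endo_algD(3)[OF E.nat_pow_closed[OF Yd_carrier[OF j j]]]) simp
    then show ?thesis using False by (simp add: endo_alg_simps GG_def)
  next
    case True
    have "\<not> N j \<le> l j mod N j" using N_pos[OF j] by (simp add: not_le)
    moreover have "(inverse (chi j h) * PP j j l) ^ N j = 1" if r: "rtp D j \<noteq> 0"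
    proof -
      have "chi b (el j) ^ N j = 1" if b: "b \<in> {1..<j}" for b
      proof -
        have bI: "b \<in> I" "b \<noteq> j" using idx_less[OF j b] b by auto
        have "(chi b (el j) * chi j (el b)) ^ N j = 1" using chi_symm[OF bI(1) j bI(2)] by simp
        then show ?thesis using rooted[OF j r el[OF bI(1)]] by (simp add: power_mult_distrib)
      qed
      then have "PP j j l ^ N j = 1"
        unfolding PP_def prod_power_distrib
        by (intro prod.neutral) (simp add: power_mult[symmetric] mult.commute[of _ "N j"] power_mult)
      then show ?thesis using rooted[OF j r True] by (simp add: power_mult_distrib power_inverse)
    qed
    ultimately show ?thesis
      using Yraise_pow[OF j True order_refl, of F l] True by (cases "rtp D j = 0") (simp_all add: endo_alg_simps GG_def algebra_simps)
  qed
qed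

text \<open>In a suitable order all pieces commute pairwise up to the same scalar
  \<open>q j\<close>, of exact order \<open>N j\<close>. The power of the sum is then the sum of the
  powers; the lowering pieces drop out by nilpotency and the raising piece gives the root
  relation.\<close>

lemma XX_root:
  assumes j: "j \<in> I"
  shows "XX j [^]\<^bsub>EE\<^esub> N j =
    rtp D j \<odot>\<^bsub>EE\<^esub> \<one>\<^bsub>EE\<^esub> \<oplus>\<^bsub>EE\<^esub> (- rtp D j) \<odot>\<^bsub>EE\<^esub> GG (el j [^]\<^bsub>grp D\<^esub> N j)"
proof -
  define xs where "xs = map (Y2 j) [1..<j] @ [Y j j] @ map (Y1 j) [1..<j]"
  have aI: "a \<in> I" "a < j" if "1 \<le> a" "a < j" for a using that j by (auto simp: idx_def)
  have cl: "set xs \<subseteq> carrier EE" unfolding xs_def using aI j Yd_carrier Y_carrier by auto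
  define R where "R x y \<longleftrightarrow> x \<otimes>\<^bsub>EE\<^esub> y = q j \<odot>\<^bsub>EE\<^esub> (y \<otimes>\<^bsub>EE\<^esub> x)" for x y
  have R: "R x y" if "\<And>F \<beta>. x (y F) \<beta> = q j * y (x F) \<beta>" for x y
    using that by (simp add: R_def endo_alg_simps fun_eq_iff)
  have sw: "sorted_wrt R xs"
  proof -
    have s: "sorted_wrt R (map T [1..<j])" if "\<And>a b. 1 \<le> a \<Longrightarrow> a < b \<Longrightarrow> b < j \<Longrightarrow> R (T a) (T b)" for T
      unfolding sorted_wrt_map by (rule sorted_wrt_mono_rel[OF _ sorted_wrt_upt]) (auto intro: that)
    have 21: "R (Y2 j a) (Y1 j b)" if "1 \<le> a" "a < j" "1 \<le> b" "b < j" for a b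
      using low_comm[OF j, of a b "u2 j a" "\<one>\<^sub>G" "z2 j a" "z1 j b"] Y21_comm[OF j, of a] aI that
      by (intro R, cases "a = b") (simp_all add: Y1_def Y2_def)
    have 11: "R (Y1 j a) (Y1 j b)" if "1 \<le> a" "a < b" "b < j" for a b
      using low_comm[OF j, of a b "\<one>\<^sub>G" "\<one>\<^sub>G" "z1 j a" "z1 j b"] aI that by (intro R) (simp add: Y1_def)
    have 22: "R (Y2 j a) (Y2 j b)" if "1 \<le> a" "a < b" "b < j" for a b
      using low_comm[OF j, of a b "u2 j a" "u2 j b" "z2 j a" "z2 j b"] aI that by (intro R) (simp add: Y2_def)
    have "R (Y j j) (Y1 j a)" "R (Y2 j a) (Y j j)" if "1 \<le> a" "a < j" for a
      using Yraise_comm[OF j] aI[OF that] by (auto intro: R)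
    then show ?thesis
      unfolding xs_def sorted_wrt_append using s[of "Y1 j", OF 11] s[of "Y2 j", OF 22] 21 by auto
  qed
  then have sw: "sorted_wrt (\<lambda>x y. x \<otimes>\<^bsub>EE\<^esub> y = q j \<odot>\<^bsub>EE\<^esub> (y \<otimes>\<^bsub>EE\<^esub> x)) xs" unfolding R_def[abs_def] .
  have fs: "foldr (\<oplus>\<^bsub>EE\<^esub>) (map T ys) \<zero>\<^bsub>EE\<^esub> = (\<lambda>F \<beta>. \<Sum>a\<leftarrow>ys. T a F \<beta>)" for T :: "nat \<Rightarrow> _" and ys
    by (induction ys) (simp_all add: endo_alg_simps)
  have fa: "foldr (\<oplus>\<^bsub>EE\<^esub>) (xs @ ys) \<zero>\<^bsub>EE\<^esub> = foldr (\<oplus>\<^bsub>EE\<^esub>) xs \<zero>\<^bsub>EE\<^esub> \<oplus>\<^bsub>EE\<^esub> foldr (\<oplus>\<^bsub>EE\<^esub>) ys \<zero>\<^bsub>EE\<^esub>" for xs ys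
    by (induction xs) (simp_all add: endo_alg_simps add.assoc)
  have "foldr (\<oplus>\<^bsub>EE\<^esub>) xs \<zero>\<^bsub>EE\<^esub> = XX j"
  proof (intro ext)
    fix F \<beta>
    have j1: "{1..j} = insert j {1..<j}" using j by (auto simp: idx_def)
    have "foldr (\<oplus>\<^bsub>EE\<^esub>) xs \<zero>\<^bsub>EE\<^esub> F \<beta> = (\<Sum>a\<leftarrow>[1..<j]. Y2 j a F \<beta>) + Y j j F \<beta> + (\<Sum>a\<leftarrow>[1..<j]. Y1 j a F \<beta>)"
      unfolding xs_def fa fs by (simp add: endo_alg_simps)
    also have "\<dots> = XX j F \<beta>"
      unfolding XX_def j1 interv_sum_list_conv_sum_set_nat set_upt
      by (simp add: sum.distrib Y_def[of j a for a])
    finally show "foldr (\<oplus>\<^bsub>EE\<^esub>) xs \<zero>\<^bsub>EE\<^esub> F \<beta> = XX j F \<beta>" .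
  qed
  then have "XX j [^]\<^bsub>EE\<^esub> N j = foldr (\<oplus>\<^bsub>EE\<^esub>) (map (\<lambda>x. x [^]\<^bsub>EE\<^esub> N j) xs) \<zero>\<^bsub>EE\<^esub>"
    using E.qcomm_list_pow[OF cl sw q_pow_iff[OF j] N_pos[OF j]] by simp
  also have "\<dots> = Y j j [^]\<^bsub>EE\<^esub> N j"
  proof -
    have m: "map ((\<lambda>x. x [^]\<^bsub>EE\<^esub> N j) \<circ> T) [1..<j] = map (\<lambda>_. \<zero>\<^bsub>EE\<^esub>) [1..<j]" if "T = Y1 j \<or> T = Y2 j" for T
      using low_nilpotent[OF j] aI that by auto
    have z: "foldr (\<oplus>\<^bsub>EE\<^esub>) (map (\<lambda>_. \<zero>\<^bsub>EE\<^esub>) ys) \<zero>\<^bsub>EE\<^esub> = \<zero>\<^bsub>EE\<^esub>" for ys :: "nat list"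
      by (induction ys) simp_all
    show ?thesis
      unfolding xs_def map_append list.map map_map fa m[OF disjI1[OF refl]] m[OF disjI2[OF refl]] z
      by (simp add: E.nat_pow_closed[OF Yd_carrier[OF j j]])
  qed
  also note Yraise_root[OF j]
  finally show ?thesis .
qed

definition "opgen y = (case y of GenG g \<Rightarrow> GG g | GenX i \<Rightarrow> XX i)"

lemma sat_opgen: "sat D EE opgen"
  unfolding sat_def
proof (intro conjI ballI impI)
  fix g h assume "g \<in> \<Gamma>" "h \<in> \<Gamma>"
  then show "opgen (GenG g) \<otimes>\<^bsub>EE\<^esub> opgen (GenG h) = opgen (GenG (g \<otimes>\<^sub>G h))"
    by (simp add: opgen_def endo_alg_simps(1) GG_mult)
next
  show "opgen (GenG \<one>\<^sub>G) = \<one>\<^bsub>EE\<^esub>" by (simp add: opgen_def GG_one)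
next
  fix g i assume "g \<in> \<Gamma>" "i \<in> I"
  then show "opgen (GenG g) \<otimes>\<^bsub>EE\<^esub> opgen (GenX i) = chi i g \<odot>\<^bsub>EE\<^esub> (opgen (GenX i) \<otimes>\<^bsub>EE\<^esub> opgen (GenG g))"
    by (simp add: opgen_def endo_alg_simps fun_eq_iff GG_XX)
next
  fix i j assume ij: "i \<in> I" "j \<in> I" "i < j"
  have o: "XX j F (h, l) = 0" if "h \<notin> \<Gamma>" "j \<in> I" for j F h l
    using that by (simp add: XX_def Y_outside)
  show "opgen (GenX j) \<otimes>\<^bsub>EE\<^esub> opgen (GenX i) = chi i (el j) \<odot>\<^bsub>EE\<^esub> (opgen (GenX i) \<otimes>\<^bsub>EE\<^esub> opgen (GenX j)) \<oplus>\<^bsub>EE\<^esub>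
      (lnk D i j \<odot>\<^bsub>EE\<^esub> \<one>\<^bsub>EE\<^esub> \<oplus>\<^bsub>EE\<^esub> (- lnk D i j) \<odot>\<^bsub>EE\<^esub> opgen (GenG (el i \<otimes>\<^sub>G el j)))"
  proof (intro ext, clarify)
    fix F h l
    show "(opgen (GenX j) \<otimes>\<^bsub>EE\<^esub> opgen (GenX i)) F (h, l) = (chi i (el j) \<odot>\<^bsub>EE\<^esub> (opgen (GenX i) \<otimes>\<^bsub>EE\<^esub> opgen (GenX j)) \<oplus>\<^bsub>EE\<^esub>
      (lnk D i j \<odot>\<^bsub>EE\<^esub> \<one>\<^bsub>EE\<^esub> \<oplus>\<^bsub>EE\<^esub> (- lnk D i j) \<odot>\<^bsub>EE\<^esub> opgen (GenG (el i \<otimes>\<^sub>G el j)))) F (h, l)"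
      using XX_comm[OF ij, of h F l] ij
      by (cases "h \<in> \<Gamma>") (simp_all add: opgen_def endo_alg_simps GG_def o algebra_simps)
  qed
next
  fix i assume "i \<in> I"
  then show "opgen (GenX i) [^]\<^bsub>EE\<^esub> N i = rtp D i \<odot>\<^bsub>EE\<^esub> \<one>\<^bsub>EE\<^esub> \<oplus>\<^bsub>EE\<^esub> (- rtp D i) \<odot>\<^bsub>EE\<^esub> opgen (GenG (el i [^]\<^bsub>grp D\<^esub> N i))"
    by (simp add: opgen_def XX_root)
qed

lemma rep_ex: "\<exists>p\<in>alg_hom (Ualg D) EE. \<forall>y\<in>gens D. p (Ugen D y) = opgen y"
proof (rule Ualg_ext[OF D endo_alg_k_algebra _ sat_opgen])
  fix y assume "y \<in> gens D"
  then show "opgen y \<in> carrier EE" by (auto simp: gens_def opgen_def GG_carrier XX_carrier)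
qed

definition "rep = (SOME p. p \<in> alg_hom (Ualg D) EE \<and> (\<forall>y\<in>gens D. p (Ugen D y) = opgen y))"

lemma rep: "rep \<in> alg_hom (Ualg D) EE" "y \<in> gens D \<Longrightarrow> rep (Ugen D y) = opgen y"
proof -
  have "\<exists>p. p \<in> alg_hom (Ualg D) EE \<and> (\<forall>y\<in>gens D. p (Ugen D y) = opgen y)" using rep_ex by blast
  from someI_ex[OF this] show "rep \<in> alg_hom (Ualg D) EE" "y \<in> gens D \<Longrightarrow> rep (Ugen D y) = opgen y"
    unfolding rep_def by blast+
qed

end

section \<open>The PBW basis\<close>

context k_algebra begin

inductive_set lsp :: "'a set \<Rightarrow> 'a set" for X where
  lsp_base: "x \<in> X \<Longrightarrow> x \<in> lsp X"
| lsp_zero: "\<zero> \<in> lsp X"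
| lsp_add: "x \<in> lsp X \<Longrightarrow> y \<in> lsp X \<Longrightarrow> x \<oplus> y \<in> lsp X"
| lsp_smult: "x \<in> lsp X \<Longrightarrow> c \<odot> x \<in> lsp X"

lemma lsp_carrier:
  assumes "X \<subseteq> carrier A" "x \<in> lsp X"
  shows "x \<in> carrier A"
  using assms(2) by induction (use assms(1) in \<open>auto simp: smult_closed\<close>)

lemma lsp_mult_left:
  assumes X: "X \<subseteq> carrier A" and y: "y \<in> carrier A" and v: "v \<in> lsp X"
    and c: "\<And>x. x \<in> X \<Longrightarrow> y \<otimes> x \<in> lsp Z"
  shows "y \<otimes> v \<in> lsp Z"
  using v
proof induction
  case (lsp_add a b)
  then show ?case using lsp_carrier[OF X] y by (simp add: r_distr lsp.lsp_add)
next
  case (lsp_smult a k)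
  then show ?case using lsp_carrier[OF X] y by (simp add: smult_mult_r lsp.lsp_smult)
qed (use y c in \<open>simp_all add: lsp.lsp_zero\<close>)

lemma lsp_mult_right:
  assumes X: "X \<subseteq> carrier A" and y: "y \<in> carrier A" and v: "v \<in> lsp X"
    and c: "\<And>x. x \<in> X \<Longrightarrow> x \<otimes> y \<in> lsp Z"
  shows "v \<otimes> y \<in> lsp Z"
  using v
proof induction
  case (lsp_add a b)
  then show ?case using lsp_carrier[OF X] y by (simp add: l_distr lsp.lsp_add)
next
  case (lsp_smult a k)
  then show ?case using lsp_carrier[OF X] y by (simp add: smult_mult_l lsp.lsp_smult)
qed (use y c in \<open>simp_all add: lsp.lsp_zero\<close>)

end

context datum begin

interpretation E: k_algebra EE by (rule endo_alg_k_algebra)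

abbreviation "UU \<equiv> Ualg D"
abbreviation umult (infixl "\<otimes>\<^sub>U" 70) where "u \<otimes>\<^sub>U v \<equiv> u \<otimes>\<^bsub>UU\<^esub> v"
abbreviation uadd (infixl "\<oplus>\<^sub>U" 65) where "u \<oplus>\<^sub>U v \<equiv> u \<oplus>\<^bsub>UU\<^esub> v"
abbreviation usmult (infixl "\<odot>\<^sub>U" 70) where "c \<odot>\<^sub>U v \<equiv> c \<odot>\<^bsub>UU\<^esub> v"
abbreviation uone ("\<one>\<^sub>U") where "\<one>\<^sub>U \<equiv> \<one>\<^bsub>UU\<^esub>"
abbreviation uzero ("\<zero>\<^sub>U") where "\<zero>\<^sub>U \<equiv> \<zero>\<^bsub>UU\<^esub>"

lemma ug_closed [simp]: "g \<in> \<Gamma> \<Longrightarrow> ug D g \<in> carrier UU" by (rule Ugen_closed'(1)[OF D])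
lemma ux_closed [simp]: "i \<in> I \<Longrightarrow> ux D i \<in> carrier UU" by (rule Ugen_closed'(2)[OF D])

lemma Ualg_relations:
  shows ug_mult: "g \<in> \<Gamma> \<Longrightarrow> h \<in> \<Gamma> \<Longrightarrow> ug D g \<otimes>\<^sub>U ug D h = ug D (g \<otimes>\<^sub>G h)"
    and ug_one: "ug D \<one>\<^sub>G = \<one>\<^sub>U"
    and ug_ux: "g \<in> \<Gamma> \<Longrightarrow> i \<in> I \<Longrightarrow> ug D g \<otimes>\<^sub>U ux D i = chi i g \<odot>\<^sub>U (ux D i \<otimes>\<^sub>U ug D g)"
    and ux_ux: "i \<in> I \<Longrightarrow> j \<in> I \<Longrightarrow> i < j \<Longrightarrow> ux D j \<otimes>\<^sub>U ux D i =
        chi i (el j) \<odot>\<^sub>U (ux D i \<otimes>\<^sub>U ux D j) \<oplus>\<^sub>U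
         (lnk D i j \<odot>\<^sub>U \<one>\<^sub>U \<oplus>\<^sub>U (- lnk D i j) \<odot>\<^sub>U ug D (el i \<otimes>\<^sub>G el j))"
    and ux_pow: "i \<in> I \<Longrightarrow> ux D i [^]\<^bsub>UU\<^esub> N i =
         rtp D i \<odot>\<^sub>U \<one>\<^sub>U \<oplus>\<^sub>U (- rtp D i) \<odot>\<^sub>U ug D (el i [^]\<^bsub>grp D\<^esub> N i)"
proof -
  note S = sat_Ualg[OF D, unfolded sat_def]
  show "g \<in> \<Gamma> \<Longrightarrow> h \<in> \<Gamma> \<Longrightarrow> ug D g \<otimes>\<^sub>U ug D h = ug D (g \<otimes>\<^sub>G h)"
    by (rule S[THEN conjunct1, rule_format])
  show "ug D \<one>\<^sub>G = \<one>\<^sub>U" by (rule S[THEN conjunct2, THEN conjunct1])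
  show "g \<in> \<Gamma> \<Longrightarrow> i \<in> I \<Longrightarrow> ug D g \<otimes>\<^sub>U ux D i = chi i g \<odot>\<^sub>U (ux D i \<otimes>\<^sub>U ug D g)"
    by (rule S[THEN conjunct2, THEN conjunct2, THEN conjunct1, rule_format])
  show "i \<in> I \<Longrightarrow> j \<in> I \<Longrightarrow> i < j \<Longrightarrow> ux D j \<otimes>\<^sub>U ux D i =
        chi i (el j) \<odot>\<^sub>U (ux D i \<otimes>\<^sub>U ux D j) \<oplus>\<^sub>U
         (lnk D i j \<odot>\<^sub>U \<one>\<^sub>U \<oplus>\<^sub>U (- lnk D i j) \<odot>\<^sub>U ug D (el i \<otimes>\<^sub>G el j))"
    by (rule S[THEN conjunct2, THEN conjunct2, THEN conjunct2, THEN conjunct1, rule_format])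
  show "i \<in> I \<Longrightarrow> ux D i [^]\<^bsub>UU\<^esub> N i =
         rtp D i \<odot>\<^sub>U \<one>\<^sub>U \<oplus>\<^sub>U (- rtp D i) \<odot>\<^sub>U ug D (el i [^]\<^bsub>grp D\<^esub> N i)"
    by (rule S[THEN conjunct2, THEN conjunct2, THEN conjunct2, THEN conjunct2, rule_format])
qed

definition vac :: "'g \<times> (nat \<Rightarrow> nat) \<Rightarrow> 'k" where
  "vac \<beta> = (if \<beta> = (\<one>\<^sub>G, \<lambda>_. 0) then 1 else 0)"

text \<open>\<open>cc u (g, m)\<close> is the coefficient of \<open>u\<close> at the basis element \<open>g x\<^sup>m\<close>.\<close>

definition cc where "cc u = rep u vac"

lemma rep_closed: "u \<in> carrier UU \<Longrightarrow> rep u \<in> carrier EE"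
  using rep(1) by (auto simp: alg_hom_def Ring.ring_hom_def)

lemma rep_simps:
  "u \<in> carrier UU \<Longrightarrow> v \<in> carrier UU \<Longrightarrow> rep (u \<oplus>\<^sub>U v) = (\<lambda>F b. rep u F b + rep v F b)"
  "u \<in> carrier UU \<Longrightarrow> v \<in> carrier UU \<Longrightarrow> rep (u \<otimes>\<^sub>U v) = (\<lambda>F. rep u (rep v F))"
  "u \<in> carrier UU \<Longrightarrow> rep (c \<odot>\<^sub>U u) = (\<lambda>F b. c * rep u F b)"
  "rep \<one>\<^sub>U = \<one>\<^bsub>EE\<^esub>"
  using rep(1) by (auto simp: alg_hom_def Ring.ring_hom_def endo_alg_simps)

lemma rep_gen: "g \<in> \<Gamma> \<Longrightarrow> rep (ug D g) = GG g" "i \<in> I \<Longrightarrow> rep (ux D i) = XX i"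
  using rep(2)[of "GenG g"] rep(2)[of "GenX i"] by (auto simp: opgen_def gens_def)

lemma cc_mult: "u \<in> carrier UU \<Longrightarrow> v \<in> carrier UU \<Longrightarrow> cc (u \<otimes>\<^sub>U v) = rep u (cc v)"
  by (simp add: cc_def rep_simps)

lemma cc_add: "u \<in> carrier UU \<Longrightarrow> v \<in> carrier UU \<Longrightarrow> cc (u \<oplus>\<^sub>U v) b = cc u b + cc v b"
  by (simp add: cc_def rep_simps)

lemma cc_smult: "u \<in> carrier UU \<Longrightarrow> cc (c \<odot>\<^sub>U u) b = c * cc u b"
  by (simp add: cc_def rep_simps)

lemma cc_zero: "cc \<zero>\<^sub>U b = 0"
  using cc_smult[of "\<zero>\<^sub>U" 0 b] by simp

lemma cc_one: "cc \<one>\<^sub>U = vac"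
  by (auto simp: cc_def rep_simps endo_alg_simps vac_def fun_eq_iff)

lemma cc_ug: "g \<in> \<Gamma> \<Longrightarrow> u \<in> carrier UU \<Longrightarrow> cc (ug D g \<otimes>\<^sub>U u) = GG g (cc u)"
  by (simp add: cc_mult rep_gen)

lemma cc_ux: "i \<in> I \<Longrightarrow> u \<in> carrier UU \<Longrightarrow> cc (ux D i \<otimes>\<^sub>U u) = XX i (cc u)"
  by (simp add: cc_mult rep_gen)

lemma cc_outside: "u \<in> carrier UU \<Longrightarrow> h \<notin> \<Gamma> \<Longrightarrow> cc u (h, l) = 0"
  unfolding cc_def by (rule endo_algD(3)[OF rep_closed]) auto

lemma cc_finsum:
  assumes "finite S" "\<And>s. s \<in> S \<Longrightarrow> f s \<in> carrier UU"
  shows "cc (finsum UU f S) b = (\<Sum>s\<in>S. cc (f s) b)"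
  using assms
proof (induction S rule: finite_induct)
  case (insert x F)
  then have "f \<in> F \<rightarrow> carrier UU" "f x \<in> carrier UU" by auto
  then show ?case using insert by (simp add: U.finsum_insert cc_add U.finsum_closed)
qed (simp add: cc_zero)

definition wrd :: "(nat \<Rightarrow> nat) \<Rightarrow> 'g gen list" where
  "wrd m = concat (map (\<lambda>i. replicate (m i) (GenX i)) [1..<Suc (rk D)])"
definition "xm m = wprod UU (Ugen D) (wrd m)"
definition "box = {m. (\<forall>i\<in>I. m i < N i) \<and> (\<forall>i. i \<notin> I \<longrightarrow> m i = 0)}"

lemma wrd_lists: "wrd m \<in> lists (gens D)"
  by (auto simp: wrd_def gens_def idx_def in_lists_conv_set)

lemma xm_closed [simp]: "xm m \<in> carrier UU"
  unfolding xm_def by (rule wprod_closed[OF U.k_algebra_axioms Ugen_closed[OF D] wrd_lists])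

lemma concat_replicate_cong:
  "(\<And>i. lo \<le> i \<Longrightarrow> i < hi \<Longrightarrow> m i = m' i) \<Longrightarrow>
    concat (map (\<lambda>i. replicate (m i) (f i)) [lo..<hi]) = concat (map (\<lambda>i. replicate (m' i) (f i)) [lo..<hi])"
  by (intro arg_cong[of _ _ concat] map_cong) auto

lemma concat_replicate_0:
  "(\<And>i. lo \<le> i \<Longrightarrow> i < hi \<Longrightarrow> m i = 0) \<Longrightarrow> concat (map (\<lambda>i. replicate (m i) (f i)) [lo..<hi]) = []"
  by auto

definition up :: "nat \<Rightarrow> (nat \<Rightarrow> nat) \<Rightarrow> nat \<Rightarrow> nat" where "up j m = m(j := Suc (m j))"

lemma up_simps [simp]: "up j m j = Suc (m j)" "i \<noteq> j \<Longrightarrow> up j m i = m i"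
  by (simp_all add: up_def)

lemma wrd_split:
  assumes "j \<in> I"
  shows "wrd m = concat (map (\<lambda>i. replicate (m i) (GenX i)) [1..<j]) @ replicate (m j) (GenX j) @
    concat (map (\<lambda>i. replicate (m i) (GenX i)) [Suc j..<Suc (rk D)])"
proof -
  have "1 \<le> j" "j < Suc (rk D)" using assms by (auto simp: idx_def)
  then have "[1..<Suc (rk D)] = [1..<j] @ j # [Suc j..<Suc (rk D)]"
    using upt_add_eq_append[of 1 j "Suc (rk D) - j"] upt_conv_Cons[of j "Suc (rk D)"] by simp
  then show ?thesis unfolding wrd_def by (simp only: map_append concat_append list.map concat.simps)
qed

lemma wrd_lead:
  assumes "j \<in> I" "\<forall>i<j. m i = 0"
  shows "wrd (up j m) = GenX j # wrd m"
proof -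
  let ?m = "up j m"
  have "concat (map (\<lambda>i. replicate (m i) (GenX i :: 'g gen)) [1..<j]) = ([] :: 'g gen list)"
    "concat (map (\<lambda>i. replicate (?m i) (GenX i :: 'g gen)) [1..<j]) = []"
    by (rule concat_replicate_0, use assms in simp)+
  moreover have "concat (map (\<lambda>i. replicate (?m i) (GenX i :: 'g gen)) [Suc j..<Suc (rk D)]) =
    concat (map (\<lambda>i. replicate (m i) (GenX i :: 'g gen)) [Suc j..<Suc (rk D)])"
    by (rule concat_replicate_cong) simp
  ultimately show ?thesis
    unfolding wrd_split[OF assms(1)] by (simp only: up_simps replicate_Suc append_Nil append_Cons)
qed

lemma xm_lead:
  assumes "j \<in> I" "\<forall>i<j. m i = 0"
  shows "xm (up j m) = ux D j \<otimes>\<^sub>U xm m"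
  unfolding xm_def wrd_lead[OF assms] by simp

lemma wrd_0: "wrd (\<lambda>_. 0) = []" by (simp add: wrd_def)

lemma xm_0: "xm (\<lambda>_. 0) = \<one>\<^sub>U" by (simp add: xm_def wrd_0)

lemma xm_last:
  assumes j: "j \<in> I" and m: "\<forall>i>j. m i = 0"
  shows "xm m = xm (m(j := 0)) \<otimes>\<^sub>U ux D j [^]\<^bsub>UU\<^esub> m j"
proof -
  let ?m = "m(j := 0)"
  have "concat (map (\<lambda>i. replicate (m i) (GenX i :: 'g gen)) [Suc j..<Suc (rk D)]) = []"
    "concat (map (\<lambda>i. replicate (?m i) (GenX i :: 'g gen)) [Suc j..<Suc (rk D)]) = []"
    by (rule concat_replicate_0, use m in simp)+
  moreover have "concat (map (\<lambda>i. replicate (?m i) (GenX i :: 'g gen)) [1..<j]) =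
    concat (map (\<lambda>i. replicate (m i) (GenX i :: 'g gen)) [1..<j])"
    by (rule concat_replicate_cong) simp
  ultimately have "wrd m = wrd (m(j := 0)) @ replicate (m j) (GenX j)"
    unfolding wrd_split[OF j] by (simp only: append_Nil2 fun_upd_same replicate_0 append_Nil append_assoc)
  moreover have "replicate (m j) (GenX j) \<in> lists (gens D)" using j by (auto simp: gens_def in_lists_conv_set)
  ultimately show ?thesis
    using wprod_append[OF U.k_algebra_axioms Ugen_closed[OF D] wrd_lists] wprod_replicate[OF U.k_algebra_axioms, of "Ugen D" "GenX j"] j
    by (simp add: xm_def)
qed

text \<open>Monomials are built by prepending their smallest variable. The product
  \<open>x_j x^m\<close> is then already in order, so no relation has to be applied in the induction
  steps.\<close>

lemma box_induct [consumes 1, case_names zero step]: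
  assumes "m \<in> box" "P (\<lambda>_. 0)"
    "\<And>j m. j \<in> I \<Longrightarrow> m \<in> box \<Longrightarrow> up j m \<in> box \<Longrightarrow> \<forall>i<j. m i = 0 \<Longrightarrow> P m \<Longrightarrow> P (up j m)"
  shows "P m"
  using assms(1)
proof (induction "sum m I" arbitrary: m rule: less_induct)
  case less
  have fI: "finite I" by (simp add: idx_def)
  show ?case
  proof (cases "m = (\<lambda>_. 0)")
    case True then show ?thesis using assms(2) by simp
  next
    case False
    then obtain i0 where "m i0 \<noteq> 0" by (auto simp: fun_eq_iff)
    define j where "j = (LEAST i. m i \<noteq> 0)"
    have mj: "m j \<noteq> 0" unfolding j_def by (rule LeastI[of "\<lambda>i. m i \<noteq> 0"]) fact
    have lt: "m i = 0" if "i < j" for i using not_less_Least[of i "\<lambda>i. m i \<noteq> 0"] that unfolding j_def by blast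
    have j: "j \<in> I" using mj less.prems by (auto simp: box_def)
    define m' where "m' = m(j := m j - 1)"
    have m: "m = up j m'" using mj by (auto simp: m'_def up_def)
    have m'b: "m' \<in> box" using less.prems j by (auto simp: box_def m'_def)
    have "sum m' I < sum m I"
      using fI j mj by (intro sum_strict_mono_ex1) (auto simp: m'_def)
    then have "P m'" by (rule less.hyps[OF _ m'b])
    moreover have "\<forall>i<j. m' i = 0" using lt by (simp add: m'_def)
    ultimately have "P (up j m')"
      using assms(3)[OF j m'b less.prems[unfolded m]] by blast
    then show ?thesis by (subst m)
  qed
qed

lemma finite_box: "finite box"
proof -
  have "box \<subseteq> (\<lambda>f i. if i \<in> I then f i else 0) ` (PiE I (\<lambda>i. {..<N i}))"
  proof
    fix m assume m: "m \<in> box"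
    then have "m = (\<lambda>i. if i \<in> I then (restrict m I) i else 0)" by (auto simp: box_def)
    moreover have "restrict m I \<in> PiE I (\<lambda>i. {..<N i})" using m by (auto simp: box_def)
    ultimately show "m \<in> (\<lambda>f i. if i \<in> I then f i else 0) ` (PiE I (\<lambda>i. {..<N i}))" by blast
  qed
  moreover have "finite (PiE I (\<lambda>i. {..<N i}))" by (intro finite_PiE) (auto simp: idx_def)
  ultimately show ?thesis by (rule finite_surj[rotated])
qed

lemma box_0: "(\<lambda>_. 0) \<in> box" using N_pos by (auto simp: box_def)

lemma box_le:
  assumes "m \<in> box" "\<forall>i. k i \<le> m i"
  shows "k \<in> box"
proof -
  have "k i < N i" if "i \<in> I" for i
    using le_less_trans[of "k i" "m i" "N i"] that assms by (simp add: box_def)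
  moreover have "k i = 0" if "i \<notin> I" for i
    using assms(2)[rule_format, of i] that assms(1) by (simp add: box_def)
  ultimately show ?thesis by (simp add: box_def)
qed

text \<open>No variable smaller than \<open>x_j\<close> occurs, so there is nothing to lower and
  nothing to move past, and the bound on the exponent excludes a jump. Only plain raising is
  left.\<close>

lemma XX_lead:
  assumes j: "j \<in> I" and F: "\<And>h l. F (h, l) \<noteq> 0 \<Longrightarrow> (\<forall>i<j. l i = 0) \<and> Suc (l j) < N j" and h: "h \<in> \<Gamma>"
  shows "XX j F (h, l) = (if l j = 0 then 0 else inverse (chi j h) * F (h, l(j := l j - 1)))"
proof -
  have low: "Y j a F (h, l) = 0" if "a < j" for a
  proof -
    have "F (h', l(a := Suc (l a))) = 0" for h'
      using F[of h' "l(a := Suc (l a))"] that by (metis Zero_not_Suc fun_upd_same)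
    then show ?thesis using that h by (simp add: Ylow)
  qed
  have "XX j F (h, l) = (\<Sum>a\<in>{1..j}. if a = j then Y j j F (h, l) else 0)"
    unfolding XX_def by (intro sum.cong refl) (use low in auto)
  also have "\<dots> = Y j j F (h, l)" using j by (simp add: idx_def)
  also have "\<dots> = (if l j = 0 then 0 else inverse (chi j h) * F (h, l(j := l j - 1)))"
  proof (cases "l j mod N j = 0")
    case True
    have "F (h', l(j := l j + N j - 1)) = 0" for h'
      using F[of h' "l(j := l j + N j - 1)"] by (metis (no_types, lifting) Suc_pred' add_gr_0 fun_upd_same N_pos j not_add_less2)
    moreover have "F (h, l(j := l j - 1)) = 0" if "l j \<noteq> 0"
    proof -
      have "l j \<ge> N j" using True that by (metis mod_less not_less)
      then show ?thesis using F[of h "l(j := l j - 1)"] that by auto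
    qed
    ultimately show ?thesis using True h by (simp add: Yraise)
  next
    case False
    then have lj: "l j \<noteq> 0" by (metis mod_0)
    have "PP j j l = 1" if "F (h, l(j := l j - 1)) \<noteq> 0"
    proof -
      have "l i = 0" if "i < j" for i
        using F[OF \<open>F (h, l(j := l j - 1)) \<noteq> 0\<close>] that by (metis fun_upd_other nat_neq_iff)
      then show ?thesis unfolding PP_def by (intro prod.neutral) auto
    qed
    then show ?thesis using False lj h by (auto simp: Yraise)
  qed
  finally show ?thesis .
qed

lemma XX_outside: "h \<notin> \<Gamma> \<Longrightarrow> XX j F (h, l) = 0"
  by (simp add: XX_def Y_outside)

lemma cc_xm:
  assumes "m \<in> box"
  shows "cc (xm m) (h, l) = (if h = \<one>\<^sub>G \<and> l = m then 1 else 0)"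
  using assms
proof (induction m arbitrary: h l rule: box_induct)
  case zero
  then show ?case by (simp add: xm_0 cc_one vac_def)
next
  case (step j m)
  have s: "Suc (m j) < N j" using step by (auto simp: box_def)
  show ?case
  proof (cases "h \<in> \<Gamma>")
    case False
    then show ?thesis unfolding xm_lead[OF step(1,4)] cc_ux[OF step(1) xm_closed] by (auto simp: XX_outside)
  next
    case True
    have "cc (xm (up j m)) (h, l) = (if l j = 0 then 0 else inverse (chi j h) * cc (xm m) (h, l(j := l j - 1)))"
      unfolding xm_lead[OF step(1,4)] cc_ux[OF step(1) xm_closed]
    proof (rule XX_lead[OF step(1) _ True])
      fix h' l' assume "cc (xm m) (h', l') \<noteq> 0"
      then have "l' = m" unfolding step.IH by (auto split: if_splits)
      then show "(\<forall>i<j. l' i = 0) \<and> Suc (l' j) < N j" using step(4) s by simp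
    qed
    moreover have "l(j := l j - 1) = m \<longleftrightarrow> l = up j m" if "l j \<noteq> 0"
      using that by (auto simp: fun_eq_iff up_def)
    moreover have "l \<noteq> up j m" if "l j = 0" using that by auto
    ultimately show ?thesis unfolding step.IH using step(1) by (cases "l j = 0") simp_all
  qed
qed

definition "pbw \<beta> = ug D (fst \<beta>) \<otimes>\<^sub>U xm (snd \<beta>)"

lemma pbw_closed [simp]: "\<beta> \<in> \<Gamma> \<times> box \<Longrightarrow> pbw \<beta> \<in> carrier UU" by (auto simp: pbw_def)

text \<open>The coefficient functionals are dual to the monomials; this is their linear
  independence.\<close>

lemma cc_pbw:
  assumes "\<beta> \<in> \<Gamma> \<times> box"
  shows "cc (pbw \<beta>) \<beta>' = (if \<beta>' = \<beta> then 1 else 0)"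
proof -
  obtain g m where \<beta>: "\<beta> = (g, m)" "g \<in> \<Gamma>" "m \<in> box" using assms by auto
  obtain h l where \<beta>': "\<beta>' = (h, l)" by (cases \<beta>')
  have "h \<in> \<Gamma> \<Longrightarrow> inv\<^sub>G g \<otimes>\<^sub>G h = \<one>\<^sub>G \<longleftrightarrow> h = g"
    using \<beta> by (metis G.inv_closed G.inv_inv G.inv_solve_left G.one_closed G.r_one)
  then show ?thesis using \<beta> by (auto simp: \<beta>' pbw_def cc_ug GG_def cc_xm)
qed

text \<open>The character through which conjugation by g acts on \<open>x^m\<close>; its restriction
  to a subgroup is the weight used later.\<close>

definition "cX m g = (\<Prod>i\<in>I. chi i g ^ m i)"

lemma cX_nz [simp]: "g \<in> \<Gamma> \<Longrightarrow> cX m g \<noteq> 0" by (simp add: cX_def idx_def)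

lemma cX_up: "j \<in> I \<Longrightarrow> cX (up j m) g = chi j g * cX m g"
proof -
  assume j: "j \<in> I"
  have fI: "finite I" by (simp add: idx_def)
  have "(\<Prod>i\<in>I - {j}. chi i g ^ up j m i) = (\<Prod>i\<in>I - {j}. chi i g ^ m i)"
    by (intro prod.cong) auto
  then show ?thesis unfolding cX_def using prod.remove[OF fI j, of "\<lambda>i. chi i g ^ (up j m) i"]
    prod.remove[OF fI j, of "\<lambda>i. chi i g ^ m i"] by simp
qed

lemma ug_xm:
  assumes g: "g \<in> \<Gamma>" and m: "m \<in> box"
  shows "ug D g \<otimes>\<^sub>U xm m = cX m g \<odot>\<^sub>U (xm m \<otimes>\<^sub>U ug D g)"
  using m
proof (induction m rule: box_induct)
  case zero
  then show ?case using g by (simp add: xm_0 cX_def U.smult_one)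
next
  case (step j m)
  have "ug D g \<otimes>\<^sub>U (ux D j \<otimes>\<^sub>U xm m) = (ug D g \<otimes>\<^sub>U ux D j) \<otimes>\<^sub>U xm m"
    using g step by (simp add: U.m_assoc)
  also have "\<dots> = chi j g \<odot>\<^sub>U (ux D j \<otimes>\<^sub>U (ug D g \<otimes>\<^sub>U xm m))"
    using g step by (simp add: ug_ux U.smult_mult_l U.m_assoc)
  also have "\<dots> = (chi j g * cX m g) \<odot>\<^sub>U ((ux D j \<otimes>\<^sub>U xm m) \<otimes>\<^sub>U ug D g)"
    unfolding step.IH using g step by (simp add: U.smult_mult_r U.m_assoc U.smult_assoc1)
  finally show ?case by (simp add: xm_lead[OF step(1,4)] cX_up step)
qed

lemma xm_ug:
  assumes g: "g \<in> \<Gamma>" and m: "m \<in> box"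
  shows "xm m \<otimes>\<^sub>U ug D g = inverse (cX m g) \<odot>\<^sub>U (ug D g \<otimes>\<^sub>U xm m)"
  unfolding ug_xm[OF assms] using g by (simp add: U.smult_assoc1[symmetric] U.smult_one)

section \<open>The ordered monomials span the algebra\<close>

definition "Bgen n = {pbw (g, m) | g m. g \<in> \<Gamma> \<and> m \<in> box \<and> (\<forall>i>n. m i = 0)}"
abbreviation "B n \<equiv> U.lsp (Bgen n)"

lemma Bgen_closed: "Bgen n \<subseteq> carrier UU" by (auto simp: Bgen_def)
lemmas B_closed = U.lsp_carrier[OF Bgen_closed]

lemma B_ug:
  assumes "g \<in> \<Gamma>" "b \<in> B n"
  shows "ug D g \<otimes>\<^sub>U b \<in> B n"
proof (rule U.lsp_mult_left[OF Bgen_closed _ assms(2)])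
  fix x assume "x \<in> Bgen n"
  then obtain h m where "x = pbw (h, m)" "h \<in> \<Gamma>" "m \<in> box" "\<forall>i>n. m i = 0" by (auto simp: Bgen_def)
  moreover from this have "ug D g \<otimes>\<^sub>U x = pbw (g \<otimes>\<^sub>G h, m)"
    using assms by (simp add: pbw_def ug_mult[symmetric] U.m_assoc)
  ultimately show "ug D g \<otimes>\<^sub>U x \<in> B n" using assms by (auto simp: Bgen_def intro!: U.lsp_base)
qed (use assms in simp)

lemma B_ug_right:
  assumes "g \<in> \<Gamma>" "b \<in> B n"
  shows "b \<otimes>\<^sub>U ug D g \<in> B n"
proof (rule U.lsp_mult_right[OF Bgen_closed _ assms(2)])
  fix x assume "x \<in> Bgen n"
  then obtain h m where x: "x = pbw (h, m)" "h \<in> \<Gamma>" "m \<in> box" "\<forall>i>n. m i = 0" by (auto simp: Bgen_def)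
  then have "x \<otimes>\<^sub>U ug D g = inverse (cX m g) \<odot>\<^sub>U pbw (h \<otimes>\<^sub>G g, m)"
    using assms by (simp add: pbw_def U.m_assoc xm_ug ug_mult[symmetric] U.smult_mult_r)
  moreover have "pbw (h \<otimes>\<^sub>G g, m) \<in> Bgen n" using x assms by (auto simp: Bgen_def)
  then have "inverse (cX m g) \<odot>\<^sub>U pbw (h \<otimes>\<^sub>G g, m) \<in> B n"
    by (intro U.lsp_smult U.lsp_base)
  ultimately show "x \<otimes>\<^sub>U ug D g \<in> B n" by simp
qed (use assms in simp)

lemma B_minus_term:
  assumes "b \<in> B n" "g \<in> \<Gamma>"
  shows "c \<odot>\<^sub>U b \<oplus>\<^sub>U (- c) \<odot>\<^sub>U (ug D g \<otimes>\<^sub>U b) \<in> B n"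
  using assms by (intro U.lsp_add U.lsp_smult B_ug)

text \<open>As in an Ore extension, a larger variable moves to the right of an expression in the
  first n variables, and the remainder caused by linking again involves only those. The first
  hypothesis is what the induction in \<open>B_ux\<close> provides.\<close>

lemma B_skew:
  assumes c: "\<And>i b. i \<in> I \<Longrightarrow> i \<le> n \<Longrightarrow> b \<in> B n \<Longrightarrow> ux D i \<otimes>\<^sub>U b \<in> B n"
    and l: "l \<in> I" "l > n" and b: "b \<in> B n"
  shows "\<exists>b1\<in>B n. \<exists>b2\<in>B n. ux D l \<otimes>\<^sub>U b = b1 \<otimes>\<^sub>U ux D l \<oplus>\<^sub>U b2"
proof -
  have one: "\<one>\<^sub>U \<in> B n"
  proof (rule U.lsp_base)
    show "\<one>\<^sub>U \<in> Bgen n" unfolding Bgen_def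
      by (intro CollectI exI[of _ "\<one>\<^sub>G"] exI[of _ "\<lambda>_. 0"]) (simp add: pbw_def xm_0 ug_one box_0)
  qed
  have xmB: "xm m \<in> B n" if m: "m \<in> box" "\<forall>i>n. m i = 0" for m
  proof (rule U.lsp_base)
    show "xm m \<in> Bgen n" unfolding Bgen_def
      by (intro CollectI exI[of _ "\<one>\<^sub>G"] exI[of _ m]) (simp add: pbw_def ug_one that)
  qed
  have x: "\<exists>b1\<in>B n. \<exists>b2\<in>B n. ux D l \<otimes>\<^sub>U xm m = b1 \<otimes>\<^sub>U ux D l \<oplus>\<^sub>U b2"
    if "m \<in> box" "\<forall>i>n. m i = 0" for m
    using that
  proof (induction m rule: box_induct)
    case zero
    then show ?case using one l by (intro bexI[of _ "\<one>\<^sub>U"] bexI[of _ "\<zero>\<^sub>U"]) (simp_all add: xm_0 U.lsp_zero)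
  next
    case (step j m)
    have jn: "j \<le> n" using step.prems by (metis up_simps(1) nat.distinct(1) not_less)
    have mn: "\<forall>i>n. m i = 0" using step.prems jn by (metis up_simps(2) not_less)
    obtain b1 b2 where b: "b1 \<in> B n" "b2 \<in> B n" "ux D l \<otimes>\<^sub>U xm m = b1 \<otimes>\<^sub>U ux D l \<oplus>\<^sub>U b2"
      using step.IH mn by blast
    have bc: "b1 \<in> carrier UU" "b2 \<in> carrier UU" using b B_closed by auto
    have jl: "j < l" using jn l by simp
    define k where "k = chi j (el l)"
    define e where "e = lnk D j l"
    define g where "g = el j \<otimes>\<^sub>G el l"
    have g: "g \<in> \<Gamma>" using step l by (simp add: g_def)
    have "ux D l \<otimes>\<^sub>U (ux D j \<otimes>\<^sub>U xm m) = (ux D l \<otimes>\<^sub>U ux D j) \<otimes>\<^sub>U xm m"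
      using l step by (simp add: U.m_assoc)
    also have "\<dots> = k \<odot>\<^sub>U (ux D j \<otimes>\<^sub>U (ux D l \<otimes>\<^sub>U xm m)) \<oplus>\<^sub>U (e \<odot>\<^sub>U xm m \<oplus>\<^sub>U (- e) \<odot>\<^sub>U (ug D g \<otimes>\<^sub>U xm m))"
      unfolding ux_ux[OF step(1) l(1) jl] k_def[symmetric] e_def[symmetric] g_def[symmetric]
      using l step g by (simp add: U.l_distr U.smult_mult_l U.m_assoc U.smult_closed)
    also have "ux D j \<otimes>\<^sub>U (ux D l \<otimes>\<^sub>U xm m) = (ux D j \<otimes>\<^sub>U b1) \<otimes>\<^sub>U ux D l \<oplus>\<^sub>U ux D j \<otimes>\<^sub>U b2"
      unfolding b(3) using bc l step by (simp add: U.r_distr U.m_assoc)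
    finally have "ux D l \<otimes>\<^sub>U (ux D j \<otimes>\<^sub>U xm m) = (k \<odot>\<^sub>U (ux D j \<otimes>\<^sub>U b1)) \<otimes>\<^sub>U ux D l \<oplus>\<^sub>U
       (k \<odot>\<^sub>U (ux D j \<otimes>\<^sub>U b2) \<oplus>\<^sub>U (e \<odot>\<^sub>U xm m \<oplus>\<^sub>U (- e) \<odot>\<^sub>U (ug D g \<otimes>\<^sub>U xm m)))"
      using bc l step g by (simp add: U.smult_r_distr U.smult_mult_l U.a_assoc U.smult_closed)
    moreover have "k \<odot>\<^sub>U (ux D j \<otimes>\<^sub>U b1) \<in> B n" using c[OF step(1) jn] b by (intro U.lsp_smult)
    moreover have "k \<odot>\<^sub>U (ux D j \<otimes>\<^sub>U b2) \<oplus>\<^sub>U (e \<odot>\<^sub>U xm m \<oplus>\<^sub>U (- e) \<odot>\<^sub>U (ug D g \<otimes>\<^sub>U xm m)) \<in> B n"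
      using c[OF step(1) jn] b xmB[OF step(2) mn] g by (intro U.lsp_add[OF _ B_minus_term] U.lsp_smult)
    ultimately show ?case unfolding xm_lead[OF step(1,4)] by blast
  qed
  show ?thesis using b
  proof induction
    case (lsp_base b)
    then obtain h m where bm: "b = pbw (h, m)" "h \<in> \<Gamma>" "m \<in> box" "\<forall>i>n. m i = 0" by (auto simp: Bgen_def)
    obtain b1 b2 where b: "b1 \<in> B n" "b2 \<in> B n" "ux D l \<otimes>\<^sub>U xm m = b1 \<otimes>\<^sub>U ux D l \<oplus>\<^sub>U b2"
      using x bm by blast
    have bc: "b1 \<in> carrier UU" "b2 \<in> carrier UU" using b B_closed by auto
    have xg: "ux D l \<otimes>\<^sub>U ug D h = inverse (chi l h) \<odot>\<^sub>U (ug D h \<otimes>\<^sub>U ux D l)"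
      using ug_ux[OF bm(2) l(1)] bm l by (simp add: U.smult_assoc1[symmetric] U.smult_one)
    have "ux D l \<otimes>\<^sub>U b = (ux D l \<otimes>\<^sub>U ug D h) \<otimes>\<^sub>U xm m" using bm l by (simp add: pbw_def U.m_assoc)
    also have "\<dots> = inverse (chi l h) \<odot>\<^sub>U (ug D h \<otimes>\<^sub>U (ux D l \<otimes>\<^sub>U xm m))"
      unfolding xg using bm l by (simp add: U.smult_mult_l U.m_assoc)
    also have "\<dots> = (inverse (chi l h) \<odot>\<^sub>U (ug D h \<otimes>\<^sub>U b1)) \<otimes>\<^sub>U ux D l \<oplus>\<^sub>U inverse (chi l h) \<odot>\<^sub>U (ug D h \<otimes>\<^sub>U b2)"
      unfolding b(3) using bm l bc by (simp add: U.r_distr U.m_assoc U.smult_r_distr U.smult_mult_l)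
    finally show ?case using B_ug b bm by (blast intro: U.lsp_smult)
  next
    case lsp_zero
    then show ?case using l by (intro bexI[of _ "\<zero>\<^sub>U"]) (simp_all add: U.lsp_zero)
  next
    case (lsp_add b b')
    then obtain b1 b2 b1' b2' where b: "b1 \<in> B n" "b2 \<in> B n" "ux D l \<otimes>\<^sub>U b = b1 \<otimes>\<^sub>U ux D l \<oplus>\<^sub>U b2"
      "b1' \<in> B n" "b2' \<in> B n" "ux D l \<otimes>\<^sub>U b' = b1' \<otimes>\<^sub>U ux D l \<oplus>\<^sub>U b2'" by blast
    have bc: "b1 \<in> carrier UU" "b2 \<in> carrier UU" "b1' \<in> carrier UU" "b2' \<in> carrier UU" "b \<in> carrier UU" "b' \<in> carrier UU"
      using b lsp_add B_closed by auto
    have "ux D l \<otimes>\<^sub>U (b \<oplus>\<^sub>U b') = (b1 \<oplus>\<^sub>U b1') \<otimes>\<^sub>U ux D l \<oplus>\<^sub>U (b2 \<oplus>\<^sub>U b2')"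
      using bc l by (simp add: U.r_distr U.l_distr b U.a_ac)
    then show ?case using b by (blast intro: U.lsp_add)
  next
    case (lsp_smult b k)
    then obtain b1 b2 where b: "b1 \<in> B n" "b2 \<in> B n" "ux D l \<otimes>\<^sub>U b = b1 \<otimes>\<^sub>U ux D l \<oplus>\<^sub>U b2" by blast
    have bc: "b1 \<in> carrier UU" "b2 \<in> carrier UU" "b \<in> carrier UU" using b lsp_smult B_closed by auto
    have "ux D l \<otimes>\<^sub>U (k \<odot>\<^sub>U b) = (k \<odot>\<^sub>U b1) \<otimes>\<^sub>U ux D l \<oplus>\<^sub>U k \<odot>\<^sub>U b2"
      using bc l by (simp add: U.smult_mult_r b U.smult_r_distr U.smult_mult_l)
    then show ?case using b by (blast intro: U.lsp_smult)
  qed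
qed

lemma B_pow:
  assumes j: "j \<in> I" "j = Suc n" and b: "b \<in> B n" and k: "k < N j"
  shows "b \<otimes>\<^sub>U ux D j [^]\<^bsub>UU\<^esub> k \<in> B j"
proof (rule U.lsp_mult_right[OF Bgen_closed _ b])
  fix x assume "x \<in> Bgen n"
  then obtain h m where x: "x = pbw (h, m)" "h \<in> \<Gamma>" "m \<in> box" "\<forall>i>n. m i = 0" by (auto simp: Bgen_def)
  define m' where "m' = m(j := k)"
  have m': "m' \<in> box" "\<forall>i>j. m' i = 0" using x j k by (auto simp: box_def m'_def)
  have "m'(j := 0) = m" using x j by (auto simp: m'_def)
  then have "pbw (h, m') = x \<otimes>\<^sub>U ux D j [^]\<^bsub>UU\<^esub> k"
    using xm_last[OF j(1), of m'] m' x j by (simp add: pbw_def m'_def U.m_assoc)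
  then have "x \<otimes>\<^sub>U ux D j [^]\<^bsub>UU\<^esub> k \<in> Bgen j" using m' x unfolding Bgen_def by blast
  then show "x \<otimes>\<^sub>U ux D j [^]\<^bsub>UU\<^esub> k \<in> B j" by (rule U.lsp_base)
qed (use j in simp)

text \<open>Split off the power of the last variable \<open>x_j\<close>. A smaller variable is
  absorbed by the other factor; \<open>x_j\<close> itself is moved next to its power by
  \<open>B_skew\<close>. If the exponent then reaches \<open>N j\<close>, the root relation turns
  the power into group elements.\<close>

lemma B_ux:
  assumes "i \<in> I" "i \<le> n" "n \<le> rk D" "b \<in> B n"
  shows "ux D i \<otimes>\<^sub>U b \<in> B n"
  using assms
proof (induction n arbitrary: i b)
  case 0 then show ?case by (simp add: idx_def)
next
  case (Suc n)
  define j where "j = Suc n"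
  have j: "j \<in> I" using Suc by (auto simp: idx_def j_def)
  have c: "ux D i \<otimes>\<^sub>U b \<in> B n" if "i \<in> I" "i \<le> n" "b \<in> B n" for i b
    using Suc.IH Suc.prems(3) that by simp
  show ?case
  proof (rule U.lsp_mult_left[OF Bgen_closed _ Suc.prems(4)], unfold j_def[symmetric])
    fix x assume "x \<in> Bgen j"
    then obtain h m where x: "x = pbw (h, m)" "h \<in> \<Gamma>" "m \<in> box" "\<forall>i>j. m i = 0" by (auto simp: Bgen_def)
    define b where "b = pbw (h, m(j := 0))"
    define k where "k = m j"
    have k: "k < N j" using x j by (auto simp: k_def box_def)
    have bB: "b \<in> B n"
    proof (rule U.lsp_base)
      have "m(j := 0) \<in> box" "\<forall>i>n. (m(j := 0)) i = 0" using x j N_pos by (auto simp: box_def j_def)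
      then show "b \<in> Bgen n" using x unfolding b_def Bgen_def by blast
    qed
    have bc: "b \<in> carrier UU" using bB B_closed by blast
    have xb: "x = b \<otimes>\<^sub>U ux D j [^]\<^bsub>UU\<^esub> k"
      using xm_last[OF j, of m] x j by (simp add: b_def pbw_def k_def U.m_assoc)
    show "ux D i \<otimes>\<^sub>U x \<in> B j"
    proof (cases "i \<le> n")
      case True
      have "ux D i \<otimes>\<^sub>U x = (ux D i \<otimes>\<^sub>U b) \<otimes>\<^sub>U ux D j [^]\<^bsub>UU\<^esub> k"
        using Suc.prems bc j by (simp add: xb U.m_assoc)
      then show ?thesis using B_pow[OF j j_def c[OF Suc.prems(1) True bB] k] by simp
    next
      case False
      then have i: "i = j" using Suc.prems by (simp add: j_def)
      obtain b1 b2 where b12: "b1 \<in> B n" "b2 \<in> B n" "ux D j \<otimes>\<^sub>U b = b1 \<otimes>\<^sub>U ux D j \<oplus>\<^sub>U b2"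
      proof -
        have "n < j" by (simp add: j_def)
        from B_skew[OF _ j this bB] c that show ?thesis by blast
      qed
      have bc2: "b1 \<in> carrier UU" "b2 \<in> carrier UU" using b12 B_closed by auto
      have "ux D j \<otimes>\<^sub>U x = (ux D j \<otimes>\<^sub>U b) \<otimes>\<^sub>U ux D j [^]\<^bsub>UU\<^esub> k"
        using bc j by (simp add: xb U.m_assoc)
      also have "\<dots> = b1 \<otimes>\<^sub>U (ux D j \<otimes>\<^sub>U ux D j [^]\<^bsub>UU\<^esub> k) \<oplus>\<^sub>U b2 \<otimes>\<^sub>U ux D j [^]\<^bsub>UU\<^esub> k"
        unfolding b12(3) using bc2 j by (simp add: U.l_distr U.m_assoc)
      also have "ux D j \<otimes>\<^sub>U ux D j [^]\<^bsub>UU\<^esub> k = ux D j [^]\<^bsub>UU\<^esub> Suc k"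
        using U.nat_pow_Suc2[OF ux_closed[OF j], of k] by simp
      finally have e: "ux D j \<otimes>\<^sub>U x = b1 \<otimes>\<^sub>U ux D j [^]\<^bsub>UU\<^esub> Suc k \<oplus>\<^sub>U b2 \<otimes>\<^sub>U ux D j [^]\<^bsub>UU\<^esub> k" .
      have "b1 \<otimes>\<^sub>U ux D j [^]\<^bsub>UU\<^esub> Suc k \<in> B j"
      proof (cases "Suc k < N j")
        case True
        then show ?thesis using B_pow[OF j j_def b12(1)] by blast
      next
        case False
        then have sk: "Suc k = N j" using k by simp
        have "b1 \<otimes>\<^sub>U ux D j [^]\<^bsub>UU\<^esub> Suc k = rtp D j \<odot>\<^sub>U b1 \<oplus>\<^sub>U (- rtp D j) \<odot>\<^sub>U (b1 \<otimes>\<^sub>U ug D (el j [^]\<^bsub>grp D\<^esub> N j))"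
          unfolding sk ux_pow[OF j] using bc2 j by (simp add: U.r_distr U.smult_mult_r U.smult_closed)
        also have "\<dots> \<in> B n" using b12 j by (intro U.lsp_add U.lsp_smult B_ug_right) auto
        finally have "b1 \<otimes>\<^sub>U ux D j [^]\<^bsub>UU\<^esub> Suc k \<in> B n" .
        from B_pow[OF j j_def this N_pos[OF j]] show ?thesis using bc2 j by simp
      qed
      then show ?thesis unfolding i e by (intro U.lsp_add B_pow[OF j j_def b12(2) k])
    qed
  qed (use Suc.prems in simp)
qed

lemma U_span:
  assumes "u \<in> carrier UU"
  shows "u \<in> B (rk D)"
proof -
  interpret F: k_algebra "free_algebra (gens D) :: ('k, 'g gen list \<Rightarrow>\<^sub>0 'k) module" by (rule free_algebra_k_algebra)
  have one: "\<one>\<^sub>U \<in> B (rk D)"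
  proof (rule U.lsp_base)
    show "\<one>\<^sub>U \<in> Bgen (rk D)" unfolding Bgen_def
      by (intro CollectI exI[of _ "\<one>\<^sub>G"] exI[of _ "\<lambda>_. 0"]) (simp add: pbw_def xm_0 ug_one box_0)
  qed
  have w: "wprod UU (Ugen D) w \<in> B (rk D)" if "w \<in> lists (gens D)" for w
    using that
  proof (induction w)
    case (Cons y w)
    then show ?case using B_ug B_ux[of _ "rk D"] by (auto simp: gens_def idx_def)
  qed (simp add: one)
  obtain p where p: "p \<in> carrier (free_algebra (gens D))" "u = Uproj D p"
    using assms unfolding Ualg_def F.quot_carrier Uproj_def[OF D] by blast
  have hp: "Uproj D \<in> alg_hom (free_algebra (gens D)) UU" by (rule Uproj_hom[OF D])
  have "Uproj D p \<in> B (rk D)"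
    using p(1)[unfolded free_algebra_def]
  proof (rule ma_induct)
    show "Uproj D 0 \<in> B (rk D)"
      using free_hom(4)[OF U.k_algebra_axioms hp p(1) p(1)] by (simp add: U.lsp_zero)
  next
    fix w and c :: 'k assume "w \<in> carrier (free_monoid (gens D))"
    then have "w \<in> lists (gens D)" by (simp add: free_monoid_def)
    then show "Uproj D (sng w c) \<in> B (rk D)" using Uproj_word[OF D, of w c] w by (simp add: U.lsp_smult)
  next
    fix p q :: "'g gen list \<Rightarrow>\<^sub>0 'k"
    assume pq: "p \<in> carrier (monoid_algebra (free_monoid (gens D)))" "q \<in> carrier (monoid_algebra (free_monoid (gens D)))"
      "Uproj D p \<in> B (rk D)" "Uproj D q \<in> B (rk D)"
    then show "Uproj D (p + q) \<in> B (rk D)"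
      using free_hom(2)[OF U.k_algebra_axioms hp pq(1,2)[folded free_algebra_def]] by (simp add: U.lsp_add)
  qed
  then show ?thesis using p by simp
qed

lemma U_induct [consumes 1, case_names pbw add smult]:
  assumes u: "u \<in> carrier UU" and pbw: "\<And>g m. g \<in> \<Gamma> \<Longrightarrow> m \<in> box \<Longrightarrow> P (pbw (g, m))"
    and add: "\<And>u v. u \<in> carrier UU \<Longrightarrow> v \<in> carrier UU \<Longrightarrow> P u \<Longrightarrow> P v \<Longrightarrow> P (u \<oplus>\<^sub>U v)"
    and smult: "\<And>c u. u \<in> carrier UU \<Longrightarrow> P u \<Longrightarrow> P (c \<odot>\<^sub>U u)"
  shows "P u"
  using U_span[OF u]
proof induction
  case (lsp_base x)
  then show ?case using pbw by (auto simp: Bgen_def)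
next
  case lsp_zero
  have "P (0 \<odot>\<^sub>U pbw (\<one>\<^sub>G, \<lambda>_. 0))" by (rule smult) (simp_all add: pbw box_0)
  moreover have "0 \<odot>\<^sub>U pbw (\<one>\<^sub>G, \<lambda>_. 0) = \<zero>\<^sub>U" by (simp add: box_0)
  ultimately show ?case by simp
next
  case (lsp_add x y)
  show ?case by (rule add[OF B_closed[OF lsp_add(1)] B_closed[OF lsp_add(2)] lsp_add.IH])
next
  case (lsp_smult x c)
  show ?case by (rule smult[OF B_closed[OF lsp_smult(1)] lsp_smult.IH])
qed

lemma cc_support:
  assumes "u \<in> carrier UU" "cc u \<beta> \<noteq> 0"
  shows "\<beta> \<in> \<Gamma> \<times> box"
proof -
  have "\<beta> \<notin> \<Gamma> \<times> box \<longrightarrow> cc u \<beta> = 0"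
    using assms(1)
  proof (induction u rule: U_induct)
    case (pbw g m)
    then have "(g, m) \<in> \<Gamma> \<times> box" by simp
    then show ?case using cc_pbw by auto
  qed (auto simp: cc_add cc_smult)
  then show ?thesis using assms by blast
qed

lemma U_expand:
  assumes "u \<in> carrier UU"
  shows "u = finsum UU (\<lambda>\<beta>. cc u \<beta> \<odot>\<^sub>U pbw \<beta>) (\<Gamma> \<times> box)"
proof -
  let ?S = "\<Gamma> \<times> box"
  have fS: "finite ?S" using fin_G finite_box by simp
  have c: "(\<lambda>\<beta>. f \<beta> \<odot>\<^sub>U pbw \<beta>) \<in> ?S \<rightarrow> carrier UU" for f
    by (auto simp: U.smult_closed simp del: mem_Sigma_iff)
  show ?thesis using assms
  proof (induction u rule: U_induct)
    case (pbw g m)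
    then have gm: "(g, m) \<in> ?S" by simp
    have "finsum UU (\<lambda>\<beta>. cc (pbw (g, m)) \<beta> \<odot>\<^sub>U pbw \<beta>) ?S
      = finsum UU (\<lambda>\<beta>. cc (pbw (g, m)) \<beta> \<odot>\<^sub>U pbw \<beta>) {(g, m)}"
      by (rule finsum_superset[OF U.abelian_monoid_axioms fS])
        (use gm in \<open>auto simp: cc_pbw[OF gm] U.smult_closed simp del: mem_Sigma_iff\<close>)
    also have "\<dots> = pbw (g, m)" using gm by (simp add: U.smult_closed cc_pbw[OF gm] U.smult_one del: mem_Sigma_iff)
    finally show ?case by simp
  next
    case (add u v)
    have "finsum UU (\<lambda>\<beta>. cc (u \<oplus>\<^sub>U v) \<beta> \<odot>\<^sub>U pbw \<beta>) ?S
      = finsum UU (\<lambda>\<beta>. cc u \<beta> \<odot>\<^sub>U pbw \<beta> \<oplus>\<^sub>U cc v \<beta> \<odot>\<^sub>U pbw \<beta>) ?S"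
      by (rule U.finsum_cong') (use add in \<open>auto simp: cc_add U.smult_l_distr U.smult_closed simp del: mem_Sigma_iff\<close>)
    also have "\<dots> = u \<oplus>\<^sub>U v" using U.finsum_addf[OF c[of "cc u"] c[of "cc v"]] add.IH by simp
    finally show ?case by simp
  next
    case (smult k u)
    have "k \<odot>\<^sub>U finsum UU f S = finsum UU (\<lambda>x. k \<odot>\<^sub>U f x) S" if "finite S" "f \<in> S \<rightarrow> carrier UU" for S and f :: "'g \<times> (nat \<Rightarrow> nat) \<Rightarrow> _"
      using that
    proof (induction S rule: finite_induct)
      case (insert x S)
      then have f: "f x \<in> carrier UU" "f \<in> S \<rightarrow> carrier UU" "(\<lambda>x. k \<odot>\<^sub>U f x) \<in> S \<rightarrow> carrier UU"
        by (auto intro!: U.smult_closed)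
      then show ?case using insert by (simp add: U.smult_r_distr U.smult_closed)
    qed simp
    from this[OF fS c, of "cc u"] have "k \<odot>\<^sub>U u = finsum UU (\<lambda>\<beta>. k \<odot>\<^sub>U (cc u \<beta> \<odot>\<^sub>U pbw \<beta>)) ?S"
      using smult.IH by simp
    also have "\<dots> = finsum UU (\<lambda>\<beta>. cc (k \<odot>\<^sub>U u) \<beta> \<odot>\<^sub>U pbw \<beta>) ?S"
      by (rule U.finsum_cong') (use smult in \<open>auto simp: cc_smult U.smult_assoc1 U.smult_closed simp del: mem_Sigma_iff\<close>)
    finally show ?case .
  qed
qed

text \<open>Equality in the presented algebra becomes a comparison of coefficient functions, the
  form in which later identities are verified.\<close>

lemma cc_inject:
  assumes "u \<in> carrier UU" "v \<in> carrier UU" "\<And>h l. cc u (h, l) = cc v (h, l)"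
  shows "u = v"
proof -
  have "cc u = cc v" using assms(3) by (auto simp: fun_eq_iff)
  then show ?thesis using U_expand[OF assms(1)] U_expand[OF assms(2)] by simp
qed

end

section \<open>The coproduct in PBW coordinates\<close>

context datum begin

interpretation E: k_algebra EE by (rule endo_alg_k_algebra)
interpretation T: k_algebra "tensor_algebra UU UU" by (rule tensor_k_algebra[OF U.k_algebra_axioms U.k_algebra_axioms])

abbreviation "TT \<equiv> tensor_algebra UU UU"
abbreviation MM :: "('k, ('g gen list \<Rightarrow>\<^sub>0 'k) set \<times> ('g gen list \<Rightarrow>\<^sub>0 'k) set \<Rightarrow>\<^sub>0 'k) module"
  where "MM \<equiv> monoid_algebra (UU \<times>\<times> UU)"

lemma UU_monoid: "Group.monoid (UU \<times>\<times> UU)"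
  by (rule AB_monoid[OF U.k_algebra_axioms U.k_algebra_axioms])

interpretation M: k_algebra MM by (rule ma_k_algebra[OF UU_monoid])

text \<open>\<open>K0 p \<beta>' \<beta>\<close> is the coefficient of \<open>p\<close> at \<open>\<beta>' \<otimes> \<beta>\<close>. The elements all of whose right multiples
  have vanishing coefficients form an ideal containing the relators of the tensor product, so \<open>K0\<close>
  is well defined on classes; \<open>DK u\<close> below is its value at \<open>\<Delta>(u)\<close>.\<close>

definition K0 where
  "K0 p \<beta>' \<beta> = (\<Sum>x\<in>Poly_Mapping.keys p. Poly_Mapping.lookup p x * (cc (fst x) \<beta>' * cc (snd x) \<beta>))"

lemma K0_add: "K0 (p + p') \<beta>' \<beta> = K0 p \<beta>' \<beta> + K0 p' \<beta>' \<beta>"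
  unfolding K0_def by (rule pm_sum_add) (simp_all add: algebra_simps)

lemma K0_0: "K0 0 \<beta>' \<beta> = 0" by (simp add: K0_def)

lemma K0_single: "K0 (sng (a, b) c) \<beta>' \<beta> = c * (cc a \<beta>' * cc b \<beta>)"
  by (cases "c = 0") (simp_all add: K0_def)

text \<open>Left multiplication by a tensor acts on coefficients through the tensor product of the
  two representations. In particular the result depends on p only through its coefficients.\<close>

lemma K0_left:
  assumes ab: "a \<in> carrier UU" "b \<in> carrier UU" and p: "p \<in> carrier MM"
  shows "K0 (sng (a, b) c \<otimes>\<^bsub>MM\<^esub> p) \<beta>' \<beta> = c * rep a (\<lambda>\<gamma>'. rep b (\<lambda>\<gamma>. K0 p \<gamma>' \<gamma>) \<beta>) \<beta>'"
  using p
proof (rule ma_induct)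
  note ra = rep_closed[OF ab(1)] and rb = rep_closed[OF ab(2)]
  show "K0 (sng (a, b) c \<otimes>\<^bsub>MM\<^esub> 0) \<beta>' \<beta> = c * rep a (\<lambda>\<gamma>'. rep b (\<lambda>\<gamma>. K0 0 \<gamma>' \<gamma>) \<beta>) \<beta>'"
    by (simp add: ma_mult0 K0_0 endo_alg_zero[OF ra] endo_alg_zero[OF rb])
  fix x and d :: 'k assume "x \<in> carrier (UU \<times>\<times> UU)"
  then obtain a' b' where x: "x = (a', b')" "a' \<in> carrier UU" "b' \<in> carrier UU" by (auto simp: DirProd_def)
  have m: "sng (a, b) c \<otimes>\<^bsub>MM\<^esub> sng x d = sng (a \<otimes>\<^sub>U a', b \<otimes>\<^sub>U b') (c * d)"
    by (simp add: ma_mult_single x DirProd_def)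
  have 1: "rep b (\<lambda>\<gamma>. K0 (sng x d) \<gamma>' \<gamma>) \<beta> = (d * rep b (cc b') \<beta>) * cc a' \<gamma>'" for \<gamma>'
    using endo_algD(2)[OF rb, of "d * cc a' \<gamma>'" "cc b'"] by (simp add: x K0_single algebra_simps)
  have 2: "rep a (\<lambda>\<gamma>'. rep b (\<lambda>\<gamma>. K0 (sng x d) \<gamma>' \<gamma>) \<beta>) \<beta>' = (d * rep b (cc b') \<beta>) * rep a (cc a') \<beta>'"
    unfolding 1 endo_algD(2)[OF ra] ..
  show "K0 (sng (a, b) c \<otimes>\<^bsub>MM\<^esub> sng x d) \<beta>' \<beta> = c * rep a (\<lambda>\<gamma>'. rep b (\<lambda>\<gamma>. K0 (sng x d) \<gamma>' \<gamma>) \<beta>) \<beta>'"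
    unfolding m K0_single 2 using x ab by (simp add: cc_mult)
next
  note ra = rep_closed[OF ab(1)] and rb = rep_closed[OF ab(2)]
  fix p q :: "('g gen list \<Rightarrow>\<^sub>0 'k) set \<times> ('g gen list \<Rightarrow>\<^sub>0 'k) set \<Rightarrow>\<^sub>0 'k"
  assume IH: "K0 (sng (a, b) c \<otimes>\<^bsub>MM\<^esub> p) \<beta>' \<beta> = c * rep a (\<lambda>\<gamma>'. rep b (\<lambda>\<gamma>. K0 p \<gamma>' \<gamma>) \<beta>) \<beta>'"
    "K0 (sng (a, b) c \<otimes>\<^bsub>MM\<^esub> q) \<beta>' \<beta> = c * rep a (\<lambda>\<gamma>'. rep b (\<lambda>\<gamma>. K0 q \<gamma>' \<gamma>) \<beta>) \<beta>'"
  show "K0 (sng (a, b) c \<otimes>\<^bsub>MM\<^esub> (p + q)) \<beta>' \<beta> = c * rep a (\<lambda>\<gamma>'. rep b (\<lambda>\<gamma>. K0 (p + q) \<gamma>' \<gamma>) \<beta>) \<beta>'"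
    by (simp add: ma_mult_addr K0_add IH endo_algD(1)[OF ra] endo_algD(1)[OF rb] distrib_left)
qed

definition "coprod_ker = {p \<in> carrier MM. \<forall>s\<in>carrier MM. \<forall>\<beta>' \<beta>. K0 (p \<otimes>\<^bsub>MM\<^esub> s) \<beta>' \<beta> = 0}"

lemma coprod_kerI: "p \<in> carrier MM \<Longrightarrow> (\<And>s \<beta>' \<beta>. s \<in> carrier MM \<Longrightarrow> K0 (p \<otimes>\<^bsub>MM\<^esub> s) \<beta>' \<beta> = 0) \<Longrightarrow> p \<in> coprod_ker"
  unfolding coprod_ker_def by blast

lemma coprod_ker_carrier: "p \<in> coprod_ker \<Longrightarrow> p \<in> carrier MM" by (simp add: coprod_ker_def)

lemma coprod_kerD: "p \<in> coprod_ker \<Longrightarrow> s \<in> carrier MM \<Longrightarrow> K0 (p \<otimes>\<^bsub>MM\<^esub> s) \<beta>' \<beta> = 0"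
  unfolding coprod_ker_def by blast

text \<open>Stability under right multiplication is built into \<open>coprod_ker\<close>. On the
  left, \<open>K0_left\<close> expresses the new coefficients by linear operators applied to
  coefficients that vanish.\<close>

lemma coprod_ker_ideal: "ideal coprod_ker MM"
proof (rule idealI[OF M.ring_axioms])
  show "subgroup coprod_ker (add_monoid MM)"
  proof (rule M.add.subgroupI)
    show "coprod_ker \<subseteq> carrier MM" using coprod_ker_carrier by blast
    have "\<zero>\<^bsub>MM\<^esub> \<in> coprod_ker" by (rule coprod_kerI) (simp_all add: ma_simps(3) ma_mult0 K0_0 ma_zero_closed)
    then show "coprod_ker \<noteq> {}" by blast
  next
    fix p assume p: "p \<in> coprod_ker"
    have pc: "p \<in> carrier MM" by (rule coprod_ker_carrier[OF p])
    show "\<ominus>\<^bsub>MM\<^esub> p \<in> coprod_ker"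
    proof (rule coprod_kerI)
      fix s \<beta>' \<beta> assume s: "s \<in> carrier MM"
      have "\<ominus>\<^bsub>MM\<^esub> p \<otimes>\<^bsub>MM\<^esub> s \<oplus>\<^bsub>MM\<^esub> p \<otimes>\<^bsub>MM\<^esub> s = \<zero>\<^bsub>MM\<^esub>"
        using pc s by (simp add: M.l_minus M.l_neg)
      then have "K0 (\<ominus>\<^bsub>MM\<^esub> p \<otimes>\<^bsub>MM\<^esub> s) \<beta>' \<beta> + K0 (p \<otimes>\<^bsub>MM\<^esub> s) \<beta>' \<beta> = 0"
        unfolding K0_add[symmetric] by (simp add: ma_simps(3,4) K0_0)
      then show "K0 (\<ominus>\<^bsub>MM\<^esub> p \<otimes>\<^bsub>MM\<^esub> s) \<beta>' \<beta> = 0" unfolding coprod_kerD[OF p s] by simp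
    qed (use pc in simp)
  next
    fix p p' assume p: "p \<in> coprod_ker" "p' \<in> coprod_ker"
    show "p \<oplus>\<^bsub>MM\<^esub> p' \<in> coprod_ker"
    proof (rule coprod_kerI)
      fix s \<beta>' \<beta> assume s: "s \<in> carrier MM"
      show "K0 ((p \<oplus>\<^bsub>MM\<^esub> p') \<otimes>\<^bsub>MM\<^esub> s) \<beta>' \<beta> = 0"
        unfolding ma_simps(4) ma_mult_addl K0_add coprod_kerD[OF p(1) s] coprod_kerD[OF p(2) s] by simp
    qed (use p coprod_ker_carrier in simp)
  qed
next
  fix p x assume p: "p \<in> coprod_ker" and x: "x \<in> carrier MM"
  have pc: "p \<in> carrier MM" by (rule coprod_ker_carrier[OF p])
  show "p \<otimes>\<^bsub>MM\<^esub> x \<in> coprod_ker"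
  proof (rule coprod_kerI)
    fix s \<beta>' \<beta> assume s: "s \<in> carrier MM"
    show "K0 (p \<otimes>\<^bsub>MM\<^esub> x \<otimes>\<^bsub>MM\<^esub> s) \<beta>' \<beta> = 0"
      unfolding M.m_assoc[OF pc x s] by (rule coprod_kerD[OF p M.m_closed[OF x s]])
  qed (use pc x in simp)
  show "x \<otimes>\<^bsub>MM\<^esub> p \<in> coprod_ker"
  proof (rule coprod_kerI)
    fix s \<beta>' \<beta> assume s: "s \<in> carrier MM"
    have "K0 (x \<otimes>\<^bsub>MM\<^esub> (p \<otimes>\<^bsub>MM\<^esub> s)) \<beta>' \<beta> = 0"
      using x
    proof (rule ma_induct)
      fix y and d :: 'k assume "y \<in> carrier (UU \<times>\<times> UU)"
      then obtain a b where y: "y = (a, b)" "a \<in> carrier UU" "b \<in> carrier UU" by (auto simp: DirProd_def)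
      show "K0 (sng y d \<otimes>\<^bsub>MM\<^esub> (p \<otimes>\<^bsub>MM\<^esub> s)) \<beta>' \<beta> = 0"
        unfolding y(1) K0_left[OF y(2,3) M.m_closed[OF pc s]] coprod_kerD[OF p s]
        by (simp add: endo_alg_zero[OF rep_closed[OF y(2)]] endo_alg_zero[OF rep_closed[OF y(3)]])
    qed (simp_all add: ma_mult0 K0_0 ma_mult_addl K0_add)
    then show "K0 (x \<otimes>\<^bsub>MM\<^esub> p \<otimes>\<^bsub>MM\<^esub> s) \<beta>' \<beta> = 0" unfolding M.m_assoc[OF x pc s] .
  qed (use pc x in simp)
qed

lemma K0_diff_mult: "K0 ((p - p') \<otimes>\<^bsub>MM\<^esub> s) \<beta>' \<beta> = K0 (p \<otimes>\<^bsub>MM\<^esub> s) \<beta>' \<beta> - K0 (p' \<otimes>\<^bsub>MM\<^esub> s) \<beta>' \<beta>"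
  using K0_add[of "(p - p') \<otimes>\<^bsub>MM\<^esub> s" "p' \<otimes>\<^bsub>MM\<^esub> s" \<beta>' \<beta>] ma_mult_addl[of "UU \<times>\<times> UU" "p - p'" p' s] by simp

lemma relators_coprod_ker: "bilinearity_relators UU UU \<subseteq> coprod_ker"
proof -
  have c: "x \<in> carrier MM" if "x \<in> bilinearity_relators UU UU" for x
    using bilinearity_relators_closed[OF U.k_algebra_axioms U.k_algebra_axioms] that by blast
  have "K0 (x \<otimes>\<^bsub>MM\<^esub> s) \<beta>' \<beta> = 0" if x: "x \<in> bilinearity_relators UU UU" and s: "s \<in> carrier MM" for x s \<beta>' \<beta>
    using s
  proof (rule ma_induct)
    fix y and d :: 'k assume "y \<in> carrier (UU \<times>\<times> UU)"
    then obtain a1 b1 where y: "y = (a1, b1)" "a1 \<in> carrier UU" "b1 \<in> carrier UU" by (auto simp: DirProd_def)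
    have m: "sng (a, b) e \<otimes>\<^bsub>MM\<^esub> sng (a1, b1) d = sng (a \<otimes>\<^sub>U a1, b \<otimes>\<^sub>U b1) (e * d)" for a b e
      by (simp add: ma_mult_single DirProd_def)
    show "K0 (x \<otimes>\<^bsub>MM\<^esub> sng y d) \<beta>' \<beta> = 0"
      using x unfolding bilinearity_relators_def y(1)
      by (auto simp: K0_diff_mult m K0_single y U.l_distr cc_add cc_smult U.smult_mult_l) (simp_all add: algebra_simps)
  qed (simp_all add: ma_mult0 K0_0 ma_mult_addr K0_add)
  then show ?thesis using c coprod_kerI by blast
qed

lemma K0_class:
  assumes p: "p \<in> carrier MM" and q: "p' \<in> carrier MM" and e: "tensor_class UU UU p = tensor_class UU UU p'"
  shows "K0 p \<beta>' \<beta> = K0 p' \<beta>' \<beta>"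
proof -
  have I: "ideal (tensor_ideal UU UU) MM" by (rule tensor_ideal_ideal[OF U.k_algebra_axioms U.k_algebra_axioms])
  interpret I: ideal "tensor_ideal UU UU" MM by (rule I)
  have sub: "tensor_ideal UU UU \<subseteq> coprod_ker"
    unfolding tensor_ideal_def by (rule M.genideal_minimal[OF coprod_ker_ideal relators_coprod_ker])
  note tc = ma_hom[OF UU_monoid T.k_algebra_axioms tensor_class_hom[OF U.k_algebra_axioms U.k_algebra_axioms] p q]
  have "tensor_class UU UU (p - p') = \<zero>\<^bsub>TT\<^esub>" using tc(4) e by simp
  then have "tensor_ideal UU UU +>\<^bsub>MM\<^esub> (p - p') = tensor_ideal UU UU"
    by (simp add: tensor_class_def tensor_algebra_def quot_algebra_def FactRing_def)
  then have "p - p' \<in> tensor_ideal UU UU" using I.a_rcos_self[OF tc(5)] by simp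
  then have "p - p' \<in> coprod_ker" using sub by blast
  then have "K0 ((p - p') \<otimes>\<^bsub>MM\<^esub> \<one>\<^bsub>MM\<^esub>) \<beta>' \<beta> = 0" by (rule coprod_kerD) simp
  then show ?thesis using K0_diff_mult[of p p' "\<one>\<^bsub>MM\<^esub>" \<beta>' \<beta>] p q by simp
qed

definition "DK u = K0 (SOME p. p \<in> carrier MM \<and> comult D u = tensor_class UU UU p)"

lemma comult_hom: "comult D \<in> alg_hom UU TT"
  using is_comult_comult[OF D] by (simp add: is_comult_def)

lemma DKI:
  assumes "p \<in> carrier MM" "comult D u = tensor_class UU UU p"
  shows "DK u \<beta>' \<beta> = K0 p \<beta>' \<beta>"
proof -
  define q where "q = (SOME p. p \<in> carrier MM \<and> comult D u = tensor_class UU UU p)"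
  have "q \<in> carrier MM \<and> comult D u = tensor_class UU UU q"
    unfolding q_def by (rule someI[of _ p]) (use assms in blast)
  then show ?thesis using K0_class[of q p] assms unfolding DK_def q_def[symmetric] by simp
qed

lemma DKE:
  assumes "u \<in> carrier UU"
  obtains p where "p \<in> carrier MM" "comult D u = tensor_class UU UU p" "DK u = K0 p"
proof -
  have "comult D u \<in> carrier TT" using comult_hom assms by (auto simp: alg_hom_def Ring.ring_hom_def)
  then obtain p where p: "p \<in> carrier MM" "comult D u = tensor_class UU UU p"
    unfolding tensor_algebra_def M.quot_carrier tensor_class_def by blast
  moreover have "DK u = K0 p" using DKI[OF p] by (auto simp: fun_eq_iff)
  ultimately show ?thesis using that by blast
qed

lemma tensor_class_simps:
  "p \<in> carrier MM \<Longrightarrow> p' \<in> carrier MM \<Longrightarrow> tensor_class UU UU (p + p') = tensor_class UU UU p \<oplus>\<^bsub>TT\<^esub> tensor_class UU UU p'"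
  "p \<in> carrier MM \<Longrightarrow> p' \<in> carrier MM \<Longrightarrow> tensor_class UU UU (p \<otimes>\<^bsub>MM\<^esub> p') = tensor_class UU UU p \<otimes>\<^bsub>TT\<^esub> tensor_class UU UU p'"
  "p \<in> carrier MM \<Longrightarrow> tensor_class UU UU (c \<odot>\<^bsub>MM\<^esub> p) = c \<odot>\<^bsub>TT\<^esub> tensor_class UU UU p"
  using tensor_class_hom[OF U.k_algebra_axioms U.k_algebra_axioms]
  by (auto simp: alg_hom_def Ring.ring_hom_def ma_simps(4))

lemma comult_simps:
  "u \<in> carrier UU \<Longrightarrow> v \<in> carrier UU \<Longrightarrow> comult D (u \<oplus>\<^sub>U v) = comult D u \<oplus>\<^bsub>TT\<^esub> comult D v"
  "u \<in> carrier UU \<Longrightarrow> v \<in> carrier UU \<Longrightarrow> comult D (u \<otimes>\<^sub>U v) = comult D u \<otimes>\<^bsub>TT\<^esub> comult D v"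
  "u \<in> carrier UU \<Longrightarrow> comult D (c \<odot>\<^sub>U u) = c \<odot>\<^bsub>TT\<^esub> comult D u"
  "comult D \<one>\<^sub>U = \<one>\<^bsub>TT\<^esub>"
  using comult_hom by (auto simp: alg_hom_def Ring.ring_hom_def)

lemma DK_add:
  assumes u: "u \<in> carrier UU" and v: "v \<in> carrier UU"
  shows "DK (u \<oplus>\<^sub>U v) \<beta>' \<beta> = DK u \<beta>' \<beta> + DK v \<beta>' \<beta>"
proof -
  obtain p where p: "p \<in> carrier MM" "comult D u = tensor_class UU UU p" "DK u = K0 p" by (rule DKE[OF u])
  obtain q where q: "q \<in> carrier MM" "comult D v = tensor_class UU UU q" "DK v = K0 q" by (rule DKE[OF v])
  have "p + q \<in> carrier MM" using M.a_closed[OF p(1) q(1)] by (simp add: ma_simps(4))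
  then have "DK (u \<oplus>\<^sub>U v) \<beta>' \<beta> = K0 (p + q) \<beta>' \<beta>"
    by (rule DKI) (use p q u v in \<open>simp add: comult_simps tensor_class_simps\<close>)
  then show ?thesis by (simp add: K0_add p q)
qed

lemma K0_smult: "p \<in> carrier MM \<Longrightarrow> K0 (c \<odot>\<^bsub>MM\<^esub> p) \<beta>' \<beta> = c * K0 p \<beta>' \<beta>"
proof (erule ma_induct)
  fix x and d :: 'k
  show "K0 (c \<odot>\<^bsub>MM\<^esub> sng x d) \<beta>' \<beta> = c * K0 (sng x d) \<beta>' \<beta>"
    by (cases x) (simp add: ma_smult_single K0_single)
qed (simp_all add: ma_smult0 K0_0 ma_smult_add K0_add distrib_left)

lemma DK_smult:
  assumes u: "u \<in> carrier UU"
  shows "DK (c \<odot>\<^sub>U u) \<beta>' \<beta> = c * DK u \<beta>' \<beta>"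
proof -
  obtain p where p: "p \<in> carrier MM" "comult D u = tensor_class UU UU p" "DK u = K0 p" by (rule DKE[OF u])
  have "DK (c \<odot>\<^sub>U u) \<beta>' \<beta> = K0 (c \<odot>\<^bsub>MM\<^esub> p) \<beta>' \<beta>"
    by (rule DKI) (use p u in \<open>simp_all add: comult_simps tensor_class_simps M.smult_closed\<close>)
  then show ?thesis by (simp add: K0_smult p)
qed

lemma sng_pair_closed: "a \<in> carrier UU \<Longrightarrow> b \<in> carrier UU \<Longrightarrow> sng (a, b) (c::'k) \<in> carrier MM"
  by (rule AB_single[OF U.k_algebra_axioms U.k_algebra_axioms])

lemma DK_one: "DK \<one>\<^sub>U \<beta>' \<beta> = vac \<beta>' * vac \<beta>"
proof -
  have "comult D \<one>\<^sub>U = tensor_class UU UU (sng (\<one>\<^sub>U, \<one>\<^sub>U) 1)"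
    using pt_one[OF U.k_algebra_axioms U.k_algebra_axioms] by (simp add: comult_simps pure_tensor_def)
  then have "DK \<one>\<^sub>U \<beta>' \<beta> = K0 (sng (\<one>\<^sub>U, \<one>\<^sub>U) 1) \<beta>' \<beta>" by (intro DKI sng_pair_closed) auto
  then show ?thesis by (simp add: K0_single cc_one)
qed

lemma DK_ug:
  assumes g: "g \<in> \<Gamma>" and u: "u \<in> carrier UU"
  shows "DK (ug D g \<otimes>\<^sub>U u) \<beta>' \<beta> = GG g (\<lambda>\<gamma>'. GG g (DK u \<gamma>') \<beta>) \<beta>'"
proof -
  obtain p where p: "p \<in> carrier MM" "comult D u = tensor_class UU UU p" "DK u = K0 p" by (rule DKE[OF u])
  have s: "sng (ug D g, ug D g) 1 \<in> carrier MM" using g by (intro sng_pair_closed) auto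
  have "comult D (ug D g) = tensor_class UU UU (sng (ug D g, ug D g) 1)"
    using is_comult_comult[OF D] g by (simp add: is_comult_def pure_tensor_def)
  then have "DK (ug D g \<otimes>\<^sub>U u) \<beta>' \<beta> = K0 (sng (ug D g, ug D g) 1 \<otimes>\<^bsub>MM\<^esub> p) \<beta>' \<beta>"
    using s p u g by (intro DKI M.m_closed) (simp_all add: comult_simps tensor_class_simps)
  then show ?thesis using K0_left[of "ug D g" "ug D g" p 1 \<beta>' \<beta>] g p by (simp add: rep_gen)
qed

text \<open>The case distinction comes from the left factor of the summand
  \<open>1 \<otimes> x_i\<close>: the unit acts as the identity of \<open>EE\<close>, which
  truncates to group coordinates in \<Gamma>.\<close>

lemma DK_ux:
  assumes i: "i \<in> I" and u: "u \<in> carrier UU"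
  shows "DK (ux D i \<otimes>\<^sub>U u) \<beta>' \<beta> = XX i (\<lambda>\<gamma>'. GG (el i) (DK u \<gamma>') \<beta>) \<beta>' +
     (if \<beta>' \<in> \<Gamma> \<times> UNIV then XX i (DK u \<beta>') \<beta> else 0)"
proof -
  obtain p where p: "p \<in> carrier MM" "comult D u = tensor_class UU UU p" "DK u = K0 p" by (rule DKE[OF u])
  define s where "s = sng (ux D i, ug D (el i)) (1::'k)"
  define t where "t = sng (\<one>\<^sub>U, ux D i) (1::'k)"
  have s: "s \<in> carrier MM" "t \<in> carrier MM" using i unfolding s_def t_def by (auto intro!: sng_pair_closed)
  then have st: "s + t \<in> carrier MM" using M.a_closed[OF s] by (simp add: ma_simps(4))
  have "comult D (ux D i) = tensor_class UU UU (s + t)"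
    using is_comult_comult[OF D] i by (simp add: is_comult_def pure_tensor_def tensor_class_simps(1)[OF s]) (simp add: s_def t_def)
  then have "DK (ux D i \<otimes>\<^sub>U u) \<beta>' \<beta> = K0 ((s + t) \<otimes>\<^bsub>MM\<^esub> p) \<beta>' \<beta>"
    using st p u i by (intro DKI M.m_closed) (simp_all add: comult_simps tensor_class_simps)
  also have "\<dots> = K0 (s \<otimes>\<^bsub>MM\<^esub> p) \<beta>' \<beta> + K0 (t \<otimes>\<^bsub>MM\<^esub> p) \<beta>' \<beta>" by (simp add: ma_mult_addl K0_add)
  also have "K0 (s \<otimes>\<^bsub>MM\<^esub> p) \<beta>' \<beta> = XX i (\<lambda>\<gamma>'. GG (el i) (DK u \<gamma>') \<beta>) \<beta>'"
    using K0_left[of "ux D i" "ug D (el i)" p 1 \<beta>' \<beta>] i p by (simp add: rep_gen s_def)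
  also have "K0 (t \<otimes>\<^bsub>MM\<^esub> p) \<beta>' \<beta> = (if \<beta>' \<in> \<Gamma> \<times> UNIV then XX i (DK u \<beta>') \<beta> else 0)"
    using K0_left[of "\<one>\<^sub>U" "ux D i" p 1 \<beta>' \<beta>] i p by (simp add: rep_gen rep_simps(4) endo_alg_simps t_def)
  finally show ?thesis .
qed

lemma DK_outside:
  assumes "u \<in> carrier UU" "h' \<notin> \<Gamma> \<or> h \<notin> \<Gamma>"
  shows "DK u (h', k) (h, l) = 0"
proof -
  obtain p where p: "p \<in> carrier MM" "DK u = K0 p" by (rule DKE[OF assms(1)])
  have "cc (fst x) (h', k) * cc (snd x) (h, l) = 0" if "x \<in> Poly_Mapping.keys p" for x
    using p(1) that assms(2) cc_outside by (auto simp: ma_simps(1) DirProd_def)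
  then show ?thesis unfolding p(2) K0_def by (intro sum.neutral) auto
qed

text \<open>The degree of \<open>x^m\<close> in the grading by \<Gamma>: the group element on the
  right in the term \<open>x^m \<otimes> g^m\<close> of the coproduct.\<close>

definition "gm m = finprod (grp D) (\<lambda>i. el i [^]\<^bsub>grp D\<^esub> (m i :: nat)) I"

lemma finite_I: "finite I" by (simp add: idx_def)

lemma gm_closed [simp]: "gm m \<in> \<Gamma>" unfolding gm_def by (rule G.finprod_closed) auto

lemma gm_remove: "j \<in> I \<Longrightarrow> gm m = el j [^]\<^bsub>grp D\<^esub> m j \<otimes>\<^sub>G finprod (grp D) (\<lambda>i. el i [^]\<^bsub>grp D\<^esub> (m i)) (I - {j})"
proof -
  assume j: "j \<in> I"
  then have "gm m = finprod (grp D) (\<lambda>i. el i [^]\<^bsub>grp D\<^esub> (m i)) (insert j (I - {j}))"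
    unfolding gm_def by (simp add: insert_absorb)
  also have "\<dots> = el j [^]\<^bsub>grp D\<^esub> m j \<otimes>\<^sub>G finprod (grp D) (\<lambda>i. el i [^]\<^bsub>grp D\<^esub> (m i)) (I - {j})"
    using j finite_I by (intro G.finprod_insert) auto
  finally show ?thesis .
qed

lemma gm_up: "j \<in> I \<Longrightarrow> gm (up j m) = el j \<otimes>\<^sub>G gm m"
proof -
  assume j: "j \<in> I"
  have "finprod (grp D) (\<lambda>i. el i [^]\<^bsub>grp D\<^esub> (up j m i)) (I - {j}) = finprod (grp D) (\<lambda>i. el i [^]\<^bsub>grp D\<^esub> (m i)) (I - {j})"
    by (intro G.finprod_cong') auto
  moreover have "finprod (grp D) (\<lambda>i. el i [^]\<^bsub>grp D\<^esub> (m i)) (I - {j}) \<in> \<Gamma>" by (intro G.finprod_closed) auto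
  ultimately show ?thesis unfolding gm_remove[OF j] using j by (simp add: G.m_assoc G.m_comm[of "el j"] G.m_lcomm)
qed

lemma gm_0 [simp]: "gm (\<lambda>_. 0) = \<one>\<^sub>G"
  unfolding gm_def by (intro G.finprod_one_eqI) simp

lemma chi_gm: "j \<in> I \<Longrightarrow> chi j (gm m) = (\<Prod>b\<in>I. chi j (el b) ^ m b)"
proof -
  assume j: "j \<in> I"
  have "chi j (finprod (grp D) (\<lambda>i. el i [^]\<^bsub>grp D\<^esub> m i) S) = (\<Prod>b\<in>S. chi j (el b) ^ m b)" if "finite S" "S \<subseteq> I" for S
    using that
  proof (induction S rule: finite_induct)
    case (insert x S)
    then have "(\<lambda>i. el i [^]\<^bsub>grp D\<^esub> m i) \<in> S \<rightarrow> \<Gamma>" by auto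
    then show ?case using insert j by (simp add: G.finprod_closed)
  qed (use j in simp)
  then show ?thesis unfolding gm_def using finite_I by blast
qed

text \<open>The coefficient of \<open>\<Delta>(x\<^sup>m)\<close> whose right tensor factor has the single variable \<open>x\<^sub>i\<close>.\<close>

definition "dd i m = (\<Prod>b\<in>{b\<in>I. i < b}. inverse (chi i (el b)) ^ m b) * qn (inverse (q i)) (m i)"

text \<open>Since 0 < \<open>m i\<close> < \<open>N i\<close>, the q-integer of the inverse of
  \<open>q i\<close> does not vanish. Differentiating a basis monomial therefore never loses
  information.\<close>

lemma dd_nz: "i \<in> I \<Longrightarrow> m \<in> box \<Longrightarrow> m i > 0 \<Longrightarrow> dd i m \<noteq> 0"
proof -
  assume i: "i \<in> I" and m: "m \<in> box" "m i > 0"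
  have q1: "inverse (q i) \<noteq> 1" using q_ne1[OF i] by simp
  have "m i < N i" using m i by (simp add: box_def)
  then have "\<not> N i dvd m i" using m(2) by (auto dest: dvd_imp_le)
  then have "q i ^ m i \<noteq> 1" using q_pow_iff[OF i] by blast
  then have "inverse (q i) ^ m i \<noteq> 1" by (simp add: power_inverse)
  then have "qn (inverse (q i)) (m i) \<noteq> 0" using qn_zero_iff[OF q1] by blast
  moreover have "(\<Prod>b\<in>{b\<in>I. i < b}. inverse (chi i (el b)) ^ m b) \<noteq> 0"
    using i finite_I by (simp add: prod_zero_iff)
  ultimately show ?thesis by (simp add: dd_def)
qed

lemma dd_up_other: "j < i \<Longrightarrow> dd i (up j m) = dd i m"
proof -
  assume ji: "j < i"
  have "(\<Prod>b\<in>{b\<in>I. i < b}. inverse (chi i (el b)) ^ up j m b) = (\<Prod>b\<in>{b\<in>I. i < b}. inverse (chi i (el b)) ^ m b)"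
    using ji by (intro prod.cong) auto
  then show ?thesis using ji by (simp add: dd_def)
qed

text \<open>The new contribution takes \<open>1 \<otimes> x_j\<close> from the prepended variable
  and multiplies it with \<open>x^m \<otimes> g^m\<close>; moving \<open>x_j\<close> to the right of
  the group element \<open>gm m\<close> gives the added scalar.\<close>

lemma dd_up:
  assumes j: "j \<in> I" and m: "\<forall>i<j. m i = 0"
  shows "dd j (up j m) = dd j m + inverse (chi j (gm m))"
proof -
  define W where "W = (\<Prod>b\<in>{b\<in>I. j < b}. inverse (chi j (el b)) ^ m b)"
  have 1: "(\<Prod>b\<in>{b\<in>I. j < b}. inverse (chi j (el b)) ^ up j m b) = W"
    unfolding W_def by (intro prod.cong) auto
  have "inverse (chi j (gm m)) = (\<Prod>b\<in>I. inverse (chi j (el b)) ^ m b)"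
    unfolding chi_gm[OF j] by (simp add: power_inverse prod_inversef[symmetric] o_def)
  also have "\<dots> = (\<Prod>b\<in>insert j {b\<in>I. j < b}. inverse (chi j (el b)) ^ m b)"
  proof (rule prod.mono_neutral_right)
    have "m i = 0" if "i \<in> I - insert j {b\<in>I. j < b}" for i
      using that m by (cases i j rule: linorder_cases) auto
    then show "\<forall>i\<in>I - insert j {b\<in>I. j < b}. inverse (chi j (el i)) ^ m i = 1" by simp
  qed (use j finite_I in auto)
  also have "\<dots> = inverse (q j) ^ m j * W" using finite_I by (simp add: W_def q_def)
  finally show ?thesis unfolding dd_def 1 W_def[symmetric] by (simp add: qn_Suc algebra_simps)
qed

text \<open>The two summands come from \<open>x_j \<otimes> g_j\<close> and
  \<open>1 \<otimes> x_j\<close>. The support hypothesis guarantees that multiplication by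
  \<open>x_j\<close> is plain raising in either tensor factor.\<close>

lemma DK_step:
  assumes j: "j \<in> I" and m: "m \<in> box" "up j m \<in> box" "\<forall>i<j. m i = 0"
    and s: "\<And>h' k h l. DK (xm m) (h', k) (h, l) \<noteq> 0 \<Longrightarrow> (\<forall>i. k i \<le> m i) \<and> (\<forall>i. l i \<le> m i)"
    and h: "h \<in> \<Gamma>" "h' \<in> \<Gamma>"
  shows "DK (xm (up j m)) (h', k) (h, l) =
    (if k j = 0 then 0 else inverse (chi j h') * DK (xm m) (h', k(j := k j - 1)) (inv\<^sub>G (el j) \<otimes>\<^sub>G h, l)) +
    (if l j = 0 then 0 else inverse (chi j h) * DK (xm m) (h', k) (h, l(j := l j - 1)))"
proof -
  have mj: "Suc (m j) < N j" using m j by (auto simp: box_def)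
  have le: "(\<forall>i<j. k i = 0) \<and> Suc (k j) < N j" if "\<forall>i. k i \<le> m i" for k
    using that m(3) mj by (metis le_zero_eq Suc_le_mono le_less_trans)
  have "XX j (\<lambda>\<gamma>'. GG (el j) (DK (xm m) \<gamma>') (h, l)) (h', k) =
     (if k j = 0 then 0 else inverse (chi j h') * GG (el j) (DK (xm m) (h', k(j := k j - 1))) (h, l))"
  proof (rule XX_lead[OF j _ h(2)])
    fix h'' k' assume "GG (el j) (DK (xm m) (h'', k')) (h, l) \<noteq> 0"
    then have "DK (xm m) (h'', k') (inv\<^sub>G (el j) \<otimes>\<^sub>G h, l) \<noteq> 0" using h by (simp add: GG_def)
    then show "(\<forall>i<j. k' i = 0) \<and> Suc (k' j) < N j" using s le by blast
  qed
  moreover have "XX j (DK (xm m) (h', k)) (h, l) = (if l j = 0 then 0 else inverse (chi j h) * DK (xm m) (h', k) (h, l(j := l j - 1)))"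
    by (rule XX_lead[OF j _ h(1)]) (use s le in blast)
  ultimately show ?thesis
    unfolding xm_lead[OF j m(3)] DK_ux[OF j xm_closed] using h by (simp add: GG_def)
qed

lemma DK_support:
  assumes "m \<in> box" "DK (xm m) (h', k) (h, l) \<noteq> 0"
  shows "(\<forall>i. k i \<le> m i) \<and> (\<forall>i. l i \<le> m i)"
  using assms
proof (induction m arbitrary: h' k h l rule: box_induct)
  case zero
  then show ?case by (auto simp: xm_0 DK_one vac_def split: if_splits)
next
  case (step j m)
  have h: "h \<in> \<Gamma>" "h' \<in> \<Gamma>" using DK_outside[OF xm_closed] step.prems by blast+
  have dn: "k i \<le> up j m i" if "\<forall>i. (k(j := k j - 1)) i \<le> m i" for k i
    using that[rule_format, of i] by (cases "i = j") auto
  have up: "k i \<le> up j m i" if "\<forall>i. k i \<le> m i" for k i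
    using that[rule_format, of i] by (cases "i = j") auto
  from DK_step[OF step(1,2,3,4) step.IH h, where k = k and l = l] step.prems
  have "DK (xm m) (h', k(j := k j - 1)) (inv\<^sub>G (el j) \<otimes>\<^sub>G h, l) \<noteq> 0 \<or> DK (xm m) (h', k) (h, l(j := l j - 1)) \<noteq> 0"
    by (auto split: if_splits)
  then show ?case using step.IH dn up by blast
qed

lemma inv_eq_iff:
  assumes "a \<in> \<Gamma>" "h \<in> \<Gamma>" "x \<in> \<Gamma>"
  shows "inv\<^sub>G a \<otimes>\<^sub>G h = x \<longleftrightarrow> h = a \<otimes>\<^sub>G x"
  using assms by (metis G.inv_solve_left)

lemma DK_xm_0:
  assumes "m \<in> box" "h \<in> \<Gamma>" "h' \<in> \<Gamma>"
  shows "DK (xm m) (h', k) (h, \<lambda>_. 0) = (if h = gm m \<and> h' = \<one>\<^sub>G \<and> k = m then 1 else 0)"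
  using assms
proof (induction m arbitrary: h' k h rule: box_induct)
  case zero
  then show ?case by (simp add: xm_0 DK_one vac_def)
next
  case (step j m)
  have k: "k(j := k j - 1) = m \<longleftrightarrow> k = up j m" if "k j \<noteq> 0" using that by (auto simp: fun_eq_iff up_def)
  have k0: "k \<noteq> up j m" if "k j = 0" using that by auto
  have "inv\<^sub>G (el j) \<otimes>\<^sub>G h \<in> \<Gamma>" using step by simp
  then show ?case
    using DK_step[OF step(1-4) DK_support[OF step(2)] step.prems, where k = k and l = "\<lambda>_. 0"] step.IH[of "inv\<^sub>G (el j) \<otimes>\<^sub>G h" h'] step k k0
    by (cases "k j = 0") (auto simp: inv_eq_iff gm_up)
qed

text \<open>Exactly one occurrence of \<open>x_i\<close> must go to the right factor while every
  other variable leaves its group element there. This determines both the left monomial and the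
  group coordinate on the right; \<open>dd\<close> sums over the occurrences.\<close>

lemma DK_xm_1:
  assumes "m \<in> box" "h \<in> \<Gamma>" "h' \<in> \<Gamma>" "i \<in> I"
  shows "DK (xm m) (h', k) (h, up i (\<lambda>_. 0)) =
    (if m i > 0 \<and> h = gm (m(i := m i - 1)) \<and> h' = \<one>\<^sub>G \<and> k = m(i := m i - 1) then dd i m else 0)"
  using assms
proof (induction m arbitrary: h' k h rule: box_induct)
  case zero
  have "up i (\<lambda>_. 0) \<noteq> (\<lambda>_. 0)" by (metis up_simps(1) nat.distinct(1))
  then show ?case by (simp add: xm_0 DK_one vac_def)
next
  case (step j m)
  have hj: "inv\<^sub>G (el j) \<otimes>\<^sub>G h \<in> \<Gamma>" using step by simp
  note IH = step.IH[OF hj step.prems(2,3)]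
  have st: "DK (xm (up j m)) (h', k) (h, up i (\<lambda>_. 0)) =
    (if k j = 0 then 0 else inverse (chi j h') * DK (xm m) (h', k(j := k j - 1)) (inv\<^sub>G (el j) \<otimes>\<^sub>G h, up i (\<lambda>_. 0))) +
    (if up i (\<lambda>_. 0) j = 0 then 0 else inverse (chi j h) * DK (xm m) (h', k) (h, (up i (\<lambda>_. 0))(j := up i (\<lambda>_. 0) j - 1)))"
    by (rule DK_step[OF step(1-4) _ step.prems(1,2)]) (rule DK_support[OF step(2)])
  show ?case
  proof (cases "i = j")
    case True
    have e: "(up j m)(j := up j m j - 1) = m" by (auto simp: up_def)
    have l: "(up j (\<lambda>_. 0))(j := up j (\<lambda>_. 0) j - 1) = (\<lambda>_. 0)" by (auto simp: up_def)
    have t2: "DK (xm m) (h', k) (h, (up j (\<lambda>_. 0))(j := up j (\<lambda>_. 0) j - 1)) = (if h = gm m \<and> h' = \<one>\<^sub>G \<and> k = m then 1 else 0)"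
      unfolding l using DK_xm_0[OF step(2) step.prems(1,2)] .
    have t1: "(if k j = 0 then 0 else inverse (chi j h') * DK (xm m) (h', k(j := k j - 1)) (inv\<^sub>G (el j) \<otimes>\<^sub>G h, up j (\<lambda>_. 0)))
      = (if h = gm m \<and> h' = \<one>\<^sub>G \<and> k = m then dd j m else 0)"
    proof (cases "m j = 0")
      case m0: True
      then show ?thesis using IH True by (simp add: dd_def)
    next
      case mj: False
      define m1 where "m1 = m(j := m j - 1)"
      have "up j m1 = m" using mj by (auto simp: up_def m1_def)
      then have g: "gm m = el j \<otimes>\<^sub>G gm m1" using gm_up[OF step(1), of m1] by simp
      have k: "k(j := k j - 1) = m1 \<longleftrightarrow> k = m" if "k j \<noteq> 0"
        unfolding m1_def
      proof
        assume e: "k(j := k j - 1) = m(j := m j - 1)"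
        have "k j - 1 = m j - 1" using fun_cong[OF e, of j] by simp
        then have "k j = m j" using that mj by simp
        moreover have "k i = m i" if "i \<noteq> j" for i using fun_cong[OF e, of i] that by simp
        ultimately show "k = m" by (metis ext)
      next
        assume "k = m"
        then show "k(j := k j - 1) = m(j := m j - 1)" by simp
      qed
      have k0: "k \<noteq> m" if "k j = 0" using that mj by auto
      have gh: "inv\<^sub>G (el j) \<otimes>\<^sub>G h = gm m1 \<longleftrightarrow> h = gm m"
        using step by (simp add: inv_eq_iff g)
      show ?thesis
      proof (cases "k j = 0")
        case k0': True
        then show ?thesis using k0 by simp
      next
        case kj: False
        show ?thesis
          unfolding IH[of "k(j := k j - 1)", unfolded True, folded m1_def] k[OF kj] gh
          using kj mj step(1) by auto
      qed
    qed
    have d: "dd j (up j m) = dd j m + inverse (chi j (gm m))" by (rule dd_up[OF step(1,4)])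
    show ?thesis
      unfolding True e d using st[unfolded True] t1 t2 by auto
  next
    case False
    define m1 where "m1 = m(i := m i - 1)"
    have l: "up i (\<lambda>_. 0) j = 0" using False by simp
    have ui: "up j m i = m i" using False by simp
    have m': "(up j m)(i := m i - 1) = up j m1" using False by (auto simp: up_def m1_def)
    have k: "k(j := k j - 1) = m1 \<longleftrightarrow> k = up j m1" if "k j \<noteq> 0"
      using that False by (auto simp: fun_eq_iff up_def m1_def)
    have k0: "k \<noteq> up j m1" if "k j = 0" using that by auto
    have d: "dd i (up j m) = dd i m" if "m i > 0"
    proof -
      have "\<not> i < j" using that step(4) by auto
      then show ?thesis using False by (intro dd_up_other) simp
    qed
    show ?thesis
    proof (cases "k j = 0")
      case True
      then show ?thesis unfolding st ui m' l using k0 by simp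
    next
      case kj: False
      have "inv\<^sub>G (el j) \<otimes>\<^sub>G h = gm m1 \<longleftrightarrow> h = gm (up j m1)"
        using step by (simp add: inv_eq_iff gm_up)
      then show ?thesis
        unfolding st ui m' l IH[of "k(j := k j - 1)", folded m1_def] k[OF kj] using kj d step.prems step(1) by auto
    qed
  qed
qed

lemma DK_pbw:
  assumes "g \<in> \<Gamma>" "m \<in> box" "h \<in> \<Gamma>" "h' \<in> \<Gamma>"
  shows "DK (pbw (g, m)) (h', k) (h, l) = DK (xm m) (inv\<^sub>G g \<otimes>\<^sub>G h', k) (inv\<^sub>G g \<otimes>\<^sub>G h, l)"
  using assms by (simp add: pbw_def DK_ug GG_def)

text \<open>Fixing the right factor to be a group element t thus extracts the component of degree
  t.\<close>

lemma DK_0: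
  assumes "u \<in> carrier UU" and h: "h \<in> \<Gamma>" "h' \<in> \<Gamma>"
  shows "DK u (h', k) (h, \<lambda>_. 0) = (if h = h' \<otimes>\<^sub>G gm k then cc u (h', k) else 0)"
  using assms(1)
proof (induction u rule: U_induct)
  case (pbw g m)
  then have "(g, m) \<in> \<Gamma> \<times> box" by simp
  from cc_pbw[OF this, of "(h', k)"] show ?case
    using pbw h by (auto simp: DK_pbw DK_xm_0 inv_eq_iff)
qed (simp_all add: DK_add DK_smult cc_add cc_smult)

lemma DK_1:
  assumes "u \<in> carrier UU" and h: "h \<in> \<Gamma>" "h' \<in> \<Gamma>" and i: "i \<in> I"
  shows "DK u (h', k) (h, up i (\<lambda>_. 0)) =
    (if h = h' \<otimes>\<^sub>G gm k then dd i (up i k) * cc u (h', up i k) else 0)"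
  using assms(1)
proof (induction u rule: U_induct)
  case (pbw g m)
  then have "(g, m) \<in> \<Gamma> \<times> box" by simp
  note c = cc_pbw[OF this, of "(h', up i k)"]
  have d: "DK (pbw (g, m)) (h', k) (h, up i (\<lambda>_. 0)) =
    (if m i > 0 \<and> h = g \<otimes>\<^sub>G gm (m(i := m i - 1)) \<and> h' = g \<and> k = m(i := m i - 1) then dd i m else 0)"
    using pbw h i by (simp add: DK_pbw DK_xm_1 inv_eq_iff)
  have e: "m i > 0 \<and> h = g \<otimes>\<^sub>G gm (m(i := m i - 1)) \<and> h' = g \<and> k = m(i := m i - 1)
    \<longleftrightarrow> h = h' \<otimes>\<^sub>G gm k \<and> h' = g \<and> up i k = m"
  proof (cases "up i k = m")
    case True
    then have "m(i := m i - 1) = k" "m i > 0" by (auto simp: up_def)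
    then show ?thesis using True by auto
  next
    case False
    then have "\<not> (m i > 0 \<and> k = m(i := m i - 1))" by (auto simp: up_def)
    then show ?thesis using False by blast
  qed
  show ?case unfolding d c e by auto
qed (simp_all add: DK_add DK_smult cc_add cc_smult distrib_left)

end

section \<open>Characters, congruence, total degree and conjugation\<close>

context datum begin

abbreviation "DG \<equiv> dual_group (grp D) :: ('g \<Rightarrow> 'k) monoid"

lemma dual_carrier: "\<phi> \<in> carrier DG \<longleftrightarrow> \<phi> \<in> extensional \<Gamma> \<and> (\<forall>g\<in>\<Gamma>. \<phi> g \<noteq> 0) \<and> (\<forall>g\<in>\<Gamma>. \<forall>h\<in>\<Gamma>. \<phi> (g \<otimes>\<^sub>G h) = \<phi> g * \<phi> h)"
  by (auto simp: dual_group_def hom_def)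

lemma dual_ops: "\<phi> \<otimes>\<^bsub>DG\<^esub> \<psi> = (\<lambda>g\<in>\<Gamma>. \<phi> g * \<psi> g)" "\<one>\<^bsub>DG\<^esub> = (\<lambda>g\<in>\<Gamma>. 1)"
  by (simp_all add: dual_group_def)

lemma dual_group: "group DG"
proof (rule groupI)
  fix \<phi> assume p: "\<phi> \<in> carrier DG"
  show "\<exists>\<psi>\<in>carrier DG. \<psi> \<otimes>\<^bsub>DG\<^esub> \<phi> = \<one>\<^bsub>DG\<^esub>"
    using p by (intro bexI[of _ "\<lambda>g\<in>\<Gamma>. inverse (\<phi> g)"]) (auto simp: dual_carrier dual_ops fun_eq_iff restrict_def extensional_def)
  show "\<one>\<^bsub>DG\<^esub> \<otimes>\<^bsub>DG\<^esub> \<phi> = \<phi>"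
    using p by (auto simp: dual_carrier dual_ops fun_eq_iff restrict_def extensional_def)
qed (auto simp: dual_carrier dual_ops fun_eq_iff restrict_def extensional_def)

lemma chi_dual: "i \<in> I \<Longrightarrow> chi i \<in> carrier DG"
  using D by (simp add: is_datum_def)

lemma one_dual: "\<one>\<^bsub>DG\<^esub> \<in> carrier DG"
  by (rule Group.monoid.one_closed[OF group.is_monoid[OF dual_group]])

lemma dual_inv:
  assumes "\<phi> \<in> carrier DG" "g \<in> \<Gamma>"
  shows "(inv\<^bsub>DG\<^esub> \<phi>) g = inverse (\<phi> g)"
proof -
  have "(inv\<^bsub>DG\<^esub> \<phi> \<otimes>\<^bsub>DG\<^esub> \<phi>) g = \<one>\<^bsub>DG\<^esub> g" using group.l_inv[OF dual_group assms(1)] by simp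
  then have "(inv\<^bsub>DG\<^esub> \<phi>) g * \<phi> g = 1" using assms(2) by (simp add: dual_ops)
  moreover have "\<phi> g \<noteq> 0" using assms by (simp add: dual_carrier)
  ultimately show ?thesis by (simp add: field_simps)
qed

text \<open>The quotient of the two characters is trivial on G exactly when they agree there; this
  is how the relation on indices is used from here on.\<close>

lemma dual_rcong:
  assumes "\<phi> \<in> carrier DG" "\<psi> \<in> carrier DG" "G \<subseteq> \<Gamma>"
  shows "(\<phi>, \<psi>) \<in> rcong\<^bsub>DG\<^esub> (perp (grp D) G) \<longleftrightarrow> (\<forall>g\<in>G. \<phi> g = \<psi> g)"
proof -
  have c: "inv\<^bsub>DG\<^esub> \<phi> \<otimes>\<^bsub>DG\<^esub> \<psi> \<in> carrier DG"
    using assms group.inv_closed[OF dual_group] by (intro Group.monoid.m_closed[OF group.is_monoid[OF dual_group]])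
  have "(inv\<^bsub>DG\<^esub> \<phi> \<otimes>\<^bsub>DG\<^esub> \<psi>) g = 1 \<longleftrightarrow> \<phi> g = \<psi> g" if "g \<in> G" for g
  proof -
    have g: "g \<in> \<Gamma>" using that assms by blast
    then have "\<phi> g \<noteq> 0" using assms by (simp add: dual_carrier)
    then show ?thesis using g assms by (auto simp: dual_ops dual_inv field_simps)
  qed
  then show ?thesis using assms c by (auto simp: r_congruent_def perp_def)
qed

lemma sim_iff:
  assumes "G \<subseteq> \<Gamma>"
  shows "(i, j) \<in> sim D G \<longleftrightarrow> i \<in> I \<and> j \<in> I \<and> inv\<^sub>G (el i) \<otimes>\<^sub>G el j \<in> G \<and> (\<forall>g\<in>G. chi i g = chi j g)"
  using dual_rcong[OF chi_dual chi_dual assms, of i j] by (auto simp: sim_def r_congruent_def)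

definition "tdeg m = sum m I" for m :: "nat \<Rightarrow> nat"

lemma tdeg_up: "i \<in> I \<Longrightarrow> tdeg (up i m) = Suc (tdeg m)"
proof -
  assume i: "i \<in> I"
  have "sum (up i m) (I - {i}) = sum m (I - {i})" by (intro sum.cong) auto
  then show ?thesis using sum.remove[OF finite_I i, of m] sum.remove[OF finite_I i, of "up i m"] by (simp add: tdeg_def)
qed

lemma tdeg_0: "tdeg (\<lambda>_. 0) = 0" by (simp add: tdeg_def)

lemma tdeg_eq_0: "m \<in> box \<Longrightarrow> tdeg m = 0 \<Longrightarrow> m = (\<lambda>_. 0)"
  using finite_I by (auto simp: tdeg_def box_def fun_eq_iff)

lemma tdeg_eq_1:
  assumes "m \<in> box" "tdeg m = 1"
  obtains i where "i \<in> I" "m = up i (\<lambda>_. 0)"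
proof -
  have "\<exists>i\<in>I. m i \<noteq> 0"
  proof (rule ccontr)
    assume "\<not> (\<exists>i\<in>I. m i \<noteq> 0)"
    then have "tdeg m = 0" by (simp add: tdeg_def)
    then show False using assms by simp
  qed
  then obtain i where i: "i \<in> I" "m i \<noteq> 0" by blast
  define m' where "m' = m(i := m i - 1)"
  have m: "m = up i m'" using i by (auto simp: m'_def up_def)
  have "tdeg m' = 0" using tdeg_up[OF i(1), of m'] assms m by simp
  moreover have "m' \<in> box" by (rule box_le[OF assms(1)]) (auto simp: m'_def)
  ultimately have "m' = (\<lambda>_. 0)" by (rule tdeg_eq_0[rotated])
  then show ?thesis using that i m by blast
qed

lemma ug_pbw: "g \<in> \<Gamma> \<Longrightarrow> ug D g = pbw (g, \<lambda>_. 0)"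
  by (simp add: pbw_def xm_0)

lemma cc_ug1: "g \<in> \<Gamma> \<Longrightarrow> cc (ug D g) (h, l) = (if h = g \<and> l = (\<lambda>_. 0) then 1 else 0)"
  using cc_pbw[of "(g, \<lambda>_. 0)" "(h, l)"] box_0 ug_pbw by simp

lemma cc_ug_mult: "g \<in> \<Gamma> \<Longrightarrow> h \<in> \<Gamma> \<Longrightarrow> u \<in> carrier UU \<Longrightarrow> cc (ug D g \<otimes>\<^sub>U u) (h, l) = cc u (inv\<^sub>G g \<otimes>\<^sub>G h, l)"
  by (simp add: cc_ug GG_def)

lemma cc_conj:
  assumes g: "g \<in> \<Gamma>" and u: "u \<in> carrier UU"
  shows "cc (ug D g \<otimes>\<^sub>U u \<otimes>\<^sub>U ug D (inv\<^sub>G g)) (h, k) = cX k g * cc u (h, k)"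
  using u
proof (induction u rule: U_induct)
  case (pbw g0 m)
  have "ug D g \<otimes>\<^sub>U pbw (g0, m) = ug D g0 \<otimes>\<^sub>U (ug D g \<otimes>\<^sub>U xm m)"
    using g pbw by (simp add: pbw_def U.m_assoc[symmetric] ug_mult G.m_comm)
  then have "ug D g \<otimes>\<^sub>U pbw (g0, m) \<otimes>\<^sub>U ug D (inv\<^sub>G g) =
    cX m g \<odot>\<^sub>U (ug D g0 \<otimes>\<^sub>U (xm m \<otimes>\<^sub>U (ug D g \<otimes>\<^sub>U ug D (inv\<^sub>G g))))"
    using g pbw by (simp add: ug_xm U.smult_mult_l U.smult_mult_r U.m_assoc U.smult_closed)
  also have "\<dots> = cX m g \<odot>\<^sub>U pbw (g0, m)" using g pbw by (simp add: ug_mult ug_one pbw_def)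
  finally have e: "ug D g \<otimes>\<^sub>U pbw (g0, m) \<otimes>\<^sub>U ug D (inv\<^sub>G g) = cX m g \<odot>\<^sub>U pbw (g0, m)" .
  have gm: "(g0, m) \<in> \<Gamma> \<times> box" using pbw by simp
  show ?case unfolding e using cc_pbw[OF gm, of "(h, k)"] cc_smult[OF pbw_closed[OF gm], of "cX m g" "(h, k)"] by simp
next
  case (add u v)
  then show ?case using g by (simp add: U.r_distr U.l_distr cc_add distrib_left)
next
  case (smult c u)
  then show ?case using g by (simp add: U.smult_mult_r U.smult_mult_l cc_smult)
qed

end

section \<open>Right coideal subalgebras\<close>

locale coideal_subalgebra = datum D for D :: "('g, 'k::field_char_0) datum" +
  fixes A
  assumes rcs: "right_coideal_subalgebra (Ualg D) (comult D) A"
begin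

interpretation M: k_algebra MM by (rule ma_k_algebra[OF UU_monoid])

definition "H = group_part D A"

lemma A_sub: "subring A UU" "x \<in> A \<Longrightarrow> c \<odot>\<^sub>U x \<in> A"
  using rcs by (auto simp: right_coideal_subalgebra_def is_subalgebra_def)

lemma A_closed [simp]: "x \<in> A \<Longrightarrow> x \<in> carrier UU"
  using subringE(1)[OF A_sub(1)] by blast

lemmas A_mult = subringE(6)[OF A_sub(1)]
  and A_add = subringE(7)[OF A_sub(1)]
  and A_one = subringE(3)[OF A_sub(1)]
  and A_zero = subringE(2)[OF A_sub(1)]

lemma A_lincomb:
  assumes "finite S" "\<And>s. s \<in> S \<Longrightarrow> \<exists>b\<in>A. \<forall>\<beta>. cc b \<beta> = f s \<beta>"
  shows "\<exists>b\<in>A. \<forall>\<beta>. cc b \<beta> = (\<Sum>s\<in>S. c s * f s \<beta>)"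
  using assms
proof (induction S rule: finite_induct)
  case empty
  then show ?case using A_zero cc_zero by (intro bexI[of _ "\<zero>\<^sub>U"]) auto
next
  case (insert x S)
  obtain b where b: "b \<in> A" "\<forall>\<beta>. cc b \<beta> = (\<Sum>s\<in>S. c s * f s \<beta>)" using insert by blast
  obtain b' where b': "b' \<in> A" "\<forall>\<beta>. cc b' \<beta> = f x \<beta>" using insert.prems[of x] by blast
  have "cc (c x \<odot>\<^sub>U b' \<oplus>\<^sub>U b) \<beta> = (\<Sum>s\<in>insert x S. c s * f s \<beta>)" for \<beta>
    using b(1) b'(1) insert(1,2) by (simp add: cc_add cc_smult U.smult_closed b(2)[rule_format] b'(2)[rule_format])
  then show ?case using b b' A_sub A_add by (intro bexI[of _ "c x \<odot>\<^sub>U b' \<oplus>\<^sub>U b"]) auto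
qed

text \<open>Apply a coefficient functional to the right tensor factor: the left factors lie in A, so
  a linear combination of them remains.\<close>

lemma slice:
  assumes "a \<in> A"
  shows "\<exists>b\<in>A. \<forall>\<beta>'. cc b \<beta>' = DK a \<beta>' \<beta>"
proof -
  have "comult D a \<in> tensor_subspace UU UU A (carrier UU)"
    using rcs assms by (auto simp: right_coideal_subalgebra_def)
  then obtain p where p: "Poly_Mapping.keys p \<subseteq> A \<times> carrier UU" "comult D a = tensor_class UU UU p"
    by (auto simp: tensor_subspace_def)
  have "Poly_Mapping.keys p \<subseteq> carrier (UU \<times>\<times> UU)"
    using p(1) A_closed by (auto simp: DirProd_def)
  then have pM: "p \<in> carrier MM" by (simp add: ma_simps(1))
  have "\<exists>b\<in>A. \<forall>\<beta>'. cc b \<beta>' = (\<Sum>x\<in>Poly_Mapping.keys p. (Poly_Mapping.lookup p x * cc (snd x) \<beta>) * cc (fst x) \<beta>')"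
    by (rule A_lincomb) (use p(1) in auto)
  moreover have "DK a \<beta>' \<beta> = (\<Sum>x\<in>Poly_Mapping.keys p. (Poly_Mapping.lookup p x * cc (snd x) \<beta>) * cc (fst x) \<beta>')" for \<beta>'
    unfolding DKI[OF pM p(2)] K0_def by (intro sum.cong) (simp_all add: algebra_simps)
  ultimately show ?thesis by simp
qed

lemma homogeneous_part:
  assumes a: "a \<in> A" and t: "t \<in> \<Gamma>"
  shows "\<exists>b\<in>A. \<forall>h k. cc b (h, k) = (if t = h \<otimes>\<^sub>G gm k then cc a (h, k) else 0)"
proof -
  obtain b where b: "b \<in> A" "\<forall>\<beta>'. cc b \<beta>' = DK a \<beta>' (t, \<lambda>_. 0)" using slice[OF a] by blast
  have "cc b (h, k) = (if t = h \<otimes>\<^sub>G gm k then cc a (h, k) else 0)" for h k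
  proof (cases "h \<in> \<Gamma>")
    case True
    then show ?thesis using b DK_0[OF A_closed[OF a] t] by simp
  next
    case False
    then show ?thesis using cc_outside[OF A_closed[OF b(1)] False] cc_outside[OF A_closed[OF a] False] by simp
  qed
  then show ?thesis using b by blast
qed

lemma skew_derivation:
  assumes a: "a \<in> A" and t: "t \<in> \<Gamma>" and i: "i \<in> I"
  shows "\<exists>b\<in>A. \<forall>h k. cc b (h, k) = (if t = h \<otimes>\<^sub>G gm k then dd i (up i k) * cc a (h, up i k) else 0)"
proof -
  obtain b where b: "b \<in> A" "\<forall>\<beta>'. cc b \<beta>' = DK a \<beta>' (t, up i (\<lambda>_. 0))" using slice[OF a] by blast
  have "cc b (h, k) = (if t = h \<otimes>\<^sub>G gm k then dd i (up i k) * cc a (h, up i k) else 0)" for h k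
  proof (cases "h \<in> \<Gamma>")
    case True
    then show ?thesis using b DK_1[OF A_closed[OF a] t _ i] by simp
  next
    case False
    then show ?thesis using cc_outside[OF A_closed[OF b(1)] False] cc_outside[OF A_closed[OF a] False] by simp
  qed
  then show ?thesis using b by blast
qed

text \<open>Iterated skew derivations strip \<open>x^l\<close> from each monomial. Only that the
  resulting scalars do not vanish is used, so they are left unspecified.\<close>

lemma higher_derivation:
  assumes a: "a \<in> A" and l: "l \<in> box" and t: "t \<in> \<Gamma>"
  shows "\<exists>b\<in>A. \<exists>d. (\<forall>k. d k \<noteq> 0) \<and> (\<forall>h k. cc b (h, k) = (if t = h \<otimes>\<^sub>G gm k then d k * cc a (h, \<lambda>i. k i + l i) else 0))"
  using l t
proof (induction l arbitrary: t rule: box_induct)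
  case zero
  obtain b where "b \<in> A" "\<forall>h k. cc b (h, k) = (if t = h \<otimes>\<^sub>G gm k then cc a (h, k) else 0)"
    using homogeneous_part[OF a zero] by blast
  then show ?case by (intro bexI[of _ b] exI[of _ "\<lambda>_. 1"]) simp_all
next
  case (step j l)
  \<comment> \<open>The inner derivative is taken in degree \<open>el j\<close> times t, because
    removing one more \<open>x_j\<close> lowers the degree by \<open>el j\<close>.\<close>
  obtain b d where b: "b \<in> A" "\<forall>k. d k \<noteq> 0"
    "\<forall>h k. cc b (h, k) = (if el j \<otimes>\<^sub>G t = h \<otimes>\<^sub>G gm k then d k * cc a (h, \<lambda>i. k i + l i) else 0)"
    using step.IH[OF G.m_closed[OF el[OF step(1)] step.prems]] by blast
  obtain b' where b': "b' \<in> A" "\<forall>h k. cc b' (h, k) = (if t = h \<otimes>\<^sub>G gm k then dd j (up j k) * cc b (h, up j k) else 0)"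
    using skew_derivation[OF b(1) step.prems step(1)] by blast
  \<comment> \<open>The default 1 keeps the factor nonzero where \<open>dd\<close> vanishes; there
    the exponent lies outside the box and the coefficient of a is 0 anyway.\<close>
  define d' where "d' k = (if dd j (up j k) = 0 then 1 else dd j (up j k)) * d (up j k)" for k
  have "cc b' (h, k) = (if t = h \<otimes>\<^sub>G gm k then d' k * cc a (h, \<lambda>i. k i + up j l i) else 0)" for h k
  proof (cases "h \<in> \<Gamma> \<and> t = h \<otimes>\<^sub>G gm k")
    case False
    then show ?thesis using b'(2) cc_outside[OF A_closed[OF b'(1)], of h k] cc_outside[OF A_closed[OF a], of h] by auto
  next
    case True
    have e: "(\<lambda>i. up j k i + l i) = (\<lambda>i. k i + up j l i)" by (auto simp: up_def)
    have "el j \<otimes>\<^sub>G t = h \<otimes>\<^sub>G gm (up j k)"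
      using True step(1) by (simp add: gm_up G.m_lcomm)
    then have 1: "cc b' (h, k) = dd j (up j k) * (d (up j k) * cc a (h, \<lambda>i. k i + up j l i))"
      using b'(2) b(3) True by (simp add: e)
    show ?thesis
    proof (cases "dd j (up j k) = 0")
      case z: True
      then have "up j k \<notin> box" using dd_nz[OF step(1), of "up j k"] by auto
      moreover have "up j k \<in> box" if "(\<lambda>i. up j k i + l i) \<in> box" by (rule box_le[OF that]) simp
      ultimately have "(\<lambda>i. k i + up j l i) \<notin> box" unfolding e by blast
      then have "cc a (h, \<lambda>i. k i + up j l i) = 0" using cc_support[OF A_closed[OF a]] by blast
      then show ?thesis using 1 by simp
    qed (use 1 True in \<open>simp add: d'_def\<close>)
  qed
  moreover have "d' k \<noteq> 0" for k using b(2) by (simp add: d'_def)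
  ultimately show ?case using b'(1) by blast
qed

lemma H_sub: "H \<subseteq> \<Gamma>" by (auto simp: H_def group_part_def)

lemma H_iff: "g \<in> H \<longleftrightarrow> g \<in> \<Gamma> \<and> ug D g \<in> A" by (simp add: H_def group_part_def)

text \<open>Differentiate by all of \<open>x^m\<close> in degree h. A surviving \<open>x^k\<close>
  would come from a monomial of degree \<open>tdeg k\<close> + \<open>tdeg m\<close>, so k = 0, and
  the degree condition then leaves a nonzero multiple of the group element h.\<close>

lemma top_in_H:
  assumes a: "a \<in> A" and nz: "cc a (h, m) \<noteq> 0"
    and top: "\<And>h' k. cc a (h', k) \<noteq> 0 \<Longrightarrow> tdeg k \<le> tdeg m"
  shows "h \<in> H"
proof -
  have hm: "h \<in> \<Gamma>" "m \<in> box" using cc_support[OF A_closed[OF a] nz] by auto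
  obtain b d where b: "b \<in> A" "\<forall>k. d k \<noteq> (0::'k)"
    "\<forall>h' k. cc b (h', k) = (if h = h' \<otimes>\<^sub>G gm k then d k * cc a (h', \<lambda>i. k i + m i) else 0)"
    using higher_derivation[OF a hm(2,1)] by blast
  define c where "c = d (\<lambda>_. 0) * cc a (h, m)"
  have c: "c \<noteq> 0" using b nz by (simp add: c_def)
  have k0: "k = (\<lambda>_. 0)" if k: "k \<in> box" and n: "cc a (h', \<lambda>i. k i + m i) \<noteq> 0" for h' k
  proof -
    have "tdeg (\<lambda>i. k i + m i) = tdeg k + tdeg m" by (simp add: tdeg_def sum.distrib)
    then have "tdeg k = 0" using top[OF n] by simp
    then show ?thesis using k tdeg_eq_0 by blast
  qed
  have "b = c \<odot>\<^sub>U ug D h"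
  proof (rule cc_inject)
    fix h' k
    show "cc b (h', k) = cc (c \<odot>\<^sub>U ug D h) (h', k)"
    proof (cases "k = (\<lambda>_. 0)")
      case True
      have "cc b (h', \<lambda>_. 0) = (if h' = h then c else 0)"
      proof (cases "h' \<in> \<Gamma>")
        case True
        then show ?thesis using b(3) by (auto simp: c_def)
      next
        case False
        then show ?thesis using cc_outside[OF A_closed[OF b(1)]] hm by auto
      qed
      then show ?thesis using True hm by (simp add: cc_smult cc_ug1)
    next
      case False
      have "cc b (h', k) = 0"
      proof (rule ccontr)
        assume n: "cc b (h', k) \<noteq> 0"
        then have "k \<in> box" using cc_support[OF A_closed[OF b(1)]] by blast
        moreover have "cc a (h', \<lambda>i. k i + m i) \<noteq> 0" using n b(3) by (auto split: if_splits)
        ultimately show False using k0 False by blast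
      qed
      then show ?thesis using False hm by (simp add: cc_smult cc_ug1)
    qed
  qed (use b hm in \<open>simp_all add: U.smult_closed\<close>)
  then have "inverse c \<odot>\<^sub>U b = ug D h" using c hm by (simp add: U.smult_assoc1[symmetric] U.smult_one)
  then show ?thesis using A_sub(2)[OF b(1), of "inverse c"] hm by (simp add: H_iff)
qed

lemma H_mult: "g \<in> H \<Longrightarrow> h \<in> H \<Longrightarrow> g \<otimes>\<^sub>G h \<in> H"
  using A_mult by (auto simp: H_iff ug_mult[symmetric])

lemma H_one: "\<one>\<^sub>G \<in> H" using A_one by (simp add: H_iff ug_one)

text \<open>In a finite group the inverse is a power, and A is closed under products.\<close>

lemma H_inv: "g \<in> H \<Longrightarrow> inv\<^sub>G g \<in> H"
proof -
  assume g: "g \<in> H"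
  then have gG: "g \<in> \<Gamma>" using H_sub by blast
  have p: "g [^]\<^bsub>grp D\<^esub> (n::nat) \<in> H" for n by (induction n) (simp_all add: H_one H_mult g)
  obtain n where n: "Coset.order (grp D) = Suc n"
    using G.order_gt_0_iff_finite fin_G by (metis gr0_implies_Suc)
  have "g [^]\<^bsub>grp D\<^esub> n \<otimes>\<^sub>G g = \<one>\<^sub>G" using G.pow_order_eq_1[OF gG] n by simp
  then have "inv\<^sub>G g = g [^]\<^bsub>grp D\<^esub> n" using gG by (intro G.inv_equality) auto
  then show ?thesis using p by simp
qed

lemma conj_A:
  assumes a: "a \<in> A" and g: "g \<in> H"
  shows "\<exists>b\<in>A. \<forall>\<beta>. cc b \<beta> = cX (snd \<beta>) g * cc a \<beta>"
proof -
  have "ug D g \<in> A" "ug D (inv\<^sub>G g) \<in> A" "g \<in> \<Gamma>" using g H_inv[OF g] by (simp_all add: H_iff)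
  then show ?thesis
    using a by (intro bexI[of _ "ug D g \<otimes>\<^sub>U a \<otimes>\<^sub>U ug D (inv\<^sub>G g)"] A_mult) (auto simp: cc_conj)
qed

lemma cX_mult: "g \<in> \<Gamma> \<Longrightarrow> h \<in> \<Gamma> \<Longrightarrow> cX k (g \<otimes>\<^sub>G h) = cX k g * cX k h"
  by (simp add: cX_def power_mult_distrib prod.distrib)

text \<open>Average the conjugates of a over H with the inverse values of \<open>chi i\<close>. By
  orthogonality of characters the sum over H vanishes for every other weight; characteristic zero
  allows division by the order of H.\<close>

lemma weight_part:
  assumes a: "a \<in> A" and i: "i \<in> I"
  shows "\<exists>b\<in>A. \<forall>h k. cc b (h, k) = (if \<forall>g\<in>H. cX k g = chi i g then cc a (h, k) else 0)"
proof -
  have fH: "finite H" using finite_subset[OF H_sub fin_G] .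
  have cH: "(of_nat (card H) :: 'k) \<noteq> 0" using fH H_one by (auto simp: card_eq_0_iff)
  obtain b where b: "b \<in> A" "\<forall>\<beta>. cc b \<beta> = (\<Sum>g\<in>H. (inverse (of_nat (card H)) * inverse (chi i g)) * (cX (snd \<beta>) g * cc a \<beta>))"
    using A_lincomb[OF fH, of "\<lambda>g \<beta>. cX (snd \<beta>) g * cc a \<beta>" "\<lambda>g. inverse (of_nat (card H)) * inverse (chi i g)"] conj_A[OF a] by blast
  have "cc b (h, k) = (if \<forall>g\<in>H. cX k g = chi i g then cc a (h, k) else 0)" for h k
  proof -
    define psi where "psi g = inverse (chi i g) * cX k g" for g
    have "cc b (h, k) = inverse (of_nat (card H)) * cc a (h, k) * (\<Sum>g\<in>H. psi g)"
      unfolding b(2)[rule_format] by (simp add: psi_def sum_distrib_left algebra_simps)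
    moreover have "(\<Sum>g\<in>H. psi g) = (if \<forall>g\<in>H. cX k g = chi i g then of_nat (card H) else 0)"
    proof (cases "\<forall>g\<in>H. cX k g = chi i g")
      case True
      then have "psi g = 1" if "g \<in> H" for g using that i H_sub chi_nz[OF i, of g] by (auto simp: psi_def)
      then show ?thesis using True by simp
    next
      case False
      then obtain g0 where g0: "g0 \<in> H" "cX k g0 \<noteq> chi i g0" by blast
      have g0G: "g0 \<in> \<Gamma>" using g0 H_sub by blast
      have p0: "psi g0 \<noteq> 1" using g0 chi_nz[OF i g0G] by (auto simp: psi_def field_simps)
      have pm: "psi (g0 \<otimes>\<^sub>G g) = psi g0 * psi g" if "g \<in> H" for g
        using that H_sub g0G i by (auto simp: psi_def cX_mult)
      have "(\<Sum>g\<in>H. psi g) = (\<Sum>g\<in>H. psi (g0 \<otimes>\<^sub>G g))"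
      proof (rule sum.reindex_bij_witness[of _ "\<lambda>g. g0 \<otimes>\<^sub>G g" "\<lambda>g. inv\<^sub>G g0 \<otimes>\<^sub>G g"])
        fix g assume "g \<in> H"
        then have g: "g \<in> H" "g \<in> \<Gamma>" using H_sub by auto
        show "g0 \<otimes>\<^sub>G (inv\<^sub>G g0 \<otimes>\<^sub>G g) = g" "inv\<^sub>G g0 \<otimes>\<^sub>G (g0 \<otimes>\<^sub>G g) = g"
          using g g0G by (simp_all add: G.m_assoc[symmetric])
        then show "psi (g0 \<otimes>\<^sub>G (inv\<^sub>G g0 \<otimes>\<^sub>G g)) = psi g" by simp
        show "g0 \<otimes>\<^sub>G g \<in> H" "inv\<^sub>G g0 \<otimes>\<^sub>G g \<in> H" using g g0 H_mult H_inv by blast+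
      qed
      also have "\<dots> = psi g0 * (\<Sum>g\<in>H. psi g)" by (simp add: pm sum_distrib_left)
      finally have "(1 - psi g0) * (\<Sum>g\<in>H. psi g) = 0" by (simp add: algebra_simps)
      then have "(\<Sum>g\<in>H. psi g) = 0" using p0 by simp
      then show ?thesis using False by (simp only: if_False)
    qed
    ultimately show ?thesis using cH by auto
  qed
  then show ?thesis using b by blast
qed

text \<open>This recognises the class of a variable from its term in a homogeneous linear element:
  for degree g, the group coordinate in front of \<open>x_i\<close> is g times the inverse of
  \<open>el i\<close>.\<close>

lemma sim_if_same_degree:
  assumes "i \<in> I" "j \<in> I" "g \<in> \<Gamma>" "g \<otimes>\<^sub>G inv\<^sub>G (el i) \<in> H" "g \<otimes>\<^sub>G inv\<^sub>G (el j) \<in> H" "\<forall>h\<in>H. chi i h = chi j h"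
  shows "(i, j) \<in> sim D H"
proof -
  have "inv\<^sub>G (g \<otimes>\<^sub>G inv\<^sub>G (el j)) \<otimes>\<^sub>G (g \<otimes>\<^sub>G inv\<^sub>G (el i)) \<in> H"
    using assms H_mult H_inv by blast
  moreover have "inv\<^sub>G (g \<otimes>\<^sub>G inv\<^sub>G (el j)) \<otimes>\<^sub>G (g \<otimes>\<^sub>G inv\<^sub>G (el i)) = inv\<^sub>G (el i) \<otimes>\<^sub>G el j"
  proof -
    have "inv\<^sub>G (g \<otimes>\<^sub>G inv\<^sub>G (el j)) = el j \<otimes>\<^sub>G inv\<^sub>G g"
      using assms by (simp add: G.inv_mult_group)
    then have "inv\<^sub>G (g \<otimes>\<^sub>G inv\<^sub>G (el j)) \<otimes>\<^sub>G (g \<otimes>\<^sub>G inv\<^sub>G (el i)) =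
       el j \<otimes>\<^sub>G (inv\<^sub>G g \<otimes>\<^sub>G g) \<otimes>\<^sub>G inv\<^sub>G (el i)"
      using assms by (simp only: G.m_assoc G.m_closed G.inv_closed el)
    then show ?thesis using assms by (simp add: G.m_comm)
  qed
  ultimately show ?thesis using assms by (simp add: sim_iff[OF H_sub])
qed

lemma sim_equiv: "equiv I (sim D H)"
proof (rule equivI)
  show "sim D H \<subseteq> I \<times> I" by (auto simp: sim_def)
  show "refl_on I (sim D H)" by (auto simp: refl_on_def sim_iff[OF H_sub] H_one)
  show "sym (sim D H)"
  proof (rule symI)
    fix i j assume s: "(i, j) \<in> sim D H"
    then have ij: "i \<in> I" "j \<in> I" "inv\<^sub>G (el i) \<otimes>\<^sub>G el j \<in> H" "\<forall>g\<in>H. chi i g = chi j g"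
      by (auto simp: sim_iff[OF H_sub])
    have "inv\<^sub>G (inv\<^sub>G (el i) \<otimes>\<^sub>G el j) = inv\<^sub>G (el j) \<otimes>\<^sub>G el i"
      using ij by (simp add: G.inv_mult_group)
    then show "(j, i) \<in> sim D H" using ij H_inv[OF ij(3)] by (simp add: sim_iff[OF H_sub])
  qed
  show "trans (sim D H)"
  proof (rule transI)
    fix i j k assume "(i, j) \<in> sim D H" "(j, k) \<in> sim D H"
    then have ij: "i \<in> I" "j \<in> I" "k \<in> I" "inv\<^sub>G (el i) \<otimes>\<^sub>G el j \<in> H" "inv\<^sub>G (el j) \<otimes>\<^sub>G el k \<in> H"
       "\<forall>g\<in>H. chi i g = chi j g" "\<forall>g\<in>H. chi j g = chi k g"
      by (auto simp: sim_iff[OF H_sub])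
    have "(inv\<^sub>G (el i) \<otimes>\<^sub>G el j) \<otimes>\<^sub>G (inv\<^sub>G (el j) \<otimes>\<^sub>G el k) =
      inv\<^sub>G (el i) \<otimes>\<^sub>G (el j \<otimes>\<^sub>G inv\<^sub>G (el j)) \<otimes>\<^sub>G el k"
      using ij by (simp only: G.m_assoc G.m_closed G.inv_closed el)
    then have "inv\<^sub>G (el i) \<otimes>\<^sub>G el k = (inv\<^sub>G (el i) \<otimes>\<^sub>G el j) \<otimes>\<^sub>G (inv\<^sub>G (el j) \<otimes>\<^sub>G el k)"
      using ij by simp
    then show "(i, k) \<in> sim D H" using ij H_mult[OF ij(4,5)] by (simp add: sim_iff[OF H_sub])
  qed
qed

end

section \<open>Linear elements and reduced data\<close>

text \<open>Pivots are the positions below n where some vector of W has its first nonzero entry. The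
  remaining pivot positions are cleared from left to right, because subtracting a vector with first
  entry at m leaves earlier positions alone. The hypothesis \<open>last\<close> keeps the last
  column from being a pivot, which later gives (RD3).\<close>

lemma reduced_basis_exists:
  fixes W :: "(nat \<Rightarrow> 'k::field) set"
  assumes add: "\<And>w w'. w \<in> W \<Longrightarrow> w' \<in> W \<Longrightarrow> (\<lambda>s. w s + w' s) \<in> W"
    and smult: "\<And>c w. w \<in> W \<Longrightarrow> (\<lambda>s. c * w s) \<in> W"
    and last: "\<And>w. w \<in> W \<Longrightarrow> \<forall>s<n. w s = 0 \<Longrightarrow> w n = 0"
  shows "\<exists>P \<rho>. P \<subseteq> {..<n} \<and> (\<forall>p\<in>P. \<rho> p \<in> W \<and> \<rho> p p = 1 \<and> (\<forall>t<p. \<rho> p t = 0) \<and> (\<forall>t\<in>P. t \<noteq> p \<longrightarrow> \<rho> p t = 0))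
    \<and> (\<forall>w\<in>W. (\<forall>p\<in>P. w p = 0) \<longrightarrow> (\<forall>s\<le>n. w s = 0))"
proof -
  define P where "P = {s. s < n \<and> (\<exists>w\<in>W. w s \<noteq> 0 \<and> (\<forall>t<s. w t = 0))}"
  have ex: "\<exists>w\<in>W. w p = 1 \<and> (\<forall>t<p. w t = 0) \<and> (\<forall>t\<in>P. p < t \<and> t < m \<longrightarrow> w t = 0)" if p: "p \<in> P" for p m
  proof (induction m)
    case 0
    obtain w where w: "w \<in> W" "w p \<noteq> 0" "\<forall>t<p. w t = 0" using p by (auto simp: P_def)
    then show ?case using smult[OF w(1), of "inverse (w p)"] by (intro bexI[of _ "\<lambda>s. inverse (w p) * w s"]) auto
  next
    case (Suc m)
    obtain w where w: "w \<in> W" "w p = 1" "\<forall>t<p. w t = 0" "\<forall>t\<in>P. p < t \<and> t < m \<longrightarrow> w t = 0" using Suc by blast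
    show ?case
    proof (cases "m \<in> P \<and> p < m")
      case False
      then show ?thesis using w by (intro bexI[of _ w]) (auto simp: less_Suc_eq)
    next
      case True
      obtain v where v: "v \<in> W" "v m \<noteq> 0" "\<forall>t<m. v t = 0" using True by (auto simp: P_def)
      define w' where "w' = (\<lambda>s. w s + (- (w m / v m)) * v s)"
      have "w' \<in> W" unfolding w'_def by (rule add[OF w(1) smult[OF v(1)]])
      then show ?thesis using w v True by (intro bexI[of _ w']) (auto simp: w'_def less_Suc_eq)
    qed
  qed
  have "\<exists>w\<in>W. w p = 1 \<and> (\<forall>t<p. w t = 0) \<and> (\<forall>t\<in>P. t \<noteq> p \<longrightarrow> w t = 0)" if p: "p \<in> P" for p
  proof -
    obtain w where "w \<in> W" "w p = 1" "\<forall>t<p. w t = 0" "\<forall>t\<in>P. p < t \<and> t < n \<longrightarrow> w t = 0" using ex[OF p] by blast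
    then show ?thesis by (intro bexI[of _ w]) (auto simp: P_def linorder_neq_iff)
  qed
  then have "\<forall>p\<in>P. \<exists>w. w \<in> W \<and> w p = 1 \<and> (\<forall>t<p. w t = 0) \<and> (\<forall>t\<in>P. t \<noteq> p \<longrightarrow> w t = 0)" by blast
  from bchoice[OF this] obtain \<rho> where
    \<rho>: "\<forall>p\<in>P. \<rho> p \<in> W \<and> \<rho> p p = 1 \<and> (\<forall>t<p. \<rho> p t = 0) \<and> (\<forall>t\<in>P. t \<noteq> p \<longrightarrow> \<rho> p t = 0)" ..
  have "\<forall>s\<le>n. w s = 0" if w: "w \<in> W" "\<forall>p\<in>P. w p = 0" for w
  proof -
    have "w s = 0" if "s < n" for s
      using that
    proof (induction s rule: less_induct)
      case (less s)
      then have "\<forall>t<s. w t = 0" by auto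
      then show ?case using less.prems w by (auto simp: P_def)
    qed
    then have z: "\<forall>s<n. w s = 0" by blast
    then have "w n = 0" by (rule last[OF w(1)])
    then show ?thesis using z by (auto simp: le_less)
  qed
  moreover have "P \<subseteq> {..<n}" by (auto simp: P_def)
  ultimately show ?thesis using \<rho> by (intro exI[of _ P] exI[of _ \<rho>]) blast
qed

text \<open>Rows follow the pivots in increasing order; zero rows pad the matrix, since a reduced
  datum has n rows whatever the number of pivots.\<close>

definition reduced_mat :: "nat \<Rightarrow> nat set \<Rightarrow> (nat \<Rightarrow> nat \<Rightarrow> 'k::zero) \<Rightarrow> 'k mat" where
  "reduced_mat n P \<rho> = mat n (n + 1) (\<lambda>(r, s). if r < card P then \<rho> (sorted_list_of_set P ! r) s else 0)"

context
  fixes n :: nat and P :: "nat set" and \<rho> :: "nat \<Rightarrow> nat \<Rightarrow> 'k::field"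
  assumes P: "P \<subseteq> {..<n}"
    and reduced: "\<forall>p\<in>P. \<rho> p p = 1 \<and> (\<forall>t<p. \<rho> p t = 0) \<and> (\<forall>t\<in>P. t \<noteq> p \<longrightarrow> \<rho> p t = 0)"
begin

lemma pivot_column: "p \<in> P \<Longrightarrow> \<rho> p p = 1" "p \<in> P \<Longrightarrow> t < p \<Longrightarrow> \<rho> p t = 0"
    "p \<in> P \<Longrightarrow> t \<in> P \<Longrightarrow> t \<noteq> p \<Longrightarrow> \<rho> p t = 0"
  using reduced by blast+

lemma fin_P: "finite P" using P finite_subset by blast

lemma card_P: "card P \<le> n" using card_mono[OF _ P] by simp

lemma pivot_mem: "r < card P \<Longrightarrow> sorted_list_of_set P ! r \<in> P"
  using nth_mem[of r "sorted_list_of_set P"] fin_P by simp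

lemma pivot_less: "r < r' \<Longrightarrow> r' < card P \<Longrightarrow> sorted_list_of_set P ! r < sorted_list_of_set P ! r'"
  using sorted_wrt_nth_less[OF strict_sorted_list_of_set, of r r' P] fin_P by simp

lemma reduced_mat_carrier: "reduced_mat n P \<rho> \<in> carrier_mat n (n + 1)"
  by (simp add: reduced_mat_def)

lemma reduced_mat_echelon: "row_echelon_form (reduced_mat n P \<rho>)"
proof -
  \<comment> \<open>A zero row receives the number of columns, n + 1, as its pivot position.\<close>
  let ?f = "\<lambda>r. if r < card P then sorted_list_of_set P ! r else n + 1"
  have lt: "sorted_list_of_set P ! r < n" if "r < card P" for r
    using pivot_mem[OF that] P by auto
  have "pivot_fun (reduced_mat n P \<rho>) ?f (n + 1)"
  proof (rule pivot_funI[where nr = n])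
    fix i assume i: "i < n" "?f i < n + 1"
    then have c: "i < card P" by (simp split: if_splits)
    note p = pivot_mem[OF c]
    show "reduced_mat n P \<rho> $$ (i, ?f i) = 1" using i c lt[OF c] p by (simp add: reduced_mat_def pivot_column)
    fix i' assume i': "i' < n" "i' \<noteq> i"
    show "reduced_mat n P \<rho> $$ (i', ?f i) = 0"
    proof (cases "i' < card P")
      case True
      have "sorted_list_of_set P ! i \<noteq> sorted_list_of_set P ! i'"
        using pivot_less[of i i'] pivot_less[of i' i] c True i' by (cases i i' rule: linorder_cases) auto
      then show ?thesis using i' c lt[OF c] True p pivot_mem[OF True] by (simp add: reduced_mat_def pivot_column)
    next
      case False
      then show ?thesis using i' c lt[OF c] by (simp add: reduced_mat_def)
    qed
  next
    fix i j assume i: "i < n" and j: "j < ?f i"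
    show "reduced_mat n P \<rho> $$ (i, j) = 0"
    proof (cases "i < card P")
      case True
      then show ?thesis using i j lt[OF True] pivot_mem[OF True] by (simp add: reduced_mat_def pivot_column)
    next
      case False
      then show ?thesis using i j by (simp add: reduced_mat_def)
    qed
  next
    fix i assume "i < n" "Suc i < n"
    show "?f i < ?f (Suc i) \<or> ?f (Suc i) = n + 1" using pivot_less[of i "Suc i"] by auto
  next
    fix i assume "i < n"
    show "?f i \<le> n + 1" using lt[of i] by auto
  qed (simp add: reduced_mat_def)
  then show ?thesis unfolding row_echelon_form_def by (auto simp: reduced_mat_def)
qed

text \<open>The last column is a combination of the pivot columns, which are unit vectors.\<close>

lemma reduced_mat_rank:
  "vec_space.rank n (reduced_mat n P \<rho>) = vec_space.rank n (mat n n (\<lambda>(r, s). reduced_mat n P \<rho> $$ (r, s)))"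
proof -
  interpret V: vec_space "TYPE('k)" n .
  let ?C = "reduced_mat n P \<rho>"
  let ?C' = "mat n n (\<lambda>(r, s). ?C $$ (r, s))"
  let ?S = "set (cols ?C')"
  have c': "col ?C' s = col ?C s" if "s < n" for s
    using that by (intro eq_vecI) (auto simp: reduced_mat_def)
  have S: "?S = col ?C ` {..<n}" using c' by (auto simp: cols_def)
  have C: "set (cols ?C) = ?S \<union> {col ?C n}" unfolding S by (auto simp: cols_def reduced_mat_def less_Suc_eq)
  have Sc: "?S \<subseteq> carrier_vec n" unfolding S by (auto simp: reduced_mat_def)
  have unit: "unit_vec n r \<in> V.span ?S" if r: "r < card P" for r
  proof -
    let ?p = "sorted_list_of_set P ! r"
    have p: "?p \<in> P" "?p < n" using pivot_mem[OF r] P by auto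
    have rn: "r < n" using r card_P by simp
    have "col ?C ?p = unit_vec n r"
    proof (intro eq_vecI)
      fix i assume i: "i < dim_vec (unit_vec n r :: 'k vec)"
      show "col ?C ?p $ i = unit_vec n r $ i"
      proof (cases "i < card P \<and> i \<noteq> r")
        case True
        have "sorted_list_of_set P ! i \<noteq> ?p"
          using pivot_less[of i r] pivot_less[of r i] r True by (cases i r rule: linorder_cases) auto
        then show ?thesis using True i p rn pivot_mem[of i] by (simp add: reduced_mat_def pivot_column)
      next
        case False
        then show ?thesis using i p r rn by (cases "i = r") (simp_all add: reduced_mat_def pivot_column(1))
      qed
    qed (simp add: reduced_mat_def)
    then have "unit_vec n r \<in> ?S" unfolding S using p by (metis imageI lessThan_iff)
    then show ?thesis using V.span_mem[OF Sc] by blast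
  qed
  define v where "v m = vec n (\<lambda>r. if r < m then ?C $$ (r, n) else 0)" for m
  have "v m \<in> V.span ?S" if "m \<le> card P" for m
    using that
  proof (induction m)
    case 0
    have "v 0 = V.lincomb (\<lambda>_. 0) {}" by (auto simp: v_def V.lincomb_def)
    then show ?case by (rule V.in_spanI) auto
  next
    case (Suc m)
    have "v (Suc m) = v m + ?C $$ (m, n) \<cdot>\<^sub>v unit_vec n m"
      using Suc.prems card_P by (intro eq_vecI) (auto simp: v_def less_Suc_eq)
    then show ?case using Suc V.span_add1[OF Sc _ V.smult_in_span[OF Sc unit[of m]]] by simp
  qed
  then have "v (card P) \<in> V.span ?S" by blast
  moreover have "col ?C n = v (card P)"
    by (intro eq_vecI) (auto simp: v_def reduced_mat_def)
  ultimately have "V.span ?S = V.span (set (cols ?C))"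
    unfolding C using V.already_in_span[OF Sc] by simp
  then show ?thesis by (simp add: V.rank_def)
qed

end

context datum begin

lemma tdeg_mono: "(\<And>i. k i \<le> m i) \<Longrightarrow> tdeg k \<le> tdeg m"
  unfolding tdeg_def by (rule sum_mono) simp

text \<open>In the highest degree \<open>x_j\<close> acts as in the associated graded algebra:
  lowering pieces and jumps would have to start from monomials of too large a degree.\<close>

lemma XX_top:
  assumes j: "j \<in> I" and h: "h \<in> \<Gamma>" and F: "\<And>h' k. F (h', k) \<noteq> 0 \<Longrightarrow> tdeg k \<le> n" and l: "tdeg l = Suc n"
  shows "XX j F (h, l) = (if l j mod N j \<noteq> 0 then inverse (chi j h) * PP j j l * F (h, l(j := l j - 1)) else 0)"
proof -
  have low: "Y j a F (h, l) = 0" if a: "a \<in> {1..j}" "a \<noteq> j" for a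
  proof -
    have "F (h', up a l) = 0" for h'
      using F[of h' "up a l"] tdeg_up[OF idx_le[OF j a(1)], of l] l by fastforce
    then show ?thesis using a h by (simp add: Ylow up_def)
  qed
  have "XX j F (h, l) = (\<Sum>a\<in>{1..j}. if a = j then Y j j F (h, l) else 0)"
    unfolding XX_def by (intro sum.cong refl) (use low in auto)
  also have "\<dots> = Y j j F (h, l)" using j by (simp add: idx_def)
  also have "\<dots> = (if l j mod N j \<noteq> 0 then inverse (chi j h) * PP j j l * F (h, l(j := l j - 1)) else 0)"
  proof -
    have "tdeg l \<le> tdeg (l(j := l j + N j - 1))" using N_pos[OF j] by (intro tdeg_mono) auto
    then have "F (h', l(j := l j + N j - 1)) = 0" for h' using F[of h' "l(j := l j + N j - 1)"] l by fastforce
    then show ?thesis using h by (simp add: Yraise)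
  qed
  finally show ?thesis .
qed

text \<open>The coefficient vector is a function on the naturals, so that linear combinations of
  \<xi>'s are taken pointwise.\<close>

definition "xe J w = xi_elt D J (vec (card J + 1) w)"

lemma nth_index_bij: "finite J \<Longrightarrow> bij_betw (nth_index J) {..<card J} J"
  unfolding nth_index_def[abs_def] using bij_betw_nth[of "sorted_list_of_set J" "{..<card J}" J] by simp

lemma nth_index_mem: "finite J \<Longrightarrow> s < card J \<Longrightarrow> nth_index J s \<in> J"
  using bij_betwE[OF nth_index_bij] by blast

context
  fixes J :: "nat set"
  assumes J: "J \<subseteq> I" "J \<noteq> {}"
begin

lemma J_fin: "finite J" using J finite_I finite_subset by blast

lemma J_card: "0 < card J" using J J_fin by (simp add: card_gt_0_iff)

lemma ni_I: "s < card J \<Longrightarrow> nth_index J s \<in> I"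
  using nth_index_mem[OF J_fin] J by blast

lemma xe_summand: "s < card J \<Longrightarrow> w s \<odot>\<^sub>U (ug D (inv\<^sub>G el (nth_index J s)) \<otimes>\<^sub>U ux D (nth_index J s)) \<in> carrier UU"
  using ni_I by (simp add: U.smult_closed)

lemma xe_alt:
  "xe J w = ug D (el (nth_index J 0)) \<otimes>\<^sub>U finsum UU (\<lambda>s. w s \<odot>\<^sub>U (ug D (inv\<^sub>G el (nth_index J s)) \<otimes>\<^sub>U ux D (nth_index J s))) {..<card J}
     \<oplus>\<^sub>U w (card J) \<odot>\<^sub>U ug D (el (nth_index J 0))"
proof -
  have "finsum UU (\<lambda>s. vec (card J + 1) w $ s \<odot>\<^sub>U (ug D (inv\<^sub>G el (nth_index J s)) \<otimes>\<^sub>U ux D (nth_index J s))) {..<card J}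
    = finsum UU (\<lambda>s. w s \<odot>\<^sub>U (ug D (inv\<^sub>G el (nth_index J s)) \<otimes>\<^sub>U ux D (nth_index J s))) {..<card J}"
    by (rule U.finsum_cong') (use xe_summand in auto)
  then show ?thesis unfolding xe_def xi_elt_def by simp
qed

lemma xe_closed [simp]: "xe J w \<in> carrier UU"
  unfolding xe_alt using J_card ni_I xe_summand by (intro U.a_closed U.m_closed U.smult_closed U.finsum_closed) auto

text \<open>An arbitrary right factor M is allowed because products of several \<xi>'s are formed
  later; M = 1 gives the coefficients of a single one in \<open>cc_xe\<close>.\<close>

lemma cc_xe_mult:
  assumes M: "M \<in> carrier UU" and h: "h \<in> \<Gamma>"
  shows "cc (xe J w \<otimes>\<^sub>U M) (h, l) =
    (\<Sum>s<card J. w s * XX (nth_index J s) (cc M) (el (nth_index J s) \<otimes>\<^sub>G (inv\<^sub>G el (nth_index J 0) \<otimes>\<^sub>G h), l))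
     + w (card J) * cc M (inv\<^sub>G el (nth_index J 0) \<otimes>\<^sub>G h, l)"
proof -
  let ?f = "\<lambda>s. w s \<odot>\<^sub>U (ug D (inv\<^sub>G el (nth_index J s)) \<otimes>\<^sub>U ux D (nth_index J s))"
  let ?g = "el (nth_index J 0)"
  have g: "?g \<in> \<Gamma>" using ni_I J_card by simp
  have f: "?f \<in> {..<card J} \<rightarrow> carrier UU" using xe_summand by auto
  then have fM: "?f s \<otimes>\<^sub>U M \<in> carrier UU" if "s \<in> {..<card J}" for s using that M by auto
  have S: "finsum UU ?f {..<card J} \<in> carrier UU" by (rule U.finsum_closed[OF f])
  have "xe J w \<otimes>\<^sub>U M = ug D ?g \<otimes>\<^sub>U (finsum UU ?f {..<card J} \<otimes>\<^sub>U M) \<oplus>\<^sub>U w (card J) \<odot>\<^sub>U (ug D ?g \<otimes>\<^sub>U M)"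
    unfolding xe_alt using S M g by (simp add: U.l_distr U.m_assoc U.smult_mult_l U.smult_closed)
  then have "cc (xe J w \<otimes>\<^sub>U M) (h, l) = cc (finsum UU ?f {..<card J} \<otimes>\<^sub>U M) (inv\<^sub>G ?g \<otimes>\<^sub>G h, l)
     + w (card J) * cc M (inv\<^sub>G ?g \<otimes>\<^sub>G h, l)"
    using S M g h by (simp add: cc_add cc_smult cc_ug_mult U.smult_closed)
  moreover have "finsum UU ?f {..<card J} \<otimes>\<^sub>U M = finsum UU (\<lambda>s. ?f s \<otimes>\<^sub>U M) {..<card J}"
    by (rule U.finsum_ldistr[OF _ M f]) simp
  moreover have "cc (finsum UU (\<lambda>s. ?f s \<otimes>\<^sub>U M) {..<card J}) (h', l) = (\<Sum>s<card J. w s * XX (nth_index J s) (cc M) (el (nth_index J s) \<otimes>\<^sub>G h', l))"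
    if h': "h' \<in> \<Gamma>" for h'
  proof -
    have "cc (?f s \<otimes>\<^sub>U M) (h', l) = w s * XX (nth_index J s) (cc M) (el (nth_index J s) \<otimes>\<^sub>G h', l)" if "s < card J" for s
      using ni_I[OF that] M h' by (simp add: U.smult_mult_l cc_smult U.m_assoc cc_ug_mult cc_ux)
    then show ?thesis using cc_finsum[of "{..<card J}" "\<lambda>s. ?f s \<otimes>\<^sub>U M"] fM by simp
  qed
  ultimately show ?thesis using g h by simp
qed

lemma XX_vac: "i \<in> I \<Longrightarrow> XX i vac (h, l) = (if h = \<one>\<^sub>G \<and> l = up i (\<lambda>_. 0) then 1 else 0)"
proof -
  assume i: "i \<in> I"
  have "up i (\<lambda>_. 0) \<in> box" using i N_gt1[OF i] N_pos by (auto simp: box_def up_def)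
  then have "cc (xm (up i (\<lambda>_. 0))) (h, l) = (if h = \<one>\<^sub>G \<and> l = up i (\<lambda>_. 0) then 1 else 0)" by (rule cc_xm)
  then show ?thesis using i cc_ux[OF i U.one_closed] by (simp add: xm_lead xm_0 cc_one)
qed

lemma cc_xe:
  assumes h: "h \<in> \<Gamma>"
  shows "cc (xe J w) (h, l) =
    (\<Sum>s<card J. w s * (if h = el (nth_index J 0) \<otimes>\<^sub>G inv\<^sub>G el (nth_index J s) \<and> l = up (nth_index J s) (\<lambda>_. 0) then 1 else 0))
     + w (card J) * (if h = el (nth_index J 0) \<and> l = (\<lambda>_. 0) then 1 else 0)"
proof -
  let ?g = "el (nth_index J 0)"
  have g: "?g \<in> \<Gamma>" using ni_I J_card by simp
  have 1: "el i \<otimes>\<^sub>G (inv\<^sub>G ?g \<otimes>\<^sub>G h) = \<one>\<^sub>G \<longleftrightarrow> h = ?g \<otimes>\<^sub>G inv\<^sub>G el i" if "i \<in> I" for i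
  proof -
    have "el i \<otimes>\<^sub>G (inv\<^sub>G ?g \<otimes>\<^sub>G h) = inv\<^sub>G ?g \<otimes>\<^sub>G (el i \<otimes>\<^sub>G h)"
      using that g h by (simp add: G.m_lcomm)
    also have "\<dots> = \<one>\<^sub>G \<longleftrightarrow> el i \<otimes>\<^sub>G h = ?g"
      using inv_eq_iff[of ?g "el i \<otimes>\<^sub>G h" "\<one>\<^sub>G"] that g h by simp
    also have "\<dots> \<longleftrightarrow> h = inv\<^sub>G el i \<otimes>\<^sub>G ?g"
      using that g h by (metis G.inv_closed G.inv_inv G.inv_solve_left el)
    finally show ?thesis using that g by (simp add: G.m_comm)
  qed
  have 2: "inv\<^sub>G ?g \<otimes>\<^sub>G h = \<one>\<^sub>G \<longleftrightarrow> h = ?g" using inv_eq_iff[of ?g h "\<one>\<^sub>G"] g h by simp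
  have "cc (xe J w) (h, l) = cc (xe J w \<otimes>\<^sub>U \<one>\<^sub>U) (h, l)" by simp
  also have "\<dots> = (\<Sum>s<card J. w s * (if h = ?g \<otimes>\<^sub>G inv\<^sub>G el (nth_index J s) \<and> l = up (nth_index J s) (\<lambda>_. 0) then 1 else 0))
     + w (card J) * (if h = ?g \<and> l = (\<lambda>_. 0) then 1 else 0)"
    unfolding cc_xe_mult[OF U.one_closed h] cc_one
    by (intro arg_cong2[of _ _ _ _ "(+)"] sum.cong refl)
      (simp_all add: XX_vac[OF ni_I] 1[OF ni_I] 2 vac_def)
  finally show ?thesis .
qed

lemma up_inj: "up i (\<lambda>_. 0) = up j (\<lambda>_. 0) \<Longrightarrow> i = j"
  by (metis up_simps nat.distinct(1))

lemma up_neq_0: "up i k \<noteq> (\<lambda>_. 0)"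
  by (metis up_simps(1) nat.distinct(1))

lemma ni_inj: "s < card J \<Longrightarrow> t < card J \<Longrightarrow> nth_index J s = nth_index J t \<Longrightarrow> s = t"
  using nth_index_bij[OF J_fin] by (auto simp: bij_betw_def inj_on_def)

lemma cc_xe_linear_part:
  assumes "s < card J" and h: "h \<in> \<Gamma>"
  shows "cc (xe J w) (h, up (nth_index J s) (\<lambda>_. 0)) =
    (if h = el (nth_index J 0) \<otimes>\<^sub>G inv\<^sub>G el (nth_index J s) then w s else 0)"
proof -
  have e: "up (nth_index J s) (\<lambda>_. 0) = up (nth_index J t) (\<lambda>_. 0) \<longleftrightarrow> t = s" if "t < card J" for t
    using up_inj ni_inj assms that by blast
  have "(\<Sum>t<card J. w t * (if h = el (nth_index J 0) \<otimes>\<^sub>G inv\<^sub>G el (nth_index J t) \<and> up (nth_index J s) (\<lambda>_. 0) = up (nth_index J t) (\<lambda>_. 0) then 1 else 0))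
    = (\<Sum>t<card J. if t = s then (if h = el (nth_index J 0) \<otimes>\<^sub>G inv\<^sub>G el (nth_index J s) then w s else 0) else 0)"
    by (intro sum.cong) (auto simp: e)
  then show ?thesis unfolding cc_xe[OF h] using assms up_neq_0 by simp
qed

lemma cc_xe_constant_part:
  assumes h: "h \<in> \<Gamma>"
  shows "cc (xe J w) (h, \<lambda>_. 0) = (if h = el (nth_index J 0) then w (card J) else 0)"
proof -
  have "(\<lambda>_. 0) \<noteq> up i (\<lambda>_. 0)" for i using up_neq_0[of i "\<lambda>_. 0"] by metis
  then show ?thesis unfolding cc_xe[OF h] by simp
qed

lemma cc_xe_other:
  assumes h: "h \<in> \<Gamma>" and "l \<noteq> (\<lambda>_. 0)" "\<forall>s<card J. l \<noteq> up (nth_index J s) (\<lambda>_. 0)"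
  shows "cc (xe J w) (h, l) = 0"
  unfolding cc_xe[OF h] using assms by simp

lemma xe_add: "xe J (\<lambda>s. w s + w' s) = xe J w \<oplus>\<^sub>U xe J w'"
proof (rule cc_inject)
  fix h l
  show "cc (xe J (\<lambda>s. w s + w' s)) (h, l) = cc (xe J w \<oplus>\<^sub>U xe J w') (h, l)"
  proof (cases "h \<in> \<Gamma>")
    case True
    show ?thesis unfolding cc_add[OF xe_closed xe_closed] cc_xe[OF True] by (simp add: distrib_right sum.distrib)
  qed (simp add: cc_outside)
qed simp_all

lemma xe_smult: "xe J (\<lambda>s. c * w s) = c \<odot>\<^sub>U xe J w"
proof (rule cc_inject)
  fix h l
  show "cc (xe J (\<lambda>s. c * w s)) (h, l) = cc (c \<odot>\<^sub>U xe J w) (h, l)"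
  proof (cases "h \<in> \<Gamma>")
    case True
    show ?thesis unfolding cc_smult[OF xe_closed] cc_xe[OF True] by (simp add: distrib_left sum_distrib_left mult.assoc)
  qed (simp add: cc_outside U.smult_closed)
qed (simp_all add: U.smult_closed)

end

end

context coideal_subalgebra begin

text \<open>Condition (RD2) is imposed on the vectors already, through the values of the characters
  on H; being linear, it passes to the reduced basis.\<close>

definition "WJ J = {w. xe J w \<in> A \<and> ((\<exists>g\<in>H. \<exists>j\<in>J. chi j g \<noteq> 1) \<longrightarrow> w (card J) = 0)}"

lemma class_facts:
  assumes "J \<in> I // sim D H"
  shows "J \<subseteq> I" "J \<noteq> {}" "\<And>j. j \<in> J \<Longrightarrow> sim D H `` {j} = J"
    "\<And>i j. i \<in> J \<Longrightarrow> j \<in> J \<Longrightarrow> (i, j) \<in> sim D H"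
proof -
  show "J \<subseteq> I" by (rule in_quotient_imp_subset[OF sim_equiv assms])
  show "J \<noteq> {}" by (rule in_quotient_imp_non_empty[OF sim_equiv assms])
  show "(i, j) \<in> sim D H" if "i \<in> J" "j \<in> J" for i j
    by (rule in_quotient_imp_in_rel[OF sim_equiv assms]) (use that in blast)
  obtain x where x: "x \<in> I" "J = sim D H `` {x}" using assms by (rule quotientE)
  show "sim D H `` {j} = J" if "j \<in> J" for j
    using that equiv_class_eq[OF sim_equiv, of x j] unfolding x(2) by blast
qed

lemma sim_class: "i \<in> I \<Longrightarrow> sim D H `` {i} \<in> I // sim D H" "i \<in> I \<Longrightarrow> i \<in> sim D H `` {i}"
  using equiv_class_self[OF sim_equiv] by (auto intro: quotientI)

lemma class_leader:
  assumes J: "J \<in> I // sim D H" and i: "i \<in> J"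
  shows "el (nth_index J 0) \<otimes>\<^sub>G inv\<^sub>G el i \<in> H"
proof -
  note c = class_facts[OF J]
  have "nth_index J 0 \<in> J" using nth_index_mem J_fin[OF c(1,2)] J_card[OF c(1,2)] by blast
  then have s: "(i, nth_index J 0) \<in> sim D H" using c(4) i by blast
  then have "inv\<^sub>G el i \<otimes>\<^sub>G el (nth_index J 0) \<in> H" "nth_index J 0 \<in> I" "i \<in> I"
    by (auto simp: sim_iff[OF H_sub])
  then show ?thesis by (simp add: G.m_comm)
qed

lemma WJ_add: "J \<in> I // sim D H \<Longrightarrow> w \<in> WJ J \<Longrightarrow> w' \<in> WJ J \<Longrightarrow> (\<lambda>s. w s + w' s) \<in> WJ J"
  using xe_add[OF class_facts(1,2)] A_add by (auto simp: WJ_def)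

lemma WJ_smult: "J \<in> I // sim D H \<Longrightarrow> w \<in> WJ J \<Longrightarrow> (\<lambda>s. c * w s) \<in> WJ J"
  using xe_smult[OF class_facts(1,2)] A_sub(2) by (auto simp: WJ_def)

text \<open>If the group-like element \<open>g\<^sub>i\<^sub>1\<close> itself lay in \<open>A\<close>, then \<open>\<chi>\<^sub>i\<^sub>1(g\<^sub>i\<^sub>1) \<noteq> 1\<close> would make the
  class one with nontrivial character, for which the last coordinate is required to vanish.\<close>

lemma WJ_last:
  assumes J: "J \<in> I // sim D H" and w: "w \<in> WJ J" and z: "\<forall>s<card J. w s = 0"
  shows "w (card J) = 0"
proof (rule ccontr)
  assume nz: "w (card J) \<noteq> 0"
  note c = class_facts[OF J]
  define i where "i = nth_index J 0"
  have iJ: "i \<in> J" unfolding i_def using nth_index_mem J_fin[OF c(1,2)] J_card[OF c(1,2)] by blast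
  then have iI: "i \<in> I" using c by blast
  have "xe J w = w (card J) \<odot>\<^sub>U ug D (el i)"
  proof (rule cc_inject)
    fix h l
    show "cc (xe J w) (h, l) = cc (w (card J) \<odot>\<^sub>U ug D (el i)) (h, l)"
    proof (cases "h \<in> \<Gamma>")
      case True
      show ?thesis unfolding cc_xe[OF c(1,2) True] i_def[symmetric] using z iI by (simp add: cc_smult cc_ug1)
    qed (use iI c in \<open>simp add: cc_outside U.smult_closed\<close>)
  qed (use iI c in \<open>simp_all add: U.smult_closed\<close>)
  moreover have "xe J w \<in> A" using w by (simp add: WJ_def)
  ultimately have "inverse (w (card J)) \<odot>\<^sub>U (w (card J) \<odot>\<^sub>U ug D (el i)) \<in> A" using A_sub(2) by metis
  then have "ug D (el i) \<in> A" using nz iI by (simp add: U.smult_assoc1[symmetric] U.smult_one)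
  then have "el i \<in> H" using iI by (simp add: H_iff)
  moreover have "chi i (el i) \<noteq> 1" using q_ne1[OF iI] by (simp add: q_def)
  ultimately show False using w nz iJ by (auto simp: WJ_def)
qed

text \<open>Project a to the degree of the given monomial and then to the weight
  \<open>chi i\<close> of H. The group coordinates of the linear terms lie in H by
  \<open>top_in_H\<close>, so any variable that survives has the right degree and weight and belongs
  to the class of i. The result is, after a translation, one of the \<xi>'s.\<close>

lemma linear_part_in_WJ:
  assumes a: "a \<in> A" and top: "\<And>h' k. cc a (h', k) \<noteq> 0 \<Longrightarrow> tdeg k \<le> 1"
    and i: "i \<in> I" and nz: "cc a (h, up i (\<lambda>_. 0)) \<noteq> 0"
  shows "\<exists>w\<in>WJ (sim D H `` {i}). (\<exists>s<card (sim D H `` {i}). w s \<noteq> 0) \<and>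
    (\<forall>s<card (sim D H `` {i}). w s \<noteq> 0 \<longrightarrow> (\<exists>h'. cc a (h', up (nth_index (sim D H `` {i}) s) (\<lambda>_. 0)) \<noteq> 0))"
proof -
  define J where "J = sim D H `` {i}"
  have J: "J \<in> I // sim D H" and iJ: "i \<in> J" using sim_class[OF i] by (simp_all add: J_def)
  note c = class_facts[OF J]
  note xc = xe_closed[OF c(1,2)]
  define g1 where "g1 = el (nth_index J 0)"
  have g1: "g1 \<in> \<Gamma>" unfolding g1_def using ni_I[OF c(1,2)] J_card[OF c(1,2)] by simp
  have t1: "tdeg (up k (\<lambda>_. 0)) = 1" if "k \<in> I" for k using tdeg_up[OF that] by (simp add: tdeg_0)
  have lin_H: "h' \<in> H" if "cc a (h', up k (\<lambda>_. 0)) \<noteq> 0" "k \<in> I" for h' k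
    by (rule top_in_H[OF a that(1)]) (use top t1[OF that(2)] in simp)
  have hH: "h \<in> H" using lin_H[OF nz i] .
  then have hG: "h \<in> \<Gamma>" using H_sub by blast
  have gH: "g1 \<otimes>\<^sub>G inv\<^sub>G el i \<in> H" unfolding g1_def by (rule class_leader[OF J iJ])
  define t where "t = h \<otimes>\<^sub>G el i"
  have t: "t \<in> \<Gamma>" using hG i by (simp add: t_def)
  \<comment> \<open>This element lies in H and moves the degree t to g1, the common degree of all
    terms of a \<xi>.\<close>
  define u where "u = g1 \<otimes>\<^sub>G inv\<^sub>G t"
  have u: "u \<in> \<Gamma>" using t g1 by (simp add: u_def)
  have ue: "u = (g1 \<otimes>\<^sub>G inv\<^sub>G el i) \<otimes>\<^sub>G inv\<^sub>G h"
    using g1 hG i by (simp add: u_def t_def G.inv_mult_group G.m_assoc)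
  then have uH: "u \<in> H" using H_mult[OF gH H_inv[OF hH]] by simp
  obtain b1 where b1: "b1 \<in> A" "\<forall>h k. cc b1 (h, k) = (if t = h \<otimes>\<^sub>G gm k then cc a (h, k) else 0)"
    using homogeneous_part[OF a t] by blast
  define b2 where "b2 = ug D u \<otimes>\<^sub>U b1"
  have b2: "b2 \<in> A" unfolding b2_def using uH b1 by (intro A_mult) (simp_all add: H_iff)
  obtain b where b: "b \<in> A" "\<forall>h k. cc b (h, k) = (if \<forall>g\<in>H. cX k g = chi i g then cc b2 (h, k) else 0)"
    using weight_part[OF b2 i] by blast
  have tu: "t = (inv\<^sub>G u \<otimes>\<^sub>G h') \<otimes>\<^sub>G gm k \<longleftrightarrow> g1 = h' \<otimes>\<^sub>G gm k" if "h' \<in> \<Gamma>" for h' k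
  proof -
    have "(inv\<^sub>G u \<otimes>\<^sub>G h') \<otimes>\<^sub>G gm k = t \<longleftrightarrow> h' \<otimes>\<^sub>G gm k = u \<otimes>\<^sub>G t"
      using inv_eq_iff[of u "h' \<otimes>\<^sub>G gm k" t] u t that by (simp add: G.m_assoc)
    moreover have "u \<otimes>\<^sub>G t = g1" using t g1 by (simp add: u_def G.m_assoc)
    ultimately show ?thesis by metis
  qed
  have cb: "cc b (h', k) = (if (\<forall>g\<in>H. cX k g = chi i g) \<and> g1 = h' \<otimes>\<^sub>G gm k then cc a (inv\<^sub>G u \<otimes>\<^sub>G h', k) else 0)"
    if "h' \<in> \<Gamma>" for h' k
    using b(2) b1(2) cc_ug_mult[OF u that A_closed[OF b1(1)], of k] tu[OF that, of k] by (simp add: b2_def)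
  have cX1: "cX (up k (\<lambda>_. 0)) g = chi k g" if "k \<in> I" for k g
    by (simp add: cX_up[OF that]) (simp add: cX_def)
  have gm1: "gm (up k (\<lambda>_. 0)) = el k" if "k \<in> I" for k using that by (simp add: gm_up)
  have sol: "g1 = h' \<otimes>\<^sub>G el k \<longleftrightarrow> h' = g1 \<otimes>\<^sub>G inv\<^sub>G el k" if "h' \<in> \<Gamma>" "k \<in> I" for h' k
    using that g1 by (metis G.inv_closed G.inv_solve_right el)
  define w where "w s = (if s < card J then cc b (g1 \<otimes>\<^sub>G inv\<^sub>G el (nth_index J s), up (nth_index J s) (\<lambda>_. 0)) else cc b (g1, \<lambda>_. 0))" for s
  have nb: "finite J" by (rule J_fin[OF c(1,2)])
  have xb: "xe J w = b"
  proof (rule cc_inject)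
    fix h' l
    show "cc (xe J w) (h', l) = cc b (h', l)"
    proof (cases "h' \<in> \<Gamma>")
      case False
      then show ?thesis using cc_outside[OF xc] cc_outside[OF A_closed[OF b(1)]] by simp
    next
      case h': True
      show ?thesis
      proof (cases "l = (\<lambda>_. 0)")
        case True
        show ?thesis unfolding True cc_xe_constant_part[OF c(1,2) h'] g1_def[symmetric]
          using cb[OF h', of "\<lambda>_. 0"] h' by (auto simp: w_def)
      next
        case l0: False
        show ?thesis
        proof (cases "\<exists>s<card J. l = up (nth_index J s) (\<lambda>_. 0)")
          case True
          then obtain s where s: "s < card J" "l = up (nth_index J s) (\<lambda>_. 0)" by blast
          have sI: "nth_index J s \<in> I" by (rule ni_I[OF c(1,2) s(1)])
          have "cc b (h', l) = 0" if "h' \<noteq> g1 \<otimes>\<^sub>G inv\<^sub>G el (nth_index J s)"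
            using cb[OF h', of l] that sol[OF h' sI] by (auto simp: s gm1[OF sI])
          then show ?thesis
            unfolding s(2) cc_xe_linear_part[OF c(1,2) s(1) h'] g1_def[symmetric] using s by (auto simp: w_def)
        next
          case False
          have "cc b (h', l) = 0"
          proof (rule ccontr)
            assume n: "cc b (h', l) \<noteq> 0"
            then have lb: "l \<in> box" using cc_support[OF A_closed[OF b(1)]] by blast
            have wt: "\<forall>g\<in>H. cX l g = chi i g" and hg: "g1 = h' \<otimes>\<^sub>G gm l" and na: "cc a (inv\<^sub>G u \<otimes>\<^sub>G h', l) \<noteq> 0"
              using n cb[OF h', of l] by (auto split: if_splits)
            have "tdeg l \<noteq> 0" using l0 tdeg_eq_0[OF lb] by blast
            then have "tdeg l = 1" using top[OF na] by simp
            then obtain k where k: "k \<in> I" "l = up k (\<lambda>_. 0)" using tdeg_eq_1[OF lb] by blast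
            have "inv\<^sub>G u \<otimes>\<^sub>G h' \<in> H" using lin_H na k by blast
            then have "u \<otimes>\<^sub>G (inv\<^sub>G u \<otimes>\<^sub>G h') \<in> H" using H_mult[OF uH] by blast
            then have "h' \<in> H" using u h' by (simp add: G.m_assoc[symmetric])
            then have kH: "g1 \<otimes>\<^sub>G inv\<^sub>G el k \<in> H" using hg sol[OF h' k(1)] k gm1[OF k(1)] by simp
            have "\<forall>g\<in>H. chi i g = chi k g" using wt k cX1[OF k(1)] by simp
            then have "(i, k) \<in> sim D H" by (rule sim_if_same_degree[OF i k(1) g1 gH kH])
            then have "k \<in> J" by (simp add: J_def)
            then obtain s where "s < card J" "k = nth_index J s"
              using nth_index_bij[OF nb] unfolding bij_betw_def by blast
            then show False using False k by blast
          qed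
          then show ?thesis using cc_xe_other[OF c(1,2) h' l0] False by simp
        qed
      qed
    qed
  qed (use b xc in simp_all)
  have "w \<in> WJ J"
  proof -
    \<comment> \<open>A group element has trivial weight under conjugation, so projection to a
      nontrivial weight removes the constant term.\<close>
    have "w (card J) = 0" if g: "g \<in> H" "j \<in> J" "chi j g \<noteq> 1" for g j
    proof -
      have "chi i g = chi j g" using c(4)[OF iJ g(2)] g by (auto simp: sim_iff[OF H_sub])
      moreover have "cX (\<lambda>_. 0) g = 1" by (simp add: cX_def)
      ultimately have "\<not> (\<forall>g\<in>H. cX (\<lambda>_. 0) g = chi i g)" using g by metis
      then have "cc b (g1, \<lambda>_. 0) = 0" unfolding cb[OF g1] by (intro if_not_P) blast
      then show ?thesis by (simp add: w_def)
    qed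
    then show ?thesis using xb b by (auto simp: WJ_def)
  qed
  moreover have "\<exists>s<card J. w s \<noteq> 0"
  proof -
    obtain s where s: "s < card J" "i = nth_index J s"
      using nth_index_bij[OF nb] iJ unfolding bij_betw_def by blast
    have gi: "g1 \<otimes>\<^sub>G inv\<^sub>G el i \<in> \<Gamma>" using g1 i by simp
    have "inv\<^sub>G u \<otimes>\<^sub>G (g1 \<otimes>\<^sub>G inv\<^sub>G el i) = h"
    proof -
      have "u \<otimes>\<^sub>G h = g1 \<otimes>\<^sub>G inv\<^sub>G el i"
        using ue g1 hG i by (simp add: G.m_assoc)
      then show ?thesis using inv_eq_iff[OF u gi hG] by simp
    qed
    then have "w s = cc a (h, up i (\<lambda>_. 0))"
      using s cb[OF gi, of "up i (\<lambda>_. 0)"] cX1[OF i] gm1[OF i] sol[OF gi i] by (simp add: w_def)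
    then show ?thesis using nz s by auto
  qed
  moreover have "\<exists>h'. cc a (h', up (nth_index J s) (\<lambda>_. 0)) \<noteq> 0" if s: "s < card J" "w s \<noteq> 0" for s
  proof -
    have gs: "g1 \<otimes>\<^sub>G inv\<^sub>G el (nth_index J s) \<in> \<Gamma>" using g1 ni_I[OF c(1,2) s(1)] by simp
    show ?thesis using s cb[OF gs, of "up (nth_index J s) (\<lambda>_. 0)"] by (auto simp: w_def split: if_splits)
  qed
  ultimately show ?thesis unfolding J_def by blast
qed

end

section \<open>Generation\<close>

lemma is_subalgebra_generated:
  assumes "k_algebra U" "X \<subseteq> carrier U"
  shows "is_subalgebra U (subalgebra_generated U X)" "X \<subseteq> subalgebra_generated U X"
    "is_subalgebra U S \<Longrightarrow> X \<subseteq> S \<Longrightarrow> subalgebra_generated U X \<subseteq> S"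
proof -
  interpret k_algebra U by fact
  let ?F = "{S. is_subalgebra U S \<and> X \<subseteq> S}"
  have "subring (carrier U) U" by (rule subringI) auto
  then have c: "carrier U \<in> ?F" using assms(2) by (auto simp: is_subalgebra_def smult_closed)
  have "subring (\<Inter>?F) U"
  proof (rule subringI)
    show "\<Inter>?F \<subseteq> carrier U" using c by blast
  qed (auto simp: is_subalgebra_def dest: subringE)
  then show "is_subalgebra U (subalgebra_generated U X)"
    by (auto simp: is_subalgebra_def subalgebra_generated_def)
  show "X \<subseteq> subalgebra_generated U X" "is_subalgebra U S \<Longrightarrow> X \<subseteq> S \<Longrightarrow> subalgebra_generated U X \<subseteq> S"
    by (auto simp: subalgebra_generated_def)
qed

context coideal_subalgebra begin

section \<open>Elimination of top monomials inside a subalgebra containing the generators\<close>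

context
  fixes P :: "nat set \<Rightarrow> nat set" and \<rho> :: "nat set \<Rightarrow> nat \<Rightarrow> nat \<Rightarrow> 'k" and S
  assumes PS: "\<And>J. J \<in> I // sim D H \<Longrightarrow> P J \<subseteq> {..<card J}"
    and piv: "\<And>J p. J \<in> I // sim D H \<Longrightarrow> p \<in> P J \<Longrightarrow> \<rho> J p \<in> WJ J \<and> \<rho> J p p = 1 \<and> (\<forall>t\<in>P J. t \<noteq> p \<longrightarrow> \<rho> J p t = 0)"
    and sep: "\<And>J w. J \<in> I // sim D H \<Longrightarrow> w \<in> WJ J \<Longrightarrow> \<forall>p\<in>P J. w p = 0 \<Longrightarrow> \<forall>s\<le>card J. w s = 0"
    and S: "is_subalgebra UU S" "S \<subseteq> A"
    and gS: "\<And>g. g \<in> H \<Longrightarrow> ug D g \<in> S"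
    and xS: "\<And>J p. J \<in> I // sim D H \<Longrightarrow> p \<in> P J \<Longrightarrow> xe J (\<rho> J p) \<in> S"
begin

definition "pivot i \<longleftrightarrow> i \<in> I \<and> (\<exists>s\<in>P (sim D H `` {i}). nth_index (sim D H `` {i}) s = i)"

lemma S_sub: "subring S UU" "x \<in> S \<Longrightarrow> c \<odot>\<^sub>U x \<in> S"
  using S by (auto simp: is_subalgebra_def)

lemma S_mem [simp]: "x \<in> S \<Longrightarrow> x \<in> carrier UU"
  using S A_closed by blast

lemmas S_mult = subringE(6)[OF S_sub(1)]
  and S_add = subringE(7)[OF S_sub(1)]
  and S_one = subringE(3)[OF S_sub(1)]
  and S_zero = subringE(2)[OF S_sub(1)]

lemma pivot_iff:
  assumes J: "J \<in> I // sim D H" and s: "s < card J"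
  shows "pivot (nth_index J s) \<longleftrightarrow> s \<in> P J"
proof -
  note c = class_facts[OF J]
  have m: "nth_index J s \<in> J" using nth_index_mem[OF J_fin[OF c(1,2)] s] .
  have "t = s" if "t \<in> P J" "nth_index J t = nth_index J s" for t
    using ni_inj[OF c(1,2) _ s that(2)] PS[OF J] that(1) by blast
  then show ?thesis unfolding pivot_def c(3)[OF m] using m c(1) by blast
qed

text \<open>The vector found in the class of i is nonzero and hence, by \<open>sep\<close>, nonzero
  at some pivot; its nonzero linear entries point back to coefficients of a.\<close>

lemma linear_part_pivot:
  assumes a: "a \<in> A" and top: "\<And>h' k. cc a (h', k) \<noteq> 0 \<Longrightarrow> tdeg k \<le> 1"
    and i: "i \<in> I" and nz: "cc a (h, up i (\<lambda>_. 0)) \<noteq> 0"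
  shows "\<exists>p h'. p \<in> I \<and> pivot p \<and> cc a (h', up p (\<lambda>_. 0)) \<noteq> 0"
proof -
  define J where "J = sim D H `` {i}"
  have J: "J \<in> I // sim D H" unfolding J_def by (rule sim_class(1)[OF i])
  have "\<exists>w\<in>WJ J. (\<exists>s<card J. w s \<noteq> 0) \<and>
    (\<forall>s<card J. w s \<noteq> 0 \<longrightarrow> (\<exists>h'. cc a (h', up (nth_index J s) (\<lambda>_. 0)) \<noteq> 0))"
    unfolding J_def by (rule linear_part_in_WJ[OF a _ i nz]) (rule top)
  then obtain w where w: "w \<in> WJ J" "\<exists>s<card J. w s \<noteq> 0"
    "\<forall>s<card J. w s \<noteq> 0 \<longrightarrow> (\<exists>h'. cc a (h', up (nth_index J s) (\<lambda>_. 0)) \<noteq> 0)"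
    by blast
  have "\<not> (\<forall>p\<in>P J. w p = 0)"
  proof
    assume "\<forall>p\<in>P J. w p = 0"
    then have "\<forall>s\<le>card J. w s = 0" by (rule sep[OF J w(1)])
    then show False using w(2) by auto
  qed
  then obtain p where p: "p \<in> P J" "w p \<noteq> 0" by blast
  have pl: "p < card J" using PS[OF J] p by blast
  obtain h' where "cc a (h', up (nth_index J p) (\<lambda>_. 0)) \<noteq> 0" using w(3) pl p(2) by blast
  moreover have "pivot (nth_index J p)" using pivot_iff[OF J pl] p by blast
  moreover have "nth_index J p \<in> I" by (rule ni_I[OF class_facts(1,2)[OF J] pl])
  ultimately show ?thesis by blast
qed

text \<open>A top monomial of minimal total exponent in the non-pivot variables involves pivots only:
  otherwise a suitable derivative isolates one non-pivot variable, and the linear element so obtained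
  also has a pivot coefficient, which belongs to a top monomial with fewer non-pivot variables.\<close>

lemma pivot_monomial_exists:
  assumes a: "a \<in> A" and top: "\<And>h' k. cc a (h', k) \<noteq> 0 \<Longrightarrow> tdeg k \<le> n"
    and nz: "cc a (h, m) \<noteq> 0" "tdeg m = n"
  shows "\<exists>h m. cc a (h, m) \<noteq> 0 \<and> tdeg m = n \<and> (\<forall>i. m i \<noteq> 0 \<longrightarrow> pivot i)"
  using nz
proof (induction "\<Sum>i\<in>{i\<in>I. \<not> pivot i}. m i" arbitrary: h m rule: less_induct)
  case less
  let ?K = "{i\<in>I. \<not> pivot i}"
  have fK: "finite ?K" using finite_I by simp
  have hm: "h \<in> \<Gamma>" "m \<in> box" using cc_support[OF A_closed[OF a] less.prems(1)] by auto
  show ?case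
  proof (cases "\<exists>i\<in>?K. m i \<noteq> 0")
    case False
    have "pivot i" if "m i \<noteq> 0" for i
    proof -
      have "i \<in> I" using hm(2) that unfolding box_def by (metis (mono_tags, lifting) mem_Collect_eq)
      then show ?thesis using False that by blast
    qed
    then show ?thesis using less.prems by blast
  next
    case True
    then obtain i where i: "i \<in> I" "\<not> pivot i" "m i \<noteq> 0" by blast
    define m0 where "m0 = m(i := m i - 1)"
    have m: "up i m0 = m" using i by (auto simp: m0_def up_def)
    have m0: "m0 \<in> box" by (rule box_le[OF hm(2)]) (simp add: m0_def)
    have sum0: "(\<lambda>j. up k (\<lambda>_. 0) j + m0 j) = up k m0" for k by (auto simp: up_def)
    obtain b d where b: "b \<in> A" "\<forall>k. d k \<noteq> (0::'k)"
      "\<forall>h' k. cc b (h', k) = (if h \<otimes>\<^sub>G el i = h' \<otimes>\<^sub>G gm k then d k * cc a (h', \<lambda>j. k j + m0 j) else 0)"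
      using higher_derivation[OF a m0 G.m_closed[OF hm(1) el[OF i(1)]]] by (elim bexE exE conjE) (rule that)
    have d1: "tdeg k \<le> 1" if "cc b (h', k) \<noteq> 0" for h' k
    proof -
      have "cc a (h', \<lambda>j. k j + m0 j) \<noteq> 0" using that b(3) by (auto split: if_splits)
      then have "tdeg k + tdeg m0 \<le> n" using top[of h' "\<lambda>j. k j + m0 j"] by (simp add: tdeg_def sum.distrib)
      moreover have "Suc (tdeg m0) = n" using tdeg_up[OF i(1), of m0] m less.prems by simp
      ultimately show ?thesis by simp
    qed
    have "gm (up i (\<lambda>_. 0)) = el i" using i by (simp add: gm_up)
    then have "cc b (h, up i (\<lambda>_. 0)) \<noteq> 0" using b(2,3) less.prems by (simp add: sum0 m)
    then have "\<exists>p h'. p \<in> I \<and> pivot p \<and> cc b (h', up p (\<lambda>_. 0)) \<noteq> 0"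
      by (intro linear_part_pivot[OF b(1) _ i(1)]) (rule d1)
    then obtain p h' where p: "p \<in> I" "pivot p" "cc b (h', up p (\<lambda>_. 0)) \<noteq> 0" by blast
    then have 1: "cc a (h', up p m0) \<noteq> 0" using b(3) by (auto simp: sum0 split: if_splits)
    have 2: "tdeg (up p m0) = n" using tdeg_up[OF p(1), of m0] tdeg_up[OF i(1), of m0] m less.prems by simp
    have "sum (up p m0) ?K = sum m0 ?K" using p by (intro sum.cong) (auto simp: up_def)
    also have "\<dots> < sum m ?K" using i fK by (intro sum_strict_mono_ex1) (auto simp: m0_def)
    finally show ?thesis by (rule less.hyps[OF _ 1 2])
  qed
qed

text \<open>Up to a group factor and a constant, the \<xi> of a pivot is its pivot variable plus
  non-pivot variables, because reduced rows vanish at the other pivots. In a product of such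
  elements the only top monomial involving pivots alone is therefore \<open>x^m\<close>. Top
  monomials with non-pivot variables and lower terms stay uncontrolled.\<close>

lemma pivot_product:
  assumes "m \<in> box" "\<forall>i. m i \<noteq> 0 \<longrightarrow> pivot i"
  shows "\<exists>M\<in>S. \<exists>c. c \<noteq> 0 \<and> (\<forall>h l. cc M (h, l) \<noteq> 0 \<longrightarrow> tdeg l \<le> tdeg m) \<and>
    (\<forall>h l. tdeg l = tdeg m \<longrightarrow> (\<forall>i. l i \<noteq> 0 \<longrightarrow> pivot i) \<longrightarrow> cc M (h, l) = (if h = \<one>\<^sub>G \<and> l = m then c else 0))"
  using assms
proof (induction m rule: box_induct)
  case zero
  have "tdeg l = 0 \<Longrightarrow> cc \<one>\<^sub>U (h, l) = (if h = \<one>\<^sub>G \<and> l = (\<lambda>_. 0) then 1 else 0)" for h l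
    by (simp add: cc_one vac_def)
  then show ?case using S_one
    by (intro bexI[of _ "\<one>\<^sub>U"] exI[of _ 1]) (auto simp: cc_one vac_def tdeg_0 split: if_splits)
next
  case (step p m)
  have pp: "pivot p" using step.prems up_simps(1)[of p m] by (metis nat.distinct(1))
  have "\<forall>i. m i \<noteq> 0 \<longrightarrow> pivot i" using step.prems pp up_simps(2)[of _ p m] by metis
  then obtain M c where M: "M \<in> S" "c \<noteq> 0" "\<And>h l. cc M (h, l) \<noteq> 0 \<Longrightarrow> tdeg l \<le> tdeg m"
    "\<And>h l. tdeg l = tdeg m \<Longrightarrow> \<forall>i. l i \<noteq> 0 \<longrightarrow> pivot i \<Longrightarrow> cc M (h, l) = (if h = \<one>\<^sub>G \<and> l = m then c else 0)"
    using step.IH by blast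
  define J where "J = sim D H `` {p}"
  have J: "J \<in> I // sim D H" and pJ: "p \<in> J" using sim_class[OF step(1)] by (simp_all add: J_def)
  note cf = class_facts[OF J]
  obtain s0 where s0: "s0 \<in> P J" "nth_index J s0 = p" using pp by (auto simp: pivot_def J_def)
  have s0c: "s0 < card J" using PS[OF J] s0 by blast
  define w where "w = \<rho> J s0"
  have w: "w s0 = 1" "\<forall>t\<in>P J. t \<noteq> s0 \<longrightarrow> w t = 0" using piv[OF J s0(1)] by (simp_all add: w_def)
  define X where "X = xe J w"
  have X: "X \<in> S" unfolding X_def w_def by (rule xS[OF J s0(1)])
  define g1 where "g1 = el (nth_index J 0)"
  have g1: "g1 \<in> \<Gamma>" unfolding g1_def using ni_I[OF cf(1,2)] J_card[OF cf(1,2)] by simp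
  \<comment> \<open>The group coordinate of the pivot variable in X; its inverse enters
    \<open>M'\<close> so that the leading term has group coordinate 1.\<close>
  define g0 where "g0 = g1 \<otimes>\<^sub>G inv\<^sub>G el p"
  have g0H: "g0 \<in> H" unfolding g0_def g1_def by (rule class_leader[OF J pJ])
  then have g0: "g0 \<in> \<Gamma>" using H_sub by blast
  define M' where "M' = ug D (inv\<^sub>G g0) \<otimes>\<^sub>U (X \<otimes>\<^sub>U M)"
  have M'S: "M' \<in> S" unfolding M'_def using gS[OF H_inv[OF g0H]] X M(1) by (intro S_mult)
  define n where "n = tdeg m"
  have tu: "tdeg (up p m) = Suc n" using tdeg_up[OF step(1)] by (simp add: n_def)
  define x where "x h = inv\<^sub>G g1 \<otimes>\<^sub>G (g0 \<otimes>\<^sub>G h)" for h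
  have xG: "x h \<in> \<Gamma>" if "h \<in> \<Gamma>" for h using that g0 g1 by (simp add: x_def)
  have exp: "cc M' (h, l) = (\<Sum>s<card J. w s * XX (nth_index J s) (cc M) (el (nth_index J s) \<otimes>\<^sub>G x h, l)) + w (card J) * cc M (x h, l)"
    if h: "h \<in> \<Gamma>" for h l
  proof -
    have "cc M' (h, l) = cc (X \<otimes>\<^sub>U M) (g0 \<otimes>\<^sub>G h, l)"
      unfolding M'_def using h g0 X M(1) by (simp add: cc_ug_mult)
    then show ?thesis unfolding X_def using cc_xe_mult[OF cf(1,2) S_mem[OF M(1)], of "g0 \<otimes>\<^sub>G h" w l] g0 h
      by (simp add: x_def g1_def)
  qed
  have XX0: "XX i (cc M) (h, l) = 0" if "i \<in> I" "h \<in> \<Gamma>" "tdeg l > Suc n" for i h l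
  proof -
    have "Y i a (cc M) (h, l) = 0" if a: "a \<in> {1..i}" for a
    proof (cases "a = i")
      case False
      have "cc M (h', up a l) = 0" for h'
        using M(3)[of h' "up a l"] tdeg_up[OF idx_le[OF \<open>i \<in> I\<close> a], of l] \<open>tdeg l > Suc n\<close> by (fastforce simp: n_def)
      then show ?thesis using a False \<open>h \<in> \<Gamma>\<close> by (simp add: Ylow up_def)
    next
      case True
      have "tdeg l \<le> tdeg (l(i := l i + N i - 1))" using N_pos[OF \<open>i \<in> I\<close>] by (intro tdeg_mono) auto
      then have e1: "cc M (h', l(i := l i + N i - 1)) = 0" for h'
        using M(3)[of h' "l(i := l i + N i - 1)"] \<open>tdeg l > Suc n\<close> by (fastforce simp: n_def)
      have "cc M (h, l(i := l i - 1)) = 0" if "l i mod N i \<noteq> 0"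
      proof -
        have "up i (l(i := l i - 1)) = l" using that by (cases "l i") (auto simp: up_def)
        then have "Suc (tdeg (l(i := l i - 1))) = tdeg l" using tdeg_up[OF \<open>i \<in> I\<close>] by metis
        then show ?thesis using M(3)[of h "l(i := l i - 1)"] \<open>tdeg l > Suc n\<close> by (fastforce simp: n_def)
      qed
      then show ?thesis using e1 \<open>h \<in> \<Gamma>\<close> True by (simp add: Yraise)
    qed
    then show ?thesis by (simp add: XX_def)
  qed
  have top: "tdeg l \<le> tdeg (up p m)" if nz: "cc M' (h, l) \<noteq> 0" for h l
  proof (rule ccontr)
    assume "\<not> tdeg l \<le> tdeg (up p m)"
    then have l: "tdeg l > Suc n" using tu by simp
    have h: "h \<in> \<Gamma>" using cc_outside[OF S_mem[OF M'S]] nz by blast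
    have "cc M (x h, l) = 0" using M(3)[of "x h" l] l by (fastforce simp: n_def)
    moreover have "XX (nth_index J s) (cc M) (el (nth_index J s) \<otimes>\<^sub>G x h, l) = 0" if "s < card J" for s
      using ni_I[OF cf(1,2) that] xG[OF h] l by (intro XX0) auto
    ultimately have "cc M' (h, l) = 0" unfolding exp[OF h] by simp
    then show False using nz by blast
  qed
  \<comment> \<open>The factor from raising by \<open>x_p\<close> at the target exponent; the
    character contributes nothing because the group coordinate is 1.\<close>
  define c' where "c' = PP p p (up p m) * c"
  have c': "c' \<noteq> 0" using M(2) step(1) by (simp add: c'_def)
  have val: "cc M' (h, l) = (if h = \<one>\<^sub>G \<and> l = up p m then c' else 0)"
    if l: "tdeg l = tdeg (up p m)" "\<forall>i. l i \<noteq> 0 \<longrightarrow> pivot i" for h l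
  proof (cases "h \<in> \<Gamma>")
    case False
    then show ?thesis using cc_outside[OF S_mem[OF M'S] False] by auto
  next
    case h: True
    have ln: "tdeg l = Suc n" using l tu by simp
    have px: "el p \<otimes>\<^sub>G x h = h"
    proof -
      have "el p \<otimes>\<^sub>G x h = (el p \<otimes>\<^sub>G inv\<^sub>G g1 \<otimes>\<^sub>G g0) \<otimes>\<^sub>G h"
        using g0 g1 h step(1) by (simp add: x_def G.m_assoc)
      also have "el p \<otimes>\<^sub>G inv\<^sub>G g1 \<otimes>\<^sub>G g0 = el p \<otimes>\<^sub>G (inv\<^sub>G g1 \<otimes>\<^sub>G g1) \<otimes>\<^sub>G inv\<^sub>G el p"
        unfolding g0_def using g1 step(1) by (simp only: G.m_assoc G.m_closed G.inv_closed el)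
      also have "\<dots> = \<one>\<^sub>G" using g1 step(1) by simp
      finally show ?thesis using h by simp
    qed
    have XXv: "XX i (cc M) (h', l) = (if l i mod N i \<noteq> 0 then inverse (chi i h') * PP i i l * cc M (h', l(i := l i - 1)) else 0)"
      if "i \<in> I" "h' \<in> \<Gamma>" for i h'
      by (rule XX_top[OF that _ ln]) (use M(3) in \<open>simp add: n_def\<close>)
    \<comment> \<open>Another pivot has entry 0 in the reduced row. A non-pivot variable does not
      occur in l, and a raising step of \<open>XX_top\<close> cannot produce a monomial without its
      own variable.\<close>
    have z: "w s * XX (nth_index J s) (cc M) (el (nth_index J s) \<otimes>\<^sub>G x h, l) = 0" if s: "s < card J" "s \<noteq> s0" for s
    proof (cases "s \<in> P J")
      case True
      then show ?thesis using w s by simp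
    next
      case False
      then have "\<not> pivot (nth_index J s)" using pivot_iff[OF J s(1)] by blast
      then have "l (nth_index J s) = 0" using l by blast
      then show ?thesis using XXv[of "nth_index J s" "el (nth_index J s) \<otimes>\<^sub>G x h"] ni_I[OF cf(1,2) s(1)] xG[OF h] by simp
    qed
    have "cc M (x h, l) = 0" using M(3)[of "x h" l] ln by (fastforce simp: n_def)
    moreover have "(\<Sum>s<card J. w s * XX (nth_index J s) (cc M) (el (nth_index J s) \<otimes>\<^sub>G x h, l)) = XX p (cc M) (h, l)"
    proof -
      have "(\<Sum>s<card J. w s * XX (nth_index J s) (cc M) (el (nth_index J s) \<otimes>\<^sub>G x h, l))
        = (\<Sum>s<card J. if s = s0 then XX p (cc M) (h, l) else 0)"
        by (intro sum.cong refl) (use z s0 w px in auto)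
      then show ?thesis using s0c by simp
    qed
    ultimately have e: "cc M' (h, l) = XX p (cc M) (h, l)" unfolding exp[OF h] by simp
    show ?thesis
    proof (cases "l p mod N p = 0")
      case True
      have "up p m p < N p" using step(1,3) by (auto simp: box_def)
      then have "l \<noteq> up p m" using True by auto
      then show ?thesis unfolding e XXv[OF step(1) h] using True by simp
    next
      case False
      then have lp: "l p \<noteq> 0" by (metis mod_0)
      define l' where "l' = l(p := l p - 1)"
      have ul: "up p l' = l" using lp by (auto simp: l'_def up_def)
      have tl: "tdeg l' = tdeg m" using tdeg_up[OF step(1), of l'] ul ln by (simp add: n_def)
      have pl: "\<forall>i. l' i \<noteq> 0 \<longrightarrow> pivot i" using l(2) lp by (auto simp: l'_def)
      have "l' = m \<longleftrightarrow> l = up p m"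
      proof
        assume "l = up p m"
        then show "l' = m" by (auto simp: l'_def up_def)
      qed (use ul in blast)
      then show ?thesis unfolding e XXv[OF step(1) h] l'_def[symmetric] M(4)[OF tl pl]
        using False step(1) by (auto simp: c'_def)
    qed
  qed
  show ?case using M'S c' top val by blast
qed

text \<open>The outer induction is on the degree bound, the inner one on the number of top monomials
  made of pivots. The inner measure ignores the other top monomials, which a subtraction may create;
  when it reaches 0, \<open>pivot_monomial_exists\<close> shows that no top monomial is left at
  all.\<close>

lemma degree_induction:
  "a \<in> A \<Longrightarrow> (\<And>h k. cc a (h, k) \<noteq> 0 \<Longrightarrow> tdeg k < n) \<Longrightarrow> a \<in> S"
proof (induction n arbitrary: a)
  case 0
  have "a = \<zero>\<^sub>U" by (rule cc_inject) (use 0 in \<open>auto simp: cc_zero\<close>)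
  then show ?case using S_zero by simp
next
  case (Suc n)
  let ?T = "\<lambda>a. {(h, m). cc a (h, m) \<noteq> 0 \<and> tdeg m = n \<and> (\<forall>i. m i \<noteq> 0 \<longrightarrow> pivot i)}"
  have fT: "finite (?T a)" if "a \<in> A" for a
    by (rule finite_subset[of _ "\<Gamma> \<times> box"]) (use cc_support[OF A_closed[OF that]] fin_G finite_box in auto)
  show ?case using Suc.prems
  proof (induction "card (?T a)" arbitrary: a rule: less_induct)
    case less
    note aA = less.prems(1)
    have dg: "tdeg k \<le> n" if "cc a (h, k) \<noteq> 0" for h k using less.prems(2)[OF that] by simp
    show ?case
    proof (cases "\<exists>h m. cc a (h, m) \<noteq> 0 \<and> tdeg m = n")
      case False
      have "tdeg k < n" if "cc a (h, k) \<noteq> 0" for h k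
        using dg[OF that] False that by (metis le_neq_implies_less)
      then show ?thesis by (rule Suc.IH[OF aA])
    next
      case True
      then obtain h0 m0 where "cc a (h0, m0) \<noteq> 0" "tdeg m0 = n" by blast
      then have "\<exists>h m. cc a (h, m) \<noteq> 0 \<and> tdeg m = n \<and> (\<forall>i. m i \<noteq> 0 \<longrightarrow> pivot i)"
        by (intro pivot_monomial_exists[OF aA]) (rule dg)
      then obtain h m where hm: "cc a (h, m) \<noteq> 0" "tdeg m = n" "\<forall>i. m i \<noteq> 0 \<longrightarrow> pivot i"
        by blast
      have sup: "h \<in> \<Gamma>" "m \<in> box" using cc_support[OF A_closed[OF aA] hm(1)] by auto
      have hH: "h \<in> H" by (rule top_in_H[OF aA hm(1)]) (use dg hm in simp)
      obtain M c where M: "M \<in> S" "c \<noteq> 0" "\<And>h l. cc M (h, l) \<noteq> 0 \<Longrightarrow> tdeg l \<le> tdeg m"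
        "\<And>h l. tdeg l = tdeg m \<Longrightarrow> \<forall>i. l i \<noteq> 0 \<longrightarrow> pivot i \<Longrightarrow> cc M (h, l) = (if h = \<one>\<^sub>G \<and> l = m then c else 0)"
        using pivot_product[OF sup(2) hm(3)] by blast
      define k where "k = cc a (h, m) / c"
      define y where "y = k \<odot>\<^sub>U (ug D h \<otimes>\<^sub>U M)"
      have yS: "y \<in> S" unfolding y_def using gS[OF hH] M by (intro S_sub(2) S_mult)
      define a' where "a' = a \<oplus>\<^sub>U (- 1) \<odot>\<^sub>U y"
      have a'A: "a' \<in> A" unfolding a'_def using yS S(2) by (intro A_add A_sub(2) aA) auto
      have cy: "cc y (h', l) = k * cc M (inv\<^sub>G h \<otimes>\<^sub>G h', l)" if "h' \<in> \<Gamma>" for h' l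
        unfolding y_def using sup M that by (simp add: cc_smult cc_ug_mult)
      have ca': "cc a' (h', l) = cc a (h', l) - cc y (h', l)" for h' l
        unfolding a'_def using aA yS by (simp add: cc_add cc_smult U.smult_closed)
      have y0: "cc y (h', l) = 0" if "h' \<notin> \<Gamma>" for h' l using cc_outside[OF S_mem[OF yS] that] .
      have cyp: "cc y (h', l) = (if h' = h \<and> l = m then cc a (h, m) else 0)" if "tdeg l = n" "\<forall>i. l i \<noteq> 0 \<longrightarrow> pivot i" for h' l
      proof (cases "h' \<in> \<Gamma>")
        case True
        have "inv\<^sub>G h \<otimes>\<^sub>G h' = \<one>\<^sub>G \<longleftrightarrow> h' = h"
          using inv_eq_iff[of h h' "\<one>\<^sub>G"] sup True by simp
        then show ?thesis unfolding cy[OF True] using M(4)[of l "inv\<^sub>G h \<otimes>\<^sub>G h'"] that hm M(2)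
          by (auto simp: k_def)
      qed (use y0 sup in auto)
      have dg': "tdeg l < Suc n" if nz: "cc a' (h', l) \<noteq> 0" for h' l
      proof -
        have "cc a (h', l) \<noteq> 0 \<or> cc y (h', l) \<noteq> 0" using nz unfolding ca' by auto
        moreover have "tdeg l \<le> n" if "cc y (h', l) \<noteq> 0"
        proof -
          have "h' \<in> \<Gamma>" using y0 that by blast
          then have "cc M (inv\<^sub>G h \<otimes>\<^sub>G h', l) \<noteq> 0" using cy that by auto
          then show ?thesis using M(3) hm by auto
        qed
        ultimately show ?thesis using dg by (meson le_imp_less_Suc)
      qed
      \<comment> \<open>Among top monomials in pivots, y has only (h, m), with the coefficient of a
        there: this one disappears and no other is created.\<close>
      have "?T a' \<subset> ?T a"
      proof
        show "?T a' \<subseteq> ?T a"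
        proof
          fix x assume x: "x \<in> ?T a'"
          obtain h' l where xe: "x = (h', l)" by (cases x)
          have l: "cc a' (h', l) \<noteq> 0" "tdeg l = n" "\<forall>i. l i \<noteq> 0 \<longrightarrow> pivot i" using x unfolding xe by simp_all
          have "cc a (h', l) \<noteq> 0"
            using l(1) hm(1) unfolding ca' cyp[OF l(2,3)] by (auto split: if_splits)
          then show "x \<in> ?T a" using l unfolding xe by simp
        qed
        have "(h, m) \<in> ?T a" using hm by simp
        moreover have "(h, m) \<notin> ?T a'" using cyp[OF hm(2,3), of h] by (simp add: ca')
        ultimately show "?T a' \<noteq> ?T a" by blast
      qed
      then have "card (?T a') < card (?T a)" by (rule psubset_card_mono[OF fT[OF aA]])
      then have a'S: "a' \<in> S" by (rule less.hyps[OF _ a'A]) (rule dg')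
      have "a = a' \<oplus>\<^sub>U y"
      proof (rule cc_inject)
        fix h' l
        show "cc a (h', l) = cc (a' \<oplus>\<^sub>U y) (h', l)" using a'S yS by (simp add: cc_add ca')
      qed (use aA a'S yS in simp_all)
      then show ?thesis using S_add[OF a'S yS] by simp
    qed
  qed
qed

lemma generated_all: "A \<subseteq> S"
proof
  fix a assume a: "a \<in> A"
  define B where "B = Max (tdeg ` box)"
  have "tdeg k < Suc B" if "cc a (h, k) \<noteq> 0" for h k
  proof -
    have "k \<in> box" using cc_support[OF A_closed[OF a] that] by blast
    then have "tdeg k \<le> B" unfolding B_def using finite_box by (intro Max_ge) auto
    then show ?thesis by simp
  qed
  then show "a \<in> S" by (rule degree_induction[OF a])
qed

end

text \<open>Each matrix consists of a reduced basis of \<open>WJ J\<close>. The inclusion in A holds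
  row by row, and \<open>generated_all\<close> is applied with the generated subalgebra in the role
  of S.\<close>

lemma reduced_data_exist:
  "\<exists>C :: nat set \<Rightarrow> 'k mat. (\<forall>J \<in> I // sim D H. reduced_datum D H J (C J))
    \<and> subalgebra_generated UU (ug D ` H \<union> (\<Union>J \<in> I // sim D H. Xset D J (C J))) = A"
proof -
  \<comment> \<open>Pivots and basis are packed into one pair, so that a single use of choice yields
    both families.\<close>
  have "\<forall>J\<in>I // sim D H. \<exists>x. fst x \<subseteq> {..<card J}
     \<and> (\<forall>p\<in>fst x. snd x p \<in> WJ J \<and> snd x p p = 1 \<and> (\<forall>t<p. snd x p t = 0) \<and> (\<forall>t\<in>fst x. t \<noteq> p \<longrightarrow> snd x p t = 0))
     \<and> (\<forall>w\<in>WJ J. (\<forall>p\<in>fst x. w p = 0) \<longrightarrow> (\<forall>s\<le>card J. w s = 0))"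
  proof
    fix J assume J: "J \<in> I // sim D H"
    have ex: "\<exists>P \<rho>. P \<subseteq> {..<card J} \<and> (\<forall>p\<in>P. \<rho> p \<in> WJ J \<and> \<rho> p p = 1 \<and> (\<forall>t<p. \<rho> p t = 0) \<and> (\<forall>t\<in>P. t \<noteq> p \<longrightarrow> \<rho> p t = 0))
      \<and> (\<forall>w\<in>WJ J. (\<forall>p\<in>P. w p = 0) \<longrightarrow> (\<forall>s\<le>card J. w s = 0))"
      by (rule reduced_basis_exists) (fact WJ_add[OF J] WJ_smult[OF J] WJ_last[OF J])+
    obtain P \<rho> where "P \<subseteq> {..<card J}" "\<forall>p\<in>P. \<rho> p \<in> WJ J \<and> \<rho> p p = 1 \<and> (\<forall>t<p. \<rho> p t = 0) \<and> (\<forall>t\<in>P. t \<noteq> p \<longrightarrow> \<rho> p t = 0)"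
      "\<forall>w\<in>WJ J. (\<forall>p\<in>P. w p = 0) \<longrightarrow> (\<forall>s\<le>card J. w s = 0)"
      using ex by (elim exE conjE) (rule that)
    then show "\<exists>x. fst x \<subseteq> {..<card J}
     \<and> (\<forall>p\<in>fst x. snd x p \<in> WJ J \<and> snd x p p = 1 \<and> (\<forall>t<p. snd x p t = 0) \<and> (\<forall>t\<in>fst x. t \<noteq> p \<longrightarrow> snd x p t = 0))
     \<and> (\<forall>w\<in>WJ J. (\<forall>p\<in>fst x. w p = 0) \<longrightarrow> (\<forall>s\<le>card J. w s = 0))"
      by (intro exI[of _ "(P, \<rho>)"]) (simp only: fst_conv snd_conv)
  qed
  from bchoice[OF this] obtain f where f: "\<forall>J\<in>I // sim D H. fst (f J) \<subseteq> {..<card J}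
     \<and> (\<forall>p\<in>fst (f J). snd (f J) p \<in> WJ J \<and> snd (f J) p p = 1 \<and> (\<forall>t<p. snd (f J) p t = 0) \<and> (\<forall>t\<in>fst (f J). t \<noteq> p \<longrightarrow> snd (f J) p t = 0))
     \<and> (\<forall>w\<in>WJ J. (\<forall>p\<in>fst (f J). w p = 0) \<longrightarrow> (\<forall>s\<le>card J. w s = 0))" ..
  define P where "P J = fst (f J)" for J
  define \<rho> where "\<rho> J = snd (f J)" for J
  have PS: "P J \<subseteq> {..<card J}" if "J \<in> I // sim D H" for J
    using f that unfolding P_def by blast
  have piv: "\<rho> J p \<in> WJ J" if "J \<in> I // sim D H" "p \<in> P J" for J p
    using f that unfolding P_def \<rho>_def by blast
  have pivr: "\<forall>p\<in>P J. \<rho> J p p = 1 \<and> (\<forall>t<p. \<rho> J p t = 0) \<and> (\<forall>t\<in>P J. t \<noteq> p \<longrightarrow> \<rho> J p t = 0)"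
    if "J \<in> I // sim D H" for J
    using f that unfolding P_def \<rho>_def by blast
  have sep: "\<forall>s\<le>card J. w s = 0" if "J \<in> I // sim D H" "w \<in> WJ J" "\<forall>p\<in>P J. w p = 0" for J w
    using f that unfolding P_def by blast
  define C where "C J = reduced_mat (card J) (P J) (\<rho> J)" for J
  have row: "xi_elt D J (row (C J) r) = xe J (if r < card (P J) then \<rho> J (sorted_list_of_set (P J) ! r) else (\<lambda>_. 0))"
    if "r < card J" for J r
  proof -
    have "row (C J) r = vec (card J + 1) (if r < card (P J) then \<rho> J (sorted_list_of_set (P J) ! r) else (\<lambda>_. 0))"
      using that by (intro eq_vecI) (auto simp: C_def reduced_mat_def)
    then show ?thesis by (simp add: xe_def)
  qed
  have rd: "reduced_datum D H J (C J)" if J: "J \<in> I // sim D H" for J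
  proof -
    note c = class_facts[OF J]
    have "C J $$ (r, card J) = 0" if nt: "\<exists>j\<in>J. (chi j, \<one>\<^bsub>DG\<^esub>) \<notin> rcong\<^bsub>DG\<^esub> (perp (grp D) H)" and r: "r < card J" for r
    proof -
      obtain j where j: "j \<in> J" "(chi j, \<one>\<^bsub>DG\<^esub>) \<notin> rcong\<^bsub>DG\<^esub> (perp (grp D) H)" using nt by blast
      then have "\<not> (\<forall>g\<in>H. chi j g = \<one>\<^bsub>DG\<^esub> g)"
        using dual_rcong[OF chi_dual one_dual H_sub, of j] c(1) by blast
      then obtain g where "g \<in> H" "chi j g \<noteq> 1" using H_sub by (auto simp: dual_ops)
      then have "\<rho> J p (card J) = 0" if "p \<in> P J" for p using piv[OF J that] j(1) unfolding WJ_def by blast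
      then show ?thesis using pivot_mem[OF PS[OF J] pivr[OF J]] r by (auto simp: C_def reduced_mat_def)
    qed
    then show ?thesis
      unfolding reduced_datum_def
      using reduced_mat_carrier[OF PS[OF J] pivr[OF J]] reduced_mat_echelon[OF PS[OF J] pivr[OF J]]
        reduced_mat_rank[OF PS[OF J] pivr[OF J]]
      by (simp add: C_def)
  qed
  let ?X = "ug D ` H \<union> (\<Union>J \<in> I // sim D H. Xset D J (C J))"
  have XA: "?X \<subseteq> A"
  proof -
    have "ug D ` H \<subseteq> A" by (auto simp: H_iff)
    moreover have "Xset D J (C J) \<subseteq> A" if J: "J \<in> I // sim D H" for J
    proof -
      note c = class_facts[OF J]
      have "xe J (\<rho> J p) \<in> A" if "p \<in> P J" for p using piv[OF J that] by (simp add: WJ_def)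
      \<comment> \<open>The padding rows of the matrix contribute the zero element to the
        generators.\<close>
      moreover have "xe J (\<lambda>_. 0) \<in> A"
        using xe_smult[OF c(1,2), of 0 "\<lambda>_. 0"] A_zero xe_closed[OF c(1,2)] by simp
      ultimately show ?thesis
        using pivot_mem[OF PS[OF J] pivr[OF J]] by (auto simp: Xset_def row)
    qed
    ultimately show ?thesis by blast
  qed
  have XU: "?X \<subseteq> carrier UU" using XA A_closed by blast
  have As: "is_subalgebra UU A" using A_sub by (auto simp: is_subalgebra_def)
  note gen = is_subalgebra_generated[OF U.k_algebra_axioms XU]
  have SA: "subalgebra_generated UU ?X \<subseteq> A" by (rule gen(3)[OF As XA])
  have xS: "xe J (\<rho> J p) \<in> subalgebra_generated UU ?X" if J: "J \<in> I // sim D H" and p: "p \<in> P J" for J p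
  proof -
    have fP: "finite (P J)" using PS[OF J] finite_subset by blast
    then obtain r where r: "r < card (P J)" "sorted_list_of_set (P J) ! r = p"
      using p by (metis in_set_conv_nth length_sorted_list_of_set set_sorted_list_of_set)
    have "card (P J) \<le> card J" using card_mono[OF _ PS[OF J]] by simp
    then have rJ: "r < card J" using r by simp
    then have "xe J (\<rho> J p) = xi_elt D J (row (C J) r)" using row[OF rJ] r by simp
    then have "xe J (\<rho> J p) \<in> Xset D J (C J)" using rJ by (auto simp: Xset_def)
    then show ?thesis using gen(2) J by blast
  qed
  have "A \<subseteq> subalgebra_generated UU ?X"
  proof (rule generated_all[of P \<rho>])
    show "ug D g \<in> subalgebra_generated UU ?X" if "g \<in> H" for g using gen(2) that by blast
    show "\<rho> J p \<in> WJ J \<and> \<rho> J p p = 1 \<and> (\<forall>t\<in>P J. t \<noteq> p \<longrightarrow> \<rho> J p t = 0)" if "J \<in> I // sim D H" "p \<in> P J" for J p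
      using piv[OF that] pivr[OF that(1)] that(2) by blast
  qed (rule PS sep gen(1) SA xS; assumption)+
  then show ?thesis using rd SA by (intro exI[of _ C]) blast
qed

end

theorem theorem3p3:
  fixes D :: "('g, 'k :: {alg_closed_field, field_char_0}) datum"
    and A :: "('g gen list \<Rightarrow>\<^sub>0 'k) set set"
  assumes "is_datum D"
    and "right_coideal_subalgebra (Ualg D) (comult D) A"
  shows "\<exists>C :: nat set \<Rightarrow> 'k mat.
    (\<forall>J \<in> idx D // sim D (group_part D A). reduced_datum D (group_part D A) J (C J))
    \<and> subalgebra_generated (Ualg D)
        (ug D ` group_part D A \<union> (\<Union>J \<in> idx D // sim D (group_part D A). Xset D J (C J))) = A"
proof -
  interpret coideal_subalgebra D A
    by unfold_locales (rule assms)+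
  show ?thesis using reduced_data_exist unfolding H_def .
qed

end
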